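(* Let $N\ge1$ and let $u_0,\ldots,u_{N-1}\in\mathbb C$ satisfy $u_s=u^*_{N-1-s}\ne0$ for $s=0,\ldots,N-1$ and, if $N$ is odd, $u_{(N-1)/2}>0$. Then the weight $$\omega(z')=\sum_{s=0}^{N-1}u_s\,{z'}^{-s},\qquad z'\in\mathbb S_1,$$ yields a cyclic Pólya ensemble, and this ensemble is the Haar measure on $\mathrm U(N)$; in particular, the joint probability density of the eigenvalues of a Haar distributed unitary matrix is given by $$\frac{1}{N!\prod_{j=0}^{N-1}[j!\,\mathcal S\omega(j)]}\,\Delta_N(z)\det[(-z_a\partial_{z_a})^{b-1}\omega(z_a)]_{a,b=1,\ldots,N}.$$
   Context: $\mathbb S_1=\{z\in\mathbb C: |z|=1\}$ carries the normalised Haar measure $\frac{dz'}{2\pi i z'}$ (i.e. $\frac{d\theta}{2\pi}$ for $z'=e^{i\theta}$). A star denotes complex conjugation, and $z'\partial_{z'}=-i\,\frac{d}{d\theta}$. $\Delta_N(z)=\prod_{1\le a<b\le N}(z_b-z_a)$. For $w\in L^1(\mathbb S_1)$ and $s\in\mathbb Z$, $\mathcal Sw(s)=\int_{\mathbb S_1}\frac{dz'}{2\pi i z'}{z'}^{s}w(z')$. Densities of eigenvalues are with respect to $\prod_{j=1}^N\frac{dz_j}{2\pi i z_j}$ on $\mathbb S_1^N$. $L_N^1(\mathbb S_1)=\{w\in L^1(\mathbb S_1): [w(z)]^*=z^{N-1}w(z)\}$, and $\widetilde L_N^1(\mathbb S_1)$ is the set of $w\in L_N^1(\mathbb S_1)$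 that are $(N-1)$-times differentiable with $\partial^jw\in L^1(\mathbb S_1)$ for $j=0,\ldots,N-1$. Cyclic Pólya ensemble: a unitarily invariant random matrix $U\in\mathrm U(N)$ (distribution invariant under conjugation by every $V\in\mathrm U(N)$) is drawn from the cyclic Pólya ensemble associated to $\omega\in\widetilde L_N^1(\mathbb S_1)$ iff its eigenvalues have joint density $$p_N^{(U)}(z)=\frac{1}{N!\prod_{j=0}^{N-1}[j!\,\mathcal S\omega(j)]}\,\Delta_N(z)\det[(-z_a\partial_{z_a})^{b-1}\omega(z_a)]_{a,b=1,\ldots,N}\ge0 ,$$ where it is part of the definition that $\prod_{j=0}^{N-1}\mathcal S\omega(j)>0$. *)

theory Defs
  imports
    "Jordan_Normal_Form.Determinant"
    "HOL-Library.Complex_Order"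
    "HOL-Probability.Probability"
begin

text \<open>
  On \<^typ>\<open>complex\<close> the order is that of \<^theory>\<open>HOL-Library.Complex_Order\<close>:
  \<open>0 < x\<close> means that \<open>x\<close> is real and positive, and \<open>0 \<le> x\<close> that it is real and nonnegative.

  The matrix size \<open>N\<close> is \<^term>\<open>CARD('n)\<close>; group elements are of type \<open>complex ^ 'n ^ 'n\<close>.
  Tuples of eigenvalues are indexed by \<open>0, \<dots>, N - 1\<close>, because the Vandermonde product and the
  orders of differentiation refer to the order of the indices. Determinants of arrays indexed
  in this way are those of \<^theory>\<open>Jordan_Normal_Form.Determinant\<close>.
\<close>

abbreviation unit_circle :: "complex set" where
  "unit_circle \<equiv> sphere 0 1"

definition circle_measure :: "complex measure" where
  "circle_measure =
     distr (uniform_measure lborel {0..<2 * pi}) (restrict_space borel unit_circle) cis"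

definition torus_measure :: "nat \<Rightarrow> (nat \<Rightarrow> complex) measure" where
  "torus_measure N = (\<Pi>\<^sub>M j\<in>{..<N}. circle_measure)"

definition circle_transform :: "(complex \<Rightarrow> complex) \<Rightarrow> int \<Rightarrow> complex" where
  "circle_transform w s = (LINT z|circle_measure. z powi s * w z)"

text \<open>
  The derivative along the circle, normalised such that \<open>z \<partial>\<^sub>z = - \<i> d/d\<theta>\<close> for \<open>z = cis \<theta>\<close>.
  Only its values on the circle are meaningful, and they depend only on \<open>w\<close> on the circle.
\<close>

definition circle_deriv :: "(complex \<Rightarrow> complex) \<Rightarrow> complex \<Rightarrow> complex" where
  "circle_deriv w z = - \<i> * vector_derivative (\<lambda>\<theta>. w (cis \<theta>)) (at (Arg z)) / z"

definition neg_euler_deriv :: "(complex \<Rightarrow> complex) \<Rightarrow> complex \<Rightarrow> complex" where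
  "neg_euler_deriv w z = - z * circle_deriv w z"

definition L1_sym :: "nat \<Rightarrow> (complex \<Rightarrow> complex) set" where
  "L1_sym N = {w. integrable circle_measure w \<and>
     (AE z in circle_measure. cnj (w z) = z ^ (N - 1) * w z)}"

definition L1_sym_diff :: "nat \<Rightarrow> (complex \<Rightarrow> complex) set" where
  "L1_sym_diff N = {w \<in> L1_sym N.
     (\<forall>j < N - 1. \<forall>\<theta>::real. (\<lambda>t. (circle_deriv ^^ j) w (cis t)) differentiable (at \<theta>)) \<and>
     (\<forall>j \<le> N - 1. integrable circle_measure ((circle_deriv ^^ j) w))}"

definition adjoint_matrix :: "complex ^ 'n ^ 'n \<Rightarrow> complex ^ 'n ^ 'n" where
  "adjoint_matrix A = (\<chi> i j. cnj (A $ j $ i))"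

definition unitary_group :: "(complex ^ 'n ^ 'n) set" where
  "unitary_group = {A. A ** adjoint_matrix A = mat 1 \<and> adjoint_matrix A ** A = mat 1}"

text \<open>A random unitary matrix is represented by its law.\<close>

definition unitary_law :: "(complex ^ 'n ^ 'n) measure \<Rightarrow> bool" where
  "unitary_law M \<longleftrightarrow> prob_space M \<and> sets M = sets (restrict_space borel unitary_group)"

definition unitarily_invariant :: "(complex ^ 'n ^ 'n) measure \<Rightarrow> bool" where
  "unitarily_invariant M \<longleftrightarrow> unitary_law M \<and>
     (\<forall>V \<in> unitary_group. distr M M (\<lambda>A. V ** A ** adjoint_matrix V) = M)"

text \<open>
  The normalised left Haar measure; since the group is compact, it is also right invariant.
\<close>

definition haar_unitary :: "(complex ^ 'n ^ 'n) measure \<Rightarrow> bool" where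
  "haar_unitary M \<longleftrightarrow> unitary_law M \<and>
     (\<forall>V \<in> unitary_group. distr M M (\<lambda>A. V ** A) = M)"

text \<open>
  The tuple \<open>z\<close> lists the eigenvalues of \<open>A\<close>, with algebraic multiplicities, in some order:
  the characteristic polynomial factorises accordingly.
\<close>

definition eigenvalue_tuple :: "complex ^ 'n ^ 'n \<Rightarrow> (nat \<Rightarrow> complex) \<Rightarrow> bool" where
  "eigenvalue_tuple A z \<longleftrightarrow> (\<forall>t. Determinants.det (mat t - A) = (\<Prod>j<CARD('n). t - z j))"

definition permutation_closed :: "nat \<Rightarrow> (nat \<Rightarrow> complex) set \<Rightarrow> bool" where
  "permutation_closed N B \<longleftrightarrow> (\<forall>\<sigma>. \<sigma> permutes {..<N} \<longrightarrow> (\<forall>z\<in>B. z \<circ> \<sigma> \<in> B))"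

text \<open>
  Eigenvalues come without an order. Hence their joint density is a symmetric function, and it is
  characterised by the probabilities of the permutation invariant events.
\<close>

definition eigenvalue_density ::
    "(complex ^ 'n ^ 'n) measure \<Rightarrow> ((nat \<Rightarrow> complex) \<Rightarrow> complex) \<Rightarrow> bool" where
  "eigenvalue_density M p \<longleftrightarrow>
     p \<in> borel_measurable (torus_measure CARD('n)) \<and>
     (AE z in torus_measure CARD('n). 0 \<le> p z) \<and>
     (\<forall>\<sigma>. \<sigma> permutes {..<CARD('n)} \<longrightarrow> (AE z in torus_measure CARD('n). p (z \<circ> \<sigma>) = p z)) \<and>
     (\<forall>B \<in> sets (torus_measure CARD('n)). permutation_closed CARD('n) B \<longrightarrow>
        {A \<in> space M. \<exists>z\<in>B. eigenvalue_tuple A z} \<in> sets M \<and>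
        emeasure M {A \<in> space M. \<exists>z\<in>B. eigenvalue_tuple A z} =
          (\<integral>\<^sup>+ z\<in>B. ennreal (Re (p z)) \<partial>torus_measure CARD('n)))"

definition vandermonde :: "nat \<Rightarrow> (nat \<Rightarrow> complex) \<Rightarrow> complex" where
  "vandermonde N z = (\<Prod>b<N. \<Prod>a<b. z b - z a)"

definition polya_density :: "nat \<Rightarrow> (complex \<Rightarrow> complex) \<Rightarrow> (nat \<Rightarrow> complex) \<Rightarrow> complex" where
  "polya_density N \<omega> z =
     1 / (fact N * (\<Prod>j<N. fact j * circle_transform \<omega> (int j))) * vandermonde N z *
     Determinant.det (Matrix.mat N N (\<lambda>(a, b). (neg_euler_deriv ^^ b) \<omega> (z a)))"

definition cyclic_polya_ensemble ::
    "(complex \<Rightarrow> complex) \<Rightarrow> (complex ^ 'n ^ 'n) measure \<Rightarrow> bool" where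
  "cyclic_polya_ensemble \<omega> M \<longleftrightarrow>
     \<omega> \<in> L1_sym_diff CARD('n) \<and>
     0 < (\<Prod>j<CARD('n). circle_transform \<omega> (int j)) \<and>
     unitarily_invariant M \<and>
     eigenvalue_density M (polya_density CARD('n) \<omega>)"

end

theory Submission
  imports Defs "HOL-Computational_Algebra.Fundamental_Theorem_Algebra"
begin

text \<open>
  For a weight \<open>\<Sum>\<^sub>s u\<^sub>s z\<^sup>-\<^sup>s\<close> with \<open>N\<close> nonzero coefficients the determinant factors into two Vandermonde
  determinants, and the density becomes \<open>\<bar>\<Delta>\<^sub>N\<bar>\<^sup>2 / N!\<close>, independently of the \<open>u\<^sub>s\<close>. That this is the law of
  the eigenvalues of a Haar matrix (Weyl's formula) is shown without a change of variables:
  differentiating along the flows \<open>U \<mapsto> U exp (\<i> t P)\<close> with projections \<open>P\<close>, which preserve the Haar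
  measure, yields loop (Schwinger-Dyson) equations for the expectations of symmetric functions of
  the eigenvalues. Integration by parts on the torus gives the same equations for the density
  \<open>\<bar>\<Delta>\<^sub>N\<bar>\<^sup>2 / N!\<close>. By Newton's identities the equations determine by recursion the expectations of all
  products of elementary symmetric polynomials, hence the law on permutation invariant events.
  Conversely a conjugation invariant law is determined by the law of its eigenvalues, since
  averaging over conjugation turns every event into a function of the eigenvalues.
\<close>

section \<open>Derivatives along measure-preserving flows\<close>

text \<open>A Haar measure is given only by translation invariance, without coordinates on the
  group. Flows in the group exist only for Hermitian generators, but the resulting identities are
  complex linear in the generator, and orthogonal projections span all complex matrices; this yields
  the matrix units whose contraction turns entries into traces. The recursion closes for two
  reasons. Combining the equations for the powers z_i^a with Newton coefficients collapses their
  quadratic part to r (N + 1 - r) e_r, and the cross terms of products of elementary symmetric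
  polynomials only involve index pairs that are further apart. If r is the largest index with 0 < r
  < N, the product to be computed has the coefficient (N - r) (r + k - n), where k is the power of
  the inverse determinant and n < k the number of factors e_N; so it is positive. Powers of the
  inverse determinant supply the negative exponents of Fourier coefficients. The Haar measure used
  for averaging comes from orthonormalising Lebesgue-random matrices.\<close>

no_notation Matrix.vec_index (infixl "$" 100)
hide_const (open) Matrix.mat Matrix.vec Determinant.det Matrix.row Matrix.col

text \<open>One constant bounds \<open>f\<close>, \<open>g\<close> and the quadratic remainder on
  all of \<open>S\<close>. The uniformity lets the derivative pass under an integral with an
  explicit rate, and the bounds on \<open>f\<close> and \<open>g\<close> make the notion stable
  under products.\<close>

definition flow_deriv ::
    "'a set \<Rightarrow> (real \<Rightarrow> 'a \<Rightarrow> 'a) \<Rightarrow> ('a \<Rightarrow> complex) \<Rightarrow> ('a \<Rightarrow> complex) \<Rightarrow> bool" where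
  "flow_deriv S T f g \<longleftrightarrow> (\<exists>K. \<forall>x\<in>S. norm (f x) \<le> K \<and> norm (g x) \<le> K \<and>
     (\<forall>t. \<bar>t\<bar> \<le> 1 \<longrightarrow> norm (f (T t x) - f x - of_real t * g x) \<le> K * t\<^sup>2))"

lemma flow_derivE:
  assumes "flow_deriv S T f g"
  obtains K where "K \<ge> 0" "\<And>x. x \<in> S \<Longrightarrow> norm (f x) \<le> K" "\<And>x. x \<in> S \<Longrightarrow> norm (g x) \<le> K"
    "\<And>x t. x \<in> S \<Longrightarrow> \<bar>t\<bar> \<le> 1 \<Longrightarrow> norm (f (T t x) - f x - of_real t * g x) \<le> K * t\<^sup>2"
proof -
  obtain K where K: "\<forall>x\<in>S. norm (f x) \<le> K \<and> norm (g x) \<le> K \<and>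
     (\<forall>t. \<bar>t\<bar> \<le> 1 \<longrightarrow> norm (f (T t x) - f x - of_real t * g x) \<le> K * t\<^sup>2)"
    using assms unfolding flow_deriv_def by blast
  have "K * t\<^sup>2 \<le> max K 0 * t\<^sup>2" for t :: real
    by (intro mult_right_mono) auto
  then show ?thesis
    using K by (intro that[of "max K 0"]) (auto intro: order_trans simp: le_max_iff_disj)
qed

lemma flow_derivI:
  assumes "\<And>x. x \<in> S \<Longrightarrow> norm (f x) \<le> K1" "\<And>x. x \<in> S \<Longrightarrow> norm (g x) \<le> K2"
    "\<And>x t. x \<in> S \<Longrightarrow> \<bar>t\<bar> \<le> 1 \<Longrightarrow> norm (f (T t x) - f x - of_real t * g x) \<le> K3 * t\<^sup>2"
  shows "flow_deriv S T f g"
  unfolding flow_deriv_def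
proof (intro exI[of _ "max K1 (max K2 K3)"] ballI conjI allI impI)
  fix x t assume "x \<in> S" "\<bar>t\<bar> \<le> (1::real)"
  then have "norm (f (T t x) - f x - of_real t * g x) \<le> K3 * t\<^sup>2" using assms by blast
  also have "\<dots> \<le> max K1 (max K2 K3) * t\<^sup>2" by (intro mult_right_mono) auto
  finally show "norm (f (T t x) - f x - of_real t * g x) \<le> max K1 (max K2 K3) * t\<^sup>2" .
qed (use assms in \<open>auto simp: le_max_iff_disj\<close>)

lemma flow_deriv_cong:
  assumes "flow_deriv S T f g" "\<And>x. x \<in> S \<Longrightarrow> f' x = f x" "\<And>x. x \<in> S \<Longrightarrow> g' x = g x"
    "\<And>x t. x \<in> S \<Longrightarrow> T t x \<in> S"
  shows "flow_deriv S T f' g'"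
  using assms unfolding flow_deriv_def by (metis (no_types, lifting))

lemma flow_deriv_const: "flow_deriv S T (\<lambda>x. c) (\<lambda>x. 0)"
  by (rule flow_derivI[of _ _ "norm c" _ 0 _ 0]) auto

lemma flow_deriv_add:
  assumes "flow_deriv S T f1 g1" "flow_deriv S T f2 g2"
  shows "flow_deriv S T (\<lambda>x. f1 x + f2 x) (\<lambda>x. g1 x + g2 x)"
proof -
  obtain K1 where K1: "\<And>x. x \<in> S \<Longrightarrow> norm (f1 x) \<le> K1" "\<And>x. x \<in> S \<Longrightarrow> norm (g1 x) \<le> K1"
    "\<And>x t. x \<in> S \<Longrightarrow> \<bar>t\<bar> \<le> 1 \<Longrightarrow> norm (f1 (T t x) - f1 x - of_real t * g1 x) \<le> K1 * t\<^sup>2"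
    using assms(1) by (rule flow_derivE) (blast intro: that)
  obtain K2 where K2: "\<And>x. x \<in> S \<Longrightarrow> norm (f2 x) \<le> K2" "\<And>x. x \<in> S \<Longrightarrow> norm (g2 x) \<le> K2"
    "\<And>x t. x \<in> S \<Longrightarrow> \<bar>t\<bar> \<le> 1 \<Longrightarrow> norm (f2 (T t x) - f2 x - of_real t * g2 x) \<le> K2 * t\<^sup>2"
    using assms(2) by (rule flow_derivE) (blast intro: that)
  show ?thesis
  proof (rule flow_derivI[of _ _ "K1 + K2" _ "K1 + K2" _ "K1 + K2"])
    fix x t assume x: "x \<in> S" "\<bar>t\<bar> \<le> (1::real)"
    have "f1 (T t x) + f2 (T t x) - (f1 x + f2 x) - of_real t * (g1 x + g2 x)
      = (f1 (T t x) - f1 x - of_real t * g1 x) + (f2 (T t x) - f2 x - of_real t * g2 x)"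
      by (simp add: algebra_simps)
    then show "norm (f1 (T t x) + f2 (T t x) - (f1 x + f2 x) - of_real t * (g1 x + g2 x))
      \<le> (K1 + K2) * t\<^sup>2"
      using norm_triangle_mono[OF K1(3)[OF x] K2(3)[OF x]] by (simp add: algebra_simps)
  qed (auto intro!: norm_triangle_mono K1 K2)
qed

lemma flow_deriv_mult:
  assumes "flow_deriv S T f1 g1" "flow_deriv S T f2 g2"
  shows "flow_deriv S T (\<lambda>x. f1 x * f2 x) (\<lambda>x. g1 x * f2 x + f1 x * g2 x)"
proof -
  obtain K1 where K1: "K1 \<ge> 0" "\<And>x. x \<in> S \<Longrightarrow> norm (f1 x) \<le> K1" "\<And>x. x \<in> S \<Longrightarrow> norm (g1 x) \<le> K1"
    "\<And>x t. x \<in> S \<Longrightarrow> \<bar>t\<bar> \<le> 1 \<Longrightarrow> norm (f1 (T t x) - f1 x - of_real t * g1 x) \<le> K1 * t\<^sup>2"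
    using assms(1) by (rule flow_derivE) (blast intro: that)
  obtain K2 where K2: "K2 \<ge> 0" "\<And>x. x \<in> S \<Longrightarrow> norm (f2 x) \<le> K2" "\<And>x. x \<in> S \<Longrightarrow> norm (g2 x) \<le> K2"
    "\<And>x t. x \<in> S \<Longrightarrow> \<bar>t\<bar> \<le> 1 \<Longrightarrow> norm (f2 (T t x) - f2 x - of_real t * g2 x) \<le> K2 * t\<^sup>2"
    using assms(2) by (rule flow_derivE) (blast intro: that)
  show ?thesis
  proof (rule flow_derivI[of _ _ "K1 * K2" _ "K1 * K2 + K1 * K2" _ "6 * (K1 * K2)"])
    fix x assume x: "x \<in> S"
    show "norm (f1 x * f2 x) \<le> K1 * K2"
      using K1 K2 x by (auto simp: norm_mult intro!: mult_mono)
    show "norm (g1 x * f2 x + f1 x * g2 x) \<le> K1 * K2 + K1 * K2"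
      using K1 K2 x by (intro norm_triangle_mono) (auto simp: norm_mult intro!: mult_mono)
    fix t assume t: "\<bar>t\<bar> \<le> (1::real)"
    define r1 where "r1 = f1 (T t x) - f1 x - of_real t * g1 x"
    define r2 where "r2 = f2 (T t x) - f2 x - of_real t * g2 x"
    define s where "s = complex_of_real t"
    have r: "norm r1 \<le> K1 * t\<^sup>2" "norm r2 \<le> K2 * t\<^sup>2"
      unfolding r1_def r2_def using K1 K2 x t by auto
    have s1: "norm s \<le> 1" using t by (simp add: s_def)
    have t2: "t\<^sup>2 \<le> 1" using t by (simp add: abs_square_le_1)
    \<comment> \<open>Multiplying \<open>f1 + s g1 + r1\<close> by \<open>f2 + s g2 + r2\<close>
      leaves six terms beyond first order; each is at most \<open>K1 * K2 * t\<^sup>2\<close>,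
      whence the factor 6.\<close>
    have e: "f1 (T t x) * f2 (T t x) - f1 x * f2 x - s * (g1 x * f2 x + f1 x * g2 x)
       = s\<^sup>2 * (g1 x * g2 x) + r1 * f2 x + r1 * (s * g2 x) + r1 * r2 + f1 x * r2 + (s * g1 x) * r2"
      unfolding r1_def r2_def s_def by (simp add: algebra_simps power2_eq_square)
    have n2: "norm r2 \<le> K2" using r(2) t2 K2(1) by (meson mult_left_le order_trans)
    have b1: "norm (s\<^sup>2 * (g1 x * g2 x)) \<le> t\<^sup>2 * (K1 * K2)"
      unfolding norm_mult using K1 K2 x by (intro mult_mono) (auto simp: s_def norm_power)
    have b2: "norm (r1 * f2 x) \<le> (K1 * t\<^sup>2) * K2"
      unfolding norm_mult using K1 K2 x r by (intro mult_mono) auto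
    have b3: "norm (r1 * (s * g2 x)) \<le> (K1 * t\<^sup>2) * (1 * K2)"
      unfolding norm_mult using K1 K2 x r s1 by (intro mult_mono) auto
    have b4: "norm (r1 * r2) \<le> (K1 * t\<^sup>2) * K2"
      unfolding norm_mult using K1 K2 x r n2 by (intro mult_mono) auto
    have b5: "norm (f1 x * r2) \<le> K1 * (K2 * t\<^sup>2)"
      unfolding norm_mult using K1 K2 x r by (intro mult_mono) auto
    have b6: "norm ((s * g1 x) * r2) \<le> (1 * K1) * (K2 * t\<^sup>2)"
      unfolding norm_mult using K1 K2 x r s1 by (intro mult_mono) auto
    have "norm (f1 (T t x) * f2 (T t x) - f1 x * f2 x - s * (g1 x * f2 x + f1 x * g2 x))
      \<le> t\<^sup>2 * (K1 * K2) + (K1 * t\<^sup>2) * K2 + (K1 * t\<^sup>2) * (1 * K2) + (K1 * t\<^sup>2) * K2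
         + K1 * (K2 * t\<^sup>2) + (1 * K1) * (K2 * t\<^sup>2)"
      unfolding e by (intro norm_triangle_mono b1 b2 b3 b4 b5 b6)
    also have "\<dots> = 6 * (K1 * K2) * t\<^sup>2" by simp
    finally show "norm (f1 (T t x) * f2 (T t x) - f1 x * f2 x
        - complex_of_real t * (g1 x * f2 x + f1 x * g2 x)) \<le> 6 * (K1 * K2) * t\<^sup>2"
      by (simp add: s_def)
  qed
qed

lemma flow_deriv_cmult:
  "flow_deriv S T f g \<Longrightarrow> flow_deriv S T (\<lambda>x. c * f x) (\<lambda>x. c * g x)"
  using flow_deriv_mult[OF flow_deriv_const[of S T c], of f g] by simp

lemma flow_deriv_sum:
  assumes "\<And>i. i \<in> I \<Longrightarrow> flow_deriv S T (f i) (g i)"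
  shows "flow_deriv S T (\<lambda>x. \<Sum>i\<in>I. f i x) (\<lambda>x. \<Sum>i\<in>I. g i x)"
  using assms
  by (induction I rule: infinite_finite_induct) (auto simp: flow_deriv_const intro: flow_deriv_add)

text \<open>Derivatives given as multiples of the functions add up under products. Nothing is
  divided by, so the rule covers factors with zeros, such as those of the squared Vandermonde
  product.\<close>

lemma flow_deriv_prod_log:
  assumes "\<And>i. i \<in> I \<Longrightarrow> flow_deriv S T (f i) (\<lambda>x. f i x * g i x)"
  shows "flow_deriv S T (\<lambda>x. \<Prod>i\<in>I. f i x) (\<lambda>x. (\<Prod>i\<in>I. f i x) * (\<Sum>i\<in>I. g i x))"
  using assms
proof (induction I rule: infinite_finite_induct)
  case (insert a I)
  have "flow_deriv S T (\<lambda>x. f a x * (\<Prod>i\<in>I. f i x))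
     (\<lambda>x. (f a x * g a x) * (\<Prod>i\<in>I. f i x) + f a x * ((\<Prod>i\<in>I. f i x) * (\<Sum>i\<in>I. g i x)))"
    using insert by (intro flow_deriv_mult) auto
  then show ?case using insert by (simp add: algebra_simps)
qed (auto simp: flow_deriv_const)

text \<open>Integration by parts: since \<open>T t\<close> preserves \<open>M\<close>, every
  difference quotient of \<open>f\<close> has integral zero, and the quotient at step
  \<open>1 / (n + 1)\<close> is within \<open>K / (n + 1)\<close> of \<open>g\<close>. The same
  limit gives measurability of \<open>g\<close>.\<close>

lemma (in prob_space) integral_flow_deriv_eq_0:
  assumes T: "\<And>t. T t \<in> measurable M M" "\<And>t. distr M M (T t) = M"
    and f: "f \<in> borel_measurable M" and fg: "flow_deriv (space M) T f g"
  shows "integrable M g" "integral\<^sup>L M g = 0"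
proof -
  obtain K where K: "K \<ge> 0" "\<And>x. x \<in> space M \<Longrightarrow> norm (f x) \<le> K" "\<And>x. x \<in> space M \<Longrightarrow> norm (g x) \<le> K"
    "\<And>x t. x \<in> space M \<Longrightarrow> \<bar>t\<bar> \<le> 1 \<Longrightarrow> norm (f (T t x) - f x - of_real t * g x) \<le> K * t\<^sup>2"
    using fg by (rule flow_derivE) (blast intro: that)
  define u where "u n x = of_real (Suc n) * (f (T (1 / Suc n) x) - f x)" for n x
  have u: "norm (g x - u n x) \<le> K / Suc n" if x: "x \<in> space M" for n x
  proof -
    define t where "t = 1 / real (Suc n)"
    have t: "\<bar>t\<bar> \<le> 1" "t > 0" "real (Suc n) = 1 / t" by (simp_all add: t_def field_simps)
    have u': "u n x = (f (T t x) - f x) / of_real t"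
      unfolding u_def t(3) t_def[symmetric] by simp
    have "g x - u n x = - (f (T t x) - f x - of_real t * g x) / of_real t"
      unfolding u' using t(2) by (simp add: field_simps)
    then have "norm (g x - u n x) = norm (f (T t x) - f x - of_real t * g x) / t"
      using t(2) by (simp add: norm_divide norm_minus_commute)
    also have "\<dots> \<le> K * t\<^sup>2 / t" using K(4)[OF x t(1)] t(2) by (intro divide_right_mono) auto
    also have "\<dots> = K / Suc n" using t(2) by (simp add: t_def power2_eq_square)
    finally show ?thesis .
  qed
  have lim0: "(\<lambda>n. K / real (Suc n)) \<longlonglongrightarrow> 0"
    using lim_const_over_n LIMSEQ_Suc by blast
  have mu: "u n \<in> borel_measurable M" for n
    unfolding u_def using f T(1) by (intro borel_measurable_times borel_measurable_diff
      borel_measurable_const measurable_compose[OF T(1) f]) auto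
  have lim: "(\<lambda>n. u n x) \<longlonglongrightarrow> g x" if x: "x \<in> space M" for x
  proof -
    have "(\<lambda>n. g x - u n x) \<longlonglongrightarrow> 0"
      by (rule Lim_null_comparison[OF _ lim0]) (use u x in \<open>auto intro!: always_eventually\<close>)
    from tendsto_diff[OF tendsto_const[of "g x"] this] show ?thesis by simp
  qed
  have mg: "g \<in> borel_measurable M"
    by (rule borel_measurable_LIMSEQ_metric[OF mu lim])
  show ig: "integrable M g"
    using K(3) by (intro integrable_const_bound[OF _ mg, of K]) auto
  have if1: "integrable M f"
    using K(2) by (intro integrable_const_bound[OF _ f, of K]) auto
  have if2: "integrable M (\<lambda>x. f (T t x))" for t
    using if1 T by (metis integrable_distr)
  have "(\<integral>x. f (T t x) \<partial>M) = integral\<^sup>L M f" for t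
    using integral_distr[OF T(1) f, of t] T(2) by simp
  then have iu: "integral\<^sup>L M (u n) = 0" and iu': "integrable M (u n)" for n
    unfolding u_def using if1 if2 by auto
  have "norm (integral\<^sup>L M g) \<le> K / Suc n" for n
  proof -
    have "norm (integral\<^sup>L M g) = norm (\<integral>x. g x - u n x \<partial>M)"
      using iu iu' ig by simp
    also have "\<dots> \<le> (\<integral>x. norm (g x - u n x) \<partial>M)" by (rule integral_norm_bound)
    also have "\<dots> \<le> (\<integral>x. K / Suc n \<partial>M)"
      using u iu' ig by (intro integral_mono) auto
    finally show ?thesis using prob_space by simp
  qed
  from tendsto_le[OF sequentially_bot lim0 tendsto_const, of "norm (integral\<^sup>L M g)"]
  have "norm (integral\<^sup>L M g) \<le> 0" using \<open>\<And>n. norm (integral\<^sup>L M g) \<le> K / Suc n\<close> by auto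
  then show "integral\<^sup>L M g = 0" by simp
qed

section \<open>The circle and the torus\<close>

inductive_set lincomb :: "('a \<Rightarrow> complex) set \<Rightarrow> ('a \<Rightarrow> complex) set"
  for B :: "('a \<Rightarrow> complex) set" where
  lincomb_gen: "f \<in> B \<Longrightarrow> f \<in> lincomb B"
| lincomb_zero: "(\<lambda>x. 0) \<in> lincomb B"
| lincomb_add: "f \<in> lincomb B \<Longrightarrow> g \<in> lincomb B \<Longrightarrow> (\<lambda>x. f x + g x) \<in> lincomb B"
| lincomb_cmult: "f \<in> lincomb B \<Longrightarrow> (\<lambda>x. c * f x) \<in> lincomb B"

lemma lincomb_sum:
  assumes "\<And>i. i \<in> I \<Longrightarrow> f i \<in> lincomb B"
  shows "(\<lambda>x. \<Sum>i\<in>I. f i x) \<in> lincomb B"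
  using assms
  by (induction I rule: infinite_finite_induct) (auto intro: lincomb_zero lincomb_add)

lemma lincomb_diff:
  assumes "f \<in> lincomb B" "g \<in> lincomb B"
  shows "(\<lambda>x. f x - g x) \<in> lincomb B"
  using lincomb_add[OF assms(1) lincomb_cmult[OF assms(2), of "-1"]] by simp

lemma lincomb_mult:
  assumes "\<And>a b. a \<in> A \<Longrightarrow> b \<in> B \<Longrightarrow> (\<lambda>x. a x * b x) \<in> lincomb C"
    and "f \<in> lincomb A" "g \<in> lincomb B"
  shows "(\<lambda>x. f x * g x) \<in> lincomb C"
  using assms(2)
proof induction
  case (lincomb_gen a)
  show ?case
    using assms(3)
  proof induction
    case (lincomb_cmult g c)
    then show ?case using lincomb.lincomb_cmult[of _ C c] by (simp add: algebra_simps)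
  qed (use assms(1) lincomb_gen in \<open>auto intro: lincomb.intros simp: distrib_left\<close>)
next
  case (lincomb_cmult f c)
  then show ?case using lincomb.lincomb_cmult[of _ C c] by (simp add: mult.assoc)
qed (auto intro: lincomb.intros simp: distrib_right)

lemma lincomb_subst:
  assumes "f \<in> lincomb A" "\<And>a. a \<in> A \<Longrightarrow> (\<lambda>x. a (h x)) \<in> lincomb B"
  shows "(\<lambda>x. f (h x)) \<in> lincomb B"
  using assms(1) by induction (use assms(2) in \<open>auto intro: lincomb.intros\<close>)

lemma lincomb_integral_eq:
  assumes "f \<in> lincomb B"
    and "\<And>b. b \<in> B \<Longrightarrow> integrable M b" "\<And>b. b \<in> B \<Longrightarrow> integrable M' b"
    and "\<And>b. b \<in> B \<Longrightarrow> integral\<^sup>L M b = integral\<^sup>L M' b"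
  shows "integrable M f \<and> integrable M' f \<and> integral\<^sup>L M f = integral\<^sup>L M' f"
  using assms(1) by induction (use assms(2-) in auto)

text \<open>On the circle the coordinates are \<open>(z + 1/z) / 2\<close> and
  \<open>(z - 1/z) / (2 \<i>)\<close>, so real polynomials in them become Laurent polynomials. This
  links Stone-Weierstrass for real polynomials to Fourier coefficients.\<close>

lemma real_polynomial_function_on_circle:
  fixes f :: "complex \<Rightarrow> real"
  assumes "real_polynomial_function f"
  shows "\<exists>g \<in> lincomb (range (\<lambda>(k::int) z. z powi k)). \<forall>z\<in>unit_circle. of_real (f z) = g z"
  using assms
proof induction
  case (linear f)
  interpret bounded_linear f by fact
  have pw: "(\<lambda>z. z powi k) \<in> lincomb (range (\<lambda>(k::int) (z::complex). z powi k))" for k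
    by (rule lincomb_gen) auto
  define g where "g z = complex_of_real (f 1) * (1/2 * (z powi 1 + z powi (-1)))
     + complex_of_real (f \<i>) * (- \<i>/2 * (z powi 1 + (-1) * z powi (-1)))" for z :: complex
  have "g \<in> lincomb (range (\<lambda>(k::int) z. z powi k))"
    unfolding g_def by (intro lincomb_add lincomb_cmult pw)
  moreover have "of_real (f z) = g z" if "z \<in> unit_circle" for z
  proof -
    have "z * cnj z = 1"
      using that by (simp add: complex_norm_square[symmetric])
    then have inv: "inverse z = cnj z" by (rule inverse_unique)
    have "z = Re z *\<^sub>R 1 + Im z *\<^sub>R \<i>" by (simp add: complex_eq_iff)
    from arg_cong[OF this, of f] have "f z = f (Re z *\<^sub>R 1 + Im z *\<^sub>R \<i>)" .
    also have "\<dots> = Re z * f 1 + Im z * f \<i>" by (simp add: add scaleR)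
    finally have fz: "f z = Re z * f 1 + Im z * f \<i>" .
    show ?thesis
      unfolding fz g_def by (simp add: power_int_minus inv complex_eq_iff)
  qed
  ultimately show ?case by blast
next
  case (const c)
  have "(\<lambda>z. complex_of_real c * z powi 0) \<in> lincomb (range (\<lambda>(k::int) (z::complex). z powi k))"
    by (intro lincomb_cmult lincomb_gen rangeI)
  then show ?case by (intro bexI) auto
next
  case (add f1 f2)
  then obtain g1 g2 where "g1 \<in> lincomb (range (\<lambda>(k::int) (z::complex). z powi k))"
    "\<forall>z\<in>unit_circle. of_real (f1 z) = g1 z" "g2 \<in> lincomb (range (\<lambda>(k::int) (z::complex). z powi k))"
    "\<forall>z\<in>unit_circle. of_real (f2 z) = g2 z" by blast
  then show ?case by (intro bexI[of _ "\<lambda>z. g1 z + g2 z"]) (auto intro: lincomb_add)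
next
  case (mult f1 f2)
  then obtain g1 g2 where g: "g1 \<in> lincomb (range (\<lambda>(k::int) (z::complex). z powi k))"
    "\<forall>z\<in>unit_circle. of_real (f1 z) = g1 z" "g2 \<in> lincomb (range (\<lambda>(k::int) (z::complex). z powi k))"
    "\<forall>z\<in>unit_circle. of_real (f2 z) = g2 z" by blast
  \<comment> \<open>The rule \<open>z powi k * z powi l = z powi (k + l)\<close> fails at
    \<open>z = 0\<close>, for instance for \<open>k = 1\<close> and \<open>l = -1\<close>. The
    product is therefore first expanded over functions that agree with powers off 0, and these are
    then replaced by genuine powers on the circle.\<close>
  let ?B = "{h. \<exists>k::int. \<forall>z::complex. z \<noteq> 0 \<longrightarrow> h z = z powi k}"
  have "(\<lambda>z. g1 z * g2 z) \<in> lincomb ?B"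
  proof (rule lincomb_mult[OF _ g(1) g(3)])
    fix a b :: "complex \<Rightarrow> complex" assume "a \<in> range (\<lambda>(k::int) z. z powi k)" "b \<in> range (\<lambda>(k::int) z. z powi k)"
    then obtain k l :: int where "a = (\<lambda>z. z powi k)" "b = (\<lambda>z. z powi l)" by auto
    then have "(\<lambda>x. a x * b x) \<in> ?B" by (auto intro!: exI[of _ "k + l"] simp: power_int_add)
    then show "(\<lambda>x. a x * b x) \<in> lincomb ?B" by (rule lincomb_gen)
  qed
  moreover have "\<exists>g \<in> lincomb (range (\<lambda>(k::int) z. z powi k)). \<forall>z\<in>unit_circle. h z = g z"
    if "h \<in> lincomb ?B" for h
    using that
  proof induction
    case (lincomb_gen f)
    then obtain k where k: "\<And>z. z \<noteq> 0 \<Longrightarrow> f z = z powi k" by auto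
    then show ?case
      by (intro bexI[of _ "\<lambda>z. z powi k"]) (auto intro!: lincomb.lincomb_gen k)
  next
    case lincomb_zero
    then show ?case by (intro bexI[of _ "\<lambda>z. 0"]) (auto intro: lincomb.intros)
  next
    case (lincomb_add f g)
    then obtain f' g' where "f' \<in> lincomb (range (\<lambda>(k::int) (z::complex). z powi k))"
     "g' \<in> lincomb (range (\<lambda>(k::int) (z::complex). z powi k))"
     "\<forall>z\<in>unit_circle. f z = f' z" "\<forall>z\<in>unit_circle. g z = g' z" by blast
    then show ?case by (intro bexI[of _ "\<lambda>z. f' z + g' z"]) (auto intro: lincomb.intros)
  next
    case (lincomb_cmult f c)
    then obtain f' where "f' \<in> lincomb (range (\<lambda>(k::int) (z::complex). z powi k))"
     "\<forall>z\<in>unit_circle. f z = f' z" by blast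
    then show ?case by (intro bexI[of _ "\<lambda>z. c * f' z"]) (auto intro: lincomb.intros)
  qed
  ultimately obtain g where "g \<in> lincomb (range (\<lambda>(k::int) z. z powi k))"
    "\<forall>z\<in>unit_circle. g1 z * g2 z = g z" by blast
  then show ?case using g by (intro bexI[of _ g]) auto
qed

text \<open>The functions \<open>max 0 (1 - n * infdist z C)\<close> decrease to the indicator of
  the closed set, and Stone-Weierstrass approximates the n-th one within \<open>1 / (n + 1)\<close>.
  The bound 2 is 1 for the function plus at most 1 for the error.\<close>

lemma trig_approx_indicator:
  fixes C :: "complex set"
  assumes "closed C"
  obtains p where "\<And>n. p n \<in> lincomb (range (\<lambda>(k::int) z. z powi k))"
    "\<And>n z. z \<in> unit_circle \<Longrightarrow> norm (p n z) \<le> 2"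
    "\<And>z. z \<in> unit_circle \<Longrightarrow> (\<lambda>n. p n z) \<longlonglongrightarrow> indicator C z"
\<comment> \<open>\<open>infdist\<close> to the empty set is 0 by convention, so the distance
  functions would tend to 1 instead of 0.\<close>
proof (cases "C = {}")
  case True
  then show ?thesis by (intro that[of "\<lambda>n z. 0"]) (auto intro: lincomb_zero)
next
  case False
  define f where "f n z = max 0 (1 - real n * infdist z C)" for n z
  have "\<exists>p\<in>lincomb (range (\<lambda>(k::int) z. z powi k)).
      \<forall>z\<in>unit_circle. norm (of_real (f n z) - p z) \<le> 1 / Suc n" for n
  proof -
    have "continuous_on unit_circle (f n)"
      unfolding f_def by (intro continuous_intros)
    then obtain g where g: "real_polynomial_function g" "\<And>z. z \<in> unit_circle \<Longrightarrow> \<bar>f n z - g z\<bar> < 1 / Suc n"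
      using Stone_Weierstrass_real_polynomial_function[of unit_circle "f n" "1 / Suc n"] by auto
    from real_polynomial_function_on_circle[OF g(1)]
    obtain p where p: "p\<in>lincomb (range (\<lambda>(k::int) z. z powi k))" "\<forall>z\<in>unit_circle. of_real (g z) = p z" by blast
    have "norm (complex_of_real (f n z) - p z) \<le> 1 / Suc n" if "z \<in> unit_circle" for z
    proof -
      have "complex_of_real (f n z) - p z = of_real (f n z - g z)" using p that by simp
      then show ?thesis using g(2)[OF that] by (simp only: norm_of_real less_imp_le)
    qed
    then show ?thesis using p by blast
  qed
  then obtain p where p: "\<And>n. p n \<in> lincomb (range (\<lambda>(k::int) z. z powi k))"
     "\<And>n z. z \<in> unit_circle \<Longrightarrow> norm (of_real (f n z) - p n z) \<le> 1 / Suc n" by metis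
  show ?thesis
  proof (rule that[of p])
    fix n z assume z: "z \<in> unit_circle"
    have "norm (p n z) \<le> norm (complex_of_real (f n z)) + norm (of_real (f n z) - p n z)"
      using norm_triangle_sub[of "p n z" "complex_of_real (f n z)"] by (simp add: norm_minus_commute)
    moreover have "norm (complex_of_real (f n z)) \<le> 1"
      using infdist_nonneg[of z C] by (auto simp: f_def)
    moreover have "1 / real (Suc n) \<le> 1" by simp
    ultimately show "norm (p n z) \<le> 2" using p(2)[OF z, of n] by linarith
  next
    fix z :: complex assume z: "z \<in> unit_circle"
    have flim: "(\<lambda>n. f n z) \<longlonglongrightarrow> indicator C z"
    proof (cases "z \<in> C")
      case True
      then show ?thesis by (simp add: f_def)
    next
      case False
      then have d: "infdist z C > 0" using infdist_pos_not_in_closed assms \<open>C \<noteq> {}\<close> by blast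
      obtain n0 :: nat where "real n0 > 1 / infdist z C" using reals_Archimedean2 by blast
      then have n0: "real n0 * infdist z C > 1" using d by (simp add: field_simps)
      have "f n z = 0" if "n \<ge> n0" for n
      proof -
        have "real n * infdist z C \<ge> real n0 * infdist z C"
          using that d by (intro mult_right_mono) auto
        then show ?thesis using n0 by (simp add: f_def)
      qed
      then show ?thesis
        using False by (auto intro!: tendsto_eventually eventually_sequentiallyI)
    qed
    have "(\<lambda>n. complex_of_real (f n z) - p n z) \<longlonglongrightarrow> 0"
      by (rule Lim_null_comparison[OF always_eventually LIMSEQ_Suc[OF lim_const_over_n]])
         (use p(2)[OF z] in auto)
    from tendsto_diff[OF tendsto_of_real[OF flim] this]
    show "(\<lambda>n. p n z) \<longlonglongrightarrow> indicator C z"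
      by (cases "z \<in> C") simp_all
  qed (rule p)
qed

section \<open>Measurable structure of the circle and the torus\<close>

lemma measurable_cis: "cis \<in> measurable borel (restrict_space borel unit_circle)"
  by (intro measurable_restrict_space2) (auto intro!: borel_measurable_continuous_onI continuous_intros)

lemma prob_space_circle_measure: "prob_space circle_measure"
  unfolding circle_measure_def
proof (rule prob_space.prob_space_distr)
  show "prob_space (uniform_measure lborel {0..<2 * pi})"
    by (rule prob_space_uniform_measure) auto
  show "cis \<in> measurable (uniform_measure lborel {0..<2 * pi}) (restrict_space borel unit_circle)"
    by (subst measurable_cong_sets[OF _ refl, of _ borel]) (auto intro: measurable_cis)
qed

lemma sets_circle_measure [measurable_cong]: "sets circle_measure = sets (restrict_space borel unit_circle)"
  by (simp add: circle_measure_def)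

lemma circle_ident_measurable [measurable]: "(\<lambda>z. z) \<in> borel_measurable circle_measure"
  by (subst measurable_cong_sets[OF sets_circle_measure refl])
     (intro measurable_restrict_space1 measurable_ident_sets refl)

lemma space_circle_measure: "space circle_measure = unit_circle"
  by (simp add: circle_measure_def space_restrict_space)

lemma sets_circle_closed:
  "sets circle_measure = sets (sigma unit_circle {C. closed C \<and> C \<subseteq> unit_circle})"
proof -
  have "sets circle_measure = (\<inter>) unit_circle ` sigma_sets UNIV (Collect closed)"
    by (simp add: sets_circle_measure sets_restrict_space borel_eq_closed sets_measure_of)
  also have "\<dots> = sigma_sets unit_circle ((\<inter>) unit_circle ` Collect closed)"
    by (rule sigma_sets_Int) (auto intro: sigma_sets.Basic)
  also have "(\<inter>) unit_circle ` Collect closed = {C. closed C \<and> C \<subseteq> unit_circle}"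
    by (auto intro!: image_eqI closed_Int)
  finally show ?thesis by (subst sets_measure_of) auto
qed

lemma prob_space_torus_measure: "prob_space (torus_measure N)"
  unfolding torus_measure_def by (intro prob_space_PiM prob_space_circle_measure)

lemma space_torus_measure: "space (torus_measure N) = (\<Pi>\<^sub>E j\<in>{..<N}. unit_circle)"
  by (simp add: torus_measure_def space_PiM space_circle_measure)

lemma torus_coord_measurable [measurable]:
  "j < N \<Longrightarrow> (\<lambda>z. z j) \<in> borel_measurable (torus_measure N)"
proof -
  assume "j < N"
  then have "(\<lambda>z. z j) \<in> measurable (torus_measure N) circle_measure"
    unfolding torus_measure_def by (intro measurable_component_singleton) simp
  then have "(\<lambda>z. z j) \<in> measurable (torus_measure N) (restrict_space borel unit_circle)"
    using measurable_cong_sets[OF refl sets_circle_measure] by blast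
  then show ?thesis by (simp add: measurable_restrict_space2_iff)
qed

lemma torus_coord_norm: "z \<in> space (torus_measure N) \<Longrightarrow> j < N \<Longrightarrow> norm (z j) = 1"
  by (auto simp: space_torus_measure PiE_def Pi_def)

text \<open>Boxes with closed sides are stable under intersection and their indicators factor over
  the coordinates, which makes them the right generator for comparing measures on the torus.\<close>

lemma sets_torus_closed:
  "sets (torus_measure N) = sigma_sets (\<Pi>\<^sub>E j\<in>{..<N}. unit_circle)
     {Pi\<^sub>E {..<N} C |C. \<forall>j<N. closed (C j) \<and> C j \<subseteq> unit_circle}"
proof -
  let ?E = "{C. closed C \<and> C \<subseteq> unit_circle}"
  let ?P = "{{f\<in>(\<Pi>\<^sub>E i\<in>{..<N}. unit_circle). \<forall>i\<in>j. f i \<in> A i} | A j. j \<in> {{..<N}} \<and> A \<in> Pi j (\<lambda>_. ?E)}"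
  have "sets (torus_measure N) = sets (\<Pi>\<^sub>M i\<in>{..<N}. sigma unit_circle ?E)"
    unfolding torus_measure_def by (intro sets_PiM_cong refl) (rule sets_circle_closed)
  also have "\<dots> = sets (sigma (\<Pi>\<^sub>E i\<in>{..<N}. unit_circle) ?P)"
    by (rule sets_PiM_sigma) (auto intro!: exI[of _ "{unit_circle}"])
  also have "?P = {Pi\<^sub>E {..<N} C |C. \<forall>j<N. closed (C j) \<and> C j \<subseteq> unit_circle}" (is "_ = ?Q")
  proof (intro equalityI subsetI)
    fix X assume "X \<in> ?P"
    then obtain A where A: "A \<in> Pi {..<N} (\<lambda>_. ?E)"
      "X = {f\<in>(\<Pi>\<^sub>E i\<in>{..<N}. unit_circle). \<forall>i\<in>{..<N}. f i \<in> A i}" by auto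
    have "A j \<subseteq> unit_circle" if "j < N" for j using A(1) that by auto
    then have "Pi\<^sub>E {..<N} A \<subseteq> (\<Pi>\<^sub>E i\<in>{..<N}. unit_circle)" by (intro PiE_mono) auto
    then have sub: "f \<in> (\<Pi>\<^sub>E i\<in>{..<N}. unit_circle)" if "f \<in> Pi\<^sub>E {..<N} A" for f
      using that by blast
    have "X = Pi\<^sub>E {..<N} A"
    proof (intro equalityI subsetI)
      fix f assume "f \<in> X" then show "f \<in> Pi\<^sub>E {..<N} A" unfolding A(2) by (simp add: PiE_iff)
    next
      fix f assume "f \<in> Pi\<^sub>E {..<N} A"
      then show "f \<in> X" unfolding A(2) using sub by blast
    qed
    then show "X \<in> ?Q" using A by (auto simp: Pi_def)
  next
    fix X assume "X \<in> ?Q"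
    then obtain A where A: "\<forall>j<N. closed (A j) \<and> A j \<subseteq> unit_circle" "X = Pi\<^sub>E {..<N} A" by auto
    have "X = {f\<in>(\<Pi>\<^sub>E i\<in>{..<N}. unit_circle). \<forall>i\<in>{..<N}. f i \<in> A i}"
    proof (intro equalityI subsetI)
      fix f assume f: "f \<in> X"
      then have "f \<in> (\<Pi>\<^sub>E i\<in>{..<N}. unit_circle)"
        using PiE_mono[of "{..<N}" A "\<lambda>_. unit_circle"] A by (meson lessThan_iff subsetD)
      then show "f \<in> {f\<in>(\<Pi>\<^sub>E i\<in>{..<N}. unit_circle). \<forall>i\<in>{..<N}. f i \<in> A i}"
        using f unfolding A(2) PiE_iff by simp
    next
      fix f assume "f \<in> {f\<in>(\<Pi>\<^sub>E i\<in>{..<N}. unit_circle). \<forall>i\<in>{..<N}. f i \<in> A i}"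
      then show "f \<in> X" unfolding A(2) PiE_iff by simp
    qed
    moreover have "A \<in> Pi {..<N} (\<lambda>_. ?E)" using A(1) by simp
    ultimately have "\<exists>A' j. X = {f\<in>(\<Pi>\<^sub>E i\<in>{..<N}. unit_circle). \<forall>i\<in>j. f i \<in> A' i} \<and>
        j \<in> {{..<N}} \<and> A' \<in> Pi j (\<lambda>_. ?E)"
      by (intro exI[of _ A] exI[of _ "{..<N}"] conjI singletonI)
    then show "X \<in> ?P" by (rule CollectI)
  qed
  also have "sets (sigma (\<Pi>\<^sub>E i\<in>{..<N}. unit_circle) ?Q) = sigma_sets (\<Pi>\<^sub>E i\<in>{..<N}. unit_circle) ?Q"
  proof (rule sets_measure_of, rule subsetI)
    fix X assume "X \<in> ?Q"
    then obtain C where C: "\<forall>j<N. closed (C j) \<and> C j \<subseteq> unit_circle" and X: "X = Pi\<^sub>E {..<N} C" by auto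
    have "X \<subseteq> (\<Pi>\<^sub>E i\<in>{..<N}. unit_circle)" unfolding X using C by (intro PiE_mono) auto
    then show "X \<in> Pow (\<Pi>\<^sub>E i\<in>{..<N}. unit_circle)" by (rule PowI)
  qed
  finally show ?thesis .
qed

lemma prod_lincomb_monomial:
  fixes f :: "nat \<Rightarrow> complex \<Rightarrow> complex"
  assumes "finite I" "\<And>j. j \<in> I \<Longrightarrow> f j \<in> lincomb (range (\<lambda>(k::int) z. z powi k))"
  shows "(\<lambda>z. \<Prod>j\<in>I. f j (z j)) \<in> lincomb (range (\<lambda>(l::nat \<Rightarrow> int) z. \<Prod>j\<in>I. z j powi l j))"
  using assms
proof (induction I rule: finite_induct)
  case empty
  then show ?case by (auto intro!: lincomb_gen)
next
  case (insert i I)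
  let ?A = "range (\<lambda>(k::int) (z::nat \<Rightarrow> complex). z i powi k)"
  let ?B = "range (\<lambda>(l::nat \<Rightarrow> int) (z::nat \<Rightarrow> complex). \<Prod>j\<in>I. z j powi l j)"
  have "(\<lambda>z. f i (z i)) \<in> lincomb ?A"
    by (rule lincomb_subst[of "f i" "range (\<lambda>(k::int) z. z powi k)" "\<lambda>z. z i"]) (use insert in \<open>auto intro: lincomb_gen\<close>)
  moreover have "(\<lambda>z. \<Prod>j\<in>I. f j (z j)) \<in> lincomb ?B" using insert by auto
  moreover have "(\<lambda>x. a x * b x) \<in> lincomb (range (\<lambda>(l::nat \<Rightarrow> int) z. \<Prod>j\<in>insert i I. z j powi l j))"
    if "a \<in> ?A" "b \<in> ?B" for a b
  proof -
    from that(1) obtain k :: int where k: "a = (\<lambda>z. z i powi k)" by (rule rangeE)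
    from that(2) obtain l where l: "b = (\<lambda>z. \<Prod>j\<in>I. z j powi l j)" by (rule rangeE)
    note kl = k l
    have "(\<lambda>x. a x * b x) = (\<lambda>z. \<Prod>j\<in>insert i I. z j powi (l(i := k)) j)"
    proof
      fix z :: "nat \<Rightarrow> complex"
      have "(\<Prod>j\<in>I. z j powi (l(i := k)) j) = (\<Prod>j\<in>I. z j powi l j)"
        using insert.hyps by (intro prod.cong) auto
      then show "a z * b z = (\<Prod>j\<in>insert i I. z j powi (l(i := k)) j)"
        unfolding kl using insert.hyps by simp
    qed
    then show ?thesis by (intro lincomb_gen range_eqI[of _ _ "l(i := k)"])
  qed
  ultimately have "(\<lambda>z. f i (z i) * (\<Prod>j\<in>I. f j (z j))) \<in>
     lincomb (range (\<lambda>(l::nat \<Rightarrow> int) z. \<Prod>j\<in>insert i I. z j powi l j))"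
    by (rule lincomb_mult[of ?A ?B, rotated])
  then show ?case using insert.hyps by simp
qed

lemma borel_measurable_powi [measurable]:
  fixes f :: "'a \<Rightarrow> complex"
  assumes "f \<in> borel_measurable M" shows "(\<lambda>x. f x powi k) \<in> borel_measurable M"
  using assms unfolding power_int_def by (cases "k \<ge> 0") auto

lemma finite_measure_torus_monomial:
  assumes "finite_measure M" "sets M = sets (torus_measure N)"
  shows "integrable M (\<lambda>z. \<Prod>j<N. z j powi l j)"
proof -
  interpret finite_measure M by fact
  have sp: "space M = space (torus_measure N)" using assms(2) by (rule sets_eq_imp_space_eq)
  have "(\<lambda>z. \<Prod>j<N. z j powi l j) \<in> borel_measurable (torus_measure N)"
    by measurable
  then have "(\<lambda>z. \<Prod>j<N. z j powi l j) \<in> borel_measurable M"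
    using measurable_cong_sets[OF assms(2) refl] by blast
  moreover have "norm (\<Prod>j<N. z j powi l j) \<le> 1" if "z \<in> space M" for z
    using that sp by (simp add: norm_power_int torus_coord_norm flip: prod_norm)
  ultimately show ?thesis by (intro integrable_const_bound[of _ 1]) auto
qed

text \<open>A finite measure on the torus is determined by its Fourier coefficients: indicators of
  closed boxes are bounded pointwise limits of products of one-variable trigonometric polynomials,
  and closed boxes form a generating pi-system.\<close>

lemma torus_measure_eqI:
  assumes "finite_measure M" "finite_measure M'"
    and sets: "sets M = sets (torus_measure N)" "sets M' = sets (torus_measure N)"
    and eq: "\<And>l :: nat \<Rightarrow> int. (\<integral>z. (\<Prod>j<N. z j powi l j) \<partial>M) = (\<integral>z. (\<Prod>j<N. z j powi l j) \<partial>M')"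
  shows "M = M'"
proof -
  interpret M: finite_measure M by fact
  interpret M': finite_measure M' by fact
  let ?\<Omega> = "\<Pi>\<^sub>E j\<in>{..<N}. unit_circle"
  let ?E = "{Pi\<^sub>E {..<N} C |C. \<forall>j<N. closed (C j) \<and> C j \<subseteq> unit_circle}"
  have sp: "space M = ?\<Omega>" "space M' = ?\<Omega>"
    using sets_eq_imp_space_eq[OF sets(1)] sets_eq_imp_space_eq[OF sets(2)]
    by (simp_all add: space_torus_measure)
  show ?thesis
  proof (rule measure_eqI_generator_eq[of ?E ?\<Omega> M M' "\<lambda>_. ?\<Omega>"])
    show "Int_stable ?E"
    proof (rule Int_stableI)
      fix a b assume "a \<in> ?E" "b \<in> ?E"
      then obtain C D where CD: "\<forall>j<N. closed (C j) \<and> C j \<subseteq> unit_circle"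
        "\<forall>j<N. closed (D j) \<and> D j \<subseteq> unit_circle" "a = Pi\<^sub>E {..<N} C" "b = Pi\<^sub>E {..<N} D" by auto
      then have "a \<inter> b = Pi\<^sub>E {..<N} (\<lambda>j. C j \<inter> D j)" by (auto simp: PiE_Int)
      then show "a \<inter> b \<in> ?E" using CD by (auto intro!: exI[of _ "\<lambda>j. C j \<inter> D j"])
    qed
    show "?E \<subseteq> Pow ?\<Omega>" by (auto simp: PiE_def Pi_def subset_eq)
    show "sets M = sigma_sets ?\<Omega> ?E" "sets M' = sigma_sets ?\<Omega> ?E"
      using sets sets_torus_closed by auto
    show "range (\<lambda>_. ?\<Omega>) \<subseteq> ?E" by auto
    show "emeasure M ?\<Omega> \<noteq> \<infinity>" by auto
  next
    fix X assume "X \<in> ?E"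
    then obtain C where C: "\<forall>j<N. closed (C j) \<and> C j \<subseteq> unit_circle" "X = Pi\<^sub>E {..<N} C" by auto
    have "\<exists>p. (\<forall>n. p n \<in> lincomb (range (\<lambda>(k::int) z. z powi k))) \<and>
      (\<forall>n. \<forall>z\<in>unit_circle. norm (p n z) \<le> 2) \<and> (\<forall>z\<in>unit_circle. (\<lambda>n. p n z) \<longlonglongrightarrow> indicator (C j) z)"
      if "j < N" for j
      using trig_approx_indicator[of "C j"] C(1) that by metis
    then obtain p where p: "\<And>j n. j < N \<Longrightarrow> p j n \<in> lincomb (range (\<lambda>(k::int) z. z powi k))"
      "\<And>j n z. j < N \<Longrightarrow> z\<in>unit_circle \<Longrightarrow> norm (p j n z) \<le> 2"
      "\<And>j z. j < N \<Longrightarrow> z\<in>unit_circle \<Longrightarrow> (\<lambda>n. p j n z) \<longlonglongrightarrow> indicator (C j) z" by metis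
    define F where "F n z = (\<Prod>j<N. p j n (z j))" for n and z :: "nat \<Rightarrow> complex"
    have F: "F n \<in> lincomb (range (\<lambda>(l::nat \<Rightarrow> int) z. \<Prod>j<N. z j powi l j))" for n
      unfolding F_def by (rule prod_lincomb_monomial) (use p(1) in auto)
    have FI: "integrable M (F n) \<and> integrable M' (F n) \<and> integral\<^sup>L M (F n) = integral\<^sup>L M' (F n)" for n
      by (rule lincomb_integral_eq[OF F])
         (use finite_measure_torus_monomial[OF assms(1) sets(1)]
            finite_measure_torus_monomial[OF assms(2) sets(2)] eq in blast)+
    have Fm: "F n \<in> borel_measurable M" "F n \<in> borel_measurable M'" for n
      using FI[of n] by (auto dest: borel_measurable_integrable)
    have Flim: "(\<lambda>n. F n z) \<longlonglongrightarrow> indicator X z" if z: "z \<in> ?\<Omega>" for z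
    proof -
      have "(\<lambda>n. F n z) \<longlonglongrightarrow> (\<Prod>j<N. indicator (C j) (z j))"
        unfolding F_def by (intro tendsto_prod p(3)) (use z in \<open>auto simp: PiE_iff\<close>)
      also have "(\<Prod>j<N. indicator (C j) (z j) :: complex) = indicator X z"
      proof (cases "z \<in> X")
        case False
        then obtain j where "j < N" "z j \<notin> C j" using z C(2) by (auto simp: PiE_iff)
        then have "indicator (C j) (z j) = (0::complex)" by simp
        then have "(\<Prod>j<N. indicator (C j) (z j) :: complex) = 0"
          using \<open>j < N\<close> by (intro prod_zero bexI[of _ j]) simp_all
        then show ?thesis using False by simp
      next
        case True
        then have "z j \<in> C j" if "j < N" for j using C(2) that by (auto simp: PiE_iff)
        then have "(\<Prod>j<N. indicator (C j) (z j) :: complex) = (\<Prod>j<N. 1)"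
          by (intro prod.cong) auto
        then show ?thesis using True by simp
      qed
      finally show ?thesis .
    qed
    have Fb: "norm (F n z) \<le> 2 ^ N" if z: "z \<in> ?\<Omega>" for z n
    proof -
      have "norm (F n z) = (\<Prod>j<N. norm (p j n (z j)))" by (simp add: F_def prod_norm)
      also have "\<dots> \<le> (\<Prod>j<N. 2)" using z by (intro prod_mono conjI norm_ge_zero p(2)) (auto simp: PiE_iff)
      finally show ?thesis by simp
    qed
    have X: "X \<in> sets M" "X \<in> sets M'"
      using C \<open>X \<in> ?E\<close> sets sets_torus_closed by (auto intro: sigma_sets.Basic)
    have ind: "A \<in> sets M \<Longrightarrow> integral\<^sup>L M (indicator A) = complex_of_real (measure M A)"
      "A \<in> sets M' \<Longrightarrow> integral\<^sup>L M' (indicator A) = complex_of_real (measure M' A)" for A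
    proof -
      have e: "(indicator A :: _ \<Rightarrow> complex) = (\<lambda>x. of_real (indicator A x))"
        by (auto simp: indicator_def)
      show "A \<in> sets M \<Longrightarrow> integral\<^sup>L M (indicator A) = complex_of_real (measure M A)"
        "A \<in> sets M' \<Longrightarrow> integral\<^sup>L M' (indicator A) = complex_of_real (measure M' A)"
        unfolding e integral_complex_of_real by (simp_all add: sets.Int_space_eq2)
    qed
    have l1: "(\<lambda>n. integral\<^sup>L M (F n)) \<longlonglongrightarrow> integral\<^sup>L M (indicator X :: _ \<Rightarrow> complex)"
      by (rule integral_dominated_convergence[where w="\<lambda>_. 2 ^ N"])
         (use Flim Fb X sp Fm in auto)
    have l2: "(\<lambda>n. integral\<^sup>L M' (F n)) \<longlonglongrightarrow> integral\<^sup>L M' (indicator X :: _ \<Rightarrow> complex)"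
      by (rule integral_dominated_convergence[where w="\<lambda>_. 2 ^ N"])
         (use Flim Fb X sp Fm in auto)
    have "(\<lambda>n. integral\<^sup>L M (F n)) = (\<lambda>n. integral\<^sup>L M' (F n))" using FI by blast
    from LIMSEQ_unique[OF l1[unfolded this] l2]
    have "integral\<^sup>L M (indicator X :: _ \<Rightarrow> complex) = integral\<^sup>L M' (indicator X :: _ \<Rightarrow> complex)"
      .
    then have "complex_of_real (measure M X) = of_real (measure M' X)"
      unfolding ind(1)[OF X(1)] ind(2)[OF X(2)] .
    then show "emeasure M X = emeasure M' X"
      by (simp add: M.emeasure_eq_measure M'.emeasure_eq_measure)
  qed auto
qed

section \<open>Fourier coefficients of the uniform measures and rotations of one coordinate\<close>

lemma integral_circle_measure:
  fixes f :: "complex \<Rightarrow> complex"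
  assumes "f \<in> borel_measurable circle_measure"
  shows "integral\<^sup>L circle_measure f = (LINT t:{0..<2*pi}|lborel. f (cis t)) / (2 * pi)"
proof -
  note m' = measurable_cis
  have m: "cis \<in> measurable (uniform_measure lborel {0..<2 * pi}) (restrict_space borel unit_circle)"
    by (subst measurable_cong_sets[OF _ refl, of _ borel]) (auto intro: measurable_cis)
  have f: "f \<in> borel_measurable (restrict_space borel unit_circle)"
    using assms measurable_cong_sets[OF sets_circle_measure refl] by blast
  have fc: "(\<lambda>t. f (cis t)) \<in> borel_measurable borel"
    using measurable_compose[OF m' f] .
  have "integral\<^sup>L circle_measure f = integral\<^sup>L (uniform_measure lborel {0..<2 * pi}) (\<lambda>t. f (cis t))"
    unfolding circle_measure_def by (rule integral_distr[OF m f])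
  also have "uniform_measure lborel {0..<2 * pi} =
      density lborel (\<lambda>t. ennreal (indicator {0..<2*pi} t / (2*pi)))"
    unfolding uniform_measure_def
    by (intro density_cong) (auto simp: divide_ennreal[symmetric] ennreal_indicator)
  also have "integral\<^sup>L \<dots> (\<lambda>t. f (cis t)) = (\<integral>t. (indicator {0..<2*pi} t / (2*pi)) *\<^sub>R f (cis t) \<partial>lborel)"
    using fc by (subst integral_density) auto
  also have "\<dots> = (\<integral>t. (1 / (2*pi)) *\<^sub>R (indicator {0..<2*pi} t *\<^sub>R f (cis t)) \<partial>lborel)"
    by (intro Bochner_Integration.integral_cong) auto
  also have "\<dots> = (LINT t:{0..<2*pi}|lborel. f (cis t)) / (2 * pi)"
    by (simp add: set_lebesgue_integral_def scaleR_conv_of_real)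
  finally show ?thesis .
qed

text \<open>For \<open>k \<noteq> 0\<close> the antiderivative
  \<open>exp (\<i> * k * t) / (\<i> * k)\<close> has period 2 pi. The half-open interval is closed
  up to a null set so that the fundamental theorem of calculus applies.\<close>

lemma integral_circle_powi: "(\<integral>z. z powi k \<partial>circle_measure) = (if k = 0 then 1 else 0)"
proof (cases "k = 0")
  case True
  interpret prob_space circle_measure by (rule prob_space_circle_measure)
  show ?thesis using True prob_space by simp
next
  case False
  have m: "(\<lambda>z. z powi k) \<in> borel_measurable circle_measure"
    by measurable
  have e: "cis t powi k = exp (\<i> * of_int k * of_real t)" for t
    by (simp add: cis_conv_exp exp_power_int mult_ac)
  have "(LINT t:{0..<2*pi}|lborel. cis t powi k) = (LINT t:{0..2*pi}|lborel. cis t powi k)"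
    unfolding set_lebesgue_integral_def
  proof (rule integral_cong_AE)
    have "cis \<in> borel_measurable borel"
      by (intro borel_measurable_continuous_onI continuous_intros)
    then have m: "(\<lambda>t. cis t powi k) \<in> borel_measurable borel"
      by (rule borel_measurable_powi)
    then show "(\<lambda>t. indicator {0..<2*pi} t *\<^sub>R cis t powi k) \<in> borel_measurable lborel"
      "(\<lambda>t. indicator {0..2*pi} t *\<^sub>R cis t powi k) \<in> borel_measurable lborel"
      by (auto intro!: borel_measurable_scaleR)
    show "AE t in lborel. indicator {0..<2*pi} t *\<^sub>R cis t powi k = indicator {0..2*pi} t *\<^sub>R cis t powi k"
      by (rule AE_mp[OF AE_lborel_singleton[of "2*pi"]]) (auto simp: indicator_def)
  qed
  also have "\<dots> = exp (\<i> * of_int k * of_real (2 * pi)) / (\<i> * of_int k) - exp (\<i> * of_int k * of_real 0) / (\<i> * of_int k)"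
    unfolding e set_lebesgue_integral_def
  proof (rule integral_FTC_Icc)
    fix x :: real
    have "((\<lambda>z. exp (\<i> * of_int k * z) / (\<i> * of_int k)) has_field_derivative exp (\<i> * of_int k * of_real x))
        (at (complex_of_real x))"
      using False by (auto intro!: derivative_eq_intros)
    then show "((\<lambda>t. exp (\<i> * of_int k * of_real t) / (\<i> * of_int k)) has_vector_derivative
       exp (\<i> * of_int k * of_real x)) (at x within {0..2 * pi})"
      by (rule has_vector_derivative_real_field)
  qed (auto intro!: continuous_intros)
  also have "exp (\<i> * of_int k * of_real (2 * pi)) = 1"
    unfolding e[of "2 * pi", symmetric] by simp
  finally show ?thesis using False by (subst integral_circle_measure[OF m]) simp
qed

lemma integral_torus_monomial:
  "(\<integral>z. (\<Prod>j<N. z j powi l j) \<partial>torus_measure N) = (if \<forall>j<N. l j = 0 then 1 else 0)"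
proof -
  interpret prob_space circle_measure by (rule prob_space_circle_measure)
  interpret product_sigma_finite "\<lambda>_::nat. circle_measure" by standard
  have i: "integrable circle_measure (\<lambda>z. z powi k)" for k
  proof (rule integrable_const_bound[of _ 1])
    show "(\<lambda>z. z powi k) \<in> borel_measurable circle_measure"
      by measurable
  qed (auto simp: space_circle_measure norm_power_int)
  have "(\<integral>z. (\<Prod>j<N. z j powi l j) \<partial>torus_measure N) = (\<Prod>j<N. \<integral>z. z powi l j \<partial>circle_measure)"
    unfolding torus_measure_def by (rule product_integral_prod) (auto intro: i)
  then show ?thesis by (auto simp: integral_circle_powi intro!: prod_zero)
qed

definition rotate_coord :: "nat \<Rightarrow> real \<Rightarrow> (nat \<Rightarrow> complex) \<Rightarrow> nat \<Rightarrow> complex" where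
  "rotate_coord i t z = z(i := cis t * z i)"

lemma rotate_coord_measurable:
  assumes "i < N" shows "rotate_coord i t \<in> measurable (torus_measure N) (torus_measure N)"
  unfolding torus_measure_def rotate_coord_def
proof (rule measurable_PiM_single')
  fix j assume "j \<in> {..<N}"
  have "(\<lambda>z. (z(i := cis t * z i)) j) \<in> borel_measurable (torus_measure N)"
    using assms \<open>j \<in> {..<N}\<close> by (cases "j = i") auto
  then have "(\<lambda>z. (z(i := cis t * z i)) j) \<in> measurable (torus_measure N) (restrict_space borel unit_circle)"
    using assms \<open>j \<in> {..<N}\<close>
    by (intro measurable_restrict_space2) (auto simp: norm_mult torus_coord_norm)
  then show "(\<lambda>z. (z(i := cis t * z i)) j) \<in> measurable (Pi\<^sub>M {..<N} (\<lambda>j. circle_measure)) circle_measure"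
    using measurable_cong_sets[OF refl sets_circle_measure] unfolding torus_measure_def by blast
qed (use assms in \<open>auto simp: space_PiM space_circle_measure norm_mult PiE_iff extensional_def\<close>)

text \<open>The rotation multiplies the monomial with exponents \<open>l\<close> by
  \<open>cis t powi l i\<close>. This factor is 1 when \<open>l i = 0\<close>, and otherwise the
  integral of the monomial vanishes; so all Fourier coefficients agree.\<close>

lemma distr_rotate_coord:
  assumes "i < N" shows "distr (torus_measure N) (torus_measure N) (rotate_coord i t) = torus_measure N"
proof (rule torus_measure_eqI[of _ _ N])
  interpret prob_space "torus_measure N" by (rule prob_space_torus_measure)
  show "finite_measure (torus_measure N)" by (rule finite_measure_axioms)
  show "finite_measure (distr (torus_measure N) (torus_measure N) (rotate_coord i t))"
    using prob_space_distr[OF rotate_coord_measurable[OF assms]] by (simp add: prob_space.finite_measure)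
  fix l :: "nat \<Rightarrow> int"
  have "(\<integral>z. (\<Prod>j<N. z j powi l j) \<partial>distr (torus_measure N) (torus_measure N) (rotate_coord i t))
     = (\<integral>z. (\<Prod>j<N. rotate_coord i t z j powi l j) \<partial>torus_measure N)"
    by (rule integral_distr[OF rotate_coord_measurable[OF assms]]) measurable
  also have "(\<lambda>z. \<Prod>j<N. rotate_coord i t z j powi l j) = (\<lambda>z. (cis t powi l i) * (\<Prod>j<N. z j powi l j))"
  proof
    fix z :: "nat \<Rightarrow> complex"
    have "(\<Prod>j<N. rotate_coord i t z j powi l j) = (\<Prod>j<N. (if j = i then cis t powi l i else 1) * z j powi l j)"
      by (intro prod.cong) (auto simp: rotate_coord_def power_int_mult_distrib)
    then show "(\<Prod>j<N. rotate_coord i t z j powi l j) = (cis t powi l i) * (\<Prod>j<N. z j powi l j)"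
      using assms by (simp add: prod.distrib)
  qed
  finally show "(\<integral>z. (\<Prod>j<N. z j powi l j) \<partial>distr (torus_measure N) (torus_measure N) (rotate_coord i t))
     = (\<integral>z. (\<Prod>j<N. z j powi l j) \<partial>torus_measure N)"
    using assms by (auto simp: integral_torus_monomial)
qed auto

section \<open>Newton identities\<close>

definition lin_fps :: "complex \<Rightarrow> complex fps" where
  "lin_fps z = 1 + fps_const z * fps_X"

definition geom_fps :: "complex \<Rightarrow> complex fps" where
  "geom_fps z = Abs_fps (\<lambda>n. (- z) ^ n)"

text \<open>The logarithmic Euler derivative of \<open>1 + z X\<close>, namely
  \<open>z X / (1 + z X)\<close>, written as \<open>1 - 1 / (1 + z X)\<close>. The identities for
  symmetric polynomials are read off as coefficients of such series.\<close>

definition log_fps :: "complex \<Rightarrow> complex fps" where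
  "log_fps z = 1 - geom_fps z"

definition euler_fps :: "complex fps \<Rightarrow> complex fps" where
  "euler_fps f = fps_X * fps_deriv f"

lemma euler_fps_nth: "fps_nth (euler_fps f) n = of_nat n * fps_nth f n"
  by (cases n) (simp_all add: euler_fps_def)

lemma euler_fps_mult: "euler_fps (f * g) = euler_fps f * g + f * euler_fps g"
  by (simp add: euler_fps_def algebra_simps)

lemma euler_fps_add: "euler_fps (f + g) = euler_fps f + euler_fps g"
  by (simp add: euler_fps_def algebra_simps)

lemma euler_fps_sum: "euler_fps (\<Sum>i\<in>I. f i) = (\<Sum>i\<in>I. euler_fps (f i))"
  by (induction I rule: infinite_finite_induct) (auto simp: euler_fps_add, simp_all add: euler_fps_def)

lemma geom_lin_fps: "geom_fps z * lin_fps z = 1"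
proof (rule fps_ext)
  fix n
  show "fps_nth (geom_fps z * lin_fps z) n = fps_nth 1 n"
  proof -
    have e: "geom_fps z * lin_fps z = geom_fps z + fps_const z * (fps_X * geom_fps z)"
      by (simp add: lin_fps_def algebra_simps)
    show ?thesis unfolding e by (cases n) (simp_all add: geom_fps_def)
  qed
qed

lemma log_fps_lin: "log_fps z = fps_const z * fps_X * geom_fps z"
proof -
  have "1 = geom_fps z + fps_const z * fps_X * geom_fps z"
    using geom_lin_fps[of z] by (simp add: lin_fps_def algebra_simps)
  then show ?thesis by (metis add_diff_cancel_left' log_fps_def)
qed

lemma log_fps_nth: "fps_nth (log_fps z) n = (if n = 0 then 0 else - ((- 1) ^ n)) * z ^ n"
  by (simp add: log_fps_def geom_fps_def power_minus[of z])

lemma euler_lin_fps: "euler_fps (lin_fps z) = log_fps z * lin_fps z"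
proof -
  have "log_fps z * lin_fps z = fps_const z * fps_X * (geom_fps z * lin_fps z)"
    by (simp add: log_fps_lin mult.assoc)
  then show ?thesis by (simp add: geom_lin_fps) (simp add: euler_fps_def lin_fps_def algebra_simps)
qed

text \<open>Apply the Euler derivative to \<open>geom_fps z * lin_fps z = 1\<close> and multiply by
  \<open>geom_fps z\<close> to divide by \<open>lin_fps z\<close>.\<close>

lemma euler_log_fps: "euler_fps (log_fps z) = log_fps z * geom_fps z"
proof -
  have "0 = euler_fps (geom_fps z * lin_fps z)"
    by (simp add: geom_lin_fps euler_fps_def)
  then have "0 = euler_fps (geom_fps z) * lin_fps z + log_fps z * (geom_fps z * lin_fps z)"
    by (simp add: euler_fps_mult euler_lin_fps algebra_simps)
  then have "0 = (euler_fps (geom_fps z) * lin_fps z + log_fps z * (geom_fps z * lin_fps z)) * geom_fps z"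
    by simp
  also have "\<dots> = euler_fps (geom_fps z) * (geom_fps z * lin_fps z)
      + log_fps z * geom_fps z * (geom_fps z * lin_fps z)"
    by (simp add: algebra_simps)
  finally have "0 = euler_fps (geom_fps z) + log_fps z * geom_fps z" by (simp add: geom_lin_fps)
  moreover have "euler_fps (log_fps z) = - euler_fps (geom_fps z)"
    by (simp add: log_fps_def euler_fps_def)
  ultimately show ?thesis by (metis neg_eq_iff_add_eq_0)
qed

section \<open>Elementary symmetric polynomials and power sums via generating functions\<close>

definition esym_fps :: "nat \<Rightarrow> (nat \<Rightarrow> complex) \<Rightarrow> complex fps" where
  "esym_fps N z = (\<Prod>i<N. lin_fps (z i))"

definition esym :: "nat \<Rightarrow> nat \<Rightarrow> (nat \<Rightarrow> complex) \<Rightarrow> complex" where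
  "esym N r z = fps_nth (esym_fps N z) r"

text \<open>The part of the elementary symmetric polynomial that contains the variable \<open>z i\<close>.\<close>

definition esym_part :: "nat \<Rightarrow> nat \<Rightarrow> nat \<Rightarrow> (nat \<Rightarrow> complex) \<Rightarrow> complex" where
  "esym_part N r i z = fps_nth (log_fps (z i) * esym_fps N z) r"

definition psum :: "nat \<Rightarrow> int \<Rightarrow> (nat \<Rightarrow> complex) \<Rightarrow> complex" where
  "psum N b z = (\<Sum>i<N. z i powi b)"

text \<open>The sign of the coefficient of \<open>log_fps\<close> at \<open>a\<close>. The value 0
  at \<open>a = 0\<close> reflects that this series has no constant term, and lets the convolution
  sums start at 0.\<close>

abbreviation newton_sign :: "nat \<Rightarrow> complex" where
  "newton_sign a \<equiv> (if a = 0 then 0 else - ((- 1) ^ a))"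

lemma euler_esym_fps: "euler_fps (esym_fps N z) = (\<Sum>i<N. log_fps (z i)) * esym_fps N z"
proof (induction N)
  case 0
  then show ?case by (simp add: esym_fps_def euler_fps_def)
next
  case (Suc N)
  have "esym_fps (Suc N) z = esym_fps N z * lin_fps (z N)" by (simp add: esym_fps_def)
  then show ?case by (simp add: Suc euler_fps_mult euler_lin_fps algebra_simps)
qed

lemma esym_0: "esym N 0 z = 1"
proof (induction N)
  case (Suc N)
  have "esym_fps (Suc N) z = esym_fps N z * lin_fps (z N)" by (simp add: esym_fps_def)
  then show ?case using Suc by (simp add: esym_def lin_fps_def)
qed (simp add: esym_def esym_fps_def)

lemma esym_Suc: "esym (Suc N) (Suc r) z = esym N (Suc r) z + z N * esym N r z"
proof -
  have "esym_fps (Suc N) z = esym_fps N z + fps_const (z N) * (fps_X * esym_fps N z)"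
    by (simp add: esym_fps_def lin_fps_def algebra_simps)
  then show ?thesis by (simp add: esym_def)
qed

lemma esym_eq_0: "r > N \<Longrightarrow> esym N r z = 0"
proof (induction N arbitrary: r)
  case 0
  then show ?case by (simp add: esym_def esym_fps_def)
next
  case (Suc N)
  then obtain r' where "r = Suc r'" by (cases r) auto
  then show ?case using Suc by (simp add: esym_Suc)
qed

lemma esym_top: "esym N N z = (\<Prod>i<N. z i)"
  by (induction N) (simp_all add: esym_0 esym_Suc esym_eq_0)

lemma esym_part_0: "esym_part N 0 i z = 0"
  by (simp add: esym_part_def log_fps_nth)

text \<open>The monomials of degree r + 1 containing \<open>z i\<close> are \<open>z i\<close> times
  the monomials of degree r free of it, and the latter sum to
  \<open>esym N r z - esym_part N r i z\<close>.\<close>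

lemma esym_part_Suc: "esym_part N (Suc r) i z = z i * (esym N r z - esym_part N r i z)"
proof -
  have "log_fps (z i) * esym_fps N z = fps_const (z i) * (fps_X * (esym_fps N z - log_fps (z i) * esym_fps N z))"
  proof -
    have "geom_fps (z i) = 1 - log_fps (z i)" by (simp add: log_fps_def)
    then have "log_fps (z i) = fps_const (z i) * fps_X * (1 - log_fps (z i))"
      using log_fps_lin[of "z i"] by simp
    then have "log_fps (z i) * esym_fps N z = fps_const (z i) * fps_X * (1 - log_fps (z i)) * esym_fps N z"
      by simp
    then show ?thesis by (simp add: algebra_simps)
  qed
  then have "esym_part N (Suc r) i z = fps_nth (fps_const (z i) * (fps_X * (esym_fps N z - log_fps (z i) * esym_fps N z))) (Suc r)"
    by (simp add: esym_part_def)
  then show ?thesis by (simp add: esym_def esym_part_def)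
qed

lemma esym_part_sum: "esym_part N r i z = (\<Sum>a=0..r. newton_sign a * z i ^ a * esym N (r - a) z)"
  by (simp add: esym_part_def esym_def fps_mult_nth log_fps_nth)

text \<open>Euler's relation for a homogeneous polynomial: every monomial of \<open>esym N r\<close>
  contains r of the variables.\<close>

lemma sum_esym_part: "(\<Sum>i<N. esym_part N r i z) = of_nat r * esym N r z"
proof -
  have "(\<Sum>i<N. esym_part N r i z) = fps_nth (euler_fps (esym_fps N z)) r"
    by (simp add: euler_esym_fps esym_part_def sum_distrib_right fps_sum_nth)
  then show ?thesis by (simp add: euler_fps_nth esym_def)
qed

lemma newton_identity: "of_nat r * esym N r z = (\<Sum>a=0..r. newton_sign a * psum N (int a) z * esym N (r - a) z)"
proof -
  have "of_nat r * esym N r z = (\<Sum>i<N. \<Sum>a=0..r. newton_sign a * z i ^ a * esym N (r - a) z)"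
    by (simp flip: sum_esym_part esym_part_sum)
  also have "\<dots> = (\<Sum>a=0..r. \<Sum>i<N. newton_sign a * z i ^ a * esym N (r - a) z)"
    by (rule sum.swap)
  finally show ?thesis by (simp add: psum_def sum_distrib_left sum_distrib_right mult_ac)
qed

text \<open>This is \<open>newton_identity\<close> under \<open>z i\<close> times the partial
  derivative in \<open>z i\<close>: a power sum gives \<open>a * z i ^ a\<close>, and
  \<open>esym\<close> gives \<open>esym_part\<close>. On generating functions it is the Euler
  derivative of \<open>log_fps (z i) * esym_fps N z\<close>. It serves to identify
  \<open>esym_part\<close> as the derivative of \<open>esym\<close>.\<close>

lemma newton_identity_part:
  assumes "i < N"
  shows "of_nat r * esym_part N r i z = (\<Sum>a=0..r. newton_sign a *
     (of_nat a * z i ^ a * esym N (r - a) z + psum N (int a) z * esym_part N (r - a) i z))"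
proof -
  let ?L = "log_fps (z i)" and ?P = "\<Sum>j<N. log_fps (z j)" and ?E = "esym_fps N z"
  have P: "fps_nth ?P a = newton_sign a * psum N (int a) z" for a
    by (simp add: fps_sum_nth log_fps_nth psum_def sum_distrib_left sum_negf)
  have "of_nat r * esym_part N r i z = fps_nth (euler_fps (?L * ?E)) r"
    by (simp add: euler_fps_nth esym_part_def)
  also have "euler_fps (?L * ?E) = euler_fps ?L * ?E + ?P * (?L * ?E)"
    by (simp add: euler_fps_mult euler_esym_fps algebra_simps)
  also have "fps_nth \<dots> r = (\<Sum>a=0..r. fps_nth (euler_fps ?L) a * fps_nth ?E (r - a)) +
       (\<Sum>a=0..r. fps_nth ?P a * fps_nth (?L * ?E) (r - a))"
    by (simp only: fps_add_nth fps_mult_nth[of "euler_fps ?L"] fps_mult_nth[of ?P "?L * ?E"])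
  also have "\<dots> = (\<Sum>a=0..r. newton_sign a *
     (of_nat a * z i ^ a * esym N (r - a) z + psum N (int a) z * esym_part N (r - a) i z))"
    unfolding P euler_fps_nth log_fps_nth
    by (simp add: sum.distrib[symmetric] esym_def esym_part_def algebra_simps)
  finally show ?thesis .
qed

text \<open>The sum over \<open>1 \<le> t \<le> a\<close> of products of the power sums of orders t
  and \<open>a - t\<close>. On matrices it arises as a sum of products of traces of powers; on the
  torus it comes from the derivative of \<open>z i ^ a\<close> and the logarithmic derivative of the
  squared Vandermonde product.\<close>

definition repulsion :: "nat \<Rightarrow> nat \<Rightarrow> (nat \<Rightarrow> complex) \<Rightarrow> complex" where
  "repulsion N a z = (\<Sum>i<N. \<Sum>j<N. \<Sum>t=1..a. z i ^ t * z j ^ (a - t))"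

text \<open>With Newton coefficients the quadratic repulsion terms collapse to a multiple of a
  single \<open>esym N r z\<close>. In generating functions both sums over \<open>a\<close> become
  the left side of \<open>C\<close>, which is expressed there by the first and second Euler
  derivatives of \<open>esym_fps\<close>.\<close>

lemma repulsion_esym:
  "(\<Sum>a=0..r. newton_sign a * (repulsion N a z * esym N (r - a) z
      + (\<Sum>i<N. z i ^ a * esym_part N (r - a) i z))) = of_nat r * (of_nat N + 1 - of_nat r) * esym N r z"
proof -
  let ?E = "esym_fps N z" and ?P = "\<Sum>j<N. log_fps (z j)"
  have H: "fps_nth (log_fps x * geom_fps y) a = newton_sign a * (\<Sum>t=1..a. x ^ t * y ^ (a - t))" for x y a
  proof -
    have "fps_nth (log_fps x * geom_fps y) a = (\<Sum>t=0..a. fps_nth (log_fps x) t * (- y) ^ (a - t))"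
      by (simp add: fps_mult_nth geom_fps_def)
    also have "\<dots> = (\<Sum>t=1..a. fps_nth (log_fps x) t * (- y) ^ (a - t))"
      by (rule sum.mono_neutral_right) (auto simp: log_fps_nth)
    also have "\<dots> = (\<Sum>t=1..a. newton_sign a * (x ^ t * y ^ (a - t)))"
    proof (intro sum.cong refl)
      fix t assume "t \<in> {1..a}"
      then have "(-1::complex) ^ a = (-1) ^ t * (-1) ^ (a - t)" by (simp flip: power_add)
      then show "fps_nth (log_fps x) t * (- y) ^ (a - t) = newton_sign a * (x ^ t * y ^ (a - t))"
        using \<open>t \<in> {1..a}\<close> by (simp add: log_fps_nth power_minus[of y])
    qed
    finally show ?thesis by (simp add: sum_distrib_left)
  qed
  have A: "fps_nth ((\<Sum>i<N. \<Sum>j<N. log_fps (z i) * geom_fps (z j)) * ?E) r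
     = (\<Sum>a=0..r. newton_sign a * (repulsion N a z * esym N (r - a) z))"
    unfolding fps_mult_nth[of "\<Sum>i<N. _ i"] fps_sum_nth H
    by (simp only: sum_distrib_left[symmetric] repulsion_def esym_def mult.assoc)
  have B: "fps_nth (\<Sum>i<N. log_fps (z i) * (log_fps (z i) * ?E)) r
     = (\<Sum>a=0..r. newton_sign a * (\<Sum>i<N. z i ^ a * esym_part N (r - a) i z))"
    unfolding fps_sum_nth fps_mult_nth[of "log_fps _" "log_fps _ * ?E"] 
    by (subst sum.swap) (simp add: log_fps_nth esym_part_def sum_distrib_left mult.assoc)
  \<comment> \<open>Let P be the sum of the \<open>log_fps (z i)\<close>, S the sum of their squares
    and E the series \<open>esym_fps N z\<close>. Since \<open>geom_fps\<close> is
    \<open>1 - log_fps\<close>, the left side is (N P - P^2 + S) E. The Euler derivative maps E to P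
    E and P to P - S, so applied twice it maps E to (P - S + P^2) E.\<close>
  have C: "(\<Sum>i<N. \<Sum>j<N. log_fps (z i) * geom_fps (z j)) * ?E + (\<Sum>i<N. log_fps (z i) * (log_fps (z i) * ?E))
     = (of_nat N + 1) * euler_fps ?E - euler_fps (euler_fps ?E)"
  proof -
    define P S where "P = ?P" and "S = (\<Sum>i<N. log_fps (z i) * log_fps (z i))"
    have a: "(\<Sum>i<N. \<Sum>j<N. log_fps (z i) * geom_fps (z j)) = of_nat N * P - P * P"
      unfolding sum_distrib_left[symmetric] sum_distrib_right[symmetric] P_def
      by (simp add: log_fps_def sum_subtractf sum.distrib algebra_simps)
    have b: "(\<Sum>i<N. log_fps (z i) * geom_fps (z i)) = P - S"
      unfolding P_def S_def sum_subtractf[symmetric]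
      by (intro sum.cong refl) (simp add: log_fps_def algebra_simps)
    have c: "(\<Sum>i<N. log_fps (z i) * (log_fps (z i) * ?E)) = S * ?E"
      by (simp add: S_def sum_distrib_right mult.assoc)
    have d: "euler_fps ?E = P * ?E" by (simp add: P_def euler_esym_fps)
    have e: "euler_fps (P * ?E) = (P - S) * ?E + P * (P * ?E)"
      by (simp only: euler_fps_mult d) (simp only: P_def euler_fps_sum euler_log_fps b[unfolded P_def])
    show ?thesis unfolding a c d e by (simp add: algebra_simps)
  qed
  have "of_nat N + 1 = fps_const (of_nat N + 1 :: complex)"
    by (simp add: fps_of_nat[symmetric] flip: fps_const_add)
  then have D: "fps_nth ((of_nat N + 1) * euler_fps ?E - euler_fps (euler_fps ?E)) r
      = of_nat r * (of_nat N + 1 - of_nat r) * esym N r z"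
    by (simp add: euler_fps_nth esym_def algebra_simps)
  have "(\<Sum>a=0..r. newton_sign a * (repulsion N a z * esym N (r - a) z)) +
     (\<Sum>a=0..r. newton_sign a * (\<Sum>i<N. z i ^ a * esym_part N (r - a) i z))
     = of_nat r * (of_nat N + 1 - of_nat r) * esym N r z"
    unfolding A[symmetric] B[symmetric] fps_add_nth[symmetric] C D ..
  then show ?thesis by (simp only: distrib_left sum.distrib)
qed

text \<open>Exchange argument: by \<open>esym_part_Suc\<close>, the product of \<open>z i\<close>,
  \<open>esym N r z - esym_part N r i z\<close> and \<open>esym N s z - esym_part N s i z\<close>
  can be read in two ways, which trades the index pair (r, s + 1) for (r + 1, s). Descending to
  second index 0 leaves the leading product and products whose indices are further apart; their
  coefficients stay existential, since the spread of the indices is what matters later.\<close>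

lemma sum_esym_part_mult:
  assumes "s \<le> r"
  shows "\<exists>c. \<forall>z. (\<Sum>i<N. esym_part N r i z * esym_part N s i z) = of_nat s * esym N r z * esym N s z
     + (\<Sum>t=1..s. c t * (esym N (r + t) z * esym N (s - t) z))"
  using assms
proof (induction s arbitrary: r)
  case 0
  show ?case by (auto simp: esym_part_0)
next
  case (Suc s)
  have "s \<le> Suc r" using Suc.prems by simp
  from Suc.IH[OF this] obtain c where "\<forall>z. (\<Sum>i<N. esym_part N (Suc r) i z * esym_part N s i z) =
     of_nat s * esym N (Suc r) z * esym N s z + (\<Sum>t=1..s. c t * (esym N (Suc r + t) z * esym N (s - t) z))" ..
  then have c: "\<And>z. (\<Sum>i<N. esym_part N (Suc r) i z * esym_part N s i z) =
     of_nat s * esym N (Suc r) z * esym N s z + (\<Sum>t=1..s. c t * (esym N (Suc r + t) z * esym N (s - t) z))"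
    by blast
  \<comment> \<open>The first spread pair gets s from the leading term of the induction hypothesis
    and \<open>- (r + 1)\<close> from \<open>sum_esym_part\<close>; the later coefficients are those
    of the hypothesis shifted by one.\<close>
  define c' where "c' t = (if t = 1 then of_nat s - of_nat (Suc r) else c (t - 1))" for t
  show ?case
  proof (intro exI[of _ c'] allI)
    fix z
    have "esym_part N (Suc r) i z * (esym N s z - esym_part N s i z)
        = (esym N r z - esym_part N r i z) * esym_part N (Suc s) i z" for i
      by (simp add: esym_part_Suc)
    then have e: "esym_part N r i z * esym_part N (Suc s) i z = esym_part N (Suc r) i z * esym_part N s i z
        + esym N r z * esym_part N (Suc s) i z - esym N s z * esym_part N (Suc r) i z" for i
      by (simp add: algebra_simps)
    have "(\<Sum>i<N. esym_part N r i z * esym_part N (Suc s) i z) =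
       (\<Sum>i<N. esym_part N (Suc r) i z * esym_part N s i z)
        + esym N r z * (\<Sum>i<N. esym_part N (Suc s) i z) - esym N s z * (\<Sum>i<N. esym_part N (Suc r) i z)"
      by (simp add: e sum.distrib sum_subtractf sum_distrib_left)
    also have "\<dots> = of_nat (Suc s) * esym N r z * esym N (Suc s) z
       + ((of_nat s - of_nat (Suc r)) * (esym N (Suc r) z * esym N s z)
        + (\<Sum>t=1..s. c t * (esym N (Suc r + t) z * esym N (s - t) z)))"
      unfolding c sum_esym_part by (simp add: algebra_simps)
    also have "(of_nat s - of_nat (Suc r)) * (esym N (Suc r) z * esym N s z)
        + (\<Sum>t=1..s. c t * (esym N (Suc r + t) z * esym N (s - t) z))
       = (\<Sum>t=1..Suc s. c' t * (esym N (r + t) z * esym N (Suc s - t) z))"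
    proof -
      have "(\<Sum>t=1..Suc s. c' t * (esym N (r + t) z * esym N (Suc s - t) z))
        = c' 1 * (esym N (r + 1) z * esym N s z) + (\<Sum>t=Suc 1..Suc s. c' t * (esym N (r + t) z * esym N (Suc s - t) z))"
        by (subst sum.atLeast_Suc_atMost) auto
      also have "(\<Sum>t=Suc 1..Suc s. c' t * (esym N (r + t) z * esym N (Suc s - t) z))
        = (\<Sum>t=1..s. c' (Suc t) * (esym N (r + Suc t) z * esym N (Suc s - Suc t) z))"
        by (rule sum.shift_bounds_cl_Suc_ivl)
      also have "\<dots> = (\<Sum>t=1..s. c t * (esym N (Suc r + t) z * esym N (s - t) z))"
        by (intro sum.cong) (auto simp: c'_def)
      finally show ?thesis by (simp add: c'_def)
    qed
    finally show "(\<Sum>i<N. esym_part N r i z * esym_part N (Suc s) i z) = of_nat (Suc s) * esym N r z * esym N (Suc s) z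
     + (\<Sum>t=1..Suc s. c' t * (esym N (r + t) z * esym N (Suc s - t) z))" .
  qed
qed

section \<open>Loop equations on the torus\<close>

text \<open>In contrast to the space of \<open>torus_measure\<close>, no value is prescribed outside
  \<open>{..<N}\<close>, so that the set is closed under inverting all values.\<close>

definition unit_tuples :: "nat \<Rightarrow> (nat \<Rightarrow> complex) set" where
  "unit_tuples N = {z. \<forall>i<N. norm (z i) = 1}"

lemma unit_tuples_nonzero: "z \<in> unit_tuples N \<Longrightarrow> i < N \<Longrightarrow> z i \<noteq> 0"
  by (auto simp: unit_tuples_def)

lemma unit_tuples_inverse: "z \<in> unit_tuples N \<Longrightarrow> (\<lambda>i. inverse (z i)) \<in> unit_tuples N"
  by (auto simp: unit_tuples_def norm_inverse)

lemma space_torus_unit_tuples: "space (torus_measure N) \<subseteq> unit_tuples N"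
  by (auto simp: unit_tuples_def torus_coord_norm)

text \<open>
  The symmetric functions generated by the power sums, together with their derivatives
  \<open>d i = z\<^sub>i \<partial>/\<partial>z\<^sub>i f\<close>. Both matter only at tuples of complex units.
\<close>

inductive sym_deriv ::
    "nat \<Rightarrow> ((nat \<Rightarrow> complex) \<Rightarrow> complex) \<Rightarrow> (nat \<Rightarrow> (nat \<Rightarrow> complex) \<Rightarrow> complex) \<Rightarrow> bool"
  for N :: nat where
  sym_deriv_const: "sym_deriv N (\<lambda>z. c) (\<lambda>i z. 0)"
| sym_deriv_psum: "sym_deriv N (psum N b) (\<lambda>i z. of_int b * z i powi b)"
| sym_deriv_add: "sym_deriv N f d \<Longrightarrow> sym_deriv N g e \<Longrightarrow> sym_deriv N (\<lambda>z. f z + g z) (\<lambda>i z. d i z + e i z)"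
| sym_deriv_mult: "sym_deriv N f d \<Longrightarrow> sym_deriv N g e \<Longrightarrow>
    sym_deriv N (\<lambda>z. f z * g z) (\<lambda>i z. d i z * g z + f z * e i z)"
| sym_deriv_cong: "sym_deriv N f d \<Longrightarrow> (\<And>z. z \<in> unit_tuples N \<Longrightarrow> f' z = f z) \<Longrightarrow>
    (\<And>i z. z \<in> unit_tuples N \<Longrightarrow> i < N \<Longrightarrow> d' i z = d i z) \<Longrightarrow> sym_deriv N f' d'"

lemma sym_deriv_cmult: "sym_deriv N f d \<Longrightarrow> sym_deriv N (\<lambda>z. c * f z) (\<lambda>i z. c * d i z)"
  using sym_deriv_mult[OF sym_deriv_const[of N c]] by simp

lemma sym_deriv_sum:
  assumes "\<And>a. a \<in> A \<Longrightarrow> sym_deriv N (f a) (d a)"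
  shows "sym_deriv N (\<lambda>z. \<Sum>a\<in>A. f a z) (\<lambda>i z. \<Sum>a\<in>A. d a i z)"
  using assms by (induction A rule: infinite_finite_induct) (auto intro: sym_deriv_const sym_deriv_add)

text \<open>Inverting the variables reverses the sign of the Euler derivative \<open>z\<close>
  d/dz.\<close>

lemma sym_deriv_inverse:
  assumes "sym_deriv N f d"
  shows "sym_deriv N (\<lambda>z. f (\<lambda>i. inverse (z i))) (\<lambda>i z. - d i (\<lambda>i. inverse (z i)))"
  using assms
proof induction
  case (sym_deriv_psum b)
  show ?case
    by (rule sym_deriv_cong[OF sym_deriv.sym_deriv_psum[of N "- b"]])
       (simp_all add: psum_def power_int_inverse power_int_minus)
next
  case (sym_deriv_const c)
  show ?case using sym_deriv.sym_deriv_const[of N c] by simp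
next
  case (sym_deriv_add f d g e)
  then show ?case using sym_deriv.sym_deriv_add[OF sym_deriv_add.IH] by simp
next
  case (sym_deriv_mult f d g e)
  then show ?case using sym_deriv.sym_deriv_mult[OF sym_deriv_mult.IH] by (simp add: algebra_simps)
next
  case (sym_deriv_cong f d f' d')
  show ?case
    by (rule sym_deriv.sym_deriv_cong[OF sym_deriv_cong.IH])
       (simp_all add: sym_deriv_cong.hyps unit_tuples_inverse)
qed

section \<open>Bounded measurable functions on the torus\<close>

definition bdd_torus_fun :: "nat \<Rightarrow> ((nat \<Rightarrow> complex) \<Rightarrow> complex) \<Rightarrow> bool" where
  "bdd_torus_fun N f \<longleftrightarrow> f \<in> borel_measurable (torus_measure N) \<and>
     (\<exists>K. \<forall>z\<in>unit_tuples N. norm (f z) \<le> K)"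

lemma bdd_torus_fun_const: "bdd_torus_fun N (\<lambda>z. c)"
  by (auto simp: bdd_torus_fun_def)

lemma bdd_torus_fun_add:
  assumes "bdd_torus_fun N f" "bdd_torus_fun N g"
  shows "bdd_torus_fun N (\<lambda>z. f z + g z)"
proof -
  obtain K L where "\<forall>z\<in>unit_tuples N. norm (f z) \<le> K" "\<forall>z\<in>unit_tuples N. norm (g z) \<le> L"
    using assms unfolding bdd_torus_fun_def by blast
  then have "\<forall>z\<in>unit_tuples N. norm (f z + g z) \<le> K + L" by (simp add: norm_triangle_mono)
  moreover have "(\<lambda>z. f z + g z) \<in> borel_measurable (torus_measure N)"
    using assms unfolding bdd_torus_fun_def by (intro borel_measurable_add) blast+
  ultimately show ?thesis unfolding bdd_torus_fun_def by blast
qed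

lemma bdd_torus_fun_mult:
  assumes "bdd_torus_fun N f" "bdd_torus_fun N g"
  shows "bdd_torus_fun N (\<lambda>z. f z * g z)"
proof -
  obtain K L where KL: "\<forall>z\<in>unit_tuples N. norm (f z) \<le> K" "\<forall>z\<in>unit_tuples N. norm (g z) \<le> L"
    using assms unfolding bdd_torus_fun_def by blast
  have "norm (f z * g z) \<le> max K 0 * max L 0" if "z \<in> unit_tuples N" for z
    unfolding norm_mult using KL that by (intro mult_mono) (auto simp: le_max_iff_disj)
  moreover have "(\<lambda>z. f z * g z) \<in> borel_measurable (torus_measure N)"
    using assms unfolding bdd_torus_fun_def by (intro borel_measurable_times) blast+
  ultimately show ?thesis unfolding bdd_torus_fun_def by blast
qed

lemma bdd_torus_fun_sum:
  assumes "\<And>a. a \<in> A \<Longrightarrow> bdd_torus_fun N (f a)"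
  shows "bdd_torus_fun N (\<lambda>z. \<Sum>a\<in>A. f a z)"
  using assms
  by (induction A rule: infinite_finite_induct) (auto intro: bdd_torus_fun_const bdd_torus_fun_add)

lemma bdd_torus_fun_powi: "i < N \<Longrightarrow> bdd_torus_fun N (\<lambda>z. z i powi b)"
  unfolding bdd_torus_fun_def
proof (intro conjI exI[of _ 1])
  assume "i < N"
  then show "(\<lambda>z. z i powi b) \<in> borel_measurable (torus_measure N)"
    by (intro borel_measurable_powi torus_coord_measurable)
  show "\<forall>z\<in>unit_tuples N. cmod (z i powi b) \<le> 1"
    using \<open>i < N\<close> by (simp add: unit_tuples_def norm_power_int)
qed

lemma bdd_torus_fun_power: "i < N \<Longrightarrow> bdd_torus_fun N (\<lambda>z. z i ^ b)"
  using bdd_torus_fun_powi[of i N "int b"] by simp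

lemma bdd_torus_fun_cong:
  assumes "bdd_torus_fun N f" "\<And>z. z \<in> unit_tuples N \<Longrightarrow> g z = f z"
  shows "bdd_torus_fun N g"
proof -
  have "g \<in> borel_measurable (torus_measure N) \<longleftrightarrow> f \<in> borel_measurable (torus_measure N)"
    using assms(2) space_torus_unit_tuples by (intro measurable_cong) blast
  then show ?thesis using assms unfolding bdd_torus_fun_def by simp
qed

lemma bdd_torus_fun_sym_deriv:
  assumes "sym_deriv N f d"
  shows "bdd_torus_fun N f" "i < N \<Longrightarrow> bdd_torus_fun N (d i)"
proof -
  have "bdd_torus_fun N f \<and> (\<forall>i<N. bdd_torus_fun N (d i))"
    using assms
  proof induction
    case (sym_deriv_psum b)
    then show ?case
      unfolding psum_def
      by (intro conjI allI impI bdd_torus_fun_sum bdd_torus_fun_mult bdd_torus_fun_const bdd_torus_fun_powi) auto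
  next
    case (sym_deriv_cong f d f' d')
    show ?case
    proof (intro conjI allI impI)
      show "bdd_torus_fun N f'"
        using sym_deriv_cong by (intro bdd_torus_fun_cong[of N f f']) auto
      fix i assume "i < N"
      then show "bdd_torus_fun N (d' i)"
        using sym_deriv_cong by (intro bdd_torus_fun_cong[of N "d i" "d' i"]) auto
    qed
  next
    case (sym_deriv_add f d g e)
    then show ?case by (intro conjI allI impI bdd_torus_fun_add) auto
  next
    case (sym_deriv_mult f d g e)
    then show ?case by (intro conjI allI impI bdd_torus_fun_add bdd_torus_fun_mult) auto
  qed (auto intro: bdd_torus_fun_const)
  then show "bdd_torus_fun N f" "i < N \<Longrightarrow> bdd_torus_fun N (d i)" by auto
qed

lemma bdd_torus_fun_integrable:
  assumes "bdd_torus_fun N f" "finite_measure M" "sets M = sets (torus_measure N)"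
  shows "integrable M f"
proof -
  interpret finite_measure M by fact
  obtain K where K: "\<forall>z\<in>unit_tuples N. norm (f z) \<le> K"
    using assms(1) unfolding bdd_torus_fun_def by blast
  have "space M = space (torus_measure N)" using assms(3) by (rule sets_eq_imp_space_eq)
  then have "norm (f z) \<le> K" if "z \<in> space M" for z
    using that K space_torus_unit_tuples by blast
  moreover have "f \<in> borel_measurable M"
    using assms(1) measurable_cong_sets[OF assms(3) refl] unfolding bdd_torus_fun_def by blast
  ultimately show ?thesis by (intro integrable_const_bound[of _ K]) auto
qed

text \<open>Divided by r, Newton's identity expresses \<open>esym N r\<close> by power sums and
  lower elementary symmetric polynomials, and \<open>newton_identity_part\<close> is the matching
  identity for the derivatives. The summand at 0 vanishes, so only smaller indices occur.\<close>

lemma sym_deriv_esym: "sym_deriv N (esym N r) (esym_part N r)"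
proof (induction r rule: less_induct)
  case (less r)
  show ?case
  proof (cases "r = 0")
    case True
    then show ?thesis
      by (intro sym_deriv_cong[OF sym_deriv_const[of N 1]]) (simp_all add: esym_0 esym_part_0)
  next
    case False
    let ?f = "\<lambda>z. 1 / of_nat r * (\<Sum>a=1..r. newton_sign a * (psum N (int a) z * esym N (r - a) z))"
    let ?d = "\<lambda>i z. 1 / of_nat r * (\<Sum>a=1..r. newton_sign a *
      ((of_int (int a) * z i powi int a) * esym N (r - a) z + psum N (int a) z * esym_part N (r - a) i z))"
    have "sym_deriv N ?f ?d"
      by (intro sym_deriv_cmult sym_deriv_sum sym_deriv_mult sym_deriv_psum less.IH) auto
    then show ?thesis
    proof (rule sym_deriv_cong)
      fix z :: "nat \<Rightarrow> complex"
      have "of_nat r * esym N r z = (\<Sum>a=1..r. newton_sign a * (psum N (int a) z * esym N (r - a) z))"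
        unfolding newton_identity by (subst sum.atLeast_Suc_atMost) (simp_all add: mult.assoc)
      then show "esym N r z = ?f z" using False by (simp add: field_simps)
      fix i assume "i < N"
      have "of_nat r * esym_part N r i z = (\<Sum>a=1..r. newton_sign a *
        ((of_int (int a) * z i powi int a) * esym N (r - a) z + psum N (int a) z * esym_part N (r - a) i z))"
        unfolding newton_identity_part[OF \<open>i < N\<close>] by (subst sum.atLeast_Suc_atMost) simp_all
      then show "esym_part N r i z = ?d i z" using False by (simp add: field_simps)
    qed
  qed
qed

lemma prod_lin_fps_nth_eq_0:
  "finite A \<Longrightarrow> n > card A \<Longrightarrow> fps_nth (\<Prod>j\<in>A. lin_fps (z j)) n = 0"
proof (induction A arbitrary: n rule: finite_induct)
  case (insert a A)
  then obtain m where "n = Suc m" by (cases n) auto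
  have "(\<Prod>j\<in>insert a A. lin_fps (z j)) = (\<Prod>j\<in>A. lin_fps (z j)) + fps_const (z a) * (fps_X * (\<Prod>j\<in>A. lin_fps (z j)))"
    using insert.hyps by (simp add: lin_fps_def[of "z a"] algebra_simps)
  then show ?case using insert \<open>n = Suc m\<close> by simp
qed simp

lemma esym_part_top:
  assumes "i < N" "z i \<noteq> 0"
  shows "esym_part N N i z = esym N N z"
proof -
  have "esym_fps N z = lin_fps (z i) * (\<Prod>j\<in>{..<N} - {i}. lin_fps (z j))"
    unfolding esym_fps_def using assms(1) by (intro prod.remove) auto
  then have "geom_fps (z i) * esym_fps N z = (geom_fps (z i) * lin_fps (z i)) * (\<Prod>j\<in>{..<N} - {i}. lin_fps (z j))"
    by (simp add: mult.assoc)
  then have "geom_fps (z i) * esym_fps N z = (\<Prod>j\<in>{..<N} - {i}. lin_fps (z j))"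
    by (simp add: geom_lin_fps)
  moreover have "fps_nth (\<Prod>j\<in>{..<N} - {i}. lin_fps (z j)) N = 0"
    using assms(1) by (intro prod_lin_fps_nth_eq_0) auto
  ultimately have "fps_nth (geom_fps (z i) * esym_fps N z) N = 0" by simp
  moreover have "log_fps (z i) * esym_fps N z = esym_fps N z - geom_fps (z i) * esym_fps N z"
    by (simp add: log_fps_def algebra_simps)
  ultimately show ?thesis by (simp add: esym_part_def esym_def)
qed

text \<open>The inverse determinant in terms of the eigenvalues; its powers supply the negative
  exponents that products of \<open>esym\<close> lack.\<close>

definition inv_prod :: "nat \<Rightarrow> (nat \<Rightarrow> complex) \<Rightarrow> complex" where
  "inv_prod N z = (\<Prod>i<N. inverse (z i))"

lemma sym_deriv_inv_prod: "sym_deriv N (inv_prod N) (\<lambda>i z. - inv_prod N z)"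
  by (rule sym_deriv_cong[OF sym_deriv_inverse[OF sym_deriv_esym[of N N]]])
     (auto simp: inv_prod_def esym_top esym_part_top unit_tuples_nonzero)

lemma sym_deriv_inv_prod_power:
  "sym_deriv N (\<lambda>z. inv_prod N z ^ k) (\<lambda>i z. - (of_nat k * inv_prod N z ^ k))"
proof (induction k)
  case 0
  show ?case using sym_deriv_const[of N 1] by simp
next
  case (Suc k)
  show ?case
    by (rule sym_deriv_cong[OF sym_deriv_mult[OF sym_deriv_inv_prod Suc]]) (simp_all add: algebra_simps)
qed

text \<open>Integration by parts against the vector field with components \<open>z i ^ a\<close> in
  the Euler directions: the sum is its action on \<open>f\<close>, and \<open>repulsion\<close> is
  its divergence with respect to the squared Vandermonde density.\<close>

definition loop_equations :: "nat \<Rightarrow> (nat \<Rightarrow> complex) measure \<Rightarrow> bool" where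
  "loop_equations N M \<longleftrightarrow> (\<forall>a f d. sym_deriv N f d \<longrightarrow>
     (\<integral>z. repulsion N a z * f z + (\<Sum>i<N. z i ^ a * d i z) \<partial>M) = 0)"

lemma bdd_torus_fun_repulsion: "bdd_torus_fun N (repulsion N a)"
  unfolding repulsion_def
  by (intro bdd_torus_fun_sum bdd_torus_fun_mult bdd_torus_fun_power) auto

text \<open>The equations for \<open>a = 0, ..., r\<close> with test functions
  \<open>esym N (r - a)\<close> times \<open>g\<close> are added with weights
  \<open>newton_sign a\<close>. By \<open>esym_part_sum\<close> the vector fields combine to
  \<open>esym_part N r\<close>, and by \<open>repulsion_esym\<close> the quadratic terms to r (N + 1
  - r) times \<open>esym N r\<close>.\<close>

lemma loop_equations_esym:
  assumes M: "finite_measure M" "sets M = sets (torus_measure N)" and loop: "loop_equations N M"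
    and g: "sym_deriv N g d"
  shows "(\<integral>z. of_nat r * (of_nat N + 1 - of_nat r) * (esym N r z * g z)
     + (\<Sum>i<N. esym_part N r i z * d i z) \<partial>M) = 0"
proof -
  let ?D = "\<lambda>a i z. esym_part N (r - a) i z * g z + esym N (r - a) z * d i z"
  let ?T = "\<lambda>a z. repulsion N a z * (esym N (r - a) z * g z) + (\<Sum>i<N. z i ^ a * ?D a i z)"
  note bdd = bdd_torus_fun_add bdd_torus_fun_mult bdd_torus_fun_sum bdd_torus_fun_power
    bdd_torus_fun_repulsion bdd_torus_fun_sym_deriv[OF g] bdd_torus_fun_sym_deriv[OF sym_deriv_esym]
  have int: "integrable M (?T a)" for a
    by (rule bdd_torus_fun_integrable[OF _ M], intro bdd) auto
  have zero: "integral\<^sup>L M (?T a) = 0" for a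
    using loop sym_deriv_mult[OF sym_deriv_esym g] unfolding loop_equations_def by blast
  have "of_nat r * (of_nat N + 1 - of_nat r) * (esym N r z * g z) + (\<Sum>i<N. esym_part N r i z * d i z)
     = (\<Sum>a=0..r. newton_sign a * ?T a z)" for z
  proof -
    have "(\<Sum>a=0..r. newton_sign a * ?T a z) =
      (\<Sum>a=0..r. newton_sign a * (repulsion N a z * esym N (r - a) z
         + (\<Sum>i<N. z i ^ a * esym_part N (r - a) i z)) * g z
         + (\<Sum>i<N. newton_sign a * z i ^ a * esym N (r - a) z * d i z))"
      by (intro sum.cong refl)
         (simp add: distrib_left distrib_right sum.distrib sum_distrib_left sum_distrib_right mult_ac)
    also have "\<dots> = (\<Sum>a=0..r. newton_sign a * (repulsion N a z * esym N (r - a) z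
         + (\<Sum>i<N. z i ^ a * esym_part N (r - a) i z))) * g z
        + (\<Sum>i<N. (\<Sum>a=0..r. newton_sign a * z i ^ a * esym N (r - a) z) * d i z)"
      unfolding sum.distrib sum_distrib_right[symmetric] sum.swap[of _ "{..<N}" "{0..r}"] by simp
    also have "\<dots> = of_nat r * (of_nat N + 1 - of_nat r) * (esym N r z * g z) + (\<Sum>i<N. esym_part N r i z * d i z)"
      unfolding repulsion_esym esym_part_sum[symmetric] by (simp add: mult.assoc)
    finally show ?thesis by simp
  qed
  then have "(\<integral>z. of_nat r * (of_nat N + 1 - of_nat r) * (esym N r z * g z)
     + (\<Sum>i<N. esym_part N r i z * d i z) \<partial>M) = (\<integral>z. (\<Sum>a=0..r. newton_sign a * ?T a z) \<partial>M)"
    by simp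
  also have "\<dots> = (\<Sum>a=0..r. \<integral>z. newton_sign a * ?T a z \<partial>M)"
    by (rule Bochner_Integration.integral_sum) (intro integrable_mult_right int)
  also have "\<dots> = (\<Sum>a=0..r. newton_sign a * integral\<^sup>L M (?T a))"
    by (intro sum.cong refl integral_mult_right_zero)
  finally show ?thesis by (simp add: zero del: integral_mult_right_zero)
qed

section \<open>Products of elementary symmetric polynomials and the order of the recursion\<close>

definition eprod :: "nat \<Rightarrow> nat list \<Rightarrow> (nat \<Rightarrow> complex) \<Rightarrow> complex" where
  "eprod N ms z = (\<Prod>m\<leftarrow>ms. esym N m z)"

primrec deprod :: "nat \<Rightarrow> nat list \<Rightarrow> nat \<Rightarrow> (nat \<Rightarrow> complex) \<Rightarrow> complex" where
  "deprod N [] i z = 0"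
| "deprod N (m # ms) i z = esym_part N m i z * eprod N ms z + esym N m z * deprod N ms i z"

lemma eprod_simps [simp]: "eprod N [] z = 1" "eprod N (m # ms) z = esym N m z * eprod N ms z"
  by (simp_all add: eprod_def)

lemma eprod_append: "eprod N (ms @ ms') z = eprod N ms z * eprod N ms' z"
  by (induction ms) simp_all

lemma sym_deriv_eprod: "sym_deriv N (eprod N ms) (deprod N ms)"
proof (induction ms)
  case Nil
  show ?case by (rule sym_deriv_cong[OF sym_deriv_const[of N 1]]) simp_all
next
  case (Cons m ms)
  show ?case by (rule sym_deriv_cong[OF sym_deriv_mult[OF sym_deriv_esym Cons]]) simp_all
qed

lemma sum_deprod: "(\<Sum>i<N. deprod N ms i z) = of_nat (sum_list ms) * eprod N ms z"
  by (induction ms)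
     (simp_all add: sum.distrib sum_distrib_right[symmetric] sum_distrib_left[symmetric] sum_esym_part algebra_simps)

text \<open>The rank for the recursion: it grows when two indices with fixed sum move apart, and it
  is at most \<open>length ms * N\<^sup>2\<close> as long as all indices are at most N.\<close>

definition sumsq :: "nat list \<Rightarrow> nat" where
  "sumsq ms = (\<Sum>m\<leftarrow>ms. m\<^sup>2)"

lemma sumsq_simps [simp]: "sumsq [] = 0" "sumsq (m # ms) = m\<^sup>2 + sumsq ms"
  by (simp_all add: sumsq_def)

abbreviation spread_lists :: "nat \<Rightarrow> nat \<Rightarrow> nat \<Rightarrow> ((nat \<Rightarrow> complex) \<Rightarrow> complex) set" where
  "spread_lists N l q \<equiv> {eprod N ms |ms. length ms = l \<and> q < sumsq ms}"

lemma sum_esym_part_mult_min: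
  "\<exists>h \<in> lincomb (spread_lists N 2 (r\<^sup>2 + s\<^sup>2)). \<forall>z.
     (\<Sum>i<N. esym_part N r i z * esym_part N s i z) = of_nat (min r s) * (esym N r z * esym N s z) + h z"
proof -
  have *: "\<exists>h \<in> lincomb (spread_lists N 2 (r\<^sup>2 + s\<^sup>2)). \<forall>z.
     (\<Sum>i<N. esym_part N r i z * esym_part N s i z) = of_nat (min r s) * (esym N r z * esym N s z) + h z"
    if sr: "s \<le> r" for r s
  proof -
    obtain c where c: "\<And>z. (\<Sum>i<N. esym_part N r i z * esym_part N s i z) = of_nat s * esym N r z * esym N s z
     + (\<Sum>t=1..s. c t * (esym N (r + t) z * esym N (s - t) z))"
      using sum_esym_part_mult[OF sr, of N] by blast
    have gen: "(\<lambda>z. esym N (r + t) z * esym N (s - t) z) \<in> lincomb (spread_lists N 2 (r\<^sup>2 + s\<^sup>2))"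
      if t: "t \<in> {1..s}" for t
    proof (rule lincomb_gen, rule CollectI, intro exI[of _ "[r + t, s - t]"] conjI)
      obtain u where u: "s = t + u" using t le_Suc_ex by (metis atLeastAtMost_iff)
      obtain v where v: "r = s + v" using \<open>s \<le> r\<close> le_Suc_ex by blast
      have "(r + t)\<^sup>2 + (s - t)\<^sup>2 = r\<^sup>2 + s\<^sup>2 + 2 * t\<^sup>2 + 2 * t * v"
        unfolding v u by (simp add: power2_eq_square algebra_simps)
      moreover have "t\<^sup>2 > 0" using t by simp
      ultimately show "r\<^sup>2 + s\<^sup>2 < sumsq [r + t, s - t]" by (simp del: zero_less_power2)
    qed (auto simp: fun_eq_iff)
    have "(\<lambda>z. \<Sum>t=1..s. c t * (esym N (r + t) z * esym N (s - t) z)) \<in> lincomb (spread_lists N 2 (r\<^sup>2 + s\<^sup>2))"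
      by (intro lincomb_sum lincomb_cmult gen)
    then show ?thesis using c sr by (intro bexI) (auto simp: min_def mult.assoc)
  qed
  show ?thesis
  proof (cases "s \<le> r")
    case False
    then have "r \<le> s" by simp
    from *[OF this] show ?thesis by (simp add: min.commute mult.commute add.commute)
  qed (rule *)
qed

text \<open>By the product rule each factor \<open>esym N m\<close> is paired with
  \<open>esym_part N r\<close>. The pairing gives \<open>min r m\<close> times the original product
  and a remainder in which this pair is spread out while the other factors stay, so that
  \<open>sumsq\<close> grows.\<close>

lemma sum_esym_part_deprod:
  "\<exists>h \<in> lincomb (spread_lists N (Suc (length ms)) (r\<^sup>2 + sumsq ms)). \<forall>z.
     (\<Sum>i<N. esym_part N r i z * deprod N ms i z) =
       of_nat (\<Sum>m\<leftarrow>ms. min r m) * (esym N r z * eprod N ms z) + h z"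
proof (induction ms)
  case Nil
  show ?case by (intro bexI[of _ "\<lambda>z. 0"]) (auto intro: lincomb_zero)
next
  case (Cons m ms)
  then obtain h where h: "h \<in> lincomb (spread_lists N (Suc (length ms)) (r\<^sup>2 + sumsq ms))"
    "\<And>z. (\<Sum>i<N. esym_part N r i z * deprod N ms i z) =
       of_nat (\<Sum>m\<leftarrow>ms. min r m) * (esym N r z * eprod N ms z) + h z" by blast
  obtain h' where h': "h' \<in> lincomb (spread_lists N 2 (r\<^sup>2 + m\<^sup>2))"
    "\<And>z. (\<Sum>i<N. esym_part N r i z * esym_part N m i z) = of_nat (min r m) * (esym N r z * esym N m z) + h' z"
    using sum_esym_part_mult_min by blast
  let ?B = "spread_lists N (Suc (length (m # ms))) (r\<^sup>2 + sumsq (m # ms))"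
  have "(\<lambda>z. h' z * eprod N ms z) \<in> lincomb ?B"
  proof (rule lincomb_mult[OF _ h'(1) lincomb_gen[OF singletonI]])
    fix a b assume "a \<in> spread_lists N 2 (r\<^sup>2 + m\<^sup>2)" "b \<in> {eprod N ms}"
    then obtain xs where xs: "a = eprod N xs" "length xs = 2" "r\<^sup>2 + m\<^sup>2 < sumsq xs" and b: "b = eprod N ms" by blast
    have "(\<lambda>x. a x * b x) = eprod N (xs @ ms)" by (simp add: xs b eprod_append fun_eq_iff)
    moreover have "r\<^sup>2 + sumsq (m # ms) < sumsq (xs @ ms)" using xs by (simp add: sumsq_def)
    ultimately show "(\<lambda>x. a x * b x) \<in> lincomb ?B" using xs by (intro lincomb_gen CollectI exI[of _ "xs @ ms"]) simp
  qed
  moreover have "(\<lambda>z. esym N m z * h z) \<in> lincomb ?B"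
  proof (rule lincomb_mult[OF _ lincomb_gen[OF singletonI] h(1)])
    fix a b assume "b \<in> spread_lists N (Suc (length ms)) (r\<^sup>2 + sumsq ms)" "a \<in> {esym N m}"
    then obtain xs where xs: "b = eprod N xs" "length xs = Suc (length ms)" "r\<^sup>2 + sumsq ms < sumsq xs"
      and a: "a = esym N m" by blast
    have "(\<lambda>x. a x * b x) = eprod N (m # xs)" by (simp add: xs a fun_eq_iff)
    then show "(\<lambda>x. a x * b x) \<in> lincomb ?B" using xs by (intro lincomb_gen CollectI exI[of _ "m # xs"]) simp
  qed
  ultimately have "(\<lambda>z. h' z * eprod N ms z + esym N m z * h z) \<in> lincomb ?B" by (rule lincomb_add)
  moreover have "(\<Sum>i<N. esym_part N r i z * deprod N (m # ms) i z) =
       of_nat (\<Sum>m\<leftarrow>m # ms. min r m) * (esym N r z * eprod N (m # ms) z) + (h' z * eprod N ms z + esym N m z * h z)" for z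
  proof -
    have "(\<Sum>i<N. esym_part N r i z * deprod N (m # ms) i z) =
      (\<Sum>i<N. esym_part N r i z * esym_part N m i z) * eprod N ms z
       + esym N m z * (\<Sum>i<N. esym_part N r i z * deprod N ms i z)"
      by (simp add: distrib_left sum.distrib sum_distrib_left sum_distrib_right mult_ac)
    also have "\<dots> = of_nat (\<Sum>m\<leftarrow>m # ms. min r m) * (esym N r z * eprod N (m # ms) z) + (h' z * eprod N ms z + esym N m z * h z)"
      unfolding h h' by (simp add: algebra_simps)
    finally show ?thesis .
  qed
  ultimately show ?case by (intro bexI[of _ "\<lambda>z. h' z * eprod N ms z + esym N m z * h z"]) auto
qed

section \<open>Uniqueness for the loop equations\<close>

text \<open>The equation for \<open>a = 0\<close> expresses invariance under a common rotation of
  all eigenvalues: \<open>repulsion N 0\<close> vanishes, and the derivative multiplies a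
  homogeneous function by its degree, here \<open>sum_list ms - k * N\<close>.\<close>

lemma loop_equations_scaling:
  assumes M: "finite_measure M" "sets M = sets (torus_measure N)" and loop: "loop_equations N M"
    and "sum_list ms \<noteq> k * N"
  shows "(\<integral>z. eprod N ms z * inv_prod N z ^ k \<partial>M) = 0"
proof -
  let ?c = "of_nat (sum_list ms) - of_nat (k * N) :: complex"
  have "(\<integral>z. repulsion N 0 z * (eprod N ms z * inv_prod N z ^ k) + (\<Sum>i<N. z i ^ 0 *
     (deprod N ms i z * inv_prod N z ^ k + eprod N ms z * - (of_nat k * inv_prod N z ^ k))) \<partial>M) = 0"
    using loop sym_deriv_mult[OF sym_deriv_eprod[of N ms] sym_deriv_inv_prod_power[of N k]]
    unfolding loop_equations_def by blast
  moreover have "repulsion N 0 z * (eprod N ms z * inv_prod N z ^ k) + (\<Sum>i<N. z i ^ 0 *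
     (deprod N ms i z * inv_prod N z ^ k + eprod N ms z * - (of_nat k * inv_prod N z ^ k)))
     = ?c * (eprod N ms z * inv_prod N z ^ k)" for z
  proof -
    have "(\<Sum>i<N. z i ^ 0 * (deprod N ms i z * inv_prod N z ^ k + eprod N ms z * - (of_nat k * inv_prod N z ^ k)))
       = (\<Sum>i<N. deprod N ms i z) * inv_prod N z ^ k - of_nat (k * N) * (eprod N ms z * inv_prod N z ^ k)"
      by (simp add: sum.distrib sum_subtractf sum_distrib_right)
    then show ?thesis unfolding sum_deprod by (simp add: repulsion_def algebra_simps)
  qed
  ultimately have "?c * (\<integral>z. eprod N ms z * inv_prod N z ^ k \<partial>M) = 0" by simp
  moreover have "?c \<noteq> 0" using assms(4) by (metis of_nat_eq_iff eq_iff_diff_eq_0)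
  ultimately show ?thesis by simp
qed

text \<open>An entry N contributes r instead of N to the sum of minima; every other entry
  contributes itself.\<close>

lemma sum_list_min:
  assumes "\<And>m. m \<in> set ms \<Longrightarrow> m = N \<or> m \<le> r" "r \<le> N"
  shows "(\<Sum>m\<leftarrow>ms. min r m) + N * count_list ms N = r * count_list ms N + sum_list ms"
  using assms(1)
proof (induction ms)
  case (Cons m ms)
  then have "(\<Sum>m\<leftarrow>ms. min r m) + N * count_list ms N = r * count_list ms N + sum_list ms" by simp
  then show ?case using Cons.prems[of m] assms(2) by (auto simp: algebra_simps min_def)
qed simp

text \<open>Of the indices strictly between 0 and N the largest, r, is split off, and
  \<open>loop_equations_esym\<close> for r is applied to the remaining product. The wanted integral
  gets a nonzero coefficient \<open>c\<close>, and the other terms have larger \<open>sumsq\<close>.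
  If no such index exists and the degree is \<open>k * N\<close>, the integrand is 1; a different
  degree gives integral 0, and an index above N makes the product zero.\<close>

lemma loop_equations_unique_eprod:
  assumes N: "N > 0"
    and M: "prob_space M" "sets M = sets (torus_measure N)" "loop_equations N M"
    and M': "prob_space M'" "sets M' = sets (torus_measure N)" "loop_equations N M'"
  shows "(\<integral>z. eprod N ms z * inv_prod N z ^ k \<partial>M) = (\<integral>z. eprod N ms z * inv_prod N z ^ k \<partial>M')"
proof (induction "length ms * N\<^sup>2 - sumsq ms" arbitrary: ms rule: less_induct)
  case less
  interpret M: prob_space M by fact
  interpret M': prob_space M' by fact
  have zero: "(\<integral>z. eprod N xs z * inv_prod N z ^ k \<partial>M) = (\<integral>z. eprod N xs z * inv_prod N z ^ k \<partial>M')"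
    if "\<not> (\<forall>m\<in>set xs. m \<le> N)" for xs
  proof -
    have "eprod N xs z = 0" for z
      using that by (induction xs) (auto simp: esym_eq_0)
    then show ?thesis by simp
  qed
  have sumsq_le: "sumsq xs \<le> length xs * N\<^sup>2" if "\<forall>m\<in>set xs. m \<le> N" for xs
    using that by (induction xs) (auto simp: power_mono add_mono)
  have perm: "eprod N xs z = eprod N ys z" if "mset xs = mset ys" for xs ys z
    using that unfolding eprod_def prod_mset_prod_list[symmetric] mset_map by simp
  show ?case
  proof (cases "(\<forall>m\<in>set ms. m \<le> N) \<and> sum_list ms = k * N")
    case False
    then show ?thesis
      using zero[of ms] loop_equations_scaling[OF M.finite_measure_axioms M(2,3)]
        loop_equations_scaling[OF M'.finite_measure_axioms M'(2,3)] by fastforce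
  next
    case le: True
    show ?thesis
    proof (cases "\<exists>m\<in>set ms. 0 < m \<and> m < N")
      case False
      then have z: "set ms \<subseteq> {0, N}" using le by (auto simp: le_less)
      have "eprod N xs z = esym N N z ^ count_list xs N \<and> sum_list xs = count_list xs N * N" if "set xs \<subseteq> {0, N}" for xs z
        using that N by (induction xs) (auto simp: esym_0)
      from this[OF z] have e: "eprod N ms z = esym N N z ^ k" for z
        using le N by auto
      have "eprod N ms z * inv_prod N z ^ k = 1" if "z \<in> space (torus_measure N)" for z
      proof -
        have "z i \<noteq> 0" if "i < N" for i
          using \<open>z \<in> space (torus_measure N)\<close> space_torus_unit_tuples unit_tuples_nonzero that by blast
        then have "esym N N z * inv_prod N z = 1"
          by (simp add: esym_top inv_prod_def prod.distrib[symmetric])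
        then show ?thesis by (simp add: e power_mult_distrib[symmetric])
      qed
      then have "(\<integral>z. eprod N ms z * inv_prod N z ^ k \<partial>M) = (\<integral>z. 1 \<partial>M)"
        "(\<integral>z. eprod N ms z * inv_prod N z ^ k \<partial>M') = (\<integral>z. 1 \<partial>M')"
        using sets_eq_imp_space_eq[OF M(2)] sets_eq_imp_space_eq[OF M'(2)]
        by (intro Bochner_Integration.integral_cong refl; simp)+
      then show ?thesis using M.prob_space M'.prob_space by simp
    next
      case True
      define r where "r = Max {m \<in> set ms. 0 < m \<and> m < N}"
      have fin: "finite {m \<in> set ms. 0 < m \<and> m < N}" by simp
      have r: "r \<in> set ms" "0 < r" "r < N"
        using Max_in[OF fin] True unfolding r_def by blast+
      have rmax: "m \<le> r" if "m \<in> set ms" "m < N" for m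
      proof (cases "m = 0")
        case False
        then show ?thesis using that Max_ge[OF fin, of m] unfolding r_def by simp
      qed simp
      define xs where "xs = remove1 r ms"
      have ms: "mset ms = mset (r # xs)" using r(1) by (simp add: xs_def)
      have sum_ms: "sum_list ms = r + sum_list xs" using ms by (metis sum_mset_sum_list sum_list.Cons)
      have sq_ms: "sumsq ms = r\<^sup>2 + sumsq xs"
        using ms unfolding sumsq_def sum_mset_sum_list[symmetric] mset_map by simp
      have len_ms: "length ms = Suc (length xs)" using ms by (metis length_Cons size_mset)
      have setxs: "set xs \<subseteq> set ms" unfolding xs_def by (rule set_remove1_subset)
      define n where "n = count_list xs N"
      define c where "c = (of_nat r * (of_nat N + 1 - of_nat r) - of_nat k * of_nat r
         + of_nat (\<Sum>m\<leftarrow>xs. min r m) :: complex)"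
      \<comment> \<open>Maximality of r makes every remaining index either N or at most r, so the
        sum of minima is known exactly.\<close>
      have min: "(\<Sum>m\<leftarrow>xs. min r m) + N * n = r * n + sum_list xs"
        unfolding n_def using le rmax setxs r by (intro sum_list_min) (auto simp: le_less)
      \<comment> \<open>The n indices equal to N use up \<open>N * n\<close> of the total
        \<open>k * N\<close>, and r > 0 still has to fit; hence n < k.\<close>
      have "sum_list xs \<ge> N * n" unfolding n_def by (induction xs) auto
      moreover have "N * k = r + sum_list xs" using le sum_ms by (simp add: mult.commute)
      ultimately have "N * n < N * k" using r(2) by linarith
      then have kn: "n < k" by simp
      \<comment> \<open>Inserting the sum of minima makes the coefficient factorise; the factors are
        positive because r < N and n < k.\<close>
      have "real r * (real N + 1 - real r) - real k * real r + real (\<Sum>m\<leftarrow>xs. min r m)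
          = (real N - real r) * (real r + (real k - real n))"
      proof -
        have "real (\<Sum>m\<leftarrow>xs. min r m) = real r * real n + (real k * real N - real r) - real N * real n"
        proof -
          have "real ((\<Sum>m\<leftarrow>xs. min r m) + N * n) = real (r * n + sum_list xs)" using min by simp
          moreover have "real (r + sum_list xs) = real (k * N)" using le sum_ms by simp
          ultimately show ?thesis unfolding of_nat_add of_nat_mult by linarith
        qed
        then show ?thesis by (simp add: algebra_simps)
      qed
      moreover have "(real N - real r) * (real r + (real k - real n)) > 0"
        using r kn by (intro mult_pos_pos) auto
      ultimately have "complex_of_real (real r * (real N + 1 - real r) - real k * real r + real (\<Sum>m\<leftarrow>xs. min r m)) \<noteq> 0"
        by (simp only: of_real_eq_0_iff)
      then have c0: "c \<noteq> 0" by (simp add: c_def)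
      obtain h where h: "h \<in> lincomb (spread_lists N (Suc (length xs)) (r\<^sup>2 + sumsq xs))"
        and h_eq: "\<And>z. (\<Sum>i<N. esym_part N r i z * deprod N xs i z) =
          of_nat (\<Sum>m\<leftarrow>xs. min r m) * (esym N r z * eprod N xs z) + h z"
        using sum_esym_part_deprod by blast
      let ?B = "{\<lambda>z. eprod N ys z * inv_prod N z ^ k |ys. length ys = length ms \<and> sumsq ms < sumsq ys}"
      have hB: "(\<lambda>z. h z * inv_prod N z ^ k) \<in> lincomb ?B"
        by (rule lincomb_mult[OF _ h lincomb_gen[OF singletonI]])
           (auto intro!: lincomb_gen simp: len_ms sq_ms)
      have int: "integrable M f \<and> integrable M' f" if "bdd_torus_fun N f" for f
        using bdd_torus_fun_integrable[OF that] M.finite_measure_axioms M'.finite_measure_axioms M(2) M'(2) by blast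
      have bdd: "bdd_torus_fun N (\<lambda>z. eprod N ys z * inv_prod N z ^ k)" for ys
        using sym_deriv_mult[OF sym_deriv_eprod[of N ys] sym_deriv_inv_prod_power[of N k]]
        by (rule bdd_torus_fun_sym_deriv(1))
      have hint: "integrable M (\<lambda>z. h z * inv_prod N z ^ k) \<and> integrable M' (\<lambda>z. h z * inv_prod N z ^ k) \<and>
         (\<integral>z. h z * inv_prod N z ^ k \<partial>M) = (\<integral>z. h z * inv_prod N z ^ k \<partial>M')"
      proof (rule lincomb_integral_eq[OF hB])
        fix b assume "b \<in> ?B"
        then obtain ys where ys: "b = (\<lambda>z. eprod N ys z * inv_prod N z ^ k)" "length ys = length ms" "sumsq ms < sumsq ys"
          by blast
        show "integrable M b" "integrable M' b" using int[OF bdd[of ys]] ys(1) by auto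
        show "integral\<^sup>L M b = integral\<^sup>L M' b"
        \<comment> \<open>The induction measure is a truncated difference and is sure to decrease
          only while all indices are at most N; otherwise both integrands are zero.\<close>
        proof (cases "\<forall>m\<in>set ys. m \<le> N")
          case True
          then have "length ys * N\<^sup>2 - sumsq ys < length ms * N\<^sup>2 - sumsq ms"
            using sumsq_le[of ys] ys by simp
          from less[OF this] show ?thesis by (simp add: ys)
        qed (simp add: ys(1) zero)
      qed
      have key: "c * (\<integral>z. eprod N ms z * inv_prod N z ^ k \<partial>X) + (\<integral>z. h z * inv_prod N z ^ k \<partial>X) = 0"
        if X: "finite_measure X" "sets X = sets (torus_measure N)" "loop_equations N X"
          and iX: "integrable X (\<lambda>z. h z * inv_prod N z ^ k)" for X
      proof -
        have "(\<integral>z. of_nat r * (of_nat N + 1 - of_nat r) * (esym N r z * (eprod N xs z * inv_prod N z ^ k))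
          + (\<Sum>i<N. esym_part N r i z * (deprod N xs i z * inv_prod N z ^ k
               + eprod N xs z * - (of_nat k * inv_prod N z ^ k))) \<partial>X) = 0"
          by (rule loop_equations_esym[OF X sym_deriv_mult[OF sym_deriv_eprod sym_deriv_inv_prod_power]])
        moreover have "of_nat r * (of_nat N + 1 - of_nat r) * (esym N r z * (eprod N xs z * inv_prod N z ^ k))
          + (\<Sum>i<N. esym_part N r i z * (deprod N xs i z * inv_prod N z ^ k
               + eprod N xs z * - (of_nat k * inv_prod N z ^ k)))
           = c * (eprod N ms z * inv_prod N z ^ k) + h z * inv_prod N z ^ k" for z
        proof -
          have "(\<Sum>i<N. esym_part N r i z * (deprod N xs i z * inv_prod N z ^ k
               + eprod N xs z * - (of_nat k * inv_prod N z ^ k)))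
             = (\<Sum>i<N. esym_part N r i z * deprod N xs i z) * inv_prod N z ^ k
               - of_nat k * (\<Sum>i<N. esym_part N r i z) * (eprod N xs z * inv_prod N z ^ k)"
            by (simp add: sum_distrib_left sum_distrib_right sum_subtractf algebra_simps)
          moreover have "eprod N ms z = esym N r z * eprod N xs z" using perm[OF ms] by simp
          ultimately show ?thesis unfolding h_eq sum_esym_part c_def by (simp add: algebra_simps)
        qed
        ultimately have "(\<integral>z. c * (eprod N ms z * inv_prod N z ^ k) + h z * inv_prod N z ^ k \<partial>X) = 0" by simp
        moreover have "integrable X (\<lambda>z. c * (eprod N ms z * inv_prod N z ^ k))"
          using bdd_torus_fun_integrable[OF bdd X(1,2)] by (rule integrable_mult_right)
        ultimately show ?thesis using iX by simp
      qed
      have "c * (\<integral>z. eprod N ms z * inv_prod N z ^ k \<partial>M) = c * (\<integral>z. eprod N ms z * inv_prod N z ^ k \<partial>M')"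
        using key[OF M.finite_measure_axioms M(2,3)] key[OF M'.finite_measure_axioms M'(2,3)] hint
        by (metis add_right_cancel)
      then show ?thesis using c0 by simp
    qed
  qed
qed

section \<open>Symmetric polynomials as combinations of products of elementary ones\<close>

lemma psum_in_lincomb_eprod: "psum N (int r) \<in> lincomb (range (eprod N))"
proof (induction r rule: less_induct)
  case (less r)
  have mult: "(\<lambda>z. f z * g z) \<in> lincomb (range (eprod N))"
    if "f \<in> lincomb (range (eprod N))" "g \<in> lincomb (range (eprod N))" for f g
  proof (rule lincomb_mult[OF _ that])
    fix a b assume "a \<in> range (eprod N)" "b \<in> range (eprod N)"
    then obtain xs ys where "a = eprod N xs" "b = eprod N ys" by blast
    then have "(\<lambda>x. a x * b x) = eprod N (xs @ ys)" by (simp add: eprod_append fun_eq_iff)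
    then show "(\<lambda>x. a x * b x) \<in> lincomb (range (eprod N))" by (simp add: lincomb_gen)
  qed
  have e: "esym N m \<in> lincomb (range (eprod N))" for m
  proof -
    have "esym N m = eprod N [m]" by (simp add: fun_eq_iff)
    then show ?thesis by (simp add: lincomb_gen)
  qed
  show ?case
  proof (cases "r = 0")
    case True
    have "psum N (int r) = (\<lambda>z. of_nat N * eprod N [] z)" by (simp add: True psum_def fun_eq_iff)
    then show ?thesis by (metis lincomb_cmult lincomb_gen rangeI)
  next
    case False
    \<comment> \<open>Newton's identity solved for the power sum: its summand at
      \<open>a = r\<close> is \<open>newton_sign r\<close> times \<open>psum N (int r) z\<close>
      because \<open>esym N 0 z = 1\<close>, and this sign squares to 1.\<close>
    have "psum N (int r) = (\<lambda>z. newton_sign r * (of_nat r * esym N r z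
       - (\<Sum>a=1..<r. newton_sign a * (psum N (int a) z * esym N (r - a) z))))"
    proof
      fix z
      have "of_nat r * esym N r z = (\<Sum>a=1..r. newton_sign a * (psum N (int a) z * esym N (r - a) z))"
        unfolding newton_identity by (subst sum.atLeast_Suc_atMost) (simp_all add: mult.assoc)
      also have "{1..r} = insert r {1..<r}" using False by auto
      also have "(\<Sum>a\<in>insert r {1..<r}. newton_sign a * (psum N (int a) z * esym N (r - a) z))
         = newton_sign r * psum N (int r) z + (\<Sum>a=1..<r. newton_sign a * (psum N (int a) z * esym N (r - a) z))"
        by (subst sum.insert) (auto simp: esym_0)
      finally have "of_nat r * esym N r z - (\<Sum>a=1..<r. newton_sign a * (psum N (int a) z * esym N (r - a) z))
         = newton_sign r * psum N (int r) z" by (simp add: algebra_simps)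
      then show "psum N (int r) z = newton_sign r * (of_nat r * esym N r z
       - (\<Sum>a=1..<r. newton_sign a * (psum N (int a) z * esym N (r - a) z)))"
        using False by (simp add: power_mult_distrib[symmetric] flip: mult.assoc)
    qed
    also have "\<dots> \<in> lincomb (range (eprod N))"
      by (intro lincomb_cmult lincomb_diff lincomb_sum mult less.IH e) auto
    finally show ?thesis .
  qed
qed

definition index_lists :: "nat \<Rightarrow> nat \<Rightarrow> nat list set" where
  "index_lists N n = {is. length is = n \<and> distinct is \<and> set is \<subseteq> {..<N}}"

text \<open>An integer multiple of the monomial symmetric polynomial. Summing over ordered injective
  choices of variables keeps multiplicities out of the recursion \<open>msym_Cons\<close>.\<close>

definition msym :: "nat \<Rightarrow> nat list \<Rightarrow> (nat \<Rightarrow> complex) \<Rightarrow> complex" where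
  "msym N ls z = (\<Sum>is\<in>index_lists N (length ls). \<Prod>l<length ls. z (is ! l) ^ (ls ! l))"

lemma finite_index_lists: "finite (index_lists N n)"
  by (rule finite_subset[OF _ finite_lists_length_eq[of "{..<N}" n]]) (auto simp: index_lists_def)

text \<open>In the product of \<open>psum N (int c)\<close> with \<open>msym N ls\<close> the new
  index either differs from all chosen ones, which gives \<open>msym N (c # ls)\<close>, or equals
  the l-th one and adds c to its exponent.\<close>

lemma msym_Cons:
  "msym N (c # ls) z = psum N (int c) z * msym N ls z - (\<Sum>l<length ls. msym N (ls[l := ls ! l + c]) z)"
proof -
  let ?n = "length ls"
  define P where "P is ks = (\<Prod>l<?n. z (is ! l) ^ (ks ! l))" for "is" ks :: "nat list"
  have "msym N (c # ls) z = (\<Sum>(is, i)\<in>Sigma (index_lists N ?n) (\<lambda>is. {..<N} - set is). z i ^ c * P is ls)"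
    unfolding msym_def
  proof (rule sum.reindex_bij_witness[of _ "\<lambda>(is, i). i # is" "\<lambda>js. (tl js, hd js)"])
    fix js assume js: "js \<in> index_lists N (length (c # ls))"
    then obtain i "is" where i: "js = i # is" by (cases js) (auto simp: index_lists_def)
    show "(case (tl js, hd js) of (is, i) \<Rightarrow> i # is) = js" by (simp add: i)
    show "(tl js, hd js) \<in> Sigma (index_lists N ?n) (\<lambda>is. {..<N} - set is)"
      using js by (auto simp: i index_lists_def)
    show "(case (tl js, hd js) of (is, i) \<Rightarrow> z i ^ c * P is ls) = (\<Prod>l<length (c # ls). z (js ! l) ^ ((c # ls) ! l))"
      by (simp add: i P_def prod.lessThan_Suc_shift del: prod.lessThan_Suc)
  qed (auto simp: index_lists_def)
  also have "\<dots> = (\<Sum>is\<in>index_lists N ?n. (\<Sum>i\<in>{..<N} - set is. z i ^ c * P is ls))"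
    by (rule sum.Sigma[symmetric]) (auto simp: finite_index_lists)
  also have "\<dots> = (\<Sum>is\<in>index_lists N ?n. psum N (int c) z * P is ls - (\<Sum>l<?n. P is (ls[l := ls ! l + c])))"
  proof (intro sum.cong refl)
    fix "is" assume "is \<in> index_lists N ?n"
    then have L: "length is = ?n" "distinct is" "set is \<subseteq> {..<N}" by (auto simp: index_lists_def)
    have "(\<Sum>i\<in>{..<N} - set is. z i ^ c * P is ls) = psum N (int c) z * P is ls - (\<Sum>i\<in>set is. z i ^ c * P is ls)"
      using L by (subst sum_diff) (auto simp: psum_def sum_distrib_right)
    also have "(\<Sum>i\<in>set is. z i ^ c * P is ls) = (\<Sum>l<?n. z (is ! l) ^ c * P is ls)"
      by (rule sum.reindex_bij_betw[OF bij_betw_nth[OF L(2)], symmetric]) (use L in auto)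
    also have "\<dots> = (\<Sum>l<?n. P is (ls[l := ls ! l + c]))"
    proof (intro sum.cong refl)
      fix l assume l: "l \<in> {..<?n}"
      have "P is (ls[l := ls ! l + c]) = (\<Prod>m<?n. (if m = l then z (is ! l) ^ c else 1) * z (is ! m) ^ (ls ! m))"
        unfolding P_def by (intro prod.cong) (auto simp: nth_list_update power_add)
      also have "\<dots> = z (is ! l) ^ c * P is ls"
        using l by (simp add: prod.distrib P_def)
      finally show "z (is ! l) ^ c * P is ls = P is (ls[l := ls ! l + c])" ..
    qed
    finally show "(\<Sum>i\<in>{..<N} - set is. z i ^ c * P is ls) = psum N (int c) z * P is ls - (\<Sum>l<?n. P is (ls[l := ls ! l + c]))" .
  qed
  also have "\<dots> = psum N (int c) z * (\<Sum>is\<in>index_lists N ?n. P is ls) - (\<Sum>l<?n. \<Sum>is\<in>index_lists N ?n. P is (ls[l := ls ! l + c]))"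
    by (simp only: sum_subtractf sum_distrib_left sum.swap[of _ "{..<?n}"])
  finally show ?thesis by (simp add: msym_def P_def)
qed

lemma msym_in_lincomb_eprod: "msym N ls \<in> lincomb (range (eprod N))"
proof (induction "length ls" arbitrary: ls)
  case 0
  have "index_lists N 0 = {[]}" by (auto simp: index_lists_def)
  then have "msym N ls = eprod N []" using 0 by (simp add: msym_def fun_eq_iff)
  then show ?case by (metis lincomb_gen rangeI)
next
  case (Suc n)
  then obtain c ks where ls: "ls = c # ks" "length ks = n" by (cases ls) auto
  have mult: "(\<lambda>z. f z * g z) \<in> lincomb (range (eprod N))"
    if "f \<in> lincomb (range (eprod N))" "g \<in> lincomb (range (eprod N))" for f g
  proof (rule lincomb_mult[OF _ that])
    fix a b assume "a \<in> range (eprod N)" "b \<in> range (eprod N)"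
    then obtain xs ys where "a = eprod N xs" "b = eprod N ys" by blast
    then have "(\<lambda>x. a x * b x) = eprod N (xs @ ys)" by (simp add: eprod_append fun_eq_iff)
    then show "(\<lambda>x. a x * b x) \<in> lincomb (range (eprod N))" by (simp add: lincomb_gen)
  qed
  have "msym N ls = (\<lambda>z. psum N (int c) z * msym N ks z - (\<Sum>l<n. msym N (ks[l := ks ! l + c]) z))"
    by (simp add: fun_eq_iff ls msym_Cons)
  also have "\<dots> \<in> lincomb (range (eprod N))"
    by (intro lincomb_diff mult psum_in_lincomb_eprod lincomb_sum Suc.hyps) (use ls in auto)
  finally show ?case .
qed

section \<open>Loop equations for the squared Vandermonde determinant\<close>

text \<open>The matrix is multiplied on the right by the unitriangular matrix of coefficients of the
  Newton basis polynomials \<open>q j\<close>. The entries of the product are the values of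
  \<open>q j\<close> at \<open>x i\<close>; they vanish for \<open>i < j\<close>, so the determinant
  is the product of the diagonal.\<close>

lemma vandermonde_det:
  fixes x :: "nat \<Rightarrow> complex"
  shows "Determinant.det (Matrix.mat n n (\<lambda>(i, j). x i ^ j)) = (\<Prod>b<n. \<Prod>a<b. x b - x a)"
proof -
  define q where "q j = (\<Prod>l<j. [:- x l, 1:])" for j
  define V where "V = Matrix.mat n n (\<lambda>(i, j). x i ^ j)"
  define C where "C = Matrix.mat n n (\<lambda>(k, j). coeff (q j) k)"
  have deg: "degree (q j) = j" for j
    unfolding q_def by (subst degree_prod_eq_sum_degree) auto
  have lead: "coeff (q j) j = 1" for j
  proof -
    have "lead_coeff (q j) = 1" unfolding q_def lead_coeff_prod by simp
    then show ?thesis by (simp add: deg)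
  qed
  have dims: "V \<in> carrier_mat n n" "C \<in> carrier_mat n n" by (simp_all add: V_def C_def)
  have VC: "(V * C) $$ (i, j) = poly (q j) (x i)" if "i < n" "j < n" for i j
  proof -
    have "(V * C) $$ (i, j) = (\<Sum>k = 0..<n. x i ^ k * coeff (q j) k)"
      using that by (simp add: V_def C_def times_mat_def scalar_prod_def)
    also have "\<dots> = (\<Sum>k\<le>j. x i ^ k * coeff (q j) k)"
      using that by (intro sum.mono_neutral_right) (auto simp: coeff_eq_0 deg)
    also have "\<dots> = poly (q j) (x i)"
      by (simp add: poly_altdef deg mult.commute)
    finally show ?thesis .
  qed
  have "Determinant.det C = 1"
  proof -
    have "upper_triangular C"
      by (auto simp: upper_triangular_def C_def coeff_eq_0 deg)
    then have "Determinant.det C = prod_list (diag_mat C)"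
      using dims(2) by (rule det_upper_triangular)
    also have "\<dots> = (\<Prod>i=0..<n. C $$ (i, i))" by (simp add: prod_list_diag_prod C_def)
    also have "\<dots> = 1" by (intro prod.neutral) (auto simp: C_def lead)
    finally show ?thesis .
  qed
  moreover have "Determinant.det (V * C) = (\<Prod>b<n. \<Prod>a<b. x b - x a)"
  proof -
    have pq: "poly (q j) y = (\<Prod>l<j. y - x l)" for j y
      by (simp add: q_def poly_prod)
    have "Determinant.det (V * C) = prod_list (diag_mat (V * C))"
    proof (rule det_lower_triangular)
      fix i j assume "i < j" "j < n"
      then have "(V * C) $$ (i, j) = (\<Prod>l<j. x i - x l)" by (simp add: VC pq)
      also have "\<dots> = 0" using \<open>i < j\<close> by (intro prod_zero) auto
      finally show "(V * C) $$ (i, j) = 0" .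
    qed (use dims in simp)
    also have "\<dots> = (\<Prod>i=0..<n. (V * C) $$ (i, i))" by (simp add: prod_list_diag_prod V_def)
    also have "\<dots> = (\<Prod>b<n. \<Prod>a<b. x b - x a)"
      by (intro prod.cong) (auto simp: VC pq)
    finally show ?thesis .
  qed
  moreover have "Determinant.det (V * C) = Determinant.det V * Determinant.det C"
    using dims by (rule det_mult)
  ultimately show ?thesis by (simp add: V_def)
qed

text \<open>The squared modulus of the Vandermonde product as a Laurent polynomial, which is the
  form in which it can be differentiated along rotations: at complex units each factor is
  \<open>(norm (z b - z a))\<^sup>2\<close>.\<close>

definition vdm_weight :: "nat \<Rightarrow> (nat \<Rightarrow> complex) \<Rightarrow> complex" where
  "vdm_weight N z = (\<Prod>b<N. \<Prod>a<b. 2 - z b * inverse (z a) - z a * inverse (z b))"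

lemma vdm_weight_eq:
  assumes "z \<in> unit_tuples N"
  shows "vdm_weight N z = vandermonde N z * vandermonde N (\<lambda>i. inverse (z i))"
    and "vdm_weight N z = of_real ((norm (vandermonde N z))\<^sup>2)"
proof -
  show *: "vdm_weight N z = vandermonde N z * vandermonde N (\<lambda>i. inverse (z i))"
    unfolding vdm_weight_def vandermonde_def prod.distrib[symmetric]
  proof (intro prod.cong refl)
    fix b a assume "b \<in> {..<N}" "a \<in> {..<b}"
    then have "z a \<noteq> 0" "z b \<noteq> 0" using unit_tuples_nonzero[OF assms] by auto
    then show "2 - z b * inverse (z a) - z a * inverse (z b) = (z b - z a) * (inverse (z b) - inverse (z a))"
      by (simp add: field_simps)
  qed
  have "vandermonde N (\<lambda>i. inverse (z i)) = cnj (vandermonde N z)"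
    unfolding vandermonde_def cnj_prod
  proof (intro prod.cong refl)
    fix b a assume "b \<in> {..<N}" "a \<in> {..<b}"
    then have "norm (z a) = 1" "norm (z b) = 1" using assms by (auto simp: unit_tuples_def)
    then have "z a * cnj (z a) = 1" "z b * cnj (z b) = 1" by (simp_all add: complex_norm_square[symmetric])
    then have "inverse (z a) = cnj (z a)" "inverse (z b) = cnj (z b)" by (auto intro: inverse_unique)
    then show "inverse (z b) - inverse (z a) = cnj (z b - z a)" by simp
  qed
  then show "vdm_weight N z = of_real ((norm (vandermonde N z))\<^sup>2)"
    using * by (simp only: complex_norm_square)
qed

text \<open>Expanding both Vandermonde determinants over permutations p and q gives monomials with
  exponents \<open>p i - q i\<close>. Only \<open>p = q\<close> survives integration, with squared
  sign 1, so the value is the number of permutations.\<close>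

lemma integral_vdm_weight: "(\<integral>z. vdm_weight N z \<partial>torus_measure N) = fact N"
proof -
  interpret prob_space "torus_measure N" by (rule prob_space_torus_measure)
  define S where "S = {p. p permutes {0..<N}}"
  have finS: "finite S" unfolding S_def by (rule finite_permutations) simp
  have det: "vandermonde N x = (\<Sum>p\<in>S. signof p * (\<Prod>i<N. x i ^ p i))" for x
  proof -
    have "vandermonde N x = Determinant.det (Matrix.mat N N (\<lambda>(i, j). x i ^ j))"
      by (simp add: vandermonde_det vandermonde_def)
    also have "\<dots> = (\<Sum>p\<in>S. signof p * (\<Prod>i=0..<N. Matrix.mat N N (\<lambda>(i, j). x i ^ j) $$ (i, p i)))"
      unfolding S_def by (rule det_def') simp
    also have "\<dots> = (\<Sum>p\<in>S. signof p * (\<Prod>i<N. x i ^ p i))"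
    proof (intro sum.cong refl arg_cong2[where f="(*)"] prod.cong)
      fix p i assume "p \<in> S" "i \<in> {..<N}"
      then have "p i < N" unfolding S_def using permutes_in_image[of p "{0..<N}" i] by auto
      then show "Matrix.mat N N (\<lambda>(i, j). x i ^ j) $$ (i, p i) = x i ^ p i" using \<open>i \<in> {..<N}\<close> by simp
    qed auto
    finally show ?thesis .
  qed
  let ?m = "\<lambda>p q z. \<Prod>i<N. z i powi (int (p i) - int (q i))"
  have "(\<integral>z. vdm_weight N z \<partial>torus_measure N)
     = (\<integral>z. (\<Sum>p\<in>S. \<Sum>q\<in>S. signof p * signof q * ?m p q z) \<partial>torus_measure N)"
  proof (intro Bochner_Integration.integral_cong refl)
    fix z assume z: "z \<in> space (torus_measure N)"
    then have zu: "z \<in> unit_tuples N" using space_torus_unit_tuples by blast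
    have "(\<Prod>i<N. z i ^ p i) * (\<Prod>i<N. inverse (z i) ^ q i) = ?m p q z" for p q
      unfolding prod.distrib[symmetric]
    proof (intro prod.cong refl)
      fix i assume "i \<in> {..<N}"
      then have "z i \<noteq> 0" using zu unit_tuples_nonzero by auto
      then show "z i ^ p i * inverse (z i) ^ q i = z i powi (int (p i) - int (q i))"
        by (simp add: power_int_diff divide_inverse power_inverse)
    qed
    then show "vdm_weight N z = (\<Sum>p\<in>S. \<Sum>q\<in>S. signof p * signof q * ?m p q z)"
      unfolding vdm_weight_eq(1)[OF zu] det sum_product by (simp add: mult_ac)
  qed
  also have "\<dots> = (\<Sum>p\<in>S. \<Sum>q\<in>S. signof p * signof q * (\<integral>z. ?m p q z \<partial>torus_measure N))"
  proof -
    have i: "integrable (torus_measure N) (\<lambda>z. c * ?m p q z)" for c p q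
      by (intro integrable_mult_right finite_measure_torus_monomial finite_measure_axioms refl)
    show ?thesis
      by (simp add: Bochner_Integration.integral_sum Bochner_Integration.integrable_sum i)
  qed
  also have "\<dots> = (\<Sum>p\<in>S. \<Sum>q\<in>S. if q = p then 1 else 0)"
  proof (intro sum.cong refl)
    fix p q assume pq: "p \<in> S" "q \<in> S"
    have "(\<forall>j<N. int (p j) - int (q j) = 0) \<longleftrightarrow> q = p"
    proof
      assume *: "\<forall>j<N. int (p j) - int (q j) = 0"
      show "q = p"
      proof
        fix j show "q j = p j"
          using * pq permutes_not_in[of p "{0..<N}" j] permutes_not_in[of q "{0..<N}" j]
          unfolding S_def by (cases "j < N") auto
      qed
    qed auto
    then show "signof p * signof q * (\<integral>z. ?m p q z \<partial>torus_measure N) = (if q = p then 1 else 0)"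
      unfolding integral_torus_monomial by (auto simp: sign_def)
  qed
  also have "\<dots> = of_nat (card S)" using finS by simp
  also have "card S = fact N" unfolding S_def using card_permutations[of "{0..<N}" N] by simp
  finally show ?thesis by simp
qed

lemma norm_cis_diff: "norm (cis t - 1 - \<i> * of_real t) \<le> t\<^sup>2"
proof -
  have "norm (exp (\<i> * of_real t) - (\<Sum>k\<le>1. (\<i> * of_real t) ^ k / fact k))
      \<le> exp \<bar>Re (\<i> * of_real t)\<bar> * (norm (\<i> * of_real t) ^ Suc 1) / fact 1"
    by (rule Taylor_exp)
  then show ?thesis by (simp add: cis_conv_exp norm_mult algebra_simps power2_eq_square)
qed

lemma flow_deriv_coord:
  assumes "i < N" "j < N"
  shows "flow_deriv (space (torus_measure N)) (rotate_coord i) (\<lambda>z. z j powi b)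
    (\<lambda>z. if j = i then \<i> * (of_int b * z j powi b) else 0)"
proof (rule flow_derivI[of _ _ 1 _ "\<bar>of_int b\<bar>" _ "(of_int b)\<^sup>2"])
  fix z assume z: "z \<in> space (torus_measure N)"
  then have n: "norm (z j) = 1" using assms by (simp add: torus_coord_norm)
  then show "norm (z j powi b) \<le> 1" by (simp add: norm_power_int)
  show "norm (if j = i then \<i> * (of_int b * z j powi b) else 0) \<le> \<bar>of_int b\<bar>"
    using n by (auto simp: norm_mult norm_power_int)
  fix t :: real
  show "norm (rotate_coord i t z j powi b - z j powi b - of_real t * (if j = i then \<i> * (of_int b * z j powi b) else 0))
     \<le> (of_int b)\<^sup>2 * t\<^sup>2"
  proof (cases "j = i")
    case True
    have "rotate_coord i t z j powi b - z j powi b - of_real t * (\<i> * (of_int b * z j powi b))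
      = z j powi b * (cis (of_int b * t) - 1 - \<i> * of_real (of_int b * t))"
      using True by (simp add: rotate_coord_def power_int_mult_distrib cis_power_int algebra_simps)
    then have "norm (rotate_coord i t z j powi b - z j powi b - of_real t * (\<i> * (of_int b * z j powi b)))
      = norm (cis (of_int b * t) - 1 - \<i> * of_real (of_int b * t))"
      using n by (simp only: norm_mult norm_power_int power_int_1_left mult_1)
    also have "\<dots> \<le> (of_int b * t)\<^sup>2" by (rule norm_cis_diff)
    finally show ?thesis using True by (simp only: power_mult_distrib if_True refl)
  qed (simp add: rotate_coord_def)
qed

lemma rotate_coord_space:
  "i < N \<Longrightarrow> z \<in> space (torus_measure N) \<Longrightarrow> rotate_coord i t z \<in> space (torus_measure N)"
  by (rule measurable_space[OF rotate_coord_measurable])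

lemma flow_deriv_sym_deriv:
  assumes "sym_deriv N f d" "i < N"
  shows "flow_deriv (space (torus_measure N)) (rotate_coord i) f (\<lambda>z. \<i> * d i z)"
  using assms(1)
proof induction
  case (sym_deriv_const c)
  show ?case using flow_deriv_const[of _ _ c] by simp
next
  case (sym_deriv_psum b)
  have "flow_deriv (space (torus_measure N)) (rotate_coord i) (\<lambda>z. \<Sum>j<N. z j powi b)
    (\<lambda>z. \<Sum>j<N. if j = i then \<i> * (of_int b * z j powi b) else 0)"
    by (rule flow_deriv_sum) (use assms(2) flow_deriv_coord in auto)
  then show ?case using assms(2) by (simp add: psum_def[abs_def])
next
  case (sym_deriv_add f d g e)
  then show ?case using flow_deriv_add[OF sym_deriv_add.IH] by (simp add: distrib_left)
next
  case (sym_deriv_mult f d g e)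
  then show ?case using flow_deriv_mult[OF sym_deriv_mult.IH] by (simp add: distrib_left mult_ac)
next
  case (sym_deriv_cong f d f' d')
  show ?case
    by (rule flow_deriv_cong[OF sym_deriv_cong.IH])
       (use sym_deriv_cong.hyps space_torus_unit_tuples assms(2) rotate_coord_space in \<open>auto simp: subset_iff\<close>)
qed

text \<open>The Euler derivative in \<open>z b\<close> of the logarithm of the factor
  \<open>2 - z b / z a - z a / z b\<close>; in \<open>z a\<close> it is the negative. Where
  \<open>z a = z b\<close>, division by zero yields 0, which is harmless because the factor and its
  derivative vanish there.\<close>

definition vdm_ratio :: "(nat \<Rightarrow> complex) \<Rightarrow> nat \<Rightarrow> nat \<Rightarrow> complex" where
  "vdm_ratio z b a = (z b + z a) / (z b - z a)"

lemma flow_deriv_vdm_weight: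
  assumes "i < N"
  shows "flow_deriv (space (torus_measure N)) (rotate_coord i) (vdm_weight N)
    (\<lambda>z. vdm_weight N z * (\<Sum>b<N. \<Sum>a<b. \<i> * (of_bool (b = i) - of_bool (a = i)) * vdm_ratio z b a))"
  unfolding vdm_weight_def
proof (intro flow_deriv_prod_log)
  fix b a assume ba: "b \<in> {..<N}" "a \<in> {..<b}"
  then have a: "a < N" "b < N" "a \<noteq> b" by auto
  note c = flow_deriv_coord[OF assms]
  have "flow_deriv (space (torus_measure N)) (rotate_coord i)
     (\<lambda>z. 2 + (-1) * (z b powi 1 * z a powi (-1)) + (-1) * (z a powi 1 * z b powi (-1)))
     (\<lambda>z. 0 + (-1) * ((if b = i then \<i> * (of_int 1 * z b powi 1) else 0) * z a powi (-1)
            + z b powi 1 * (if a = i then \<i> * (of_int (-1) * z a powi (-1)) else 0))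
        + (-1) * ((if a = i then \<i> * (of_int 1 * z a powi 1) else 0) * z b powi (-1)
            + z a powi 1 * (if b = i then \<i> * (of_int (-1) * z b powi (-1)) else 0)))"
    by (intro flow_deriv_add flow_deriv_cmult flow_deriv_mult flow_deriv_const c a)
  then show "flow_deriv (space (torus_measure N)) (rotate_coord i)
     (\<lambda>z. 2 - z b * inverse (z a) - z a * inverse (z b))
     (\<lambda>z. (2 - z b * inverse (z a) - z a * inverse (z b)) * (\<i> * (of_bool (b = i) - of_bool (a = i)) * vdm_ratio z b a))"
  proof (rule flow_deriv_cong)
    fix z assume z: "z \<in> space (torus_measure N)"
    then have nz: "z a \<noteq> 0" "z b \<noteq> 0" using a by (metis norm_zero torus_coord_norm zero_neq_one)+
    show "2 - z b * inverse (z a) - z a * inverse (z b) =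
      2 + (-1) * (z b powi 1 * z a powi (-1)) + (-1) * (z a powi 1 * z b powi (-1))"
      by (simp add: power_int_minus)
    have "(2 - z b * inverse (z a) - z a * inverse (z b)) * vdm_ratio z b a = z a * inverse (z b) - z b * inverse (z a)"
    proof (cases "z a = z b")
      case False
      have "2 - z b * inverse (z a) - z a * inverse (z b) = - (z b - z a) * (z b - z a) / (z a * z b)"
        using nz by (simp add: field_simps)
      then have "(2 - z b * inverse (z a) - z a * inverse (z b)) * vdm_ratio z b a = - (z b - z a) * (z b + z a) / (z a * z b)"
        using False by (simp add: vdm_ratio_def)
      then show ?thesis using nz by (simp add: field_simps)
    qed (use nz in \<open>simp add: vdm_ratio_def\<close>)
    then have "(2 - z b * inverse (z a) - z a * inverse (z b)) * (\<i> * (of_bool (b = i) - of_bool (a = i)) * vdm_ratio z b a)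
      = \<i> * (of_bool (b = i) - of_bool (a = i)) * (z a * inverse (z b) - z b * inverse (z a))"
      by (metis mult.assoc mult.commute)
    then show "(2 - z b * inverse (z a) - z a * inverse (z b)) * (\<i> * (of_bool (b = i) - of_bool (a = i)) * vdm_ratio z b a)
      = 0 + (-1) * ((if b = i then \<i> * (of_int 1 * z b powi 1) else 0) * z a powi (-1)
            + z b powi 1 * (if a = i then \<i> * (of_int (-1) * z a powi (-1)) else 0))
        + (-1) * ((if a = i then \<i> * (of_int 1 * z a powi 1) else 0) * z b powi (-1)
            + z a powi 1 * (if b = i then \<i> * (of_int (-1) * z b powi (-1)) else 0))"
      using a(3) by (auto simp: power_int_minus algebra_simps)
  qed (rule rotate_coord_space[OF assms])
qed

lemma sum_sum_pairs:
  fixes g :: "nat \<Rightarrow> nat \<Rightarrow> complex"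
  shows "(\<Sum>i<n. \<Sum>j<n. g i j) = (\<Sum>i<n. g i i) + (\<Sum>b<n. \<Sum>a<b. g b a + g a b)"
  by (induction n) (simp_all add: sum.distrib)

text \<open>The geometric sum gives \<open>(x - y) * S x y = x * (x ^ k - y ^ k)\<close>. Adding the
  expression with x and y exchanged shows that a pair contributes (x^k - y^k) (x + y) / (x - y) to
  the repulsion, while the diagonal gives \<open>k * z i ^ k\<close>. If two coordinates coincide,
  the weight makes both sides zero.\<close>

lemma vdm_weight_repulsion:
  assumes "z \<in> unit_tuples N"
  shows "vdm_weight N z * ((\<Sum>i<N. of_nat k * z i ^ k) + (\<Sum>b<N. \<Sum>a<b. (z b ^ k - z a ^ k) * vdm_ratio z b a))
    = vdm_weight N z * repulsion N k z"
proof (cases "\<exists>b<N. \<exists>a<b. z b = z a")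
  case True
  then have "vandermonde N z = 0" unfolding vandermonde_def by (auto intro!: prod_zero bexI)
  then show ?thesis using vdm_weight_eq(1)[OF assms] by simp
next
  case False
  define S where "S x y = (\<Sum>t=1..k. x ^ t * y ^ (k - t))" for x y :: complex
  have S: "(x - y) * S x y = x * (x ^ k - y ^ k)" for x y
  proof -
    have "S x y = (\<Sum>t<k. x ^ Suc t * y ^ (k - Suc t))"
      unfolding S_def by (rule sum.reindex_bij_witness[of _ Suc "\<lambda>t. t - 1"]) auto
    also have "\<dots> = x * (\<Sum>t<k. y ^ (k - Suc t) * x ^ t)" by (simp add: sum_distrib_left mult_ac)
    finally show ?thesis using power_diff_sumr2[of x k y] by simp
  qed
  have "repulsion N k z = (\<Sum>i<N. S (z i) (z i)) + (\<Sum>b<N. \<Sum>a<b. S (z b) (z a) + S (z a) (z b))"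
    unfolding repulsion_def S_def[symmetric] by (rule sum_sum_pairs)
  also have "(\<Sum>i<N. S (z i) (z i)) = (\<Sum>i<N. of_nat k * z i ^ k)"
  proof (intro sum.cong refl)
    fix i
    have "S (z i) (z i) = (\<Sum>t=1..k. z i ^ k)"
      unfolding S_def by (intro sum.cong) (auto simp flip: power_add)
    then show "S (z i) (z i) = of_nat k * z i ^ k" by simp
  qed
  also have "(\<Sum>b<N. \<Sum>a<b. S (z b) (z a) + S (z a) (z b)) = (\<Sum>b<N. \<Sum>a<b. (z b ^ k - z a ^ k) * vdm_ratio z b a)"
  proof (intro sum.cong refl)
    fix b a assume "b \<in> {..<N}" "a \<in> {..<b}"
    then have ne: "z b - z a \<noteq> 0" using False by auto
    have "(z b - z a) * (S (z b) (z a) + S (z a) (z b)) = (z b + z a) * (z b ^ k - z a ^ k)"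
      using S[of "z b" "z a"] S[of "z a" "z b"] by (simp add: algebra_simps)
    then show "S (z b) (z a) + S (z a) (z b) = (z b ^ k - z a ^ k) * vdm_ratio z b a"
      using ne by (simp add: vdm_ratio_def field_simps)
  qed
  finally show ?thesis by simp
qed

definition circular_law :: "nat \<Rightarrow> (nat \<Rightarrow> complex) measure" where
  "circular_law N = density (torus_measure N) (\<lambda>z. ennreal ((norm (vandermonde N z))\<^sup>2 / fact N))"

lemma sets_circular_law: "sets (circular_law N) = sets (torus_measure N)"
  by (simp add: circular_law_def)

lemma vandermonde_measurable [measurable]: "vandermonde N \<in> borel_measurable (torus_measure N)"
  unfolding vandermonde_def[abs_def]
  by (intro borel_measurable_prod borel_measurable_diff torus_coord_measurable) auto

lemma bdd_torus_fun_vdm_weight: "bdd_torus_fun N (vdm_weight N)"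
proof -
  have c: "bdd_torus_fun N (\<lambda>z. (z b - z a) * (inverse (z b) - inverse (z a)))" if "a < N" "b < N" for a b
  proof -
    have "bdd_torus_fun N (\<lambda>z. (z b powi 1 + (-1) * z a powi 1) * (z b powi (-1) + (-1) * z a powi (-1)))"
      using that by (intro bdd_torus_fun_add bdd_torus_fun_mult bdd_torus_fun_powi bdd_torus_fun_const)
    then show ?thesis by (simp add: power_int_minus)
  qed
  have p: "bdd_torus_fun N (\<lambda>z. \<Prod>a\<in>A. f a z)" if "\<And>a. a \<in> A \<Longrightarrow> bdd_torus_fun N (f a)" for A :: "nat set" and f
    using that by (induction A rule: infinite_finite_induct) (auto intro: bdd_torus_fun_const bdd_torus_fun_mult)
  have "bdd_torus_fun N (\<lambda>z. \<Prod>b<N. \<Prod>a<b. (z b - z a) * (inverse (z b) - inverse (z a)))"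
    by (intro p c) auto
  then show ?thesis
    by (rule bdd_torus_fun_cong) (simp add: vdm_weight_eq(1) vandermonde_def prod.distrib)
qed

lemma integral_circular_law:
  assumes "bdd_torus_fun N f"
  shows "(\<integral>z. f z \<partial>circular_law N) = (\<integral>z. vdm_weight N z * f z \<partial>torus_measure N) / fact N"
proof -
  have f: "f \<in> borel_measurable (torus_measure N)" using assms by (simp add: bdd_torus_fun_def)
  have "(\<integral>z. f z \<partial>circular_law N) = (\<integral>z. ((norm (vandermonde N z))\<^sup>2 / fact N) *\<^sub>R f z \<partial>torus_measure N)"
    unfolding circular_law_def using f
    by (intro integral_density AE_I2; measurable)
  also have "\<dots> = (\<integral>z. (vdm_weight N z * f z) / fact N \<partial>torus_measure N)"
  proof (intro Bochner_Integration.integral_cong refl)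
    fix z assume "z \<in> space (torus_measure N)"
    then have "z \<in> unit_tuples N" using space_torus_unit_tuples by blast
    then show "((norm (vandermonde N z))\<^sup>2 / fact N) *\<^sub>R f z = (vdm_weight N z * f z) / fact N"
      by (simp add: vdm_weight_eq(2) scaleR_conv_of_real)
  qed
  finally show ?thesis by simp
qed

lemma prob_space_circular_law: "prob_space (circular_law N)"
proof
  interpret T: prob_space "torus_measure N" by (rule prob_space_torus_measure)
  let ?w = "\<lambda>z. (norm (vandermonde N z))\<^sup>2 / fact N"
  have m: "?w \<in> borel_measurable (torus_measure N)"
    by measurable
  have eq: "complex_of_real (?w z) = vdm_weight N z / fact N" if "z \<in> space (torus_measure N)" for z
    using that space_torus_unit_tuples by (subst vdm_weight_eq(2)) auto
  have "integrable (torus_measure N) (\<lambda>z. vdm_weight N z / fact N)"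
    using bdd_torus_fun_integrable[OF bdd_torus_fun_vdm_weight T.finite_measure_axioms refl] by simp
  then have "integrable (torus_measure N) (\<lambda>z. complex_of_real (?w z))"
    using eq by (subst Bochner_Integration.integrable_cong[OF refl eq])
  then have i: "integrable (torus_measure N) ?w" by (simp only: complex_of_real_integrable_eq)
  have "complex_of_real (integral\<^sup>L (torus_measure N) ?w) = (\<integral>z. complex_of_real (?w z) \<partial>torus_measure N)"
    by (rule integral_complex_of_real[symmetric])
  also have "\<dots> = (\<integral>z. vdm_weight N z / fact N \<partial>torus_measure N)"
    by (rule Bochner_Integration.integral_cong[OF refl eq])
  also have "\<dots> = 1" by (simp add: integral_vdm_weight)
  finally have "integral\<^sup>L (torus_measure N) ?w = 1" by (simp only: of_real_eq_1_iff)
  then have i1: "integral\<^sup>L (torus_measure N) ?w = 1" .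
  have e1: "emeasure (circular_law N) (space (circular_law N)) = (\<integral>\<^sup>+z. ennreal (?w z) \<partial>torus_measure N)"
    unfolding circular_law_def using m by (subst emeasure_density) (auto intro!: nn_integral_cong simp: space_density)
  have e2: "(\<integral>\<^sup>+z. ennreal (?w z) \<partial>torus_measure N) = ennreal (integral\<^sup>L (torus_measure N) ?w)"
    using i by (rule nn_integral_eq_integral) simp
  show "emeasure (circular_law N) (space (circular_law N)) = 1" unfolding e1 e2 i1 by simp
qed

text \<open>Integration by parts: rotating the \<open>i\<close>-th coordinate preserves the torus measure.\<close>

lemma loop_equations_circular_law: "loop_equations N (circular_law N)"
  unfolding loop_equations_def
proof (intro allI impI)
  fix k f d assume fd: "sym_deriv N f d"
  interpret T: prob_space "torus_measure N" by (rule prob_space_torus_measure)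
  let ?R = "\<lambda>i z. \<Sum>b<N. \<Sum>a<b. (of_bool (b = i) - of_bool (a = i)) * vdm_ratio z b a"
  let ?g = "\<lambda>i z. vdm_weight N z * (of_nat k * z i ^ k * f z + z i ^ k * d i z + z i ^ k * f z * ?R i z)"
  have zero: "integrable (torus_measure N) (?g i) \<and> (\<integral>z. ?g i z \<partial>torus_measure N) = 0" if i: "i < N" for i
  proof -
    \<comment> \<open>The function to be rotated is the test function times \<open>z i ^ k\<close>
      times the density; the derivatives of these three factors yield the three summands of
      \<open>?g\<close>.\<close>
    let ?F = "\<lambda>z. (z i powi int k * f z) * vdm_weight N z"
    have "flow_deriv (space (torus_measure N)) (rotate_coord i) ?F
      (\<lambda>z. ((if i = i then \<i> * (of_int (int k) * z i powi int k) else 0) * f z + z i powi int k * (\<i> * d i z)) * vdm_weight N z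
       + (z i powi int k * f z) * (vdm_weight N z * (\<Sum>b<N. \<Sum>a<b. \<i> * (of_bool (b = i) - of_bool (a = i)) * vdm_ratio z b a)))"
      by (intro flow_deriv_mult flow_deriv_coord flow_deriv_sym_deriv flow_deriv_vdm_weight i fd)
    then have fl: "flow_deriv (space (torus_measure N)) (rotate_coord i) ?F (\<lambda>z. \<i> * ?g i z)"
    proof (rule flow_deriv_cong)
      fix z
      have "(\<Sum>b<N. \<Sum>a<b. \<i> * (of_bool (b = i) - of_bool (a = i)) * vdm_ratio z b a) = \<i> * ?R i z"
        by (simp add: sum_distrib_left mult.assoc)
      then show "\<i> * ?g i z = ((if i = i then \<i> * (of_int (int k) * z i powi int k) else 0) * f z + z i powi int k * (\<i> * d i z)) * vdm_weight N z
       + (z i powi int k * f z) * (vdm_weight N z * (\<Sum>b<N. \<Sum>a<b. \<i> * (of_bool (b = i) - of_bool (a = i)) * vdm_ratio z b a))"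
        by (simp add: algebra_simps)
    qed (auto intro: rotate_coord_space[OF i])
    have "?F \<in> borel_measurable (torus_measure N)"
      using bdd_torus_fun_mult[OF bdd_torus_fun_mult[OF bdd_torus_fun_powi[OF i, of "int k"] bdd_torus_fun_sym_deriv(1)[OF fd]] bdd_torus_fun_vdm_weight]
      by (simp add: bdd_torus_fun_def)
    note * = T.integral_flow_deriv_eq_0[OF rotate_coord_measurable[OF i] distr_rotate_coord[OF i] this fl]
    from *(1) have "integrable (torus_measure N) (\<lambda>z. - \<i> * (\<i> * ?g i z))" by (rule integrable_mult_right)
    moreover from *(2) have "(\<integral>z. - \<i> * (\<i> * ?g i z) \<partial>torus_measure N) = 0" by simp
    ultimately show ?thesis by (simp add: mult.assoc[symmetric])
  qed
  let ?G = "\<lambda>z. repulsion N k z * f z + (\<Sum>i<N. z i ^ k * d i z)"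
  have "bdd_torus_fun N ?G"
    using bdd_torus_fun_sym_deriv[OF fd]
    by (intro bdd_torus_fun_add bdd_torus_fun_mult bdd_torus_fun_sum bdd_torus_fun_power bdd_torus_fun_repulsion) auto
  then have "(\<integral>z. ?G z \<partial>circular_law N) = (\<integral>z. vdm_weight N z * ?G z \<partial>torus_measure N) / fact N"
    by (rule integral_circular_law)
  also have "(\<integral>z. vdm_weight N z * ?G z \<partial>torus_measure N) = (\<integral>z. (\<Sum>i<N. ?g i z) \<partial>torus_measure N)"
  proof (rule Bochner_Integration.integral_cong[OF refl])
    fix z assume "z \<in> space (torus_measure N)"
    then have z: "z \<in> unit_tuples N" using space_torus_unit_tuples by blast
    \<comment> \<open>For a pair \<open>a < b\<close> only \<open>i = b\<close> and
      \<open>i = a\<close> contribute, with opposite signs.\<close>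
    have R: "(\<Sum>i<N. z i ^ k * ?R i z) = (\<Sum>b<N. \<Sum>a<b. (z b ^ k - z a ^ k) * vdm_ratio z b a)"
    proof -
      have "(\<Sum>i<N. z i ^ k * ?R i z) = (\<Sum>b<N. \<Sum>a<b. \<Sum>i<N. z i ^ k * ((of_bool (b = i) - of_bool (a = i)) * vdm_ratio z b a))"
        unfolding sum_distrib_left by (rule trans[OF sum.swap], rule sum.cong[OF refl], rule sum.swap)
      also have "\<dots> = (\<Sum>b<N. \<Sum>a<b. (z b ^ k - z a ^ k) * vdm_ratio z b a)"
      proof (intro sum.cong refl)
        fix b a assume ba: "b \<in> {..<N}" "a \<in> {..<b}"
        have "(\<Sum>i<N. z i ^ k * ((of_bool (b = i) - of_bool (a = i)) * vdm_ratio z b a))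
          = (\<Sum>i<N. if b = i then z i ^ k * vdm_ratio z b a else 0) - (\<Sum>i<N. if a = i then z i ^ k * vdm_ratio z b a else 0)"
          unfolding sum_subtractf[symmetric] by (intro sum.cong) (auto simp: algebra_simps)
        also have "\<dots> = (z b ^ k - z a ^ k) * vdm_ratio z b a"
          using ba by (simp add: algebra_simps)
        finally show "(\<Sum>i<N. z i ^ k * ((of_bool (b = i) - of_bool (a = i)) * vdm_ratio z b a)) = (z b ^ k - z a ^ k) * vdm_ratio z b a" .
      qed
      finally show ?thesis .
    qed
    have "(\<Sum>i<N. ?g i z) = vdm_weight N z * ((\<Sum>i<N. of_nat k * z i ^ k) + (\<Sum>i<N. z i ^ k * ?R i z)) * f z
       + vdm_weight N z * (\<Sum>i<N. z i ^ k * d i z)"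
      by (simp add: sum.distrib distrib_left sum_distrib_left[symmetric] sum_distrib_right[symmetric] algebra_simps)
    also have "\<dots> = vdm_weight N z * ?G z"
      unfolding R vdm_weight_repulsion[OF z] by (simp add: algebra_simps)
    finally show "vdm_weight N z * ?G z = (\<Sum>i<N. ?g i z)" ..
  qed
  also have "\<dots> = 0"
    by (subst Bochner_Integration.integral_sum) (use zero in auto)
  finally show "(\<integral>z. ?G z \<partial>circular_law N) = 0" by simp
qed

section \<open>Unitary matrices\<close>

type_synonym 'n cmatrix = "complex ^ 'n ^ 'n"

lemma continuous_on_nth:
  assumes "continuous_on S f" shows "continuous_on S (\<lambda>x. f x $ i)"
  using assms unfolding continuous_on_def by (auto intro: tendsto_vec_nth)

lemma continuous_on_matrix_mult:
  fixes f g :: "'a::topological_space \<Rightarrow> 'n::finite cmatrix"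
  assumes "continuous_on S f" "continuous_on S g"
  shows "continuous_on S (\<lambda>x. f x ** g x)"
  unfolding matrix_matrix_mult_def
  by (intro continuous_on_vec_lambda continuous_on_sum continuous_on_mult continuous_on_nth assms)

lemma continuous_on_adjoint:
  fixes f :: "'a::topological_space \<Rightarrow> 'n::finite cmatrix"
  assumes "continuous_on S f"
  shows "continuous_on S (\<lambda>x. adjoint_matrix (f x))"
  unfolding adjoint_matrix_def
  by (intro continuous_on_vec_lambda continuous_on_cnj continuous_on_nth assms)

lemma continuous_on_trace:
  fixes f :: "'a::topological_space \<Rightarrow> 'n::finite cmatrix"
  assumes "continuous_on S f" shows "continuous_on S (\<lambda>x. trace (f x))"
  unfolding trace_def by (intro continuous_on_sum continuous_on_nth assms)

lemma matrix_mult_nth: "(A ** B) $ i $ j = (\<Sum>k\<in>UNIV. A $ i $ k * B $ k $ j)"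
  by (simp add: matrix_matrix_mult_def)

lemma matrix_mult_add_right: "(A + B) ** C = A ** C + B ** (C :: 'n::finite cmatrix)"
  by (simp add: vec_eq_iff matrix_mult_nth distrib_right sum.distrib)

lemma adjoint_nth: "adjoint_matrix A $ i $ j = cnj (A $ j $ i)"
  by (simp add: adjoint_matrix_def)

lemma adjoint_mult: "adjoint_matrix (A ** B) = adjoint_matrix B ** adjoint_matrix (A :: 'n::finite cmatrix)"
  by (simp add: vec_eq_iff adjoint_nth matrix_mult_nth mult.commute)

lemma adjoint_adjoint [simp]: "adjoint_matrix (adjoint_matrix A) = A"
  by (simp add: vec_eq_iff adjoint_nth)

lemma adjoint_one [simp]: "adjoint_matrix (mat 1) = mat 1"
  by (auto simp: vec_eq_iff adjoint_nth mat_def)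

lemma unitaryD:
  assumes "A \<in> unitary_group"
  shows "A ** adjoint_matrix A = mat 1" "adjoint_matrix A ** A = mat 1"
  using assms by (auto simp: unitary_group_def)

lemma unitary_one: "mat 1 \<in> unitary_group"
  by (simp add: unitary_group_def)

lemma unitary_adjoint: "A \<in> unitary_group \<Longrightarrow> adjoint_matrix A \<in> unitary_group"
  by (simp add: unitary_group_def)

lemma unitary_cancel:
  assumes "A \<in> unitary_group"
  shows "adjoint_matrix A ** (A ** B) = B" "A ** (adjoint_matrix A ** B) = B"
    "B ** A ** adjoint_matrix A = B" "B ** adjoint_matrix A ** A = B"
proof -
  show "adjoint_matrix A ** (A ** B) = B" "A ** (adjoint_matrix A ** B) = B"
    using unitaryD[OF assms] by (simp_all add: matrix_mul_assoc)
  show "B ** A ** adjoint_matrix A = B" "B ** adjoint_matrix A ** A = B"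
    using unitaryD[OF assms] by (simp_all add: matrix_mul_assoc[symmetric])
qed

lemma unitary_mult:
  assumes "A \<in> unitary_group" "B \<in> unitary_group" shows "A ** B \<in> unitary_group"
proof -
  have "A ** B ** (adjoint_matrix B ** adjoint_matrix A) = A ** (B ** adjoint_matrix B) ** adjoint_matrix A"
    by (simp add: matrix_mul_assoc)
  moreover have "adjoint_matrix B ** adjoint_matrix A ** (A ** B) = adjoint_matrix B ** (adjoint_matrix A ** A) ** B"
    by (simp add: matrix_mul_assoc)
  ultimately show ?thesis
    using unitaryD[OF assms(1)] unitaryD[OF assms(2)] by (simp add: unitary_group_def adjoint_mult)
qed

lemma unitary_entry_norm:
  assumes "A \<in> unitary_group" shows "norm (A $ i $ j) \<le> 1"
proof -
  have "(\<Sum>k\<in>UNIV. A $ i $ k * cnj (A $ i $ k)) = 1"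
    using arg_cong[OF unitaryD(1)[OF assms], of "\<lambda>B. B $ i $ i"]
    by (simp add: matrix_mult_nth adjoint_nth mat_def)
  then have "complex_of_real (\<Sum>k\<in>UNIV. (norm (A $ i $ k))\<^sup>2) = 1"
    by (simp only: of_real_sum complex_norm_square)
  then have "(\<Sum>k\<in>UNIV. (norm (A $ i $ k))\<^sup>2) = 1" by (simp only: of_real_eq_1_iff)
  moreover have "(norm (A $ i $ j))\<^sup>2 \<le> (\<Sum>k\<in>UNIV. (norm (A $ i $ k))\<^sup>2)"
    by (rule member_le_sum) auto
  ultimately have "(norm (A $ i $ j))\<^sup>2 \<le> 1" by simp
  then show ?thesis by (simp add: abs_square_le_1)
qed

lemma closed_unitary_group: "closed (unitary_group :: 'n::finite cmatrix set)"
proof -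
  have "unitary_group = {A :: 'n cmatrix. A ** adjoint_matrix A = mat 1} \<inter> {A. adjoint_matrix A ** A = mat 1}"
    by (auto simp: unitary_group_def)
  also have "closed \<dots>"
    by (intro closed_Int closed_Collect_eq continuous_on_matrix_mult continuous_on_adjoint
        continuous_on_id continuous_on_const)
  finally show ?thesis .
qed

lemma compact_unitary_group: "compact (unitary_group :: 'n::finite cmatrix set)"
proof -
  have "bounded (unitary_group :: 'n cmatrix set)"
    unfolding bounded_iff
  proof (intro exI ballI)
    fix A :: "'n cmatrix" assume A: "A \<in> unitary_group"
    have "norm A \<le> (\<Sum>i\<in>UNIV. norm (A $ i))" by (simp add: norm_vec_def L2_set_le_sum)
    also have "\<dots> \<le> (\<Sum>i\<in>(UNIV::'n set). \<Sum>j\<in>(UNIV::'n set). norm (A $ i $ j))"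
      by (intro sum_mono) (simp add: norm_vec_def L2_set_le_sum)
    also have "\<dots> \<le> (\<Sum>i\<in>(UNIV::'n set). \<Sum>j\<in>(UNIV::'n set). 1)"
      by (intro sum_mono unitary_entry_norm A)
    finally show "norm A \<le> (\<Sum>i\<in>(UNIV::'n set). \<Sum>j\<in>(UNIV::'n set). 1)" .
  qed
  then show ?thesis using closed_unitary_group compact_eq_bounded_closed by blast
qed

lemma unitary_law_space:
  assumes "unitary_law M" shows "space M = unitary_group"
proof -
  have "space M = space (restrict_space borel unitary_group)"
    using assms by (intro sets_eq_imp_space_eq) (simp add: unitary_law_def)
  then show ?thesis by (simp add: space_restrict_space)
qed

lemma unitary_law_measurable_from:
  assumes "unitary_law M" "continuous_on unitary_group f"
  shows "f \<in> borel_measurable M"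
  using borel_measurable_continuous_on_restrict[OF assms(2)] assms(1)
  by (simp add: unitary_law_def cong: measurable_cong_sets)

lemma unitary_law_measurable_into:
  assumes "unitary_law M" "f \<in> borel_measurable L" "\<And>x. x \<in> space L \<Longrightarrow> f x \<in> unitary_group"
  shows "f \<in> measurable L M"
proof -
  have "f \<in> measurable L (restrict_space borel unitary_group)"
    using assms(2,3) by (intro measurable_restrict_space2) auto
  then show ?thesis using assms(1) by (simp add: unitary_law_def cong: measurable_cong_sets)
qed

lemma unitary_law_measurable_self:
  assumes "unitary_law M" "continuous_on unitary_group f" "\<And>A. A \<in> unitary_group \<Longrightarrow> f A \<in> unitary_group"
  shows "f \<in> measurable M M"
  using assms unitary_law_measurable_from unitary_law_space unitary_law_measurable_into by metis

lemma unitary_law_integrable: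
  fixes f :: "'n::finite cmatrix \<Rightarrow> complex"
  assumes "unitary_law M" "continuous_on unitary_group f"
  shows "integrable M f"
proof -
  interpret prob_space M using assms(1) by (simp add: unitary_law_def)
  have "compact (f ` unitary_group)" by (intro compact_continuous_image assms compact_unitary_group)
  then obtain K where "\<forall>A\<in>unitary_group. norm (f A) \<le> K"
    using compact_imp_bounded bounded_iff by (metis (no_types) imageI)
  then show ?thesis
    using unitary_law_measurable_from[OF assms] unitary_law_space[OF assms(1)]
    by (intro integrable_const_bound[of _ K]) auto
qed

section \<open>Flows generated by projections and derivatives of matrix functions\<close>

definition projection :: "'n::finite cmatrix \<Rightarrow> bool" where
  "projection P \<longleftrightarrow> P ** P = P \<and> adjoint_matrix P = P"

text \<open>For an orthogonal projection P this is \<open>exp (\<i> * t * P)\<close>: all positive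
  powers of P coincide, so the exponential series has this closed form.\<close>

definition reflection :: "'n::finite cmatrix \<Rightarrow> real \<Rightarrow> 'n cmatrix" where
  "reflection P t = (\<chi> i j. mat 1 $ i $ j + (cis t - 1) * P $ i $ j)"

lemma matrix_mult_reflection:
  "(A ** reflection P t) $ i $ j = A $ i $ j + (cis t - 1) * (A ** P) $ i $ j"
proof -
  have "(A ** reflection P t) $ i $ j = (A ** mat 1) $ i $ j + (cis t - 1) * (A ** P) $ i $ j"
    unfolding matrix_mult_nth reflection_def
    by (simp add: distrib_left sum.distrib sum_distrib_left mult_ac)
  then show ?thesis by simp
qed

lemma adjoint_reflection: "projection P \<Longrightarrow> adjoint_matrix (reflection P t) = reflection P (- t)"
proof -
  assume "projection P"
  then have "cnj (P $ j $ i) = P $ i $ j" for i j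
    by (metis projection_def adjoint_nth)
  moreover have "cnj (cis t) = cis (- t)" by (simp add: cis_cnj)
  ultimately show ?thesis
    by (auto simp: vec_eq_iff adjoint_nth reflection_def mat_def)
qed

lemma reflection_unitary: "projection P \<Longrightarrow> reflection P t \<in> unitary_group"
proof -
  assume P: "projection P"
  have *: "reflection P t ** reflection P (- t) = mat 1" for t
  proof -
    have "(reflection P t ** P) $ i $ j = cis t * P $ i $ j" for i j
    proof -
      have "(reflection P t ** P) $ i $ j = (mat 1 ** P) $ i $ j + (cis t - 1) * (P ** P) $ i $ j"
        unfolding matrix_mult_nth reflection_def
        by (simp add: algebra_simps sum.distrib sum_distrib_left sum_subtractf)
      then show ?thesis using P by (simp add: projection_def algebra_simps)
    qed
    then have "(reflection P t ** reflection P (- t)) $ i $ j = mat 1 $ i $ j + (cis t - 1 + (cis (- t) - 1) * cis t) * P $ i $ j" for i j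
      unfolding matrix_mult_reflection by (simp add: reflection_def algebra_simps)
    moreover have "cis t - 1 + (cis (- t) - 1) * cis t = 0" by (simp add: algebra_simps cis_mult)
    ultimately show ?thesis by (simp add: vec_eq_iff)
  qed
  show ?thesis
    using *[of t] *[of "- t"] by (simp add: unitary_group_def adjoint_reflection[OF P])
qed

lemma flow_deriv_cnj:
  assumes "flow_deriv S T f g"
  shows "flow_deriv S T (\<lambda>x. cnj (f x)) (\<lambda>x. cnj (g x))"
proof -
  have "cnj (f (T t x)) - cnj (f x) - of_real t * cnj (g x) = cnj (f (T t x) - f x - of_real t * g x)" for t x
    by simp
  then show ?thesis using assms unfolding flow_deriv_def by (simp only: complex_mod_cnj)
qed

text \<open>
  The matrix \<open>G A\<close> is the derivative of \<open>F\<close> at \<open>A\<close> along the flow, divided by the factor \<open>\<i>\<close>.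
\<close>

definition mat_deriv :: "'n::finite cmatrix \<Rightarrow> ('n cmatrix \<Rightarrow> 'n cmatrix) \<Rightarrow> ('n cmatrix \<Rightarrow> 'n cmatrix) \<Rightarrow> bool" where
  "mat_deriv P F G \<longleftrightarrow> (\<forall>i j. flow_deriv unitary_group (\<lambda>t A. A ** reflection P t)
     (\<lambda>A. F A $ i $ j) (\<lambda>A. \<i> * G A $ i $ j))"

lemma mat_deriv_const: "mat_deriv P (\<lambda>A. C) (\<lambda>A. 0)"
  unfolding mat_deriv_def by (simp add: flow_deriv_const)

lemma mat_deriv_mult:
  assumes "mat_deriv P F G" "mat_deriv P F' G'"
  shows "mat_deriv P (\<lambda>A. F A ** F' A) (\<lambda>A. G A ** F' A + F A ** G' A)"
  unfolding mat_deriv_def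
proof (intro allI)
  fix i j
  let ?fl = "flow_deriv unitary_group (\<lambda>t A. A ** reflection P t)"
  have "?fl (\<lambda>A. \<Sum>k\<in>UNIV. F A $ i $ k * F' A $ k $ j)
    (\<lambda>A. \<Sum>k\<in>UNIV. (\<i> * G A $ i $ k) * F' A $ k $ j + F A $ i $ k * (\<i> * G' A $ k $ j))"
    using assms unfolding mat_deriv_def by (intro flow_deriv_sum flow_deriv_mult) auto
  moreover have "(\<lambda>A. \<Sum>k\<in>UNIV. (\<i> * G A $ i $ k) * F' A $ k $ j + F A $ i $ k * (\<i> * G' A $ k $ j))
     = (\<lambda>A. \<i> * (G A ** F' A + F A ** G' A) $ i $ j)"
    by (simp add: fun_eq_iff matrix_mult_nth sum.distrib sum_distrib_left distrib_left mult_ac)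
  ultimately show "?fl (\<lambda>A. (F A ** F' A) $ i $ j) (\<lambda>A. \<i> * (G A ** F' A + F A ** G' A) $ i $ j)"
    by (simp add: matrix_mult_nth)
qed

lemma mat_deriv_ident:
  assumes "projection P" shows "mat_deriv P (\<lambda>A. A) (\<lambda>A. A ** P)"
  unfolding mat_deriv_def
proof (intro allI)
  fix i j
  define K where "K = (\<Sum>k\<in>UNIV. norm (P $ k $ j))"
  have K: "norm ((A ** P) $ i $ j) \<le> K" if "A \<in> unitary_group" for A
    unfolding matrix_mult_nth K_def using unitary_entry_norm[OF that]
    by (intro sum_norm_le) (simp add: norm_mult mult_left_le_one_le)
  show "flow_deriv unitary_group (\<lambda>t A. A ** reflection P t) (\<lambda>A. A $ i $ j) (\<lambda>A. \<i> * (A ** P) $ i $ j)"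
  proof (rule flow_derivI[of _ _ 1 _ K _ K])
    fix A :: "'a cmatrix" and t :: real assume A: "A \<in> unitary_group"
    show "norm (A $ i $ j) \<le> 1" by (rule unitary_entry_norm[OF A])
    show "norm (\<i> * (A ** P) $ i $ j) \<le> K" using K[OF A] by (simp add: norm_mult)
    have "(A ** reflection P t) $ i $ j - A $ i $ j - of_real t * (\<i> * (A ** P) $ i $ j)
      = (cis t - 1 - \<i> * of_real t) * (A ** P) $ i $ j"
      by (simp add: matrix_mult_reflection algebra_simps)
    then have "norm ((A ** reflection P t) $ i $ j - A $ i $ j - of_real t * (\<i> * (A ** P) $ i $ j))
      = norm (cis t - 1 - \<i> * of_real t) * norm ((A ** P) $ i $ j)"
      by (simp only: norm_mult)
    also have "\<dots> \<le> t\<^sup>2 * K"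
      using K[OF A] by (intro mult_mono norm_cis_diff) auto
    finally show "norm ((A ** reflection P t) $ i $ j - A $ i $ j - of_real t * (\<i> * (A ** P) $ i $ j)) \<le> K * t\<^sup>2"
      by (simp add: mult.commute)
  qed
qed

lemma mat_deriv_adjoint:
  assumes "projection P" shows "mat_deriv P adjoint_matrix (\<lambda>A. - (P ** adjoint_matrix A))"
  unfolding mat_deriv_def
proof (intro allI)
  fix i j
  have "flow_deriv unitary_group (\<lambda>t A. A ** reflection P t) (\<lambda>A. cnj (A $ j $ i)) (\<lambda>A. cnj (\<i> * (A ** P) $ j $ i))"
    using mat_deriv_ident[OF assms] unfolding mat_deriv_def by (intro flow_deriv_cnj) blast
  moreover have "cnj (\<i> * (A ** P) $ j $ i) = \<i> * (- (P ** adjoint_matrix A)) $ i $ j" for A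
  proof -
    have "cnj ((A ** P) $ j $ i) = (P ** adjoint_matrix A) $ i $ j"
      using assms by (metis adjoint_mult adjoint_nth projection_def)
    then show ?thesis by simp
  qed
  ultimately show "flow_deriv unitary_group (\<lambda>t A. A ** reflection P t) (\<lambda>A. adjoint_matrix A $ i $ j)
     (\<lambda>A. \<i> * (- (P ** adjoint_matrix A)) $ i $ j)"
    by (simp add: adjoint_nth)
qed

primrec mpow :: "'n::finite cmatrix \<Rightarrow> nat \<Rightarrow> 'n cmatrix" where
  "mpow A 0 = mat 1"
| "mpow A (Suc k) = A ** mpow A k"

lemma mpow_add: "mpow A (k + l) = mpow A k ** mpow A l"
  by (induction k) (simp_all add: matrix_mul_assoc)

lemma mpow_Suc_right: "mpow A (Suc k) = mpow A k ** A"
  using mpow_add[of A k 1] by simp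

lemma continuous_on_mpow:
  fixes f :: "'a::topological_space \<Rightarrow> 'n::finite cmatrix"
  assumes "continuous_on S f" shows "continuous_on S (\<lambda>x. mpow (f x) k)"
  by (induction k) (auto intro: continuous_on_matrix_mult assms)

text \<open>Leibniz rule without commutativity: the derivative is inserted at each of the
  \<open>a\<close> positions.\<close>

lemma mat_deriv_mpow_sum:
  assumes "mat_deriv P F G"
  shows "mat_deriv P (\<lambda>A. mpow (F A) a) (\<lambda>A. \<Sum>r<a. mpow (F A) r ** (G A ** mpow (F A) (a - Suc r)))"
proof (induction a)
  case 0
  show ?case using mat_deriv_const by simp
next
  case (Suc a)
  have sum: "F A ** (\<Sum>r<n. H r) = (\<Sum>r<n. F A ** H r)" for H :: "nat \<Rightarrow> 'a cmatrix" and n A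
    by (simp add: vec_eq_iff matrix_mult_nth sum_component sum_distrib_left sum.swap[of _ "{..<n}"])
  have "G A ** mpow (F A) a + F A ** (\<Sum>r<a. mpow (F A) r ** (G A ** mpow (F A) (a - Suc r)))
    = (\<Sum>r<Suc a. mpow (F A) r ** (G A ** mpow (F A) (Suc a - Suc r)))" for A
    unfolding sum by (subst sum.lessThan_Suc_shift) (simp add: matrix_mul_assoc)
  with mat_deriv_mult[OF assms Suc] show ?case by simp
qed

lemma flow_deriv_trace:
  assumes "mat_deriv P F G"
  shows "flow_deriv unitary_group (\<lambda>t A. A ** reflection P t) (\<lambda>A. trace (F A)) (\<lambda>A. \<i> * trace (G A))"
  unfolding trace_def sum_distrib_left
  using assms unfolding mat_deriv_def by (intro flow_deriv_sum) blast

lemma trace_sum: "trace (\<Sum>r\<in>I. F r) = (\<Sum>r\<in>I. trace (F r :: 'n::finite cmatrix))"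
  unfolding trace_def by (simp add: sum.swap[of _ I])

text \<open>Under the trace, cyclicity moves all powers to one side, so every position of the
  inserted matrix contributes the same.\<close>

lemma trace_mpow_sum:
  "trace (\<Sum>r<a. mpow B r ** (G ** mpow B (a - Suc r))) = of_nat a * trace (G ** mpow B (a - 1))"
proof -
  have "trace (mpow B r ** (G ** mpow B (a - Suc r))) = trace (G ** mpow B (a - 1))" if "r < a" for r
  proof -
    have "trace (mpow B r ** (G ** mpow B (a - Suc r))) = trace (G ** mpow B (a - Suc r) ** mpow B r)"
      by (rule trace_mul_sym)
    also have "G ** mpow B (a - Suc r) ** mpow B r = G ** mpow B (a - Suc r + r)"
      by (simp add: mpow_add matrix_mul_assoc)
    finally show ?thesis using that by simp
  qed
  then show ?thesis by (simp add: trace_sum)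
qed

text \<open>Negative powers use the adjoint, which is the inverse on the unitary group and depends
  continuously on the matrix everywhere.\<close>

definition mpowi :: "'n::finite cmatrix \<Rightarrow> int \<Rightarrow> 'n cmatrix" where
  "mpowi A b = (if 0 \<le> b then mpow A (nat b) else mpow (adjoint_matrix A) (nat (- b)))"

lemma continuous_on_mpowi:
  fixes f :: "'a::topological_space \<Rightarrow> 'n::finite cmatrix"
  assumes "continuous_on S f" shows "continuous_on S (\<lambda>x. mpowi (f x) b)"
  by (cases "0 \<le> b") (simp_all add: mpowi_def continuous_on_mpow continuous_on_adjoint assms)

lemma flow_deriv_trace_mpowi:
  assumes P: "projection P"
  shows "flow_deriv unitary_group (\<lambda>t A. A ** reflection P t) (\<lambda>A. trace (mpowi A b))
    (\<lambda>A. \<i> * (of_int b * trace (mpowi A b ** P)))"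
proof (cases "0 \<le> b")
  case True
  define a where "a = nat b"
  have "trace (\<Sum>r<a. mpow A r ** (A ** P ** mpow A (a - Suc r))) = of_int b * trace (mpow A a ** P)" for A
  proof (cases a)
    case (Suc k)
    have "trace (A ** P ** mpow A k) = trace (mpow A k ** (A ** P))" by (rule trace_mul_sym)
    also have "mpow A k ** (A ** P) = mpow A (Suc k) ** P"
      by (simp only: mpow_Suc_right matrix_mul_assoc)
    finally have "trace (A ** P ** mpow A (a - 1)) = trace (mpow A a ** P)" using Suc by simp
    then show ?thesis unfolding trace_mpow_sum using True by (simp add: a_def)
  qed (use True in \<open>simp add: a_def trace_def\<close>)
  then show ?thesis
    using flow_deriv_trace[OF mat_deriv_mpow_sum[OF mat_deriv_ident[OF P]], of a] True
    by (simp add: mpowi_def a_def)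
next
  case False
  define a where "a = nat (- b)"
  have "a > 0" using False by (simp add: a_def)
  then obtain k where k: "a = Suc k" using gr0_implies_Suc by blast
  have "trace (\<Sum>r<a. mpow (adjoint_matrix A) r ** (- (P ** adjoint_matrix A) ** mpow (adjoint_matrix A) (a - Suc r)))
      = of_int b * trace (mpow (adjoint_matrix A) a ** P)" for A
  proof -
    have "- (P ** adjoint_matrix A) ** mpow (adjoint_matrix A) k = - (P ** mpow (adjoint_matrix A) a)"
      unfolding k by (simp add: vec_eq_iff matrix_mult_nth[of "- _"] matrix_mul_assoc sum_negf matrix_mult_nth[of "P ** _" "mpow _ k"])
    then have "trace (- (P ** adjoint_matrix A) ** mpow (adjoint_matrix A) (a - 1)) = - trace (P ** mpow (adjoint_matrix A) a)"
      using k by (simp add: trace_def sum_negf)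
    then show ?thesis unfolding trace_mpow_sum using False by (simp add: trace_mul_sym[of P] a_def)
  qed
  then show ?thesis
    using flow_deriv_trace[OF mat_deriv_mpow_sum[OF mat_deriv_adjoint[OF P]], of a] False
    by (simp add: mpowi_def a_def)
qed

section \<open>Diagonal matrices and their unitary conjugates\<close>

definition enum_index :: "'n::finite \<Rightarrow> nat" where
  "enum_index = (SOME f. bij_betw f (UNIV :: 'n set) {..<CARD('n)})"

lemma bij_enum_index: "bij_betw (enum_index :: 'n::finite \<Rightarrow> nat) UNIV {..<CARD('n)}"
proof -
  obtain h where "bij_betw h (UNIV :: 'n set) {..<CARD('n)}"
    using ex_bij_betw_finite_nat[of "UNIV :: 'n set"] by (auto simp: atLeast0LessThan)
  then show ?thesis unfolding enum_index_def by (rule someI[of "\<lambda>f. bij_betw f (UNIV :: 'n set) {..<CARD('n)}"])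
qed

lemma enum_index_less: "enum_index (i :: 'n::finite) < CARD('n)"
  using bij_enum_index[where 'n='n] by (auto simp: bij_betw_def)

lemma enum_index_eq_iff [simp]: "enum_index i = enum_index j \<longleftrightarrow> i = j"
  using bij_enum_index by (metis bij_betw_def injD)

lemma sum_enum_index: "(\<Sum>i\<in>(UNIV::'n::finite set). g (enum_index i)) = (\<Sum>j<CARD('n). g j)"
  by (rule sum.reindex_bij_betw[OF bij_enum_index])

lemma prod_enum_index: "(\<Prod>i\<in>(UNIV::'n::finite set). g (enum_index i)) = (\<Prod>j<CARD('n). g j)"
  by (rule prod.reindex_bij_betw[OF bij_enum_index])

definition diag_mat_of :: "(nat \<Rightarrow> complex) \<Rightarrow> 'n::finite cmatrix" where
  "diag_mat_of z = (\<chi> i j. if i = j then z (enum_index i) else 0)"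

lemma diag_mult_nth: "(diag_mat_of z ** A) $ i $ j = z (enum_index i) * A $ i $ j"
  unfolding matrix_mult_nth diag_mat_of_def by (simp add: if_distrib if_distribR sum.delta' cong: if_cong)

lemma mult_diag_nth: "(A ** diag_mat_of z) $ i $ j = A $ i $ j * z (enum_index j)"
  unfolding matrix_mult_nth diag_mat_of_def by (simp add: if_distrib if_distribR sum.delta' cong: if_cong)

lemma diag_mult: "diag_mat_of y ** diag_mat_of z = diag_mat_of (\<lambda>i. y i * z i)"
  unfolding vec_eq_iff diag_mult_nth by (simp add: diag_mat_of_def)

lemma trace_diag: "trace (diag_mat_of z :: 'n::finite cmatrix) = (\<Sum>j<CARD('n). z j)"
  unfolding trace_def diag_mat_of_def by (simp add: sum_enum_index)

lemma diag_one: "diag_mat_of (\<lambda>i. 1) = mat 1"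
  by (simp add: vec_eq_iff diag_mat_of_def mat_def)

lemma adjoint_diag: "adjoint_matrix (diag_mat_of z) = diag_mat_of (\<lambda>i. cnj (z i))"
  by (auto simp: vec_eq_iff diag_mat_of_def adjoint_nth)

definition conj_diag :: "'n::finite cmatrix \<Rightarrow> (nat \<Rightarrow> complex) \<Rightarrow> 'n cmatrix" where
  "conj_diag V z = V ** diag_mat_of z ** adjoint_matrix V"

lemma conj_diag_cong: "(\<And>i. i < CARD('n) \<Longrightarrow> y i = z i) \<Longrightarrow> conj_diag (V :: 'n::finite cmatrix) y = conj_diag V z"
  unfolding conj_diag_def diag_mat_of_def by (simp add: enum_index_less cong: if_cong)

lemma conj_diag_mult:
  assumes "V \<in> unitary_group"
  shows "conj_diag V y ** conj_diag V z = conj_diag V (\<lambda>i. y i * z i)"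
proof -
  have "conj_diag V y ** conj_diag V z = V ** diag_mat_of y ** (adjoint_matrix V ** V) ** diag_mat_of z ** adjoint_matrix V"
    by (simp add: conj_diag_def matrix_mul_assoc)
  then show ?thesis by (simp add: unitaryD[OF assms] conj_diag_def diag_mult[symmetric] matrix_mul_assoc)
qed

lemma trace_conj_diag:
  assumes "V \<in> unitary_group"
  shows "trace (conj_diag (V :: 'n::finite cmatrix) z) = (\<Sum>j<CARD('n). z j)"
proof -
  have "trace (conj_diag V z) = trace (adjoint_matrix V ** (V ** diag_mat_of z))"
    unfolding conj_diag_def by (rule trace_mul_sym)
  then show ?thesis by (simp add: unitary_cancel[OF assms] trace_diag)
qed

lemma conj_diag_one: "V \<in> unitary_group \<Longrightarrow> conj_diag V (\<lambda>i. 1) = mat 1"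
  by (simp add: conj_diag_def diag_one unitaryD)

lemma mpow_conj_diag:
  assumes "V \<in> unitary_group" shows "mpow (conj_diag V z) k = conj_diag V (\<lambda>i. z i ^ k)"
  by (induction k) (simp_all add: conj_diag_one conj_diag_mult assms)

lemma adjoint_conj_diag: "adjoint_matrix (conj_diag V z) = conj_diag V (\<lambda>i. cnj (z i))"
  by (simp add: conj_diag_def adjoint_mult adjoint_diag matrix_mul_assoc)

lemma unit_inverse_cnj: "norm (x::complex) = 1 \<Longrightarrow> inverse x = cnj x"
  by (intro inverse_unique) (simp add: complex_norm_square[symmetric])

lemma mpowi_conj_diag:
  assumes "V \<in> unitary_group" "z \<in> unit_tuples CARD('n)"
  shows "mpowi (conj_diag (V :: 'n::finite cmatrix) z) b = conj_diag V (\<lambda>i. z i powi b)"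
proof (cases "0 \<le> b")
  case True
  then show ?thesis by (simp add: mpowi_def mpow_conj_diag[OF assms(1)] power_int_def)
next
  case False
  then have "mpowi (conj_diag V z) b = conj_diag V (\<lambda>i. cnj (z i) ^ nat (- b))"
    by (simp add: mpowi_def adjoint_conj_diag mpow_conj_diag[OF assms(1)])
  also have "\<dots> = conj_diag V (\<lambda>i. z i powi b)"
  proof (rule conj_diag_cong)
    fix i assume "i < CARD('n)"
    then have "inverse (z i) = cnj (z i)" using assms(2) by (intro unit_inverse_cnj) (simp add: unit_tuples_def)
    then show "cnj (z i) ^ nat (- b) = z i powi b" using False by (simp add: power_int_def)
  qed
  finally show ?thesis .
qed

lemma conj_diag_unitary:
  assumes "V \<in> unitary_group" "z \<in> unit_tuples CARD('n)"
  shows "conj_diag (V :: 'n::finite cmatrix) z \<in> unitary_group"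
proof -
  have "conj_diag V z ** adjoint_matrix (conj_diag V z) = conj_diag V (\<lambda>i. 1)"
    "adjoint_matrix (conj_diag V z) ** conj_diag V z = conj_diag V (\<lambda>i. 1)"
    unfolding adjoint_conj_diag conj_diag_mult[OF assms(1)]
    using assms(2) by (auto intro!: conj_diag_cong simp: unit_tuples_def complex_norm_square[symmetric] mult.commute)
  then show ?thesis by (simp add: unitary_group_def conj_diag_one[OF assms(1)])
qed

section \<open>Loop equations for eigenvalues\<close>

definition smult_matrix :: "complex \<Rightarrow> 'n::finite cmatrix \<Rightarrow> 'n cmatrix" where
  "smult_matrix c A = (\<chi> i j. c * A $ i $ j)"

lemma smult_matrix_nth [simp]: "smult_matrix c A $ i $ j = c * A $ i $ j"
  by (simp add: smult_matrix_def)

lemma smult_matrix_mult: "smult_matrix c A ** B = smult_matrix c (A ** B)"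
  "A ** smult_matrix c B = smult_matrix c (A ** B)"
  by (simp_all add: vec_eq_iff matrix_mult_nth sum_distrib_left mult_ac)

lemma trace_smult: "trace (smult_matrix c A) = c * trace A"
  by (simp add: trace_def sum_distrib_left)

lemma continuous_on_smult_matrix:
  fixes f :: "'a::topological_space \<Rightarrow> 'n::finite cmatrix"
  assumes "continuous_on S c" "continuous_on S f"
  shows "continuous_on S (\<lambda>x. smult_matrix (c x) (f x))"
  unfolding smult_matrix_def
  by (intro continuous_on_vec_lambda continuous_on_mult continuous_on_nth assms)

lemma conj_diag_smult:
  fixes V :: "'n::finite cmatrix"
  shows "conj_diag V (\<lambda>i. c * y i) = smult_matrix c (conj_diag V y)"
proof -
  have "diag_mat_of (\<lambda>i. c * y i) = smult_matrix c (diag_mat_of y :: 'n cmatrix)"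
    by (simp add: vec_eq_iff diag_mat_of_def)
  then show ?thesis by (simp add: conj_diag_def smult_matrix_mult)
qed

lemma conj_diag_add:
  fixes V :: "'n::finite cmatrix"
  shows "conj_diag V (\<lambda>i. x i + y i) = conj_diag V x + conj_diag V y"
proof -
  have "diag_mat_of (\<lambda>i. x i + y i) = diag_mat_of x + (diag_mat_of y :: 'n cmatrix)"
    by (simp add: vec_eq_iff diag_mat_of_def)
  then show ?thesis by (simp add: conj_diag_def matrix_add_ldistrib matrix_mult_add_right)
qed

text \<open>The class function \<open>F\<close> lifts the symmetric function \<open>f\<close>, and \<open>G\<close> is its gradient.\<close>

definition matrix_lift ::
    "((nat \<Rightarrow> complex) \<Rightarrow> complex) \<Rightarrow> (nat \<Rightarrow> (nat \<Rightarrow> complex) \<Rightarrow> complex) \<Rightarrow>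
     ('n::finite cmatrix \<Rightarrow> complex) \<Rightarrow> ('n cmatrix \<Rightarrow> 'n cmatrix) \<Rightarrow> bool" where
  "matrix_lift f d F G \<longleftrightarrow> continuous_on UNIV F \<and> continuous_on UNIV G \<and>
    (\<forall>P. projection P \<longrightarrow> flow_deriv unitary_group (\<lambda>t A. A ** reflection P t) F (\<lambda>A. \<i> * trace (G A ** P))) \<and>
    (\<forall>V\<in>unitary_group. \<forall>z\<in>unit_tuples CARD('n). F (conj_diag V z) = f z \<and> G (conj_diag V z) = conj_diag V (\<lambda>i. d i z))"

lemma matrix_liftD:
  fixes F :: "'n::finite cmatrix \<Rightarrow> complex"
  assumes "matrix_lift f d F G"
  shows "continuous_on UNIV F" "continuous_on UNIV G"
    "projection P \<Longrightarrow> flow_deriv unitary_group (\<lambda>t A. A ** reflection P t) F (\<lambda>A. \<i> * trace (G A ** P))"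
    "V \<in> unitary_group \<Longrightarrow> z \<in> unit_tuples CARD('n) \<Longrightarrow> F (conj_diag V z) = f z"
    "V \<in> unitary_group \<Longrightarrow> z \<in> unit_tuples CARD('n) \<Longrightarrow> G (conj_diag V z) = conj_diag V (\<lambda>i. d i z)"
  using assms unfolding matrix_lift_def by blast+

text \<open>The power sum of order b lifts to the trace of \<open>mpowi A b\<close> with gradient b
  times \<open>mpowi A b\<close>; sums and products follow the usual rules. Since
  \<open>matrix_lift\<close> refers to f and d only at tuples of complex units, the congruence rule
  of \<open>sym_deriv\<close> is respected.\<close>

lemma sym_deriv_matrix_lift:
  assumes "sym_deriv CARD('n::finite) f d"
  shows "\<exists>F (G :: 'n cmatrix \<Rightarrow> 'n cmatrix). matrix_lift f d F G"
  using assms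
proof induction
  case (sym_deriv_const c)
  have "conj_diag (V :: 'n cmatrix) (\<lambda>i. 0) = 0" for V
    using conj_diag_smult[of V 0 "\<lambda>i. 0"] by (simp add: vec_eq_iff)
  moreover have "trace ((0 :: 'n cmatrix) ** P) = 0" for P
    by (simp add: trace_def matrix_mult_nth)
  ultimately show ?case
    by (intro exI[of _ "\<lambda>A. c"] exI[of _ "\<lambda>A. 0"]) (auto simp: matrix_lift_def flow_deriv_const)
next
  case (sym_deriv_psum b)
  show ?case
    unfolding matrix_lift_def
  proof (intro exI[of _ "\<lambda>A. trace (mpowi A b)"] exI[of _ "\<lambda>A. smult_matrix (of_int b) (mpowi A b)"] conjI allI impI ballI)
    fix P :: "'n cmatrix" assume "projection P"
    then show "flow_deriv unitary_group (\<lambda>t A. A ** reflection P t) (\<lambda>A. trace (mpowi A b))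
      (\<lambda>A. \<i> * trace (smult_matrix (of_int b) (mpowi A b) ** P))"
      unfolding smult_matrix_mult trace_smult by (rule flow_deriv_trace_mpowi)
  next
    fix V :: "'n cmatrix" and z assume "V \<in> unitary_group" "z \<in> unit_tuples CARD('n)"
    then show "trace (mpowi (conj_diag V z) b) = psum CARD('n) b z"
      "smult_matrix (of_int b) (mpowi (conj_diag V z) b) = conj_diag V (\<lambda>i. of_int b * z i powi b)"
      by (simp_all add: mpowi_conj_diag trace_conj_diag psum_def conj_diag_smult)
  qed (intro continuous_on_trace continuous_on_smult_matrix continuous_on_mpowi continuous_on_id continuous_on_const)+
next
  case (sym_deriv_add f d g e)
  then obtain F F' and G G' :: "'n cmatrix \<Rightarrow> 'n cmatrix" where
    lift: "matrix_lift f d F G" "matrix_lift g e F' G'" by blast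
  note c = matrix_liftD(1,2)[OF lift(1)] matrix_liftD(1,2)[OF lift(2)]
  note fl = matrix_liftD(3)[OF lift(1)] matrix_liftD(3)[OF lift(2)]
  note val = matrix_liftD(4,5)[OF lift(1)] matrix_liftD(4,5)[OF lift(2)]
  show ?case
    unfolding matrix_lift_def
  proof (intro exI[of _ "\<lambda>A. F A + F' A"] exI[of _ "\<lambda>A. G A + G' A"] conjI allI impI ballI)
    fix P :: "'n cmatrix" assume "projection P"
    then show "flow_deriv unitary_group (\<lambda>t A. A ** reflection P t) (\<lambda>A. F A + F' A)
      (\<lambda>A. \<i> * trace ((G A + G' A) ** P))"
      unfolding matrix_mult_add_right trace_add distrib_left by (intro flow_deriv_add fl)
  qed (simp_all add: val conj_diag_add continuous_on_add c)
next
  case (sym_deriv_mult f d g e)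
  then obtain F F' and G G' :: "'n cmatrix \<Rightarrow> 'n cmatrix" where
    lift: "matrix_lift f d F G" "matrix_lift g e F' G'" by blast
  note c = matrix_liftD(1,2)[OF lift(1)] matrix_liftD(1,2)[OF lift(2)]
  note fl = matrix_liftD(3)[OF lift(1)] matrix_liftD(3)[OF lift(2)]
  note val = matrix_liftD(4,5)[OF lift(1)] matrix_liftD(4,5)[OF lift(2)]
  show ?case
    unfolding matrix_lift_def
  proof (intro exI[of _ "\<lambda>A. F A * F' A"] exI[of _ "\<lambda>A. smult_matrix (F' A) (G A) + smult_matrix (F A) (G' A)"] conjI allI impI ballI)
    fix P :: "'n cmatrix" assume P: "projection P"
    have "\<i> * trace ((smult_matrix (F' A) (G A) + smult_matrix (F A) (G' A)) ** P)
      = (\<i> * trace (G A ** P)) * F' A + F A * (\<i> * trace (G' A ** P))" for A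
      unfolding matrix_mult_add_right trace_add smult_matrix_mult trace_smult by (simp add: algebra_simps)
    then show "flow_deriv unitary_group (\<lambda>t A. A ** reflection P t) (\<lambda>A. F A * F' A)
      (\<lambda>A. \<i> * trace ((smult_matrix (F' A) (G A) + smult_matrix (F A) (G' A)) ** P))"
      using flow_deriv_mult[OF fl(1)[OF P] fl(2)[OF P]] by simp
  next
    fix V :: "'n cmatrix" and z assume Vz: "V \<in> unitary_group" "z \<in> unit_tuples CARD('n)"
    have "conj_diag V (\<lambda>i. d i z * g z + f z * e i z) = smult_matrix (g z) (conj_diag V (\<lambda>i. d i z)) + smult_matrix (f z) (conj_diag V (\<lambda>i. e i z))"
      by (simp only: conj_diag_add conj_diag_smult mult.commute[of _ "g z"])
    then show "smult_matrix (F' (conj_diag V z)) (G (conj_diag V z)) + smult_matrix (F (conj_diag V z)) (G' (conj_diag V z))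
       = conj_diag V (\<lambda>i. d i z * g z + f z * e i z)"
      by (simp add: val Vz)
  qed (simp_all add: val continuous_on_mult continuous_on_add continuous_on_smult_matrix c)
next
  case (sym_deriv_cong f d f' d')
  then obtain F and G :: "'n cmatrix \<Rightarrow> 'n cmatrix" where lift: "matrix_lift f d F G" by blast
  have "F (conj_diag V z) = f' z \<and> G (conj_diag V z) = conj_diag V (\<lambda>i. d' i z)"
    if "V \<in> unitary_group" "z \<in> unit_tuples CARD('n)" for V z
    using matrix_liftD(4,5)[OF lift that] sym_deriv_cong.hyps(2)[OF that(2)]
      conj_diag_cong[of "\<lambda>i. d' i z" "\<lambda>i. d i z" V] sym_deriv_cong.hyps(3)[OF that(2)] by simp
  then have "matrix_lift f' d' F G" using lift unfolding matrix_lift_def by blast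
  then show ?case by blast
qed

section \<open>Matrix units as combinations of projections\<close>

definition outer :: "complex ^ 'n::finite \<Rightarrow> 'n cmatrix" where
  "outer v = (\<chi> i j. v $ i * cnj (v $ j))"

definition unit_matrix :: "'n::finite \<Rightarrow> 'n \<Rightarrow> 'n cmatrix" where
  "unit_matrix j k = (\<chi> s t. of_bool (s = j \<and> t = k))"

lemma outer_projection:
  "\<exists>c P. projection P \<and> outer v = smult_matrix c P"
proof (cases "v = 0")
  case True
  have "projection (0 :: 'a cmatrix)"
    by (simp add: projection_def vec_eq_iff matrix_mult_nth adjoint_nth)
  then show ?thesis using True by (intro exI[of _ 0] exI[of _ 0]) (simp add: outer_def vec_eq_iff)
next
  case False
  define c where "c = (\<Sum>i\<in>UNIV. cnj (v $ i) * v $ i)"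
  have c_real: "c = of_real (\<Sum>i\<in>UNIV. (norm (v $ i))\<^sup>2)"
    by (simp only: c_def of_real_sum complex_norm_square mult.commute)
  have "(\<Sum>i\<in>UNIV. (norm (v $ i))\<^sup>2) \<noteq> 0"
    using False by (simp add: sum_nonneg_eq_0_iff vec_eq_iff)
  then have c: "c \<noteq> 0" "cnj c = c" unfolding c_real by (simp_all only: of_real_eq_0_iff complex_cnj_complex_of_real simp_thms)
  let ?P = "smult_matrix (1 / c) (outer v)"
  have "outer v ** outer v = smult_matrix c (outer v)"
    unfolding vec_eq_iff
  proof (intro allI)
    fix i j
    have "(outer v ** outer v) $ i $ j = (\<Sum>k\<in>UNIV. v $ i * ((cnj (v $ k) * v $ k) * cnj (v $ j)))"
      by (simp add: matrix_mult_nth outer_def mult_ac)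
    also have "\<dots> = v $ i * (c * cnj (v $ j))" unfolding c_def sum_distrib_left sum_distrib_right ..
    finally show "(outer v ** outer v) $ i $ j = smult_matrix c (outer v) $ i $ j" by (simp add: outer_def)
  qed
  then have "projection ?P"
    using c by (auto simp: projection_def smult_matrix_mult vec_eq_iff adjoint_nth outer_def)
  then show ?thesis using c by (intro exI[of _ c] exI[of _ ?P]) (simp add: vec_eq_iff)
qed

text \<open>Polarisation: the first outer product contains the units at (j, k) and (k, j); adding
  \<open>\<i>\<close> times the second cancels the latter and doubles the former, and the last term
  removes the diagonal. With \<open>outer_projection\<close>, every matrix unit is a complex
  combination of projections.\<close>

lemma unit_matrix_outer:
  "unit_matrix j k = smult_matrix (1/2) (outer (axis j 1 + axis k 1)
     + (smult_matrix \<i> (outer (axis j 1 + axis k \<i>))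
     + smult_matrix (- (1 + \<i>)) (outer (axis j 1) + outer (axis k 1))))"
  unfolding vec_eq_iff
proof (intro allI)
  fix s t
  show "unit_matrix j k $ s $ t = smult_matrix (1/2) (outer (axis j 1 + axis k 1)
     + (smult_matrix \<i> (outer (axis j 1 + axis k \<i>))
     + smult_matrix (- (1 + \<i>)) (outer (axis j 1) + outer (axis k 1)))) $ s $ t"
    by (cases "s = j"; cases "s = k"; cases "t = j"; cases "t = k")
       (simp_all add: unit_matrix_def outer_def axis_def algebra_simps)
qed

text \<open>Differentiating the entry (j, k) of \<open>mpow A a\<close> times \<open>F A\<close>
  along a projection P gives \<open>I P j k\<close>, whose integral vanishes by invariance. It is
  linear in P, so P may be replaced by the matrix unit at (j, k); summing over j and k contracts the
  open indices into traces.\<close>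

lemma loop_equation_matrix:
  fixes M :: "'n::finite cmatrix measure" and G :: "'n cmatrix \<Rightarrow> 'n cmatrix"
  assumes M: "unitary_law M" and inv: "\<And>V. V \<in> unitary_group \<Longrightarrow> distr M M (\<lambda>A. A ** V) = M"
    and cont: "continuous_on UNIV F" "continuous_on UNIV G"
    and fl: "\<And>P. projection P \<Longrightarrow> flow_deriv unitary_group (\<lambda>t A. A ** reflection P t) F (\<lambda>A. \<i> * trace (G A ** P))"
  shows "(\<integral>A. (\<Sum>r<a. trace (mpow A (Suc r)) * trace (mpow A (a - Suc r))) * F A + trace (mpow A a ** G A) \<partial>M) = 0"
proof -
  interpret prob_space M using M by (simp add: unitary_law_def)
  have sp: "space M = unitary_group" by (rule unitary_law_space[OF M])
  define I where "I X j k A = (\<Sum>r<a. mpow A r ** (A ** X ** mpow A (a - Suc r))) $ j $ k * F A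
     + mpow A a $ j $ k * trace (G A ** X)" for X :: "'n cmatrix" and j k A
  have cont': "continuous_on unitary_group F" "continuous_on unitary_group G"
    using cont continuous_on_subset by blast+
  have cI: "continuous_on unitary_group (I X j k)" for X j k
    unfolding I_def
    by (intro continuous_on_add continuous_on_mult continuous_on_nth continuous_on_sum continuous_on_matrix_mult
        continuous_on_mpow continuous_on_trace continuous_on_id continuous_on_const cont')
  have intI: "integrable M (I X j k)" for X j k
    by (rule unitary_law_integrable[OF M cI])
  have zeroP: "integral\<^sup>L M (I P j k) = 0" if P: "projection P" for P j k
  proof -
    let ?T = "\<lambda>t A. A ** reflection P t"
    have T: "?T t \<in> measurable M M" "distr M M (?T t) = M" for t
      using reflection_unitary[OF P]
      by (auto intro!: unitary_law_measurable_self[OF M] continuous_on_matrix_mult continuous_on_id continuous_on_const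
          unitary_mult inv)
    have "flow_deriv unitary_group ?T (\<lambda>A. mpow A a $ j $ k * F A)
      (\<lambda>A. (\<i> * (\<Sum>r<a. mpow A r ** (A ** P ** mpow A (a - Suc r))) $ j $ k) * F A + mpow A a $ j $ k * (\<i> * trace (G A ** P)))"
      using mat_deriv_mpow_sum[OF mat_deriv_ident[OF P], of a] unfolding mat_deriv_def
      by (intro flow_deriv_mult fl P) blast
    then have fd: "flow_deriv (space M) ?T (\<lambda>A. mpow A a $ j $ k * F A) (\<lambda>A. \<i> * I P j k A)"
      by (simp add: sp I_def algebra_simps)
    have "(\<lambda>A. mpow A a $ j $ k * F A) \<in> borel_measurable M"
      by (intro unitary_law_measurable_from[OF M] continuous_on_mult continuous_on_nth continuous_on_mpow continuous_on_id cont')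
    from integral_flow_deriv_eq_0(2)[OF T this fd] show ?thesis by simp
  qed
  have I_smult: "I (smult_matrix c X) j k A = c * I X j k A" for c X j k A
    unfolding I_def smult_matrix_mult trace_smult
    by (simp add: sum_component sum_distrib_left distrib_left mult_ac)
  have I_add: "I (X + Y) j k A = I X j k A + I Y j k A" for X Y j k A
    unfolding I_def matrix_add_ldistrib matrix_mult_add_right trace_add
    by (simp add: sum_component sum.distrib distrib_left distrib_right)
  have zero_smult: "integral\<^sup>L M (I (smult_matrix c X) j k) = 0" if "integral\<^sup>L M (I X j k) = 0" for c X j k
    using that by (simp add: I_smult[abs_def])
  have zero_add: "integral\<^sup>L M (I (X + Y) j k) = 0" if "integral\<^sup>L M (I X j k) = 0" "integral\<^sup>L M (I Y j k) = 0" for X Y j k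
    using that intI by (simp add: I_add[abs_def])
  have zero_outer: "integral\<^sup>L M (I (outer v) j k) = 0" for v j k
    using outer_projection[of v] zero_smult zeroP by metis
  have zero_unit: "integral\<^sup>L M (I (unit_matrix s t) j k) = 0" for s t j k
    unfolding unit_matrix_outer by (intro zero_smult zero_add zero_outer)
  have unit_entry: "(B ** unit_matrix j k ** C) $ j $ k = B $ j $ j * C $ k $ k" for B C :: "'n cmatrix" and j k
  proof -
    have "(B ** unit_matrix j k) $ j $ s = (if s = k then B $ j $ j else 0)" for s
      unfolding matrix_mult_nth unit_matrix_def by (simp add: of_bool_def if_distrib cong: if_cong)
    then show ?thesis unfolding matrix_mult_nth[of "B ** unit_matrix j k"]
      by (simp only: if_distribR mult_delta_left sum.delta finite UNIV_I if_True)
  qed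
  have unit_trace: "trace (B ** unit_matrix j k) = B $ k $ j" for B :: "'n cmatrix" and j k
  proof -
    have "(B ** unit_matrix j k) $ i $ i = (if i = k then B $ k $ j else 0)" for i
      unfolding matrix_mult_nth unit_matrix_def by (simp add: of_bool_def if_distrib cong: if_cong)
    then show ?thesis unfolding trace_def by simp
  qed
  \<comment> \<open>With the matrix unit at (j, k) between B and C, the entry (j, k) of the product
    is \<open>B $ j $ j * C $ k $ k\<close>, which sums to a product of two traces. The trace of
    \<open>G A\<close> times this unit is the entry (k, j) of \<open>G A\<close>, which sums against
    \<open>mpow A a\<close> to the remaining trace.\<close>
  have "(\<Sum>r<a. trace (mpow A (Suc r)) * trace (mpow A (a - Suc r))) * F A + trace (mpow A a ** G A)
     = (\<Sum>j\<in>UNIV. \<Sum>k\<in>UNIV. I (unit_matrix j k) j k A)" for A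
  proof -
    have "I (unit_matrix j k) j k A = (\<Sum>r<a. mpow A (Suc r) $ j $ j * mpow A (a - Suc r) $ k $ k) * F A
       + mpow A a $ j $ k * G A $ k $ j" for j k
    proof -
      have "(mpow A r ** (A ** unit_matrix j k ** mpow A (a - Suc r))) $ j $ k = mpow A (Suc r) $ j $ j * mpow A (a - Suc r) $ k $ k" for r
      proof -
        have "mpow A r ** (A ** unit_matrix j k ** mpow A (a - Suc r)) = mpow A (Suc r) ** unit_matrix j k ** mpow A (a - Suc r)"
          by (simp only: mpow_Suc_right matrix_mul_assoc)
        then show ?thesis by (simp only: unit_entry)
      qed
      then show ?thesis unfolding I_def by (simp only: sum_component unit_trace)
    qed
    then have "(\<Sum>j\<in>UNIV. \<Sum>k\<in>UNIV. I (unit_matrix j k) j k A) =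
       (\<Sum>j\<in>UNIV. \<Sum>k\<in>UNIV. \<Sum>r<a. mpow A (Suc r) $ j $ j * mpow A (a - Suc r) $ k $ k) * F A
       + (\<Sum>j\<in>UNIV. \<Sum>k\<in>UNIV. mpow A a $ j $ k * G A $ k $ j)"
      by (simp only: sum.distrib sum_distrib_right)
    also have "(\<Sum>j\<in>UNIV. \<Sum>k\<in>UNIV. \<Sum>r<a. mpow A (Suc r) $ j $ j * mpow A (a - Suc r) $ k $ k)
      = (\<Sum>r<a. \<Sum>j\<in>UNIV. \<Sum>k\<in>UNIV. mpow A (Suc r) $ j $ j * mpow A (a - Suc r) $ k $ k)"
      by (subst sum.swap, rule trans[OF sum.cong[OF refl sum.swap]], subst sum.swap, rule sum.cong[OF refl], rule sum.swap)
    finally show ?thesis by (simp add: trace_def sum_product matrix_mult_nth[of "mpow A a"])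
  qed
  then have "(\<integral>A. (\<Sum>r<a. trace (mpow A (Suc r)) * trace (mpow A (a - Suc r))) * F A + trace (mpow A a ** G A) \<partial>M)
     = (\<integral>A. (\<Sum>j\<in>UNIV. \<Sum>k\<in>UNIV. I (unit_matrix j k) j k A) \<partial>M)" by simp
  also have "\<dots> = (\<Sum>j\<in>UNIV. \<Sum>k\<in>UNIV. integral\<^sup>L M (I (unit_matrix j k) j k))"
    by (simp add: Bochner_Integration.integral_sum Bochner_Integration.integrable_sum intI)
  finally show ?thesis by (simp add: zero_unit)
qed

text \<open>At \<open>A = conj_diag V (e A)\<close> all matrices of the matrix equation are diagonal
  in the same basis V, so traces become sums over eigenvalues. The sum over \<open>r < a\<close>
  matches \<open>repulsion\<close> with \<open>t = r + 1\<close>.\<close>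

lemma loop_equation_unitary:
  fixes M :: "'n::finite cmatrix measure"
  assumes M: "unitary_law M" and inv: "\<And>V. V \<in> unitary_group \<Longrightarrow> distr M M (\<lambda>A. A ** V) = M"
    and e: "\<And>A. A \<in> unitary_group \<Longrightarrow> e A \<in> unit_tuples CARD('n) \<and> (\<exists>V\<in>unitary_group. A = conj_diag V (e A))"
    and fd: "sym_deriv CARD('n) f d"
  shows "(\<integral>A. repulsion CARD('n) a (e A) * f (e A) + (\<Sum>i<CARD('n). e A i ^ a * d i (e A)) \<partial>M) = 0"
proof -
  obtain F and G :: "'n cmatrix \<Rightarrow> 'n cmatrix" where lift: "matrix_lift f d F G"
    using sym_deriv_matrix_lift[OF fd] by blast
  have "(\<integral>A. repulsion CARD('n) a (e A) * f (e A) + (\<Sum>i<CARD('n). e A i ^ a * d i (e A)) \<partial>M)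
    = (\<integral>A. (\<Sum>r<a. trace (mpow A (Suc r)) * trace (mpow A (a - Suc r))) * F A + trace (mpow A a ** G A) \<partial>M)"
  proof (rule Bochner_Integration.integral_cong[OF refl])
    fix A assume "A \<in> space M"
    then have "A \<in> unitary_group" using unitary_law_space[OF M] by simp
    then obtain V where V: "V \<in> unitary_group" "A = conj_diag V (e A)" and eA: "e A \<in> unit_tuples CARD('n)"
      using e by blast
    have pw: "mpow A k = conj_diag V (\<lambda>i. e A i ^ k)" for k
      using mpow_conj_diag[OF V(1), of "e A" k] V(2) by simp
    have tr: "trace (mpow A k) = (\<Sum>i<CARD('n). e A i ^ k)" for k
      unfolding pw by (rule trace_conj_diag[OF V(1)])
    have val': "F A = f (e A)" "G A = conj_diag V (\<lambda>i. d i (e A))"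
      using matrix_liftD(4,5)[OF lift V(1) eA] V(2) by simp_all
    have "trace (mpow A a ** G A) = (\<Sum>i<CARD('n). e A i ^ a * d i (e A))"
      unfolding pw val' conj_diag_mult[OF V(1)] by (rule trace_conj_diag[OF V(1)])
    moreover have "repulsion CARD('n) a (e A) = (\<Sum>r<a. trace (mpow A (Suc r)) * trace (mpow A (a - Suc r)))"
    proof -
      let ?z = "e A"
      have "repulsion CARD('n) a ?z = (\<Sum>i<CARD('n). \<Sum>j<CARD('n). \<Sum>r<a. ?z i ^ Suc r * ?z j ^ (a - Suc r))"
        unfolding repulsion_def
        by (intro sum.cong refl sum.reindex_bij_witness[of _ Suc "\<lambda>t. t - 1"]) auto
      also have "\<dots> = (\<Sum>i<CARD('n). \<Sum>r<a. \<Sum>j<CARD('n). ?z i ^ Suc r * ?z j ^ (a - Suc r))"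
        by (rule sum.cong[OF refl], rule sum.swap)
      also have "\<dots> = (\<Sum>r<a. \<Sum>i<CARD('n). \<Sum>j<CARD('n). ?z i ^ Suc r * ?z j ^ (a - Suc r))"
        by (rule sum.swap)
      finally show ?thesis unfolding tr sum_product .
    qed
    ultimately show "repulsion CARD('n) a (e A) * f (e A) + (\<Sum>i<CARD('n). e A i ^ a * d i (e A))
      = (\<Sum>r<a. trace (mpow A (Suc r)) * trace (mpow A (a - Suc r))) * F A + trace (mpow A a ** G A)"
      by (simp add: val')
  qed
  also have "\<dots> = 0" by (rule loop_equation_matrix[OF M inv matrix_liftD(1-3)[OF lift]])
  finally show ?thesis .
qed

section \<open>Unitary diagonalization\<close>

definition hprod :: "complex ^ 'n::finite \<Rightarrow> complex ^ 'n \<Rightarrow> complex" where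
  "hprod x y = (\<Sum>i\<in>UNIV. x $ i * cnj (y $ i))"

lemma hprod_add_left: "hprod (x + y) z = hprod x z + hprod y z"
  by (simp add: hprod_def distrib_right sum.distrib)

lemma hprod_smult_left: "hprod (c *s x) z = c * hprod x z"
  by (simp add: hprod_def sum_distrib_left mult_ac)

lemma hprod_smult_right: "hprod x (c *s z) = cnj c * hprod x z"
  by (simp add: hprod_def sum_distrib_left mult_ac)

lemma hprod_commute: "hprod y x = cnj (hprod x y)"
  by (simp add: hprod_def mult.commute)

lemma hprod_self: "hprod x x = of_real ((norm x)\<^sup>2)"
proof -
  have "hprod x x = (\<Sum>i\<in>UNIV. of_real ((norm (x $ i))\<^sup>2))"
    unfolding hprod_def by (simp only: complex_norm_square)
  also have "\<dots> = of_real ((norm x)\<^sup>2)"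
    by (simp add: norm_vec_def L2_set_def sum_nonneg)
  finally show ?thesis .
qed

lemma Re_hprod: "Re (hprod x y) = x \<bullet> y"
  by (simp add: hprod_def inner_vec_def inner_complex_def)

text \<open>Splits complex orthogonality into two real conditions, so that results on real subspaces
  and dimensions apply to complex vectors.\<close>

lemma hprod_eq_0_iff: "hprod x y = 0 \<longleftrightarrow> x \<bullet> y = 0 \<and> x \<bullet> (\<i> *s y) = 0"
  by (simp add: complex_eq_iff flip: Re_hprod) (simp add: hprod_smult_right)

lemma hprod_matrix: "hprod (A *v x) y = hprod x (adjoint_matrix A *v y)"
proof -
  have "hprod (A *v x) y = (\<Sum>i\<in>UNIV. \<Sum>j\<in>UNIV. A $ i $ j * x $ j * cnj (y $ i))"
    by (simp add: hprod_def matrix_vector_mult_def sum_distrib_right)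
  also have "\<dots> = (\<Sum>j\<in>UNIV. \<Sum>i\<in>UNIV. A $ i $ j * x $ j * cnj (y $ i))" by (rule sum.swap)
  also have "\<dots> = hprod x (adjoint_matrix A *v y)"
    by (simp add: hprod_def matrix_vector_mult_def adjoint_nth sum_distrib_left mult_ac)
  finally show ?thesis .
qed

lemma hprod_unitary:
  assumes "A \<in> unitary_group" shows "hprod (A *v x) (A *v y) = hprod x y"
  by (simp add: hprod_matrix matrix_vector_mul_assoc unitaryD[OF assms])

lemma matrix_vector_smult: "A *v (c *s x) = c *s (A *v (x :: complex ^ 'n::finite))"
  by (simp add: vec_eq_iff matrix_vector_mult_def sum_distrib_left mult_ac)

lemma matrix_vector_sum: "A *v (\<Sum>i\<in>I. f i) = (\<Sum>i\<in>I. A *v (f i :: complex ^ 'n::finite))"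
  by (induction I rule: infinite_finite_induct) (simp_all add: matrix_vector_right_distrib)

definition poly_vec :: "'n::finite cmatrix \<Rightarrow> complex ^ 'n \<Rightarrow> complex poly \<Rightarrow> complex ^ 'n" where
  "poly_vec A x p = (\<Sum>i\<le>degree p. coeff p i *s (mpow A i *v x))"

lemma poly_vec_eq:
  assumes "degree p \<le> n" shows "poly_vec A x p = (\<Sum>i\<le>n. coeff p i *s (mpow A i *v x))"
  unfolding poly_vec_def using assms
  by (intro sum.mono_neutral_left) (auto simp: coeff_eq_0)

lemma poly_vec_add: "poly_vec A x (p + q) = poly_vec A x p + poly_vec A x q"
proof -
  let ?n = "max (degree p) (degree q)"
  have "degree (p + q) \<le> ?n" by (rule degree_add_le_max)
  then show ?thesis
    by (simp add: poly_vec_eq[of _ ?n] vec_eq_iff sum_component sum.distrib distrib_right)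
qed

lemma poly_vec_smult: "poly_vec A x (Polynomial.smult c p) = c *s poly_vec A x p"
proof -
  have "degree (Polynomial.smult c p) \<le> degree p" by (rule degree_smult_le)
  then show ?thesis by (simp add: poly_vec_eq[of _ "degree p"] vec_eq_iff sum_component sum_distrib_left mult.assoc)
qed

lemma poly_vec_pCons: "poly_vec A x (pCons a p) = a *s x + A *v poly_vec A x p"
proof -
  have "degree (pCons a p) \<le> Suc (degree p)" by (rule degree_pCons_le)
  then have "poly_vec A x (pCons a p) = (\<Sum>i\<le>Suc (degree p). coeff (pCons a p) i *s (mpow A i *v x))"
    by (rule poly_vec_eq)
  also have "\<dots> = a *s x + (\<Sum>i\<le>degree p. coeff p i *s (mpow A (Suc i) *v x))"
    by (subst sum.atMost_Suc_shift) simp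
  also have "(\<Sum>i\<le>degree p. coeff p i *s (mpow A (Suc i) *v x)) = A *v poly_vec A x p"
    by (simp add: poly_vec_def matrix_vector_sum matrix_vector_smult matrix_vector_mul_assoc)
  finally show ?thesis .
qed

lemma poly_vec_linear: "poly_vec A x ([:- r, 1:] * q) = A *v poly_vec A x q - r *s poly_vec A x q"
proof -
  have "[:- r, 1:] * q = Polynomial.smult (- r) q + pCons 0 q" by simp
  then have "poly_vec A x ([:- r, 1:] * q) = (- r) *s poly_vec A x q + (0 *s x + A *v poly_vec A x q)"
    by (simp only: poly_vec_add poly_vec_smult poly_vec_pCons)
  then show ?thesis by (simp add: vec_eq_iff)
qed

text \<open>The iterates of x under A live in a space of finite real dimension, so some iterate is a
  real combination of the earlier ones; this relation is the polynomial.\<close>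

lemma poly_vec_annihilator:
  fixes A :: "'n::finite cmatrix"
  shows "\<exists>p. p \<noteq> 0 \<and> poly_vec A x p = 0"
proof -
  define S where "S n = (\<lambda>i. mpow A i *v x) ` {..<n}" for n
  have "\<exists>n. mpow A n *v x \<in> span (S n)"
  proof (rule ccontr)
    assume "\<nexists>n. mpow A n *v x \<in> span (S n)"
    then have not: "mpow A n *v x \<notin> span (S n)" for n by blast
    have S_Suc: "S (Suc n) = insert (mpow A n *v x) (S n)" for n
      unfolding S_def by (simp add: lessThan_Suc)
    have "independent (S n) \<and> card (S n) = n" for n
    proof (induction n)
      case 0
      show ?case by (simp add: S_def independent_empty)
    next
      case (Suc n)
      have "mpow A n *v x \<notin> S n" using not span_base by blast
      moreover have "finite (S n)" by (simp add: S_def)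
      ultimately show ?case using Suc not[of n] unfolding S_Suc by (simp add: independent_insert)
    qed
    then have "independent (S (Suc DIM(complex ^ 'n)))" "card (S (Suc DIM(complex ^ 'n))) = Suc DIM(complex ^ 'n)"
      by blast+
    then show False using independent_bound by (metis Suc_n_not_le_n)
  qed
  then obtain n where n: "mpow A n *v x \<in> span (S n)" by blast
  have "\<exists>q. poly_vec A x q = y \<and> (\<forall>i\<ge>n. coeff q i = 0)" if "y \<in> span (S n)" for y
    using that
  proof (induction rule: span_induct_alt)
    case base
    show ?case by (intro exI[of _ 0]) (simp add: poly_vec_def)
  next
    case (step c y z)
    then obtain q i where q: "poly_vec A x q = z" "\<forall>i\<ge>n. coeff q i = 0" and i: "i < n" "y = mpow A i *v x"
      unfolding S_def by blast
    have "poly_vec A x (monom (of_real c) i) = c *\<^sub>R y"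
    proof -
      have "poly_vec A x (monom (of_real c) i) = (\<Sum>k\<le>i. coeff (monom (of_real c) i) k *s (mpow A k *v x))"
        by (rule poly_vec_eq) (rule degree_monom_le)
      also have "\<dots> = (\<Sum>k\<in>{i}. coeff (monom (of_real c) i) k *s (mpow A k *v x))"
        by (rule sum.mono_neutral_right) auto
      finally show ?thesis unfolding i(2) by (simp add: vec_eq_iff complex_eq_iff)
    qed
    then show ?case using q i by (intro exI[of _ "monom (complex_of_real c) i + q"]) (auto simp: poly_vec_add)
  qed
  then obtain q where q: "poly_vec A x q = mpow A n *v x" "\<forall>i\<ge>n. coeff q i = 0" using n by blast
  let ?p = "monom 1 n + Polynomial.smult (- 1) q"
  have "poly_vec A x (monom 1 n) = mpow A n *v x"
  proof -
    have "poly_vec A x (monom 1 n) = (\<Sum>k\<le>n. coeff (monom 1 n) k *s (mpow A k *v x))"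
      by (rule poly_vec_eq) (rule degree_monom_le)
    also have "\<dots> = (\<Sum>k\<in>{n}. coeff (monom 1 n) k *s (mpow A k *v x))"
      by (rule sum.mono_neutral_right) auto
    finally show ?thesis by simp
  qed
  then have "poly_vec A x ?p = 0"
    by (simp only: poly_vec_add poly_vec_smult q) (simp add: vec_eq_iff)
  moreover have "coeff ?p n = 1" using q(2) by simp
  then have "?p \<noteq> 0" by force
  ultimately show ?thesis by blast
qed

text \<open>A polynomial p of least degree with p(A) x = 0 has a root r. Writing p = (X - r) q, the
  vector q(A) x is nonzero by minimality, lies in W, and is annihilated by A - r.\<close>

lemma invariant_subspace_eigenvector:
  fixes A :: "'n::finite cmatrix"
  assumes W: "\<And>x y. x \<in> W \<Longrightarrow> y \<in> W \<Longrightarrow> x + y \<in> W" "\<And>c x. x \<in> W \<Longrightarrow> c *s x \<in> W"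
    "\<And>x. x \<in> W \<Longrightarrow> A *v x \<in> W" and x: "x \<in> W" "x \<noteq> 0"
  obtains y r where "y \<in> W" "y \<noteq> 0" "A *v y = r *s y"
proof -
  define p where "p = (ARG_MIN degree p. p \<noteq> 0 \<and> poly_vec A x p = 0)"
  have p: "p \<noteq> 0 \<and> poly_vec A x p = 0"
    and pmin: "\<And>q. q \<noteq> 0 \<Longrightarrow> poly_vec A x q = 0 \<Longrightarrow> degree p \<le> degree q"
    using arg_min_nat_lemma[of "\<lambda>p. p \<noteq> 0 \<and> poly_vec A x p = 0" _ degree] poly_vec_annihilator[of A x]
    unfolding p_def by blast+
  have "degree p \<noteq> 0"
  proof
    assume "degree p = 0"
    then obtain c where "p = [:c:]" by (rule degree_eq_zeroE)
    then have "c \<noteq> 0" "c *s x = 0" using p by (auto simp: poly_vec_def)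
    then show False using x(2) by simp
  qed
  then have "\<not> constant (poly p)" by (simp add: constant_degree)
  then obtain r where "poly p r = 0" using fundamental_theorem_of_algebra by blast
  then obtain q where q: "p = [:- r, 1:] * q" by (auto simp: poly_eq_0_iff_dvd dvd_def)
  have "q \<noteq> 0" using p q by auto
  then have "degree p = Suc (degree q)" unfolding q by (subst degree_mult_eq) auto
  then have y0: "poly_vec A x q \<noteq> 0" using pmin[of q] \<open>q \<noteq> 0\<close> by auto
  have pow: "mpow A i *v x \<in> W" for i
    by (induction i) (use x(1) W(3) in \<open>auto simp flip: matrix_vector_mul_assoc\<close>)
  have "0 *s x \<in> W" using W(2) x(1) .
  then have "(\<Sum>i\<le>n. c i *s (mpow A i *v x)) \<in> W" for c and n :: nat
    by (induction n) (auto intro!: W(1) W(2) pow simp del: mpow.simps)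
  then have "poly_vec A x q \<in> W" by (simp add: poly_vec_def)
  moreover have "A *v poly_vec A x q = r *s poly_vec A x q"
    using p poly_vec_linear[of A x r q] q by simp
  ultimately show ?thesis using that y0 by blast
qed

text \<open>Eigenvectors are found one at a time in the orthogonal complement W of the earlier ones.
  W is invariant because A preserves \<open>hprod\<close> and the eigenvalues found so far are
  nonzero; it is nontrivial because m vectors span at most 2 m of the 2 N real dimensions.\<close>

lemma unitary_eigenbasis:
  fixes A :: "'n::finite cmatrix"
  assumes A: "A \<in> unitary_group" and "m \<le> CARD('n)"
  shows "\<exists>v z. (\<forall>k<m. A *v v k = z k *s v k \<and> norm (z k) = 1) \<and>
    (\<forall>k<m. \<forall>l<m. hprod (v k) (v l) = (if k = l then 1 else 0))"
  using assms(2)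
proof (induction m)
  case 0
  show ?case by simp
next
  case (Suc m)
  then obtain v z where v: "\<And>k. k < m \<Longrightarrow> A *v v k = z k *s v k" "\<And>k. k < m \<Longrightarrow> norm (z k) = 1"
    "\<And>k l. k < m \<Longrightarrow> l < m \<Longrightarrow> hprod (v k) (v l) = (if k = l then 1 else 0)"
    by (metis Suc_leD)
  define W where "W = {x. \<forall>k<m. hprod x (v k) = 0}"
  \<comment> \<open>The real span of these vectors is the complex span of the
    \<open>v k\<close>.\<close>
  define B where "B = v ` {..<m} \<union> (\<lambda>k. \<i> *s v k) ` {..<m}"
  have "card B \<le> m + m"
    unfolding B_def using card_Un_le card_image_le[of "{..<m}"] by (metis (no_types, lifting) add_mono card_lessThan finite_lessThan le_trans)
  have "dim B \<le> card B" by (rule dim_le_card') (simp add: B_def)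
  also have "\<dots> < DIM(complex ^ 'n)" using \<open>card B \<le> m + m\<close> Suc.prems by simp
  finally have dimB: "dim B < DIM(complex ^ 'n)" .
  obtain x where x: "x \<noteq> 0" "\<And>y. y \<in> span B \<Longrightarrow> orthogonal x y"
    by (rule orthogonal_to_subspace_exists[OF dimB]) blast
  have "x \<in> W"
    unfolding W_def
  proof (intro CollectI allI impI)
    fix k assume "k < m"
    then have "v k \<in> span B" "\<i> *s v k \<in> span B" by (auto simp: B_def intro!: span_base)
    then show "hprod x (v k) = 0" using x(2) by (simp add: hprod_eq_0_iff orthogonal_def)
  qed
  have AW: "A *v y \<in> W" if "y \<in> W" for y
    unfolding W_def
  proof (intro CollectI allI impI)
    fix k assume k: "k < m"
    have "cnj (z k) * hprod (A *v y) (v k) = hprod (A *v y) (A *v v k)"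
      using v(1)[OF k] by (simp add: hprod_smult_right)
    also have "\<dots> = 0" using that k by (simp add: hprod_unitary[OF A] W_def)
    finally show "hprod (A *v y) (v k) = 0" using v(2)[OF k] by auto
  qed
  obtain y r where y: "y \<in> W" "y \<noteq> 0" "A *v y = r *s y"
  proof (rule invariant_subspace_eigenvector[of W A x])
    show "a + b \<in> W" if "a \<in> W" "b \<in> W" for a b using that by (simp add: W_def hprod_add_left)
    show "c *s a \<in> W" if "a \<in> W" for c a using that by (simp add: W_def hprod_smult_left)
  qed (use AW \<open>x \<in> W\<close> x(1) in auto)
  have "r * cnj r * hprod y y = hprod (A *v y) (A *v y)"
    by (simp add: y(3) hprod_smult_left hprod_smult_right)
  then have "r * cnj r * hprod y y = hprod y y" by (simp add: hprod_unitary[OF A])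
  moreover have "hprod y y \<noteq> 0" using y(2) by (simp add: hprod_self)
  ultimately have "r * cnj r = 1" by simp
  then have "complex_of_real ((norm r)\<^sup>2) = 1" by (simp only: complex_norm_square)
  then have "(norm r)\<^sup>2 = 1" by (simp only: of_real_eq_1_iff)
  then have r: "norm r = 1" by (simp add: power2_eq_1_iff) (metis norm_ge_zero neg_0_le_iff_le not_one_le_zero)
  define w where "w = of_real (1 / norm y) *s y"
  have w: "A *v w = r *s w" by (simp add: w_def matrix_vector_smult y(3) vec_eq_iff mult.left_commute)
  have ww: "hprod w w = 1"
  proof -
    have "hprod w w = of_real (1 / norm y) * (cnj (of_real (1 / norm y)) * hprod y y)"
      by (simp only: w_def hprod_smult_left hprod_smult_right mult.left_commute)
    then show ?thesis using y(2) by (simp add: hprod_self power2_eq_square)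
  qed
  have wv: "hprod w (v k) = 0" "hprod (v k) w = 0" if "k < m" for k
    using y(1) that by (simp_all add: w_def W_def hprod_smult_left hprod_smult_right hprod_commute[of "v k" y])
  show ?case
    by (rule exI[of _ "v(m := w)"], rule exI[of _ "z(m := r)"])
       (use v w ww wv r in \<open>auto simp: less_Suc_eq\<close>)
qed

lemma unitary_diagonalization:
  fixes A :: "'n::finite cmatrix"
  assumes A: "A \<in> unitary_group"
  shows "\<exists>V\<in>unitary_group. \<exists>z\<in>unit_tuples CARD('n). A = conj_diag V z"
proof -
  obtain v z where v: "\<And>k. k < CARD('n) \<Longrightarrow> A *v v k = z k *s v k" "\<And>k. k < CARD('n) \<Longrightarrow> norm (z k) = 1"
    "\<And>k l. k < CARD('n) \<Longrightarrow> l < CARD('n) \<Longrightarrow> hprod (v k) (v l) = (if k = l then 1 else 0)"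
    using unitary_eigenbasis[OF A order_refl] by metis
  define V :: "'n cmatrix" where "V = (\<chi> i j. v (enum_index j) $ i)"
  have "(adjoint_matrix V ** V) $ j $ k = mat 1 $ j $ k" for j k
  proof -
    have "(adjoint_matrix V ** V) $ j $ k = hprod (v (enum_index k)) (v (enum_index j))"
      by (simp add: matrix_mult_nth adjoint_nth V_def hprod_def mult.commute)
    then show ?thesis by (simp add: v(3)[OF enum_index_less enum_index_less] mat_def)
  qed
  then have "adjoint_matrix V ** V = mat 1" by (simp add: vec_eq_iff)
  then have V: "V \<in> unitary_group"
    using matrix_left_right_inverse unfolding unitary_group_def by blast
  have "(A ** V) $ i $ j = (V ** diag_mat_of z) $ i $ j" for i j
  proof -
    have "(A ** V) $ i $ j = (A *v v (enum_index j)) $ i"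
      by (simp add: matrix_mult_nth matrix_vector_mult_def V_def)
    then show ?thesis by (simp add: v(1)[OF enum_index_less] mult_diag_nth V_def mult.commute)
  qed
  then have "A ** V = V ** diag_mat_of z" by (simp add: vec_eq_iff)
  then have "A = conj_diag V z"
    unfolding conj_diag_def using unitary_cancel(3)[OF V, of A] by simp
  moreover have "z \<in> unit_tuples CARD('n)" using v(2) by (simp add: unit_tuples_def)
  ultimately show ?thesis using V by blast
qed

section \<open>Measurable choice of the eigenvalues\<close>

lemma eigenvalue_tuple_conj_diag:
  assumes V: "V \<in> unitary_group"
  shows "eigenvalue_tuple (conj_diag V z) z"
  unfolding eigenvalue_tuple_def
proof
  fix t
  let ?D = "diag_mat_of (\<lambda>i. t - z i) :: 'a cmatrix"
  have "mat t = conj_diag V (\<lambda>i. t)"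
  proof -
    have "conj_diag V (\<lambda>i. t) = smult_matrix t (conj_diag V (\<lambda>i. 1))"
      using conj_diag_smult[of V t "\<lambda>i. 1"] by simp
    then show ?thesis by (simp add: conj_diag_one[OF V] vec_eq_iff mat_def)
  qed
  then have "mat t - conj_diag V z = conj_diag V (\<lambda>i. t + (- 1) * z i)"
    unfolding conj_diag_add conj_diag_smult by (simp add: vec_eq_iff)
  then have "Determinants.det (mat t - conj_diag V z) = Determinants.det V * Determinants.det ?D * Determinants.det (adjoint_matrix V)"
    by (simp add: conj_diag_def Determinants.det_mul)
  also have "\<dots> = Determinants.det ?D * (Determinants.det V * Determinants.det (adjoint_matrix V))" by simp
  also have "Determinants.det V * Determinants.det (adjoint_matrix V) = 1"
    by (simp add: unitaryD[OF V] flip: Determinants.det_mul)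
  also have "Determinants.det ?D = (\<Prod>i\<in>UNIV. ?D $ i $ i)"
    by (rule det_diagonal) (simp add: diag_mat_of_def)
  also have "\<dots> = (\<Prod>j<CARD('a). t - z j)"
    by (simp add: diag_mat_of_def prod_enum_index[where g="\<lambda>j. t - z j"])
  finally show "Determinants.det (mat t - conj_diag V z) = (\<Prod>j<CARD('a). t - z j)" by simp
qed

lemma mset_eq_permutes:
  fixes y z :: "nat \<Rightarrow> 'b"
  assumes "mset (map y [0..<N]) = mset (map z [0..<N])"
  shows "\<exists>\<sigma>. \<sigma> permutes {..<N} \<and> (\<forall>j<N. y j = z (\<sigma> j))"
proof -
  obtain p where p: "p permutes {..<length (map z [0..<N])}" "permute_list p (map z [0..<N]) = map y [0..<N]"
    using mset_eq_permutation[OF assms] by blast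
  have "y j = z (p j)" if "j < N" for j
  proof -
    have "p j < N" using permutes_in_image[OF p(1), of j] that by simp
    moreover have "permute_list p (map z [0..<N]) ! j = map z [0..<N] ! p j"
      using p(1) that by (intro permute_list_nth) auto
    ultimately show ?thesis using p(2) that by simp
  qed
  then show ?thesis using p(1) by auto
qed

text \<open>Equal characteristic polynomials have the same multiset of roots, and tuples with the
  same multiset of values differ by a permutation.\<close>

lemma eigenvalue_tuple_unique:
  fixes A :: "'n::finite cmatrix"
  assumes "eigenvalue_tuple A y" "eigenvalue_tuple A z"
  shows "\<exists>\<sigma>. \<sigma> permutes {..<CARD('n)} \<and> (\<forall>j<CARD('n). y j = z (\<sigma> j))"
proof (rule mset_eq_permutes)
  let ?p = "\<lambda>z :: nat \<Rightarrow> complex. \<Prod>j<CARD('n). [:- z j, 1:]"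
  have "poly (?p y) t = poly (?p z) t" for t
    using assms by (simp add: eigenvalue_tuple_def poly_prod)
  then have "?p y = ?p z" by (simp add: poly_eq_poly_eq_iff[symmetric] fun_eq_iff)
  moreover have "proots (?p z) = mset (map z [0..<CARD('n)])" for z
  proof -
    have "proots (?p z) = (\<Sum>j<CARD('n). proots [:- z j, 1:])" by (rule proots_prod) auto
    also have "\<dots> = (\<Sum>j<CARD('n). {#z j#})" by simp
    also have "\<dots> = image_mset z (mset_set {0..<CARD('n)})"
      by (simp add: sum_unfold_sum_mset lessThan_atLeast0)
    also have "\<dots> = mset (map z [0..<CARD('n)])" by simp
    finally show ?thesis .
  qed
  ultimately show "mset (map y [0..<CARD('n)]) = mset (map z [0..<CARD('n)])" by metis
qed

text \<open>Permuting the columns of V along with the eigenvalues leaves the conjugate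
  unchanged.\<close>

lemma conj_diag_permute:
  fixes V :: "'n::finite cmatrix"
  assumes V: "V \<in> unitary_group" and \<sigma>: "\<sigma> permutes {..<CARD('n)}" and y: "\<And>j. j < CARD('n) \<Longrightarrow> y j = z (\<sigma> j)"
  shows "\<exists>V'\<in>unitary_group. V' ** adjoint_matrix V \<in> unitary_group \<and> conj_diag V z = conj_diag V' y"
proof -
  define \<tau> :: "'n \<Rightarrow> 'n" where "\<tau> j = inv_into UNIV enum_index (\<sigma> (enum_index j))" for j
  have inv: "enum_index (inv_into UNIV (enum_index :: 'n \<Rightarrow> nat) k) = k" if "k < CARD('n)" for k
    using that bij_enum_index[where 'n='n] by (intro f_inv_into_f) (auto simp: bij_betw_def)
  have \<tau>: "enum_index (\<tau> j) = \<sigma> (enum_index j)" for j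
    unfolding \<tau>_def using permutes_in_image[OF \<sigma>, of "enum_index j"] enum_index_less[of j] by (intro inv) auto
  have "inj \<tau>"
  proof (rule injI)
    fix i j assume "\<tau> i = \<tau> j"
    then have "\<sigma> (enum_index i) = \<sigma> (enum_index j)" by (metis \<tau>)
    then show "i = j" using permutes_inj[OF \<sigma>] by (simp add: inj_eq)
  qed
  then have bij: "bij \<tau>" by (simp add: bij_def finite_UNIV_inj_surj)
  define V' :: "'n cmatrix" where "V' = (\<chi> i j. V $ i $ \<tau> j)"
  have "(V' ** diag_mat_of y ** adjoint_matrix V') $ i $ k = (V ** diag_mat_of z ** adjoint_matrix V) $ i $ k" for i k
  proof -
    have "(V' ** diag_mat_of y ** adjoint_matrix V') $ i $ k
       = (\<Sum>j\<in>UNIV. V $ i $ \<tau> j * z (enum_index (\<tau> j)) * cnj (V $ k $ \<tau> j))"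
      by (simp add: matrix_mult_nth[of "_ ** _"] mult_diag_nth adjoint_nth V'_def y enum_index_less \<tau>)
    also have "\<dots> = (\<Sum>j\<in>UNIV. V $ i $ j * z (enum_index j) * cnj (V $ k $ j))"
      by (rule sum.reindex_bij_betw[OF bij])
    finally show ?thesis by (simp add: matrix_mult_nth[of "_ ** _"] mult_diag_nth adjoint_nth)
  qed
  then have eq: "conj_diag V z = conj_diag V' y" by (simp add: conj_diag_def vec_eq_iff)
  have "(V' ** adjoint_matrix V') $ i $ k = (V ** adjoint_matrix V) $ i $ k" for i k
    unfolding matrix_mult_nth adjoint_nth V'_def
    using sum.reindex_bij_betw[OF bij, of "\<lambda>j. V $ i $ j * cnj (V $ k $ j)"] by simp
  then have "V' ** adjoint_matrix V' = mat 1" by (simp add: vec_eq_iff unitaryD[OF V])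
  then have "V' \<in> unitary_group" using matrix_left_right_inverse unfolding unitary_group_def by blast
  then show ?thesis using eq unitary_mult[OF _ unitary_adjoint[OF V]] by blast
qed

text \<open>The diagonalisation is chosen arbitrarily, but the sorted list of angles in [0, 2 pi)
  depends on the matrix alone, which is what makes a measurable selection possible.\<close>

definition eigen_angles :: "'n::finite cmatrix \<Rightarrow> real list" where
  "eigen_angles A = sort (map (\<lambda>j. Arg2pi ((SOME z. \<exists>V\<in>unitary_group. A = conj_diag V z \<and> z \<in> unit_tuples CARD('n)) j)) [0..<CARD('n)])"

definition eigen_sel :: "'n::finite cmatrix \<Rightarrow> nat \<Rightarrow> complex" where
  "eigen_sel A = (\<lambda>j\<in>{..<CARD('n)}. cis (eigen_angles A ! j))"

lemma cis_Arg2pi: "norm z = 1 \<Longrightarrow> cis (Arg2pi z) = z"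
  using Arg2pi_eq[of z] by (simp add: cis_conv_exp)

lemma eigen_sel:
  fixes A :: "'n::finite cmatrix"
  assumes "A \<in> unitary_group"
  shows "eigen_sel A \<in> space (torus_measure CARD('n))" (is ?in)
    and "\<exists>V\<in>unitary_group. A = conj_diag V (eigen_sel A)"
    and "length (eigen_angles A) = CARD('n)" "sorted (eigen_angles A)"
    and "\<exists>V\<in>unitary_group. \<exists>z\<in>unit_tuples CARD('n). A = conj_diag V z \<and>
      mset (eigen_angles A) = mset (map (\<lambda>j. Arg2pi (z j)) [0..<CARD('n)])"
proof -
  define z where "z = (SOME z. \<exists>V\<in>unitary_group. A = conj_diag V z \<and> z \<in> unit_tuples CARD('n))"
  have "\<exists>z. \<exists>V\<in>unitary_group. A = conj_diag V z \<and> z \<in> unit_tuples CARD('n)"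
    using unitary_diagonalization[OF assms] by blast
  then have "\<exists>V\<in>unitary_group. A = conj_diag V z \<and> z \<in> unit_tuples CARD('n)"
    unfolding z_def by (rule someI_ex)
  then obtain V where V: "V \<in> unitary_group" "A = conj_diag V z" and z: "z \<in> unit_tuples CARD('n)" by blast
  have L: "eigen_angles A = sort (map (\<lambda>j. Arg2pi (z j)) [0..<CARD('n)])"
    by (simp add: eigen_angles_def z_def)
  then show len: "length (eigen_angles A) = CARD('n)" and "sorted (eigen_angles A)" by simp_all
  have ms: "mset (eigen_angles A) = mset (map (\<lambda>j. Arg2pi (z j)) [0..<CARD('n)])" by (simp add: L)
  then show "\<exists>V\<in>unitary_group. \<exists>z\<in>unit_tuples CARD('n). A = conj_diag V z \<and>
      mset (eigen_angles A) = mset (map (\<lambda>j. Arg2pi (z j)) [0..<CARD('n)])" using V z by blast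
  have "map (\<lambda>j. eigen_angles A ! j) [0..<CARD('n)] = eigen_angles A"
    using map_nth[of "eigen_angles A"] len by simp
  then have "mset (map (\<lambda>j. eigen_angles A ! j) [0..<CARD('n)]) = mset (map (\<lambda>j. Arg2pi (z j)) [0..<CARD('n)])"
    using ms by simp
  from mset_eq_permutes[OF this] obtain \<sigma> where \<sigma>: "\<sigma> permutes {..<CARD('n)}"
    "\<And>j. j < CARD('n) \<Longrightarrow> eigen_angles A ! j = Arg2pi (z (\<sigma> j))" by blast
  have y: "eigen_sel A j = z (\<sigma> j)" if "j < CARD('n)" for j
  proof -
    have "\<sigma> j < CARD('n)" using permutes_in_image[OF \<sigma>(1), of j] that by simp
    then have "norm (z (\<sigma> j)) = 1" using z by (simp add: unit_tuples_def)
    then show ?thesis using that \<sigma>(2) by (simp add: eigen_sel_def cis_Arg2pi)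
  qed
  show ?in by (auto simp: space_torus_measure eigen_sel_def)
  show "\<exists>V\<in>unitary_group. A = conj_diag V (eigen_sel A)"
    using conj_diag_permute[OF V(1) \<sigma>(1), of "eigen_sel A" z] y V(2) by blast
qed

text \<open>Turns a bound on an order statistic into a bound on a count; here the count is a
  symmetric function of the eigenvalues.\<close>

lemma sorted_nth_le_iff:
  fixes L :: "real list"
  assumes "sorted L" "j < length L"
  shows "L ! j \<le> t \<longleftrightarrow> j < length (filter (\<lambda>x. x \<le> t) L)"
proof -
  have len: "length (filter (\<lambda>x. x \<le> t) L) = card {i. i < length L \<and> L ! i \<le> t}"
    by (rule length_filter_conv_card)
  show ?thesis
  proof
    assume "L ! j \<le> t"
    then have "{..j} \<subseteq> {i. i < length L \<and> L ! i \<le> t}"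
      using assms by (auto intro: order_trans[OF sorted_nth_mono])
    then have "card {..j} \<le> card {i. i < length L \<and> L ! i \<le> t}" by (intro card_mono) auto
    then show "j < length (filter (\<lambda>x. x \<le> t) L)" unfolding len by simp
  next
    assume *: "j < length (filter (\<lambda>x. x \<le> t) L)"
    show "L ! j \<le> t"
    proof (rule ccontr)
      assume nle: "\<not> L ! j \<le> t"
      have "{i. i < length L \<and> L ! i \<le> t} \<subseteq> {..<j}"
      proof (intro subsetI, rule ccontr)
        fix i assume i: "i \<in> {i. i < length L \<and> L ! i \<le> t}" "i \<notin> {..<j}"
        then have "L ! j \<le> L ! i" using assms(1) by (intro sorted_nth_mono) auto
        then show False using i nle by simp
      qed
      then have "card {i. i < length L \<and> L ! i \<le> t} \<le> card {..<j}" by (intro card_mono) auto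
      then show False using * unfolding len by simp
    qed
  qed
qed

lemma closed_Arg2pi_le:
  assumes "0 \<le> t" "t < 2 * pi"
  shows "closed {z. norm z = 1 \<and> Arg2pi z \<le> t}"
proof -
  have "{z. norm z = 1 \<and> Arg2pi z \<le> t} = cis ` {0..t}"
  proof (intro equalityI subsetI)
    fix z assume "z \<in> {z. norm z = 1 \<and> Arg2pi z \<le> t}"
    then have "z = cis (Arg2pi z)" "Arg2pi z \<in> {0..t}" using cis_Arg2pi Arg2pi_ge_0 by auto
    then show "z \<in> cis ` {0..t}" by blast
  next
    fix z assume "z \<in> cis ` {0..t}"
    then obtain s where s: "s \<in> {0..t}" "z = cis s" by auto
    have "Arg2pi z = s" using s assms by (intro Arg2pi_unique[of 1]) (auto simp: cis_conv_exp)
    then show "z \<in> {z. norm z = 1 \<and> Arg2pi z \<le> t}" using s by auto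
  qed
  moreover have "compact (cis ` {0..t})"
    by (intro compact_continuous_image continuous_intros) auto
  ultimately show ?thesis by (simp add: compact_imp_closed)
qed

text \<open>The j-th angle is at most t exactly if more than j eigenvalues lie on a closed arc C.
  Their number is the sum of the indicator of C over the eigenvalues, a limit of sums of
  trigonometric polynomials; those sums are combinations of traces of powers, which are continuous
  in the matrix.\<close>

lemma eigen_angles_measurable:
  assumes j: "j < CARD('n::finite)"
  shows "(\<lambda>A :: 'n cmatrix. eigen_angles A ! j) \<in> borel_measurable (restrict_space borel unitary_group)"
    (is "_ \<in> borel_measurable ?M")
proof -
  have sp: "space ?M = unitary_group" by (simp add: space_restrict_space)
  have "{A \<in> space ?M. eigen_angles A ! j \<le> t} \<in> sets ?M" for t
  proof -
    define C where "C = {z :: complex. norm z = 1 \<and> Arg2pi z \<le> t}"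
    define cnt where "cnt A = length (filter (\<lambda>x. x \<le> t) (eigen_angles A))" for A :: "'n cmatrix"
    have set_eq: "{A \<in> space ?M. eigen_angles A ! j \<le> t} = {A \<in> space ?M. real j < real (cnt A)}"
    proof -
      have "eigen_angles A ! j \<le> t \<longleftrightarrow> j < cnt A" if "A \<in> unitary_group" for A :: "'n cmatrix"
        unfolding cnt_def using eigen_sel(3,4)[OF that] j by (intro sorted_nth_le_iff) auto
      then show ?thesis unfolding sp by auto
    qed
    have "closed C"
    \<comment> \<open>Outside this range the arc is empty or the whole circle.\<close>
    proof (cases "0 \<le> t \<and> t < 2 * pi")
      case True
      then show ?thesis unfolding C_def by (intro closed_Arg2pi_le) auto
    next
      case False
      then consider "t < 0" | "2 * pi \<le> t" by linarith
      then show ?thesis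
      proof cases
        case 1
        have "\<not> Arg2pi z \<le> t" for z using Arg2pi_ge_0[of z] 1 by linarith
        then have "C = {}" by (simp add: C_def)
        then show ?thesis by simp
      next
        case 2
        have "Arg2pi z \<le> t" for z using Arg2pi_lt_2pi[of z] 2 by linarith
        then have "C = unit_circle" by (auto simp: C_def)
        then show ?thesis by simp
      qed
    qed
    then obtain p where p: "\<And>n. p n \<in> lincomb (range (\<lambda>(k::int) z. z powi k))"
      "\<And>z. z \<in> unit_circle \<Longrightarrow> (\<lambda>n. p n z) \<longlonglongrightarrow> indicator C z"
      by (rule trig_approx_indicator) blast
    have cnt_eq: "\<exists>V\<in>unitary_group. \<exists>z\<in>unit_tuples CARD('n). A = conj_diag V z \<and>
       of_nat (cnt A) = (\<Sum>i<CARD('n). indicator C (z i) :: complex)" if A: "A \<in> unitary_group" for A :: "'n cmatrix"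
    proof -
      obtain V z where Vz: "V \<in> unitary_group" "z \<in> unit_tuples CARD('n)" "A = conj_diag V z"
        "mset (eigen_angles A) = mset (map (\<lambda>j. Arg2pi (z j)) [0..<CARD('n)])"
        using eigen_sel(5)[OF A] by blast
      have "cnt A = size (filter_mset (\<lambda>x. x \<le> t) (mset (eigen_angles A)))"
        unfolding cnt_def by (metis mset_filter size_mset)
      also have "\<dots> = length (filter (\<lambda>x. x \<le> t) (map (\<lambda>j. Arg2pi (z j)) [0..<CARD('n)]))"
        unfolding Vz(4) by (metis mset_filter size_mset)
      also have "\<dots> = card {i. i < CARD('n) \<and> Arg2pi (z i) \<le> t}"
        unfolding length_filter_conv_card by (rule arg_cong[where f=card]) auto
      also have "{i. i < CARD('n) \<and> Arg2pi (z i) \<le> t} = {i \<in> {..<CARD('n)}. z i \<in> C}"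
        using Vz(2) by (auto simp: C_def unit_tuples_def)
      finally have "of_nat (cnt A) = (of_nat (card {i \<in> {..<CARD('n)}. z i \<in> C}) :: complex)" by simp
      also have "\<dots> = (\<Sum>i<CARD('n). indicator C (z i))"
        by (simp add: indicator_def of_bool_def sum.If_cases Int_def)
      finally show ?thesis using Vz by blast
    qed
    have trace_fun: "\<exists>F \<in> borel_measurable ?M. \<forall>V\<in>unitary_group. \<forall>z\<in>unit_tuples CARD('n).
        F (conj_diag V z) = (\<Sum>i<CARD('n). q (z i))"
      if "q \<in> lincomb (range (\<lambda>(k::int) z. z powi k))" for q
      using that
    proof induction
      case (lincomb_gen q)
      then obtain k where k: "q = (\<lambda>z. z powi k)" by blast
      have "(\<lambda>A. trace (mpowi A k)) \<in> borel_measurable ?M"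
        by (intro borel_measurable_continuous_on_restrict continuous_on_trace continuous_on_mpowi continuous_on_id)
      then show ?case
        by (intro bexI[of _ "\<lambda>A. trace (mpowi A k)"]) (simp_all add: mpowi_conj_diag trace_conj_diag k)
    next
      case lincomb_zero
      show ?case by (intro bexI[of _ "\<lambda>A. 0"]) auto
    next
      case (lincomb_add f g)
      then obtain F G where "F \<in> borel_measurable ?M" "G \<in> borel_measurable ?M"
        "\<forall>V\<in>unitary_group. \<forall>z\<in>unit_tuples CARD('n). F (conj_diag V z) = (\<Sum>i<CARD('n). f (z i))"
        "\<forall>V\<in>unitary_group. \<forall>z\<in>unit_tuples CARD('n). G (conj_diag V z) = (\<Sum>i<CARD('n). g (z i))" by blast
      then show ?case by (intro bexI[of _ "\<lambda>A. F A + G A"]) (auto simp: sum.distrib)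
    next
      case (lincomb_cmult f c)
      then obtain F where "F \<in> borel_measurable ?M"
        "\<forall>V\<in>unitary_group. \<forall>z\<in>unit_tuples CARD('n). F (conj_diag V z) = (\<Sum>i<CARD('n). f (z i))" by blast
      then show ?case by (intro bexI[of _ "\<lambda>A. c * F A"]) (auto simp: sum_distrib_left)
    qed
    have "\<forall>n. \<exists>F. F \<in> borel_measurable ?M \<and> (\<forall>V\<in>unitary_group. \<forall>z\<in>unit_tuples CARD('n).
        F (conj_diag V z) = (\<Sum>i<CARD('n). p n (z i)))"
      using trace_fun[OF p(1)] by blast
    then obtain F where F0: "\<forall>n. F n \<in> borel_measurable ?M \<and> (\<forall>V\<in>unitary_group. \<forall>z\<in>unit_tuples CARD('n).
        F n (conj_diag V z) = (\<Sum>i<CARD('n). p n (z i)))"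
      by (rule choice[THEN exE])
    have F1: "F n \<in> borel_measurable ?M" for n
      by (rule conjunct1[OF spec[OF F0]])
    have F2: "F n (conj_diag V z) = (\<Sum>i<CARD('n). p n (z i))"
      if "V \<in> unitary_group" "z \<in> unit_tuples CARD('n)" for n V z
      by (rule bspec[OF bspec[OF conjunct2[OF spec[OF F0]] that(1)] that(2)])
    have "(\<lambda>n. F n A) \<longlonglongrightarrow> of_nat (cnt A)" if "A \<in> space ?M" for A
    proof -
      have "A \<in> unitary_group" using that sp by simp
      from cnt_eq[OF this] obtain V z where Vz: "V \<in> unitary_group" "z \<in> unit_tuples CARD('n)" "A = conj_diag V z"
        "of_nat (cnt A) = (\<Sum>i<CARD('n). indicator C (z i) :: complex)"
        by (elim bexE conjE)
      have "(\<lambda>n. \<Sum>i<CARD('n). p n (z i)) \<longlonglongrightarrow> (\<Sum>i<CARD('n). indicator C (z i))"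
        using Vz(2) by (intro tendsto_sum p(2)) (auto simp: unit_tuples_def)
      moreover have "F n A = (\<Sum>i<CARD('n). p n (z i))" for n
        unfolding Vz(3) by (rule F2[OF Vz(1,2)])
      ultimately show ?thesis unfolding Vz(4) by presburger
    qed
    then have "(\<lambda>A. of_nat (cnt A) :: complex) \<in> borel_measurable ?M"
      by (rule borel_measurable_LIMSEQ_metric[OF F1])
    then have "(\<lambda>A. Re (of_nat (cnt A))) \<in> borel_measurable ?M"
      by (rule measurable_compose[OF _ borel_measurable_Re])
    then have "(\<lambda>A. real (cnt A)) \<in> borel_measurable ?M" by simp
    then show ?thesis unfolding set_eq by measurable
  qed
  then show ?thesis by (rule borel_measurableI_le)
qed

lemma eigen_sel_measurable:
  "(eigen_sel :: 'n::finite cmatrix \<Rightarrow> _) \<in> measurable (restrict_space borel unitary_group) (torus_measure CARD('n))"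
  unfolding torus_measure_def
proof (rule measurable_PiM_single')
  fix j assume "j \<in> {..<CARD('n)}"
  then have j: "j < CARD('n)" by simp
  have "(\<lambda>A :: 'n cmatrix. cis (eigen_angles A ! j)) \<in> measurable (restrict_space borel unitary_group) circle_measure"
    using measurable_compose[OF eigen_angles_measurable[OF j] measurable_cis]
    by (subst measurable_cong_sets[OF refl sets_circle_measure])
  then show "(\<lambda>A :: 'n cmatrix. eigen_sel A j) \<in> measurable (restrict_space borel unitary_group) circle_measure"
    using j by (simp add: eigen_sel_def)
qed (use eigen_sel(1) in \<open>auto simp: space_restrict_space space_torus_measure space_circle_measure\<close>)

section \<open>Haar measures on the unitary group\<close>

lemma unitary_law_ident_measurable: "unitary_law M \<Longrightarrow> (\<lambda>A. A) \<in> borel_measurable M"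
  by (rule unitary_law_measurable_from) (auto intro: continuous_on_id)

lemma unitary_law_pair_measurable:
  fixes M M' L :: "'n::finite cmatrix measure"
  assumes M: "unitary_law M" "unitary_law M'" "unitary_law L"
    and h: "continuous_on UNIV (\<lambda>p. h (fst p) (snd p))"
      "\<And>A B. A \<in> unitary_group \<Longrightarrow> B \<in> unitary_group \<Longrightarrow> h A B \<in> unitary_group"
  shows "(\<lambda>(A, B). h A B) \<in> measurable (M \<Otimes>\<^sub>M M') L"
proof (rule unitary_law_measurable_into[OF M(3)])
  have "(\<lambda>p. fst p) \<in> borel_measurable (M \<Otimes>\<^sub>M M')" "(\<lambda>p. snd p) \<in> borel_measurable (M \<Otimes>\<^sub>M M')"
    using measurable_compose[OF measurable_fst unitary_law_ident_measurable[OF M(1)]]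
      measurable_compose[OF measurable_snd unitary_law_ident_measurable[OF M(2)]] by auto
  then show "(\<lambda>(A, B). h A B) \<in> borel_measurable (M \<Otimes>\<^sub>M M')"
    unfolding case_prod_beta by (rule borel_measurable_continuous_Pair[OF _ _ h(1)])
qed (use h(2) unitary_law_space[OF M(1)] unitary_law_space[OF M(2)] in \<open>auto simp: space_pair_measure\<close>)

lemma haar_unitary_law: "haar_unitary M \<Longrightarrow> unitary_law M"
  by (simp add: haar_unitary_def)

lemma unitary_law_mult_measurable:
  assumes "unitary_law M" "V \<in> unitary_group" "W \<in> unitary_group"
  shows "(\<lambda>A. V ** A ** W) \<in> measurable M M"
  using assms
  by (intro unitary_law_measurable_self continuous_on_matrix_mult continuous_on_id continuous_on_const unitary_mult)

lemma unitary_law_adjoint_measurable: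
  assumes "unitary_law M" shows "adjoint_matrix \<in> measurable M M"
  using assms by (intro unitary_law_measurable_self continuous_on_adjoint continuous_on_id unitary_adjoint)

lemma unitary_law_vimage_emeasure:
  assumes M: "unitary_law M" and f: "f \<in> measurable M M" and E: "E \<in> sets M"
  shows "emeasure (distr M M f) E = (\<integral>\<^sup>+A. indicator E (f A) \<partial>M)"
proof -
  have "emeasure (distr M M f) E = (\<integral>\<^sup>+A. indicator E A \<partial>distr M M f)" using E by simp
  also have "\<dots> = (\<integral>\<^sup>+A. indicator E (f A) \<partial>M)" using f E by (intro nn_integral_distr) auto
  finally show ?thesis .
qed

text \<open>
  Integrating the indicator of \<open>E\<close> at \<open>A\<^sup>* B\<close> over \<open>B\<close> first gives the mass of \<open>E\<close> under the second
  measure; integrating over \<open>A\<close> first gives its mass under the inverted first measure.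
\<close>

lemma haar_unitary_inverse:
  fixes M M' :: "'n::finite cmatrix measure"
  assumes "haar_unitary M" "haar_unitary M'"
  shows "M' = distr M M adjoint_matrix"
proof (rule measure_eqI)
  note M = haar_unitary_law[OF assms(1)] and M' = haar_unitary_law[OF assms(2)]
  interpret M: prob_space M using M by (simp add: unitary_law_def)
  interpret M': prob_space M' using M' by (simp add: unitary_law_def)
  interpret P: pair_sigma_finite M M' ..
  note sp = unitary_law_space[OF M] unitary_law_space[OF M']
  have sets: "sets M' = sets M" using M M' by (simp add: unitary_law_def)
  then show "sets M' = sets (distr M M adjoint_matrix)" by simp
  fix E assume E': "E \<in> sets M'"
  then have E: "E \<in> sets M" using sets by simp
  have left: "(\<integral>\<^sup>+A. indicator E (V ** A) \<partial>M') = emeasure M' E" if "V \<in> unitary_group" for V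
    using unitary_law_vimage_emeasure[OF M' unitary_law_mult_measurable[OF M' that unitary_one] E'] assms(2) that
    by (simp add: haar_unitary_def)
  have meas: "(\<lambda>(A, B). indicator E (adjoint_matrix A ** B) :: ennreal) \<in> borel_measurable (M \<Otimes>\<^sub>M M')"
  proof -
    have "(\<lambda>(A, B). adjoint_matrix A ** B) \<in> measurable (M \<Otimes>\<^sub>M M') M"
      by (intro unitary_law_pair_measurable M M' continuous_on_matrix_mult continuous_on_adjoint continuous_on_fst
          continuous_on_snd continuous_on_id unitary_mult unitary_adjoint)
    from measurable_compose[OF this borel_measurable_indicator[OF E]] show ?thesis
      by (simp add: case_prod_unfold)
  qed
  have "emeasure M' E = (\<integral>\<^sup>+A. emeasure M' E \<partial>M)" by (simp add: M.emeasure_space_1)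
  also have "\<dots> = (\<integral>\<^sup>+A. \<integral>\<^sup>+B. indicator E (adjoint_matrix A ** B) \<partial>M' \<partial>M)"
    by (intro nn_integral_cong) (simp add: left unitary_adjoint sp)
  also have "\<dots> = (\<integral>\<^sup>+B. \<integral>\<^sup>+A. indicator E (adjoint_matrix A ** B) \<partial>M \<partial>M')"
    using P.Fubini[of "\<lambda>(A, B). indicator E (adjoint_matrix A ** B)"] meas by simp
  also have "\<dots> = (\<integral>\<^sup>+B. emeasure (distr M M adjoint_matrix) E \<partial>M')"
  proof (rule nn_integral_cong)
    fix B assume "B \<in> space M'"
    then have B: "adjoint_matrix B \<in> unitary_group" using sp unitary_adjoint by blast
    have m: "(\<lambda>A. adjoint_matrix B ** A) \<in> measurable M M"
      using unitary_law_mult_measurable[OF M B unitary_one] by simp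
    have f: "(\<lambda>A. indicator E (adjoint_matrix A) :: ennreal) \<in> borel_measurable M"
      using measurable_compose[OF unitary_law_adjoint_measurable[OF M] borel_measurable_indicator[OF E]] .
    have "(\<integral>\<^sup>+A. indicator E (adjoint_matrix A ** B) \<partial>M) = (\<integral>\<^sup>+A. indicator E (adjoint_matrix (adjoint_matrix B ** A)) \<partial>M)"
      by (simp add: adjoint_mult)
    also have "\<dots> = (\<integral>\<^sup>+A. indicator E (adjoint_matrix A) \<partial>distr M M (\<lambda>A. adjoint_matrix B ** A))"
      using nn_integral_distr[OF m, of "\<lambda>A. indicator E (adjoint_matrix A)"] f by simp
    also have "\<dots> = (\<integral>\<^sup>+A. indicator E (adjoint_matrix A) \<partial>M)" using assms(1) B by (simp add: haar_unitary_def)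
    also have "\<dots> = emeasure (distr M M adjoint_matrix) E"
      by (rule unitary_law_vimage_emeasure[OF M unitary_law_adjoint_measurable[OF M] E, symmetric])
    finally show "(\<integral>\<^sup>+A. indicator E (adjoint_matrix A ** B) \<partial>M) = emeasure (distr M M adjoint_matrix) E" .
  qed
  also have "\<dots> = emeasure (distr M M adjoint_matrix) E" by (simp add: M'.emeasure_space_1)
  finally show "emeasure M' E = emeasure (distr M M adjoint_matrix) E" .
qed

text \<open>\<open>haar_unitary_inverse\<close> with both measures equal shows invariance under
  inversion, and right translation is left translation by the inverse, conjugated with
  inversion.\<close>

lemma haar_unitary_right_invariant:
  fixes M :: "'n::finite cmatrix measure"
  assumes "haar_unitary M" "V \<in> unitary_group"
  shows "distr M M (\<lambda>A. A ** V) = M"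
proof -
  note M = haar_unitary_law[OF assms(1)]
  have adj: "distr M M adjoint_matrix = M" using haar_unitary_inverse[OF assms(1) assms(1)] by simp
  note ma = unitary_law_adjoint_measurable[OF M]
  have mr: "(\<lambda>A. A ** V) \<in> measurable M M" using unitary_law_mult_measurable[OF M unitary_one assms(2)] by simp
  have ml: "(\<lambda>A. adjoint_matrix V ** A) \<in> measurable M M"
    using unitary_law_mult_measurable[OF M unitary_adjoint[OF assms(2)] unitary_one] by simp
  have "distr M M (\<lambda>A. A ** V) = distr (distr M M adjoint_matrix) M (\<lambda>A. A ** V)" by (simp add: adj)
  also have "\<dots> = distr M M ((\<lambda>A. A ** V) \<circ> adjoint_matrix)" by (rule distr_distr[OF mr ma])
  also have "(\<lambda>A. A ** V) \<circ> adjoint_matrix = adjoint_matrix \<circ> (\<lambda>A. adjoint_matrix V ** A)"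
    by (simp add: fun_eq_iff adjoint_mult)
  also have "distr M M (adjoint_matrix \<circ> (\<lambda>A. adjoint_matrix V ** A)) = distr (distr M M (\<lambda>A. adjoint_matrix V ** A)) M adjoint_matrix"
    by (rule distr_distr[OF ma ml, symmetric])
  also have "distr M M (\<lambda>A. adjoint_matrix V ** A) = M"
    using assms(1) unitary_adjoint[OF assms(2)] by (simp add: haar_unitary_def)
  finally show ?thesis by (simp add: adj)
qed

lemma haar_unitary_invariant:
  assumes "haar_unitary M" shows "unitarily_invariant M"
  unfolding unitarily_invariant_def
proof (intro conjI ballI)
  note M = haar_unitary_law[OF assms]
  show "unitary_law M" by (rule M)
  fix V :: "'a cmatrix" assume V: "V \<in> unitary_group"
  have mr: "(\<lambda>A. A ** adjoint_matrix V) \<in> measurable M M" and ml: "(\<lambda>A. V ** A) \<in> measurable M M"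
    using unitary_law_mult_measurable[OF M unitary_one unitary_adjoint[OF V]]
      unitary_law_mult_measurable[OF M V unitary_one] by simp_all
  have "distr M M (\<lambda>A. V ** A ** adjoint_matrix V) = distr (distr M M (\<lambda>A. V ** A)) M (\<lambda>A. A ** adjoint_matrix V)"
    using distr_distr[OF mr ml] by (simp add: comp_def)
  also have "\<dots> = M"
    using assms V haar_unitary_right_invariant[OF assms unitary_adjoint[OF V]] by (simp add: haar_unitary_def)
  finally show "distr M M (\<lambda>A. V ** A ** adjoint_matrix V) = M" .
qed

text \<open>
  Up to the volume of the unit ball, both sides are the double integral of the indicator of
  \<open>T x + y \<in> B \<and> norm y < 1\<close> over \<open>x\<close> and \<open>y\<close>, in the two orders of integration.
\<close>

lemma emeasure_lborel_isometry_vimage: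
  fixes T :: "'a::euclidean_space \<Rightarrow> 'a"
  assumes T: "linear T" "\<And>x. norm (T x) = norm x" "\<And>y. T (T' y) = y" and B: "B \<in> sets borel"
  shows "emeasure lborel (T -` B) = emeasure lborel B"
proof -
  let ?C = "ball (0::'a) 1"
  have inj: "T x = T y \<longleftrightarrow> x = y" for x y
  proof
    assume "T x = T y"
    then have "norm (x - y) = 0" using T(1,2) by (metis linear_diff norm_zero right_minus_eq)
    then show "x = y" by simp
  qed simp
  have "continuous_on UNIV T" using T(1) by (intro linear_continuous_on) (simp add: linear_conv_bounded_linear)
  then have mT: "T \<in> borel_measurable borel" by (rule borel_measurable_continuous_onI)
  then have TB: "T -` B \<in> sets borel" using B measurable_sets_borel by (metis measurable_sets space_borel Int_UNIV_right)
  have trans: "(\<integral>\<^sup>+x. f (c + x) \<partial>lborel) = (\<integral>\<^sup>+x. f x \<partial>lborel)" if "f \<in> borel_measurable borel" for f :: "'a \<Rightarrow> ennreal" and c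
    using nn_integral_distr[of "(+) c" lborel borel f] that by (simp add: lborel_distr_plus)
  let ?f = "\<lambda>x y. indicator B (T x + y) * indicator ?C y :: ennreal"
  have meas: "(\<lambda>(x, y). ?f x y) \<in> borel_measurable (lborel \<Otimes>\<^sub>M lborel)"
  proof -
    have [measurable]: "T \<in> borel_measurable borel" "B \<in> sets borel" "?C \<in> sets borel"
      by (fact mT, fact B, simp)
    show ?thesis by measurable
  qed
  \<comment> \<open>Since \<open>T (T' y) = y\<close>, adding y after T is translating by
    \<open>T' y\<close> before T, and translation invariance removes it.\<close>
  have 1: "(\<integral>\<^sup>+x. ?f x y \<partial>lborel) = emeasure lborel (T -` B) * indicator ?C y" for y
  proof -
    have "T x + y = T (T' y + x)" for x using T(1,3) by (simp add: linear_add add.commute)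
    then have i: "indicator B (T x + y) = (indicator (T -` B) (T' y + x) :: ennreal)" for x
      by (simp add: indicator_def)
    have [measurable]: "T -` B \<in> sets borel" by (fact TB)
    have "(\<lambda>x. indicator (T -` B) (T' y + x) :: ennreal) \<in> borel_measurable lborel" by measurable
    then have "(\<integral>\<^sup>+x. ?f x y \<partial>lborel) = (\<integral>\<^sup>+x. indicator (T -` B) (T' y + x) \<partial>lborel) * indicator ?C y"
      unfolding i by (rule nn_integral_multc)
    also have "(\<integral>\<^sup>+x. indicator (T -` B) (T' y + x) \<partial>lborel) = emeasure lborel (T -` B)"
      using TB by (subst trans) auto
    finally show ?thesis .
  qed
  have 2: "(\<integral>\<^sup>+y. ?f x y \<partial>lborel) = (\<integral>\<^sup>+y. indicator B y * indicator ?C (y - T x) \<partial>lborel)" for x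
  proof -
    have [measurable]: "B \<in> sets borel" "?C \<in> sets borel" by (fact B, simp)
    have "(\<lambda>y. indicator B y * indicator ?C (y - T x) :: ennreal) \<in> borel_measurable borel" by measurable
    from trans[OF this, of "T x"] show ?thesis by simp
  qed
  have 3: "(\<integral>\<^sup>+x. indicator B y * indicator ?C (y - T x) \<partial>lborel) = indicator B y * emeasure lborel ?C" for y
  proof -
    have "indicator ?C (y - T x) = (indicator ?C (- T' y + x) :: ennreal)" for x
    proof -
      have "y - T x = T (T' y - x)" using T(1,3) by (simp add: linear_diff)
      then have "norm (y - T x) = norm (- T' y + x)" using T(2) by (metis norm_minus_commute uminus_add_conv_diff)
      then show ?thesis by (simp add: indicator_def)
    qed
    note i = this
    have [measurable]: "?C \<in> sets borel" by simp
    have "(\<lambda>x. indicator ?C (- T' y + x) :: ennreal) \<in> borel_measurable lborel" by measurable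
    then have "(\<integral>\<^sup>+x. indicator B y * indicator ?C (y - T x) \<partial>lborel) = indicator B y * (\<integral>\<^sup>+x. indicator ?C (- T' y + x) \<partial>lborel)"
      unfolding i by (rule nn_integral_cmult)
    also have "(\<integral>\<^sup>+x. indicator ?C (- T' y + x) \<partial>lborel) = emeasure lborel ?C"
      by (subst trans) auto
    finally show ?thesis .
  qed
  have mm: "(\<lambda>(x, y). indicator B y * indicator ?C (y - T x) :: ennreal) \<in> borel_measurable (lborel \<Otimes>\<^sub>M lborel)"
  proof -
    have [measurable]: "T \<in> borel_measurable borel" "B \<in> sets borel" "?C \<in> sets borel"
      by (fact mT, fact B, simp)
    show ?thesis by measurable
  qed
  have "emeasure lborel (T -` B) * emeasure lborel ?C = (\<integral>\<^sup>+y. emeasure lborel (T -` B) * indicator ?C y \<partial>lborel)"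
    by (rule nn_integral_cmult_indicator[symmetric]) simp
  also have "\<dots> = (\<integral>\<^sup>+y. \<integral>\<^sup>+x. ?f x y \<partial>lborel \<partial>lborel)" by (simp only: 1)
  also have "\<dots> = (\<integral>\<^sup>+x. \<integral>\<^sup>+y. ?f x y \<partial>lborel \<partial>lborel)"
    using lborel_pair.Fubini[of "\<lambda>(x, y). ?f x y"] meas by simp
  also have "\<dots> = (\<integral>\<^sup>+x. \<integral>\<^sup>+y. indicator B y * indicator ?C (y - T x) \<partial>lborel \<partial>lborel)" by (simp only: 2)
  also have "\<dots> = (\<integral>\<^sup>+y. \<integral>\<^sup>+x. indicator B y * indicator ?C (y - T x) \<partial>lborel \<partial>lborel)"
    using lborel_pair.Fubini[of "\<lambda>(x, y). indicator B y * indicator ?C (y - T x)"] mm by simp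
  also have "\<dots> = emeasure lborel B * emeasure lborel ?C"
    using B by (simp add: 3 nn_integral_multc)
  finally have "emeasure lborel (T -` B) * emeasure lborel ?C = emeasure lborel B * emeasure lborel ?C" .
  moreover have "emeasure lborel ?C \<noteq> 0" "emeasure lborel ?C \<noteq> \<infinity>"
    using emeasure_lborel_ball_finite[of 0 1] content_ball_pos[of 1 "0::'a"] by (auto simp: measure_def)
  ultimately show ?thesis by (auto simp: mult.commute[of _ "emeasure lborel ?C"] ennreal_mult_cancel_left)
qed

text \<open>Gram-Schmidt, total on all families: \<open>sgn\<close> normalises a nonzero vector and
  is 0 at 0, so a vanishing value records that \<open>a k\<close> depends on the earlier
  vectors.\<close>

fun gs_vec :: "(nat \<Rightarrow> complex ^ 'n::finite) \<Rightarrow> nat \<Rightarrow> complex ^ 'n" where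
  "gs_vec a k = sgn (a k - (\<Sum>l<k. hprod (a k) (gs_vec a l) *s gs_vec a l))"

declare gs_vec.simps [simp del]

lemma norm_unitary_mult_vec:
  assumes "V \<in> unitary_group" shows "norm (V *v x) = norm x"
proof -
  have "complex_of_real ((norm (V *v x))\<^sup>2) = of_real ((norm x)\<^sup>2)"
    using hprod_unitary[OF assms, of x x] by (simp only: hprod_self)
  then have "(norm (V *v x))\<^sup>2 = (norm x)\<^sup>2" by (simp only: of_real_eq_iff)
  then show ?thesis by simp
qed

lemma scaleR_eq_smult: "r *\<^sub>R x = of_real r *s (x :: complex ^ 'n)"
  by (simp add: vec_eq_iff scaleR_conv_of_real[where 'a=complex])

text \<open>The recursion uses only inner products, norms and linear combinations, all compatible
  with a unitary map.\<close>

lemma gs_vec_unitary: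
  assumes "V \<in> unitary_group" shows "gs_vec (\<lambda>k. V *v a k) k = V *v gs_vec a k"
proof (induction k rule: less_induct)
  case (less k)
  let ?r = "a k - (\<Sum>l<k. hprod (a k) (gs_vec a l) *s gs_vec a l)"
  have "(\<Sum>l<k. hprod (V *v a k) (gs_vec (\<lambda>k. V *v a k) l) *s gs_vec (\<lambda>k. V *v a k) l)
      = V *v (\<Sum>l<k. hprod (a k) (gs_vec a l) *s gs_vec a l)"
    unfolding matrix_vector_sum
    by (intro sum.cong refl) (simp add: less hprod_unitary[OF assms] matrix_vector_smult)
  then have "gs_vec (\<lambda>k. V *v a k) k = sgn (V *v ?r)"
    by (simp add: gs_vec.simps[of _ k] matrix_vector_mult_diff_distrib)
  also have "\<dots> = V *v sgn ?r"
    by (simp only: sgn_div_norm norm_unitary_mult_vec[OF assms] scaleR_eq_smult matrix_vector_smult)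
  finally show ?case by (simp add: gs_vec.simps[of a k])
qed

lemma hprod_diff_left: "hprod (x - y) z = hprod x z - hprod y z"
  by (simp add: hprod_def left_diff_distrib sum_subtractf)

lemma hprod_sum_left: "hprod (\<Sum>i\<in>I. f i) z = (\<Sum>i\<in>I. hprod (f i) z)"
  by (induction I rule: infinite_finite_induct) (simp_all add: hprod_add_left, simp_all add: hprod_def)

lemma gs_vec_orthonormal:
  assumes "\<And>k. k < N \<Longrightarrow> gs_vec a k \<noteq> 0" "k < N" "l < N"
  shows "hprod (gs_vec a k) (gs_vec a l) = (if k = l then 1 else 0)"
proof -
  have self: "hprod (gs_vec a k) (gs_vec a k) = 1" if "k < N" for k
  proof -
    have "norm (gs_vec a k) = 1" using assms(1)[OF that] by (simp add: gs_vec.simps[of a k] norm_sgn sgn_zero_iff split: if_splits)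
    then show ?thesis by (simp add: hprod_self)
  qed
  have orth: "l < k \<Longrightarrow> k < N \<Longrightarrow> hprod (gs_vec a k) (gs_vec a l) = 0" for k l
  proof (induction k arbitrary: l rule: less_induct)
    case (less k)
    let ?r = "a k - (\<Sum>m<k. hprod (a k) (gs_vec a m) *s gs_vec a m)"
    have d: "hprod (gs_vec a m) (gs_vec a l) = (if m = l then 1 else 0)" if m: "m < k" for m
    proof (cases "m < l \<or> m = l")
      case True
      then show ?thesis using less.IH[of l m] less.prems self hprod_commute[of "gs_vec a m" "gs_vec a l"] by auto
    next
      case False
      then show ?thesis using less.IH[of m l] m less.prems by auto
    qed
    have "hprod ?r (gs_vec a l) = hprod (a k) (gs_vec a l) - (\<Sum>m<k. hprod (a k) (gs_vec a m) * (if m = l then 1 else 0))"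
      unfolding hprod_diff_left hprod_sum_left hprod_smult_left by (simp add: d)
    also have "\<dots> = 0" using less.prems by (simp add: if_distrib cong: if_cong)
    finally have "hprod ?r (gs_vec a l) = 0" .
    moreover have "gs_vec a k = of_real (inverse (norm ?r)) *s ?r"
      unfolding gs_vec.simps[of a k] sgn_div_norm by (rule scaleR_eq_smult)
    ultimately show ?case by (simp only: hprod_smult_left mult_zero_right)
  qed
  show ?thesis
    using self assms(2,3) orth[of l k] orth[of k l] hprod_commute[of "gs_vec a l" "gs_vec a k"]
    by (metis complex_cnj_zero complex_cnj_cancel_iff nat_neq_iff)
qed

definition col_vec :: "'n::finite cmatrix \<Rightarrow> nat \<Rightarrow> complex ^ 'n" where
  "col_vec A k = (\<chi> i. A $ i $ inv_into UNIV enum_index k)"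

definition gs_matrix :: "'n::finite cmatrix \<Rightarrow> 'n cmatrix" where
  "gs_matrix A = (\<chi> i j. gs_vec (col_vec A) (enum_index j) $ i)"

definition gs_regular :: "'n::finite cmatrix \<Rightarrow> bool" where
  "gs_regular A \<longleftrightarrow> (\<forall>k<CARD('n). gs_vec (col_vec A) k \<noteq> 0)"

lemma col_vec_mult: "col_vec (V ** A) = (\<lambda>k. V *v col_vec A k)"
  by (simp add: fun_eq_iff vec_eq_iff col_vec_def matrix_mult_nth matrix_vector_mult_def)

lemma gs_matrix_mult:
  assumes "V \<in> unitary_group" shows "gs_matrix (V ** A) = V ** gs_matrix A"
proof -
  have "gs_vec (col_vec (V ** A)) k = V *v gs_vec (col_vec A) k" for k
    by (simp only: col_vec_mult gs_vec_unitary[OF assms])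
  then show ?thesis
    by (simp add: vec_eq_iff gs_matrix_def) (simp add: matrix_mult_nth matrix_vector_mult_def)
qed

lemma gs_regular_mult:
  assumes "V \<in> unitary_group" shows "gs_regular (V ** A) \<longleftrightarrow> gs_regular A"
proof -
  have "V *v x = 0 \<longleftrightarrow> x = 0" for x :: "complex ^ 'a"
    using norm_unitary_mult_vec[OF assms, of x] by (metis norm_eq_zero)
  then show ?thesis by (simp add: gs_regular_def col_vec_mult gs_vec_unitary[OF assms])
qed

lemma gs_matrix_unitary:
  fixes A :: "'n::finite cmatrix"
  assumes "gs_regular A" shows "gs_matrix A \<in> unitary_group"
proof -
  have "(adjoint_matrix (gs_matrix A) ** gs_matrix A) $ j $ k = mat 1 $ j $ k" for j k
  proof -
    have "(adjoint_matrix (gs_matrix A) ** gs_matrix A) $ j $ k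
       = hprod (gs_vec (col_vec A) (enum_index k)) (gs_vec (col_vec A) (enum_index j))"
      by (simp add: matrix_mult_nth adjoint_nth gs_matrix_def hprod_def mult.commute)
    also have "\<dots> = (if enum_index k = enum_index j then 1 else 0)"
      using assms by (intro gs_vec_orthonormal[of "CARD('n)"]) (auto simp: gs_regular_def enum_index_less)
    finally show ?thesis by (simp add: mat_def)
  qed
  then have "adjoint_matrix (gs_matrix A) ** gs_matrix A = mat 1" by (simp add: vec_eq_iff)
  then show ?thesis using matrix_left_right_inverse unfolding unitary_group_def by blast
qed

lemma borel_measurable_vec:
  fixes f :: "'a \<Rightarrow> ('b::euclidean_space) ^ 'n::finite"
  assumes "\<And>i. (\<lambda>x. f x $ i) \<in> borel_measurable M" shows "f \<in> borel_measurable M"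
proof -
  have "f = (\<lambda>x. \<Sum>i\<in>UNIV. axis i (f x $ i))"
    by (simp add: fun_eq_iff vec_eq_iff sum_component axis_def)
  moreover have "(\<lambda>x. \<Sum>i\<in>UNIV. axis i (f x $ i)) \<in> borel_measurable M"
  proof (intro borel_measurable_sum)
    fix i :: 'n
    have "continuous_on UNIV (\<lambda>v :: 'b. if k = i then v else 0)" for k
      by (cases "k = i") simp_all
    then have "continuous_on UNIV (\<lambda>v :: 'b. axis i v :: 'b ^ 'n)"
      unfolding axis_def by (intro continuous_on_vec_lambda)
    from measurable_compose[OF assms borel_measurable_continuous_onI[OF this]]
    show "(\<lambda>x. axis i (f x $ i)) \<in> borel_measurable M" .
  qed
  ultimately show ?thesis by simp
qed

lemma borel_measurable_vec_nth:
  fixes f :: "'a \<Rightarrow> ('b::euclidean_space) ^ 'n::finite"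
  assumes "f \<in> borel_measurable M" shows "(\<lambda>x. f x $ i) \<in> borel_measurable M"
  using measurable_compose[OF assms borel_measurable_continuous_onI[OF continuous_on_nth[OF continuous_on_id]]] by simp

lemma borel_measurable_hprod:
  assumes "f \<in> borel_measurable M" "g \<in> borel_measurable M"
  shows "(\<lambda>x. hprod (f x) (g x)) \<in> borel_measurable M"
  unfolding hprod_def
  by (intro borel_measurable_sum borel_measurable_times borel_measurable_vec_nth assms
      measurable_compose[OF borel_measurable_vec_nth[OF assms(2)] borel_measurable_continuous_onI[OF continuous_on_cnj[OF continuous_on_id]]])

lemma gs_vec_measurable: "(\<lambda>A :: 'n::finite cmatrix. gs_vec (col_vec A) k) \<in> borel_measurable borel"
proof (induction k rule: less_induct)
  case (less k)
  have col: "(\<lambda>A :: 'n cmatrix. col_vec A k) \<in> borel_measurable borel"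
    unfolding col_vec_def
    by (intro borel_measurable_continuous_onI continuous_on_vec_lambda continuous_on_nth continuous_on_id)
  have smult: "(\<lambda>A :: 'n cmatrix. hprod (col_vec A k) (gs_vec (col_vec A) l) *s gs_vec (col_vec A) l) \<in> borel_measurable borel" if "l < k" for l
  proof (rule borel_measurable_vec)
    fix i
    show "(\<lambda>A :: 'n cmatrix. (hprod (col_vec A k) (gs_vec (col_vec A) l) *s gs_vec (col_vec A) l) $ i) \<in> borel_measurable borel"
      unfolding vector_smult_component
      by (intro borel_measurable_times borel_measurable_hprod borel_measurable_vec_nth col less that)
  qed
  have r: "(\<lambda>A :: 'n cmatrix. col_vec A k - (\<Sum>l<k. hprod (col_vec A k) (gs_vec (col_vec A) l) *s gs_vec (col_vec A) l)) \<in> borel_measurable borel"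
    by (intro borel_measurable_diff borel_measurable_sum col smult) auto
  show ?case
    unfolding gs_vec.simps[of _ k] sgn_div_norm
    by (intro borel_measurable_scaleR borel_measurable_inverse measurable_compose[OF r borel_measurable_norm] r)
qed

lemma gs_matrix_measurable: "gs_matrix \<in> borel_measurable borel"
  unfolding gs_matrix_def
  by (intro borel_measurable_vec) (simp add: borel_measurable_vec_nth gs_vec_measurable)

lemma gs_regular_measurable: "{A. gs_regular A} \<in> sets borel"
proof -
  have "{A :: 'a cmatrix. gs_regular A} = (\<Inter>k\<in>{..<CARD('a)}. {A \<in> space borel. gs_vec (col_vec A) k \<noteq> 0})"
    by (auto simp: gs_regular_def)
  also have "\<dots> \<in> sets borel"
  proof (intro sets.finite_INT)
    fix k
    have "{A :: 'a cmatrix. gs_vec (col_vec A) k \<in> - {0}} \<in> sets borel"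
      using measurable_sets[OF gs_vec_measurable[of k], of "- {0}"] by (simp add: vimage_def)
    then show "{A :: 'a cmatrix \<in> space borel. gs_vec (col_vec A) k \<noteq> 0} \<in> sets borel" by simp
  qed (auto simp: lessThan_empty_iff)
  finally show ?thesis .
qed

text \<open>The columns of the identity are orthonormal, so nothing is subtracted and each residual
  is a unit vector. \<open>sgn\<close> is continuous there, which carries continuity through the
  recursion.\<close>

lemma gs_vec_at_one:
  fixes k assumes "k < CARD('n::finite)"
  shows "gs_vec (col_vec (mat 1 :: 'n cmatrix)) k = col_vec (mat 1) k"
    and "isCont (\<lambda>A :: 'n cmatrix. gs_vec (col_vec A) k) (mat 1)"
proof -
  let ?c = "col_vec (mat 1 :: 'n cmatrix)"
  have c: "?c k = axis (inv_into UNIV enum_index k) 1" for k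
    by (auto simp: col_vec_def vec_eq_iff mat_def axis_def)
  have inj: "inv_into UNIV (enum_index :: 'n \<Rightarrow> nat) k \<noteq> inv_into UNIV enum_index l" if "k < CARD('n)" "l < CARD('n)" "k \<noteq> l" for k l
    using that bij_enum_index[where 'n='n] by (metis bij_betw_def f_inv_into_f lessThan_iff)
  have orth: "hprod (?c k) (?c l) = 0" if "k < CARD('n)" "l < CARD('n)" "k \<noteq> l" for k l
    unfolding c hprod_def axis_def using inj[OF that] by (auto intro!: sum.neutral)
  have nz: "?c k \<noteq> 0" "norm (?c k) = 1" for k
    unfolding c by (simp_all add: axis_eq_0_iff norm_eq_sqrt_inner inner_axis_axis)
  have colc: "isCont (\<lambda>A :: 'n cmatrix. col_vec A k) (mat 1)" for k
  proof -
    have "continuous_on UNIV (\<lambda>A :: 'n cmatrix. col_vec A k)"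
      unfolding col_vec_def by (intro continuous_on_vec_lambda continuous_on_nth continuous_on_id)
    then show ?thesis using continuous_on_eq_continuous_at[OF open_UNIV] by blast
  qed
  have "gs_vec ?c k = ?c k \<and> isCont (\<lambda>A :: 'n cmatrix. gs_vec (col_vec A) k) (mat 1)"
    using assms
  proof (induction k rule: less_induct)
    case (less k)
    let ?r = "\<lambda>A :: 'n cmatrix. col_vec A k - (\<Sum>l<k. hprod (col_vec A k) (gs_vec (col_vec A) l) *s gs_vec (col_vec A) l)"
    have "hprod (?c k) (gs_vec ?c l) = 0" if "l < k" for l
      using less that orth[of k l] by auto
    then have r1: "?r (mat 1) = ?c k" by simp
    then have "gs_vec ?c k = ?c k" unfolding gs_vec.simps[of ?c k] by (simp add: sgn_div_norm nz)
    moreover have "isCont ?r (mat 1)"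
    proof (intro continuous_intros colc)
      fix l assume "l \<in> {..<k}"
      then have g: "isCont (\<lambda>A :: 'n cmatrix. gs_vec (col_vec A) l) (mat 1)" using less by auto
      show "isCont (\<lambda>A :: 'n cmatrix. hprod (col_vec A k) (gs_vec (col_vec A) l) *s gs_vec (col_vec A) l) (mat 1)"
        unfolding hprod_def vector_scalar_mult_def isCont_def
        by (intro tendsto_vec_lambda tendsto_mult tendsto_sum tendsto_cnj tendsto_vec_nth isContD colc g)
    qed
    then have "isCont (\<lambda>A. sgn (?r A)) (mat 1)"
      unfolding isCont_def using r1 nz by (intro tendsto_sgn) auto
    ultimately show ?case unfolding gs_vec.simps[of _ k] by simp
  qed
  then show "gs_vec ?c k = ?c k" "isCont (\<lambda>A :: 'n cmatrix. gs_vec (col_vec A) k) (mat 1)" by auto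
qed

text \<open>Ensures that the set of matrices whose columns can be orthonormalised has positive
  Lebesgue measure.\<close>

lemma gs_regular_near_one: "\<exists>e>0. \<forall>A\<in>ball (mat 1 :: 'n::finite cmatrix) e. gs_regular A"
proof -
  have "eventually (\<lambda>A. gs_vec (col_vec A) k \<noteq> 0) (nhds (mat 1 :: 'n cmatrix))" if "k < CARD('n)" for k
  proof (rule tendsto_imp_eventually_ne)
    show "((\<lambda>A :: 'n cmatrix. gs_vec (col_vec A) k) \<longlongrightarrow> gs_vec (col_vec (mat 1)) k) (nhds (mat 1))"
      using gs_vec_at_one(2)[OF that] tendsto_at_iff_tendsto_nhds[of "\<lambda>A :: 'n cmatrix. gs_vec (col_vec A) k" "mat 1"]
      by (simp add: isCont_def)
    show "gs_vec (col_vec (mat 1 :: 'n cmatrix)) k \<noteq> 0"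
      unfolding gs_vec_at_one(1)[OF that] by (simp add: col_vec_def vec_eq_iff mat_def)
  qed
  then have "eventually (\<lambda>A. \<forall>k\<in>{..<CARD('n)}. gs_vec (col_vec A) k \<noteq> 0) (nhds (mat 1 :: 'n cmatrix))"
    by (intro eventually_ball_finite) auto
  then have "eventually gs_regular (nhds (mat 1 :: 'n cmatrix))"
    by (simp add: gs_regular_def[abs_def] Ball_def)
  then show ?thesis unfolding eventually_nhds_metric by (auto simp: dist_commute)
qed

text \<open>The squared norm is the sum of the squared norms of the columns, each of which is mapped
  isometrically.\<close>

lemma norm_unitary_mult:
  fixes A :: "'n::finite cmatrix"
  assumes "V \<in> unitary_group" shows "norm (V ** A) = norm A"
proof -
  have sq: "(norm A)\<^sup>2 = (\<Sum>k\<in>UNIV. (norm (\<chi> i. A $ i $ k))\<^sup>2)" for A :: "'n cmatrix"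
    by (simp add: norm_vec_def L2_set_def sum_nonneg) (rule sum.swap)
  have "(\<chi> i. (V ** A) $ i $ k) = V *v (\<chi> i. A $ i $ k)" for k
    by (simp add: vec_eq_iff matrix_mult_nth matrix_vector_mult_def)
  then have "(norm (V ** A))\<^sup>2 = (norm A)\<^sup>2" by (simp add: sq norm_unitary_mult_vec[OF assms])
  then show ?thesis by simp
qed

text \<open>
  Orthonormalising the columns of a matrix commutes with left multiplication by unitary matrices,
  which preserves Lebesgue measure; hence it maps the uniform law on a unitarily invariant bounded
  set of matrices to a Haar measure.
\<close>

lemma haar_unitary_exists: "\<exists>M :: 'n::finite cmatrix measure. haar_unitary M"
proof -
  \<comment> \<open>This radius leaves room for a ball about the identity inside \<open>S\<close>,
    while \<open>S\<close> stays bounded and hence of finite volume.\<close>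
  define R where "R = norm (mat 1 :: 'n cmatrix) + 1"
  define S where "S = {A :: 'n cmatrix. gs_regular A} \<inter> ball 0 R"
  \<comment> \<open>The value at irregular matrices, which \<open>L\<close> does not charge, keeps
    \<open>Q\<close> inside the group everywhere.\<close>
  define Q where "Q A = (if gs_regular A then gs_matrix A else mat 1)" for A :: "'n cmatrix"
  let ?U = "restrict_space borel (unitary_group :: 'n cmatrix set)"
  define L where "L = uniform_measure lborel S"
  have S: "S \<in> sets borel" unfolding S_def using gs_regular_measurable by (intro sets.Int) auto
  obtain e where e: "e > 0" "\<And>A. A \<in> ball (mat 1 :: 'n cmatrix) e \<Longrightarrow> gs_regular A"
    using gs_regular_near_one by blast
  have "ball (mat 1 :: 'n cmatrix) (min e 1) \<subseteq> S"
  proof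
    fix A :: "'n cmatrix" assume A: "A \<in> ball (mat 1) (min e 1)"
    then have "norm (A - mat 1) < 1" by (simp add: dist_norm norm_minus_commute)
    then have "norm A < R" unfolding R_def using norm_triangle_sub[of A "mat 1"] by simp
    then show "A \<in> S" using A e(2) by (simp add: S_def)
  qed
  then have "emeasure lborel (ball (mat 1 :: 'n cmatrix) (min e 1)) \<le> emeasure lborel S"
    using S by (intro emeasure_mono) auto
  moreover have "emeasure lborel (ball (mat 1 :: 'n cmatrix) (min e 1)) \<noteq> 0"
    using content_ball_pos[of "min e 1" "mat 1 :: 'n cmatrix"] e(1) by (auto simp: measure_def)
  ultimately have S0: "emeasure lborel S \<noteq> 0" by auto
  have "bounded S" unfolding S_def by (rule bounded_subset[OF bounded_ball]) auto
  then have Sfin: "emeasure lborel S \<noteq> \<infinity>" using emeasure_bounded_finite by force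
  have L: "prob_space L" unfolding L_def using S0 Sfin by (intro prob_space_uniform_measure) auto
  have Q_meas: "Q \<in> measurable borel ?U"
  proof (rule measurable_restrict_space2)
    show "Q \<in> borel_measurable borel" unfolding Q_def
      by (intro measurable_If gs_matrix_measurable measurable_const) (use gs_regular_measurable in auto)
  qed (auto simp: Q_def gs_matrix_unitary unitary_one)
  then have Q_L: "Q \<in> measurable L ?U" by (subst measurable_cong_sets[of L borel]) (simp_all add: L_def)
  define M where "M = distr L ?U Q"
  have law: "unitary_law M"
    unfolding unitary_law_def M_def using prob_space.prob_space_distr[OF L Q_L] by simp
  have "distr M M (\<lambda>A. V ** A) = M" if V: "V \<in> unitary_group" for V
  proof (rule measure_eqI)
    fix E assume "E \<in> sets (distr M M (\<lambda>A. V ** A))"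
    then have E: "E \<in> sets ?U" by (simp add: M_def)
    have mV: "(\<lambda>A. V ** A) \<in> measurable ?U ?U"
      using unitary_law_mult_measurable[OF law V unitary_one] by (simp add: M_def)
    have "distr M M (\<lambda>A. V ** A) = distr L ?U (\<lambda>A. V ** Q A)"
    proof -
      have "distr M M (\<lambda>A. V ** A) = distr (distr L ?U Q) ?U (\<lambda>A. V ** A)"
        by (rule distr_cong) (simp_all add: M_def)
      then show ?thesis using distr_distr[OF mV Q_L] by (simp add: comp_def)
    qed
    then have "emeasure (distr M M (\<lambda>A. V ** A)) E = emeasure L ((\<lambda>A. V ** Q A) -` E \<inter> space L)"
      using emeasure_distr[OF measurable_compose[OF Q_L mV] E] by simp
    also have "\<dots> = emeasure lborel (S \<inter> ((\<lambda>A. V ** Q A) -` E)) / emeasure lborel S"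
    proof -
      have "(\<lambda>A. V ** Q A) -` E \<inter> space L \<in> sets borel"
        using measurable_sets[OF measurable_compose[OF Q_L mV] E] by (simp add: L_def)
      then show ?thesis using S by (simp add: L_def)
    qed
    \<comment> \<open>\<open>S\<close> is stable under left multiplication by V, and on
      \<open>S\<close> the map \<open>Q\<close> commutes with it.\<close>
    also have "S \<inter> ((\<lambda>A. V ** Q A) -` E) = (\<lambda>A. V ** A) -` (S \<inter> Q -` E)"
    proof -
      have "A \<in> S \<and> V ** Q A \<in> E \<longleftrightarrow> V ** A \<in> S \<and> Q (V ** A) \<in> E" for A
      proof -
        have "V ** A \<in> S \<longleftrightarrow> A \<in> S" by (simp add: S_def gs_regular_mult[OF V] norm_unitary_mult[OF V])
        moreover have "Q (V ** A) = V ** Q A" if "A \<in> S"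
          using that by (simp add: S_def Q_def gs_regular_mult[OF V] gs_matrix_mult[OF V])
        ultimately show ?thesis by auto
      qed
      then show ?thesis by auto
    qed
    also have "emeasure lborel ((\<lambda>A. V ** A) -` (S \<inter> Q -` E)) = emeasure lborel (S \<inter> Q -` E)"
    proof (rule emeasure_lborel_isometry_vimage[where T'="\<lambda>A. adjoint_matrix V ** A"])
      show "linear (\<lambda>A. V ** A)"
        by (rule linearI) (simp_all add: matrix_add_ldistrib vec_eq_iff matrix_mult_nth scaleR_sum_right)
      show "S \<inter> Q -` E \<in> sets borel" using measurable_sets[OF Q_meas E] S by auto
    qed (simp_all add: norm_unitary_mult[OF V] unitary_cancel[OF V])
    also have "emeasure lborel (S \<inter> Q -` E) / emeasure lborel S = emeasure L (Q -` E \<inter> space L)"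
    proof -
      have "Q -` E \<in> sets borel" using measurable_sets[OF Q_meas E] by simp
      then show ?thesis using S by (simp add: L_def)
    qed
    also have "\<dots> = emeasure M E" unfolding M_def using emeasure_distr[OF Q_L E] by simp
    finally show "emeasure (distr M M (\<lambda>A. V ** A)) E = emeasure M E" .
  qed simp
  then show ?thesis using law unfolding haar_unitary_def by blast
qed

section \<open>Trigonometric weights\<close>

lemma vec_deriv_trig_sum:
  "((\<lambda>t. \<Sum>s\<in>S. c s * cis t powi k s) has_vector_derivative (\<Sum>s\<in>S. c s * (\<i> * of_int (k s) * cis t powi k s))) (at t)"
proof -
  have e: "cis t powi k = exp (\<i> * of_int k * of_real t)" for t k
    by (simp add: cis_conv_exp exp_power_int mult_ac)
  have "((\<lambda>t. exp (\<i> * of_int k * of_real t)) has_vector_derivative (\<i> * of_int k * exp (\<i> * of_int k * of_real t))) (at t)" for k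
  proof -
    have "((\<lambda>z. exp (\<i> * of_int k * z)) has_field_derivative (\<i> * of_int k * exp (\<i> * of_int k * of_real t)))
        (at (complex_of_real t))"
      by (auto intro!: derivative_eq_intros)
    then show ?thesis by (rule has_vector_derivative_real_field)
  qed
  then show ?thesis
    unfolding e by (intro has_vector_derivative_sum has_vector_derivative_mult_right)
qed

text \<open>The derivative is taken along \<open>cis\<close>, so a formula for w on the circle
  suffices; the factor \<open>\<i>\<close> of the angular derivative cancels against the
  normalisation.\<close>

lemma circle_deriv_trig:
  assumes w: "\<And>z. z \<in> unit_circle \<Longrightarrow> w z = (\<Sum>s\<in>S. c s * z powi k s)" and z: "z \<in> unit_circle"
  shows "circle_deriv w z = (\<Sum>s\<in>S. (c s * of_int (k s)) * z powi (k s - 1))"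
proof -
  have "z \<noteq> 0" using z by auto
  then have z0: "z \<noteq> 0" "cis (Arg z) = z" using z cis_Arg[of z] by (auto simp: sgn_eq)
  have "(\<lambda>t. w (cis t)) = (\<lambda>t. \<Sum>s\<in>S. c s * cis t powi k s)" using w by (simp add: fun_eq_iff)
  then have "vector_derivative (\<lambda>t. w (cis t)) (at (Arg z)) = (\<Sum>s\<in>S. c s * (\<i> * of_int (k s) * z powi k s))"
    using vector_derivative_at[OF vec_deriv_trig_sum[where S=S and c=c and k=k and t="Arg z"]] by (simp add: z0)
  then have "circle_deriv w z = (\<Sum>s\<in>S. - \<i> * (c s * (\<i> * of_int (k s) * z powi k s)) / z)"
    by (simp add: circle_deriv_def sum_distrib_left sum_divide_distrib)
  also have "\<dots> = (\<Sum>s\<in>S. (c s * of_int (k s)) * z powi (k s - 1))"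
  proof (intro sum.cong refl)
    fix s
    have "z powi k s / z = z powi (k s - 1)" using z0 by (simp add: power_int_diff)
    moreover have "- \<i> * (c s * (\<i> * of_int (k s) * z powi k s)) = c s * of_int (k s) * (z powi k s)"
      by (simp add: algebra_simps)
    ultimately show "- \<i> * (c s * (\<i> * of_int (k s) * z powi k s)) / z = (c s * of_int (k s)) * z powi (k s - 1)"
      by (simp only: times_divide_eq_right[symmetric])
  qed
  finally show ?thesis .
qed

lemma circle_deriv_funpow_trig:
  assumes w: "\<And>z. z \<in> unit_circle \<Longrightarrow> w z = (\<Sum>s\<in>S. c s * z powi k s)"
  shows "\<exists>c' k'. \<forall>z\<in>unit_circle. (circle_deriv ^^ j) w z = (\<Sum>s\<in>S. c' s * z powi k' s)"
proof (induction j)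
  case 0
  show ?case using w by auto
next
  case (Suc j)
  then obtain c' k' where "\<And>z. z\<in>unit_circle \<Longrightarrow> (circle_deriv ^^ j) w z = (\<Sum>s\<in>S. c' s * z powi k' s)" by blast
  from circle_deriv_trig[OF this] show ?case
    by (intro exI[of _ "\<lambda>s. c' s * of_int (k' s)"] exI[of _ "\<lambda>s. k' s - 1"]) auto
qed

text \<open>\<open>z powi k\<close> is an eigenfunction with eigenvalue \<open>- k\<close>; for the
  exponents \<open>- s\<close> of the weight the eigenvalues are the integers s, the nodes of the
  second Vandermonde determinant.\<close>

lemma neg_euler_deriv_funpow_trig:
  assumes w: "\<And>z. z \<in> unit_circle \<Longrightarrow> w z = (\<Sum>s\<in>S. c s * z powi k s)" and z: "z \<in> unit_circle"
  shows "(neg_euler_deriv ^^ j) w z = (\<Sum>s\<in>S. c s * (- of_int (k s)) ^ j * z powi k s)"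
  using z
proof (induction j arbitrary: z)
  case 0
  then show ?case using w by simp
next
  case (Suc j)
  then have z0: "z \<noteq> 0" by auto
  have "(neg_euler_deriv ^^ Suc j) w z = - z * circle_deriv ((neg_euler_deriv ^^ j) w) z"
    by (simp add: neg_euler_deriv_def)
  also have "circle_deriv ((neg_euler_deriv ^^ j) w) z = (\<Sum>s\<in>S. (c s * (- of_int (k s)) ^ j * of_int (k s)) * z powi (k s - 1))"
    by (rule circle_deriv_trig[OF Suc.IH Suc.prems])
  also have "- z * \<dots> = (\<Sum>s\<in>S. c s * (- of_int (k s)) ^ Suc j * z powi k s)"
    unfolding sum_distrib_left
  proof (intro sum.cong refl)
    fix s
    have "z * z powi (k s - 1) = z powi k s" using z0 by (simp add: power_int_diff)
    then show "- z * ((c s * (- of_int (k s)) ^ j * of_int (k s)) * z powi (k s - 1)) = c s * (- of_int (k s)) ^ Suc j * z powi k s"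
      by (simp add: algebra_simps)
  qed
  finally show ?case .
qed

lemma integrable_trig:
  assumes w: "\<And>z. z \<in> unit_circle \<Longrightarrow> w z = (\<Sum>s\<in>S. c s * z powi k s)"
  shows "integrable circle_measure w"
proof -
  interpret prob_space circle_measure by (rule prob_space_circle_measure)
  have "integrable circle_measure (\<lambda>z. z powi k)" for k
    by (rule integrable_const_bound[of _ 1]) (auto simp: space_circle_measure norm_power_int)
  then have "integrable circle_measure (\<lambda>z. \<Sum>s\<in>S. c s * z powi k s)"
    by (intro Bochner_Integration.integrable_sum integrable_mult_right)
  then show ?thesis
    by (subst Bochner_Integration.integrable_cong[OF refl, of _ _ "\<lambda>z. \<Sum>s\<in>S. c s * z powi k s"]) (auto simp: space_circle_measure w)
qed

lemma circle_transform_trig: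
  assumes w: "\<And>z. z \<in> unit_circle \<Longrightarrow> w z = (\<Sum>s<N. u s * z powi (- int s))" and j: "j < N"
  shows "circle_transform w (int j) = u j"
proof -
  interpret prob_space circle_measure by (rule prob_space_circle_measure)
  have int: "integrable circle_measure (\<lambda>z. z powi k)" for k
    by (rule integrable_const_bound[of _ 1]) (auto simp: space_circle_measure norm_power_int)
  have "circle_transform w (int j) = (\<integral>z. (\<Sum>s<N. u s * z powi (int j - int s)) \<partial>circle_measure)"
    unfolding circle_transform_def
  proof (rule Bochner_Integration.integral_cong[OF refl])
    fix z assume "z \<in> space circle_measure"
    then have z: "z \<in> unit_circle" by (simp add: space_circle_measure)
    then have "z \<noteq> 0" by auto
    then show "z powi int j * w z = (\<Sum>s<N. u s * z powi (int j - int s))"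
      unfolding w[OF z] sum_distrib_left by (intro sum.cong refl) (simp add: power_int_diff power_int_minus divide_inverse)
  qed
  also have "\<dots> = (\<Sum>s<N. u s * (\<integral>z. z powi (int j - int s) \<partial>circle_measure))"
    by (subst Bochner_Integration.integral_sum) (auto intro: int)
  also have "\<dots> = (\<Sum>s<N. if s = j then u s else 0)"
    by (intro sum.cong refl) (simp add: integral_circle_powi)
  also have "\<dots> = u j" using j by simp
  finally show ?thesis .
qed

lemma vandermonde_of_nat: "vandermonde N of_nat = (\<Prod>b<N. fact b)"
proof -
  have "(\<Prod>a<b. of_nat b - of_nat a :: complex) = fact b" for b
  proof -
    have "(\<Prod>a<b. of_nat b - of_nat a :: complex) = (\<Prod>a<b. of_nat (Suc (b - Suc a)))"
      by (intro prod.cong refl) (simp add: of_nat_diff)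
    also have "\<dots> = (\<Prod>a<b. of_nat (Suc a))" by (rule prod.nat_diff_reindex)
    also have "\<dots> = fact b" by (simp add: fact_prod_Suc lessThan_atLeast0)
    finally show ?thesis .
  qed
  then show ?thesis by (simp add: vandermonde_def)
qed

text \<open>The derivative matrix is V D B, with V the Vandermonde matrix of the inverses of the
  \<open>z a\<close>, D diagonal with entries \<open>u s\<close>, and B the Vandermonde matrix of
  the integers 0, ..., N - 1. The determinants of B and D are the products of the
  \<open>fact b\<close> and of the \<open>u s\<close> and cancel the normalisation up to
  \<open>fact N\<close>; that of V combines with \<open>vandermonde N z\<close> to the
  weight.\<close>

lemma polya_density_eq:
  assumes w: "\<And>z. z \<in> unit_circle \<Longrightarrow> w z = (\<Sum>s<N. u s * z powi (- int s))"
    and u: "\<And>s. s < N \<Longrightarrow> u s \<noteq> 0" and z: "z \<in> unit_tuples N"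
  shows "polya_density N w z = vdm_weight N z / fact N"
proof -
  define V where "V = Matrix.mat N N (\<lambda>(a, s). inverse (z a) ^ s)"
  define D where "D = Matrix.mat N N (\<lambda>(s, t). if s = t then u s else 0)"
  define B where "B = Matrix.mat N N (\<lambda>(s, b). (of_nat s :: complex) ^ b)"
  have dims: "V \<in> carrier_mat N N" "D \<in> carrier_mat N N" "B \<in> carrier_mat N N"
    by (simp_all add: V_def D_def B_def)
  have VD: "(V * D) $$ (a, t) = inverse (z a) ^ t * u t" if "a < N" "t < N" for a t
  proof -
    have "(V * D) $$ (a, t) = (\<Sum>s = 0..<N. inverse (z a) ^ s * (if s = t then u s else 0))"
      using that by (simp add: V_def D_def times_mat_def scalar_prod_def)
    also have "\<dots> = (\<Sum>s = 0..<N. if s = t then inverse (z a) ^ s * u s else 0)"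
      by (intro sum.cong) auto
    also have "\<dots> = inverse (z a) ^ t * u t" using that by simp
    finally show ?thesis .
  qed
  have "Matrix.mat N N (\<lambda>(a, b). (neg_euler_deriv ^^ b) w (z a)) = V * D * B"
  proof (rule eq_matI)
    fix a b assume "a < dim_row (V * D * B)" "b < dim_col (V * D * B)"
    then have ab: "a < N" "b < N" using dims by auto
    have za: "z a \<in> unit_circle" using z ab by (simp add: unit_tuples_def)
    have "(V * D * B) $$ (a, b) = (\<Sum>s = 0..<N. (V * D) $$ (a, s) * B $$ (s, b))"
      using ab dims by (simp add: times_mat_def scalar_prod_def)
    also have "\<dots> = (\<Sum>s<N. u s * (of_nat s) ^ b * z a powi (- int s))"
      using ab by (intro sum.cong) (auto simp: VD B_def power_int_minus power_inverse)
    also have "\<dots> = (neg_euler_deriv ^^ b) w (z a)"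
      using neg_euler_deriv_funpow_trig[OF w za, of b] by simp
    finally show "Matrix.mat N N (\<lambda>(a, b). (neg_euler_deriv ^^ b) w (z a)) $$ (a, b) = (V * D * B) $$ (a, b)"
      using ab by simp
  qed (use dims in auto)
  moreover have "Determinant.det (V * D * B) = Determinant.det V * Determinant.det D * Determinant.det B"
    using dims by (simp add: det_mult[of _ N])
  moreover have "Determinant.det V = vandermonde N (\<lambda>i. inverse (z i))"
    unfolding V_def vandermonde_def by (rule vandermonde_det)
  moreover have "Determinant.det B = (\<Prod>b<N. fact b)"
    unfolding B_def vandermonde_of_nat[symmetric] vandermonde_def by (rule vandermonde_det)
  moreover have "Determinant.det D = (\<Prod>s<N. u s)"
  proof -
    have "upper_triangular D" by (auto simp: upper_triangular_def D_def)
    then have "Determinant.det D = prod_list (diag_mat D)" using dims(2) by (rule det_upper_triangular)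
    also have "\<dots> = (\<Prod>i=0..<N. D $$ (i, i))" by (simp add: prod_list_diag_prod D_def)
    also have "\<dots> = (\<Prod>s<N. u s)" by (intro prod.cong) (auto simp: D_def)
    finally show ?thesis .
  qed
  moreover have ct: "(\<Prod>j<N. fact j * circle_transform w (int j)) = (\<Prod>j<N. fact j * u j)"
  proof (intro prod.cong refl)
    fix j assume "j \<in> {..<N}"
    then have "j < N" by simp
    have "circle_transform w (int j) = u j" by (rule circle_transform_trig[OF w \<open>j < N\<close>])
    then show "fact j * circle_transform w (int j) = fact j * u j" by simp
  qed
  ultimately have "polya_density N w z = 1 / (fact N * (\<Prod>j<N. fact j * u j)) * vandermonde N z *
     (vandermonde N (\<lambda>i. inverse (z i)) * (\<Prod>s<N. u s) * (\<Prod>b<N. fact b))"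
    unfolding polya_density_def ct by simp
  moreover have "(\<Prod>s<N. u s) \<noteq> 0" using u by simp
  ultimately show ?thesis unfolding vdm_weight_eq(1)[OF z] by (simp add: prod.distrib field_simps)
qed

text \<open>The symmetry pairs s with \<open>N - 1 - s\<close>, and each pair multiplies to a
  positive squared modulus. For odd N the middle index remains unpaired and is positive by
  assumption.\<close>

lemma prod_transform_pos:
  fixes N :: nat and u :: "nat \<Rightarrow> complex"
  assumes u: "\<And>s. s < N \<Longrightarrow> u s = cnj (u (N - 1 - s)) \<and> u s \<noteq> 0"
    and u_mid: "odd N \<Longrightarrow> 0 < u ((N - 1) div 2)"
  shows "0 < (\<Prod>s<N. u s)"
proof -
  define h where "h = N div 2"
  have pairs: "(\<Prod>s<h. u s) * (\<Prod>s<h. u (N - 1 - s)) = of_real ((norm (\<Prod>s<h. u s))\<^sup>2)"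
  proof -
    have "(\<Prod>s<h. u (N - 1 - s)) = cnj (\<Prod>s<h. u s)"
      unfolding cnj_prod
    proof (intro prod.cong refl)
      fix s assume "s \<in> {..<h}"
      then have "s < N" by (simp add: h_def)
      then show "u (N - 1 - s) = cnj (u s)" using u[of s] by simp
    qed
    then show ?thesis by (simp only: complex_norm_square)
  qed
  have nz: "u s \<noteq> 0" if "s < h" for s
    using conjunct2[OF u[of s]] that by (simp add: h_def)
  then have "(\<Prod>s<h. u s) \<noteq> 0" by simp
  then have "0 < (norm (\<Prod>s<h. u s))\<^sup>2" by (simp only: zero_less_power2 norm_eq_zero not_False_eq_True)
  then have pos: "(0::complex) < of_real ((norm (\<Prod>s<h. u s))\<^sup>2)"
    by (simp only: less_complex_def Re_complex_of_real Im_complex_of_real zero_complex.sel simp_thms)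
  have upper: "(\<Prod>s\<in>{N - h..<N}. u s) = (\<Prod>s<h. u (N - 1 - s))"
  proof (rule prod.reindex_bij_witness[of _ "\<lambda>s. N - 1 - s" "\<lambda>s. N - 1 - s"])
    have hN: "h \<le> N" by (simp add: h_def)
    fix s
    show "s \<in> {N - h..<N} \<Longrightarrow> N - 1 - (N - 1 - s) = s" by simp
    show "s \<in> {N - h..<N} \<Longrightarrow> N - 1 - s \<in> {..<h}" using hN by auto
    show "s \<in> {..<h} \<Longrightarrow> N - 1 - (N - 1 - s) = s" using hN by simp
    show "s \<in> {..<h} \<Longrightarrow> N - 1 - s \<in> {N - h..<N}" using hN by auto
    show "s \<in> {N - h..<N} \<Longrightarrow> u (N - 1 - (N - 1 - s)) = u s" by simp
  qed
  show ?thesis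
  proof (cases "odd N")
    case False
    then have Nh: "N = 2 * h" by (simp add: h_def)
    have "x \<in> {..<N} \<longleftrightarrow> x \<in> {..<h} \<union> {N - h..<N}" for x by (simp add: Nh, linarith)
    then have "{..<N} = {..<h} \<union> {N - h..<N}" by blast
    moreover have "{..<h} \<inter> {N - h..<N} = {}" by (simp add: Nh ivl_disj_int)
    ultimately have "(\<Prod>s<N. u s) = (\<Prod>s<h. u s) * (\<Prod>s\<in>{N - h..<N}. u s)"
      using prod.union_disjoint[of "{..<h}" "{N - h..<N}" u] by simp
    then show ?thesis using pos pairs upper by simp
  next
    case True
    then have Nh: "N = 2 * h + 1" by (simp add: h_def)
    have "x \<in> {..<N} \<longleftrightarrow> x \<in> insert h ({..<h} \<union> {N - h..<N})" for x by (simp add: Nh, linarith)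
    then have "{..<N} = insert h ({..<h} \<union> {N - h..<N})" by blast
    moreover have "{..<h} \<inter> {N - h..<N} = {}" by (auto simp: Nh)
    moreover have "h \<notin> {..<h} \<union> {N - h..<N}" by (simp add: Nh)
    ultimately have "(\<Prod>s<N. u s) = u h * ((\<Prod>s<h. u s) * (\<Prod>s\<in>{N - h..<N}. u s))"
      using prod.union_disjoint[of "{..<h}" "{N - h..<N}" u] by simp
    moreover have "0 < u h" using u_mid[OF True] Nh by simp
    ultimately show ?thesis using pos pairs upper by (simp add: less_complex_def)
  qed
qed

text \<open>On the circle, conjugation maps \<open>z powi (- int s)\<close> to \<open>z ^ s\<close>.
  Reversing the summation by s to \<open>N - 1 - s\<close> and using the symmetry of u produces the
  factor \<open>z ^ (N - 1)\<close>. Smoothness holds because circle derivatives of trigonometric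
  sums are again such sums.\<close>

lemma trig_L1_sym_diff:
  assumes w: "\<And>z. z \<in> unit_circle \<Longrightarrow> w z = (\<Sum>s<N. u s * z powi (- int s))"
    and u: "\<And>s. s < N \<Longrightarrow> u s = cnj (u (N - 1 - s))" and N: "N > 0"
  shows "w \<in> L1_sym_diff N"
  unfolding L1_sym_diff_def L1_sym_def
proof (intro CollectI conjI allI impI)
  show "integrable circle_measure w" by (rule integrable_trig[OF w])
  show "AE z in circle_measure. cnj (w z) = z ^ (N - 1) * w z"
  proof (rule AE_I2)
    fix z assume "z \<in> space circle_measure"
    then have z: "z \<in> unit_circle" by (simp add: space_circle_measure)
    then have z1: "norm z = 1" "z \<noteq> 0" by auto
    have cz: "cnj (z powi (- int s)) = z ^ s" for s
    proof -
      have "z * cnj z = 1" using z1 by (simp add: complex_norm_square[symmetric])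
      then have "inverse z = cnj z" by (rule inverse_unique)
      then have "z powi (- int s) = cnj z ^ s" by (simp add: power_int_minus flip: power_inverse)
      then show ?thesis by simp
    qed
    have "cnj (w z) = (\<Sum>s<N. cnj (u s) * z ^ s)" unfolding w[OF z] by (simp add: cz del: complex_cnj_power_int)
    also have "\<dots> = (\<Sum>s<N. cnj (u (N - Suc s)) * z ^ (N - Suc s))" by (rule sum.nat_diff_reindex[symmetric])
    also have "\<dots> = (\<Sum>s<N. z ^ (N - 1) * (u s * z powi (- int s)))"
    proof (intro sum.cong refl)
      fix s assume s: "s \<in> {..<N}"
      then have "z ^ (N - 1) = z ^ (N - Suc s) * z ^ s" by (simp flip: power_add)
      then show "cnj (u (N - Suc s)) * z ^ (N - Suc s) = z ^ (N - 1) * (u s * z powi (- int s))"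
        using u[of s] s z1 by (simp add: power_int_minus)
    qed
    also have "\<dots> = z ^ (N - 1) * w z" unfolding w[OF z] by (simp add: sum_distrib_left)
    finally show "cnj (w z) = z ^ (N - 1) * w z" .
  qed
next
  fix j and t :: real
  obtain c k where ck: "\<forall>z\<in>unit_circle. (circle_deriv ^^ j) w z = (\<Sum>s<N. c s * z powi k s)"
    using circle_deriv_funpow_trig[OF w, of j] by blast
  then have "(\<lambda>t. (circle_deriv ^^ j) w (cis t)) = (\<lambda>t. \<Sum>s<N. c s * cis t powi k s)" by (simp add: fun_eq_iff)
  then show "(\<lambda>t. (circle_deriv ^^ j) w (cis t)) differentiable (at t)"
    using vec_deriv_trig_sum[where S="{..<N}" and c=c and k=k and t=t] by (simp add: differentiableI_vector)
next
  fix j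
  obtain c k where ck: "\<forall>z\<in>unit_circle. (circle_deriv ^^ j) w z = (\<Sum>s<N. c s * z powi k s)"
    using circle_deriv_funpow_trig[OF w, of j] by blast
  then show "integrable circle_measure ((circle_deriv ^^ j) w)" by (intro integrable_trig[where S="{..<N}" and c=c and k=k]) blast
qed

section \<open>Eigenvalues under the Haar measure\<close>

lemma norm_vandermonde_permute:
  assumes "\<sigma> permutes {..<N}"
  shows "norm (vandermonde N (z \<circ> \<sigma>)) = norm (vandermonde N z)"
proof -
  have \<sigma>: "\<sigma> permutes {0..<N}" using assms by (simp add: lessThan_atLeast0)
  let ?A = "Matrix.mat N N (\<lambda>(i, j). z i ^ j)"
  have "vandermonde N (z \<circ> \<sigma>) = Determinant.det (Matrix.mat N N (\<lambda>(i, j). ?A $$ (\<sigma> i, j)))"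
  proof -
    have "Matrix.mat N N (\<lambda>(i, j). ?A $$ (\<sigma> i, j)) = Matrix.mat N N (\<lambda>(i, j). (z \<circ> \<sigma>) i ^ j)"
    proof (rule eq_matI)
      fix i j assume "i < dim_row (Matrix.mat N N (\<lambda>(i, j). (z \<circ> \<sigma>) i ^ j))" "j < dim_col (Matrix.mat N N (\<lambda>(i, j). (z \<circ> \<sigma>) i ^ j))"
      then have "i < N" "j < N" "\<sigma> i < N" using permutes_in_image[OF assms, of i] by auto
      then show "Matrix.mat N N (\<lambda>(i, j). ?A $$ (\<sigma> i, j)) $$ (i, j) = Matrix.mat N N (\<lambda>(i, j). (z \<circ> \<sigma>) i ^ j) $$ (i, j)" by simp
    qed auto
    then show ?thesis by (simp only: vandermonde_det vandermonde_def)
  qed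
  also have "\<dots> = signof \<sigma> * Determinant.det ?A"
    by (rule Determinant.det_permute_rows[OF _ \<sigma>]) simp
  also have "Determinant.det ?A = vandermonde N z" by (simp add: vandermonde_det vandermonde_def)
  finally have "norm (vandermonde N (z \<circ> \<sigma>)) = norm (signof \<sigma> :: complex) * norm (vandermonde N z)"
    by (simp only: norm_mult)
  then show ?thesis by (simp add: sign_def del: comp_apply)
qed

text \<open>A repetition-free list of length N over \<open>{..<N}\<close> lists the values of a
  bijection; extending it by the identity meets the convention of \<open>permutes\<close>, and the
  hypothesis on g makes this extension invisible.\<close>

lemma sum_index_lists_permutations:
  fixes g :: "(nat \<Rightarrow> nat) \<Rightarrow> complex"
  assumes "\<And>\<sigma> \<tau>. (\<And>j. j < N \<Longrightarrow> \<sigma> j = \<tau> j) \<Longrightarrow> g \<sigma> = g \<tau>"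
  shows "(\<Sum>js\<in>index_lists N N. g (\<lambda>j. js ! j)) = (\<Sum>\<sigma> | \<sigma> permutes {..<N}. g \<sigma>)"
proof (rule sum.reindex_bij_witness[of _ "\<lambda>\<sigma>. map \<sigma> [0..<N]" "\<lambda>js j. if j < N then js ! j else j"])
  fix js assume js: "js \<in> index_lists N N"
  then have len: "length js = N" and dist: "distinct js" and sub: "set js \<subseteq> {..<N}"
    by (auto simp: index_lists_def)
  let ?\<sigma> = "\<lambda>j. if j < N then js ! j else j"
  show "map ?\<sigma> [0..<N] = js" using len by (intro nth_equalityI) auto
  have "inj_on ?\<sigma> {..<N}" using dist len by (auto simp: inj_on_def nth_eq_iff_index_eq)
  moreover have "?\<sigma> ` {..<N} \<subseteq> {..<N}" using sub len nth_mem by fastforce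
  ultimately have "bij_betw ?\<sigma> {..<N} {..<N}" unfolding bij_betw_def using endo_inj_surj[OF finite_lessThan] by blast
  then have "?\<sigma> permutes {..<N}" by (rule bij_imp_permutes) auto
  then show "?\<sigma> \<in> {\<sigma>. \<sigma> permutes {..<N}}" by simp
  show "g ?\<sigma> = g (\<lambda>j. js ! j)" by (rule assms) simp
next
  fix \<sigma> assume "\<sigma> \<in> {\<sigma>. \<sigma> permutes {..<N}}"
  then have \<sigma>: "\<sigma> permutes {..<N}" by simp
  show "(\<lambda>j. if j < N then map \<sigma> [0..<N] ! j else j) = \<sigma>"
    by (rule ext) (simp add: permutes_not_in[OF \<sigma>])
  have "inj_on \<sigma> {0..<N}" by (rule inj_on_subset[OF permutes_inj[OF \<sigma>] subset_UNIV])
  then show "map \<sigma> [0..<N] \<in> index_lists N N"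
    by (auto simp: index_lists_def distinct_map permutes_in_image[OF \<sigma>, of _, unfolded lessThan_iff])
qed

text \<open>Adding the same k to all exponents makes them nonnegative and multiplies the monomial by
  the k-th power of the product of all variables; \<open>inv_prod N z ^ k\<close> undoes this. The
  permuted monomials then sum to \<open>msym\<close>.\<close>

lemma sum_permuted_monomials:
  fixes l :: "nat \<Rightarrow> int"
  obtains f k where "f \<in> lincomb (range (eprod N))"
    "\<And>z. z \<in> unit_tuples N \<Longrightarrow> (\<Sum>\<sigma> | \<sigma> permutes {..<N}. \<Prod>j<N. z (\<sigma> j) powi l j) = f z * inv_prod N z ^ k"
proof -
  define k where "k = (\<Sum>j<N. nat \<bar>l j\<bar>)"
  define ls where "ls = map (\<lambda>j. nat (l j + int k)) [0..<N]"
  have nonneg: "l j + int k \<ge> 0" if "j < N" for j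
  proof -
    have "nat \<bar>l j\<bar> \<le> k" unfolding k_def using that by (intro member_le_sum) auto
    then show ?thesis by linarith
  qed
  have "(\<Sum>\<sigma> | \<sigma> permutes {..<N}. \<Prod>j<N. z (\<sigma> j) powi l j) = msym N ls z * inv_prod N z ^ k"
    if z: "z \<in> unit_tuples N" for z
  proof -
    have "(\<Prod>j<N. z (\<sigma> j) powi l j) = (\<Prod>j<N. z (\<sigma> j) ^ (ls ! j)) * inv_prod N z ^ k"
      if \<sigma>: "\<sigma> permutes {..<N}" for \<sigma>
    proof -
      have "inv_prod N z = (\<Prod>j<N. inverse (z (\<sigma> j)))"
        unfolding inv_prod_def using prod.permute[OF \<sigma>, of "\<lambda>i. inverse (z i)"] by (simp add: comp_def)
      then have "(\<Prod>j<N. z (\<sigma> j) ^ (ls ! j)) * inv_prod N z ^ k = (\<Prod>j<N. z (\<sigma> j) ^ (ls ! j) * inverse (z (\<sigma> j)) ^ k)"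
        by (simp add: prod.distrib prod_power_distrib)
      also have "\<dots> = (\<Prod>j<N. z (\<sigma> j) powi l j)"
      proof (intro prod.cong refl)
        fix j assume "j \<in> {..<N}"
        then have j: "j < N" "\<sigma> j < N" using permutes_in_image[OF \<sigma>, of j] by auto
        then have nz: "z (\<sigma> j) \<noteq> 0" using unit_tuples_nonzero[OF z] by simp
        have "z (\<sigma> j) ^ (ls ! j) = z (\<sigma> j) powi (l j + int k)"
          using nonneg[OF j(1)] j(1) by (simp add: ls_def power_int_def)
        also have "\<dots> = z (\<sigma> j) powi l j * z (\<sigma> j) ^ k" using nz by (simp add: power_int_add)
        finally show "z (\<sigma> j) ^ (ls ! j) * inverse (z (\<sigma> j)) ^ k = z (\<sigma> j) powi l j"
          using nz by (simp add: power_inverse)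
      qed
      finally show ?thesis ..
    qed
    then have "(\<Sum>\<sigma> | \<sigma> permutes {..<N}. \<Prod>j<N. z (\<sigma> j) powi l j)
      = (\<Sum>\<sigma> | \<sigma> permutes {..<N}. \<Prod>j<N. z (\<sigma> j) ^ (ls ! j)) * inv_prod N z ^ k"
      unfolding sum_distrib_right by (intro sum.cong) auto
    also have "(\<Sum>\<sigma> | \<sigma> permutes {..<N}. \<Prod>j<N. z (\<sigma> j) ^ (ls ! j)) = msym N ls z"
    proof -
      have "length ls = N" by (simp add: ls_def)
      then have "msym N ls z = (\<Sum>js\<in>index_lists N N. \<Prod>j<N. z (js ! j) ^ (ls ! j))" by (simp add: msym_def)
      also have "\<dots> = (\<Sum>\<sigma> | \<sigma> permutes {..<N}. \<Prod>j<N. z (\<sigma> j) ^ (ls ! j))"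
        by (rule sum_index_lists_permutations[where g="\<lambda>\<sigma>. \<Prod>j<N. z (\<sigma> j) ^ (ls ! j)"]) simp
      finally show ?thesis ..
    qed
    finally show ?thesis .
  qed
  then show ?thesis using that[of "msym N ls" k] msym_in_lincomb_eprod by blast
qed

section \<open>Symmetrisation by a random permutation of the coordinates\<close>

lemma permute_coords_measurable:
  assumes "\<sigma> permutes {..<N}"
  shows "(\<lambda>z. z \<circ> \<sigma>) \<in> measurable (torus_measure N) (torus_measure N)"
  unfolding torus_measure_def
proof (rule measurable_PiM_single')
  fix j assume "j \<in> {..<N}"
  then have "\<sigma> j \<in> {..<N}" using permutes_in_image[OF assms] by simp
  then show "(\<lambda>z. (z \<circ> \<sigma>) j) \<in> measurable (Pi\<^sub>M {..<N} (\<lambda>_. circle_measure)) circle_measure"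
    unfolding comp_def by (rule measurable_component_singleton)
next
  show "(\<lambda>z. z \<circ> \<sigma>) \<in> space (Pi\<^sub>M {..<N} (\<lambda>_. circle_measure)) \<rightarrow> (\<Pi>\<^sub>E i\<in>{..<N}. space circle_measure)"
  proof (rule Pi_I)
    fix z assume "z \<in> space (Pi\<^sub>M {..<N} (\<lambda>_. circle_measure))"
    then have z: "z \<in> (\<Pi>\<^sub>E i\<in>{..<N}. space circle_measure)" by (simp add: space_PiM)
    show "z \<circ> \<sigma> \<in> (\<Pi>\<^sub>E i\<in>{..<N}. space circle_measure)"
    proof (rule PiE_I)
      fix j assume "j \<in> {..<N}"
      then have "\<sigma> j \<in> {..<N}" using permutes_in_image[OF assms] by simp
      then show "(z \<circ> \<sigma>) j \<in> space circle_measure" using z by (auto simp: PiE_iff)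
    next
      fix j assume "j \<notin> {..<N}"
      then show "(z \<circ> \<sigma>) j = undefined" using z permutes_not_in[OF assms] by (auto simp: PiE_iff extensional_def)
    qed
  qed
qed

text \<open>The law of the tuple after an independent uniform permutation of its coordinates. Its
  Fourier coefficients are integrals of symmetric functions under M, and it agrees with M on
  permutation-closed events, so symmetric functions suffice to compare measures there.\<close>

definition symmetrized :: "nat \<Rightarrow> (nat \<Rightarrow> complex) measure \<Rightarrow> (nat \<Rightarrow> complex) measure" where
  "symmetrized N M = distr (uniform_count_measure {\<sigma>. \<sigma> permutes {..<N}} \<Otimes>\<^sub>M M) (torus_measure N) (\<lambda>(\<sigma>, z). z \<circ> \<sigma>)"

context
  fixes N :: nat and M :: "(nat \<Rightarrow> complex) measure"
  assumes M: "prob_space M" "sets M = sets (torus_measure N)"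
begin

lemma symmetrized_map_measurable:
  "(\<lambda>(\<sigma>, z). z \<circ> \<sigma>) \<in> measurable (uniform_count_measure {\<sigma>. \<sigma> permutes {..<N}} \<Otimes>\<^sub>M M) (torus_measure N)"
proof -
  let ?S = "{\<sigma>. \<sigma> permutes {..<N}}"
  have fin: "finite ?S" by (rule finite_permutations) simp
  have "(\<lambda>(\<sigma>, z). z \<circ> \<sigma>) \<in> measurable (count_space ?S \<Otimes>\<^sub>M M) (torus_measure N)"
  proof (rule measurable_pair_measure_countable1)
    fix \<sigma> assume "\<sigma> \<in> ?S"
    then have "(\<lambda>z. z \<circ> \<sigma>) \<in> measurable (torus_measure N) (torus_measure N)" by (intro permute_coords_measurable) simp
    then show "(\<lambda>y. case (\<sigma>, y) of (\<sigma>, z) \<Rightarrow> z \<circ> \<sigma>) \<in> measurable M (torus_measure N)"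
      using measurable_cong_sets[OF M(2) refl] by auto
  qed (rule countable_finite[OF fin])
  moreover have "sets (uniform_count_measure ?S \<Otimes>\<^sub>M M) = sets (count_space ?S \<Otimes>\<^sub>M M)"
    by (intro sets_pair_measure_cong) (simp_all add: sets_uniform_count_measure)
  ultimately show ?thesis using measurable_cong_sets by blast
qed

lemma prob_space_permutations: "prob_space (uniform_count_measure {\<sigma>. \<sigma> permutes {..<N}})"
proof (rule prob_space_uniform_count_measure)
  show "finite {\<sigma>. \<sigma> permutes {..<N}}" by (rule finite_permutations) simp
  show "{\<sigma>. \<sigma> permutes {..<N}} \<noteq> {}" using permutes_id by blast
qed

lemma prob_space_symmetrized: "prob_space (symmetrized N M)"
proof -
  interpret P: prob_space "uniform_count_measure {\<sigma>. \<sigma> permutes {..<N}}" by (rule prob_space_permutations)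
  interpret M: prob_space M by (rule M)
  interpret PM: pair_prob_space "uniform_count_measure {\<sigma>. \<sigma> permutes {..<N}}" M ..
  show ?thesis unfolding symmetrized_def by (rule PM.prob_space_distr[OF symmetrized_map_measurable])
qed

lemma integral_symmetrized:
  assumes f: "bdd_torus_fun N f"
  shows "integral\<^sup>L (symmetrized N M) f = (\<integral>z. (\<Sum>\<sigma> | \<sigma> permutes {..<N}. f (z \<circ> \<sigma>)) \<partial>M) / fact N"
proof -
  let ?S = "{\<sigma>. \<sigma> permutes {..<N}}"
  have fin: "finite ?S" by (rule finite_permutations) simp
  have card: "card ?S = fact N" using card_permutations[of "{..<N}" N] by simp
  interpret P: prob_space "uniform_count_measure ?S" by (rule prob_space_permutations)
  interpret M: prob_space M by (rule M)
  interpret PM: pair_prob_space "uniform_count_measure ?S" M ..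
  have fm: "f \<in> borel_measurable (torus_measure N)" using f by (simp add: bdd_torus_fun_def)
  obtain K where K: "\<And>z. z \<in> unit_tuples N \<Longrightarrow> norm (f z) \<le> K" using f unfolding bdd_torus_fun_def by blast
  have sp: "space M = space (torus_measure N)" using M(2) by (rule sets_eq_imp_space_eq)
  have comp_bound: "norm (f (z \<circ> \<sigma>)) \<le> K" if "\<sigma> \<in> ?S" "z \<in> space M" for \<sigma> z
  proof -
    have "z \<circ> \<sigma> \<in> space (torus_measure N)"
      using that measurable_space[OF permute_coords_measurable] sp by simp
    then show ?thesis using K space_torus_unit_tuples by blast
  qed
  have m2: "(\<lambda>p. f (snd p \<circ> fst p)) \<in> borel_measurable (uniform_count_measure ?S \<Otimes>\<^sub>M M)"
    using measurable_compose[OF symmetrized_map_measurable fm] by (simp add: case_prod_unfold)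
  have int: "integrable (uniform_count_measure ?S \<Otimes>\<^sub>M M) (\<lambda>p. f (snd p \<circ> fst p))"
    using comp_bound by (intro PM.integrable_const_bound[OF _ m2, of K] AE_I2)
      (auto simp: space_pair_measure space_uniform_count_measure)
  have "integral\<^sup>L (symmetrized N M) f = (\<integral>p. f (snd p \<circ> fst p) \<partial>(uniform_count_measure ?S \<Otimes>\<^sub>M M))"
    unfolding symmetrized_def using integral_distr[OF symmetrized_map_measurable fm] by (simp add: case_prod_unfold)
  also have "\<dots> = (\<integral>\<sigma>. (\<integral>z. f (z \<circ> \<sigma>) \<partial>M) \<partial>uniform_count_measure ?S)"
    using PM.integral_fst'[OF int] by simp
  also have "\<dots> = (\<Sum>\<sigma>\<in>?S. \<integral>z. f (z \<circ> \<sigma>) \<partial>M) / fact N"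
    using fin unfolding uniform_count_measure_def
    by (subst lebesgue_integral_point_measure_finite) (auto simp: card scaleR_conv_of_real sum_divide_distrib)
  also have "(\<Sum>\<sigma>\<in>?S. \<integral>z. f (z \<circ> \<sigma>) \<partial>M) = (\<integral>z. (\<Sum>\<sigma>\<in>?S. f (z \<circ> \<sigma>)) \<partial>M)"
  proof (rule Bochner_Integration.integral_sum[symmetric])
    fix \<sigma> assume \<sigma>: "\<sigma> \<in> ?S"
    have "(\<lambda>z. f (z \<circ> \<sigma>)) \<in> borel_measurable (torus_measure N)"
      using measurable_compose[OF permute_coords_measurable fm] \<sigma> by simp
    then have "(\<lambda>z. f (z \<circ> \<sigma>)) \<in> borel_measurable M" using measurable_cong_sets[OF M(2) refl] by blast
    then show "integrable M (\<lambda>z. f (z \<circ> \<sigma>))"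
      using comp_bound[OF \<sigma>] by (intro M.integrable_const_bound[of _ K]) auto
  qed
  finally show ?thesis .
qed

lemma emeasure_symmetrized:
  assumes B: "B \<in> sets (torus_measure N)" "permutation_closed N B"
  shows "emeasure (symmetrized N M) B = emeasure M B"
proof -
  let ?S = "{\<sigma>. \<sigma> permutes {..<N}}"
  interpret P: prob_space "uniform_count_measure ?S" by (rule prob_space_permutations)
  interpret M: prob_space M by (rule M)
  interpret PM: pair_prob_space "uniform_count_measure ?S" M ..
  have sp: "space M = space (torus_measure N)" using M(2) by (rule sets_eq_imp_space_eq)
  have BM: "B \<in> sets M" using B M(2) by simp
  \<comment> \<open>\<open>permutation_closed\<close> gives one implication; the other one applies
    it to the inverse permutation.\<close>
  have iff: "z \<circ> \<sigma> \<in> B \<longleftrightarrow> z \<in> B" if \<sigma>: "\<sigma> permutes {..<N}" for \<sigma> z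
  proof
    assume "z \<circ> \<sigma> \<in> B"
    then have "z \<circ> \<sigma> \<circ> inv_into UNIV \<sigma> \<in> B" using B(2) permutes_inv[OF \<sigma>] unfolding permutation_closed_def by blast
    then show "z \<in> B" using permutes_inv_o(1)[OF \<sigma>] by (simp add: comp_assoc)
  qed (use B(2) \<sigma> in \<open>auto simp: permutation_closed_def\<close>)
  have "emeasure (symmetrized N M) B = emeasure (uniform_count_measure ?S \<Otimes>\<^sub>M M)
     ((\<lambda>(\<sigma>, z). z \<circ> \<sigma>) -` B \<inter> space (uniform_count_measure ?S \<Otimes>\<^sub>M M))"
    unfolding symmetrized_def using symmetrized_map_measurable B(1) by (rule emeasure_distr)
  also have "(\<lambda>(\<sigma>, z). z \<circ> \<sigma>) -` B \<inter> space (uniform_count_measure ?S \<Otimes>\<^sub>M M) = ?S \<times> B"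
    using iff sets.sets_into_space[OF BM] by (auto simp: space_pair_measure space_uniform_count_measure)
  also have "emeasure (uniform_count_measure ?S \<Otimes>\<^sub>M M) (?S \<times> B) = emeasure (uniform_count_measure ?S) ?S * emeasure M B"
    using BM by (intro M.emeasure_pair_measure_Times) (auto simp: sets_uniform_count_measure)
  also have "emeasure (uniform_count_measure ?S) ?S = 1"
    using P.emeasure_space_1 by (simp add: space_uniform_count_measure)
  finally show ?thesis by simp
qed

end

text \<open>The symmetrised measures have the same Fourier coefficients: these are averages of
  permuted monomials, hence combinations of the integrals in
  \<open>loop_equations_unique_eprod\<close>.\<close>

lemma loop_equations_unique:
  assumes N: "N > 0"
    and M: "prob_space M" "sets M = sets (torus_measure N)" "loop_equations N M"
    and M': "prob_space M'" "sets M' = sets (torus_measure N)" "loop_equations N M'"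
    and B: "B \<in> sets (torus_measure N)" "permutation_closed N B"
  shows "emeasure M B = emeasure M' B"
proof -
  have "symmetrized N M = symmetrized N M'"
  proof (rule torus_measure_eqI[of _ _ N])
    show "finite_measure (symmetrized N M)" "finite_measure (symmetrized N M')"
      using prob_space_symmetrized[OF M(1,2)] prob_space_symmetrized[OF M'(1,2)]
      by (simp_all add: prob_space.finite_measure)
    show "sets (symmetrized N M) = sets (torus_measure N)" "sets (symmetrized N M') = sets (torus_measure N)"
      by (simp_all add: symmetrized_def)
    fix l :: "nat \<Rightarrow> int"
    have bdd_prod: "bdd_torus_fun N (\<lambda>z. \<Prod>j\<in>A. z j powi l j)" if "A \<subseteq> {..<N}" for A
    proof -
      have "finite A" using that finite_subset by blast
      then show ?thesis using that
        by (induction A rule: finite_induct) (auto intro: bdd_torus_fun_const bdd_torus_fun_mult bdd_torus_fun_powi)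
    qed
    obtain f k where f: "f \<in> lincomb (range (eprod N))"
      "\<And>z. z \<in> unit_tuples N \<Longrightarrow> (\<Sum>\<sigma> | \<sigma> permutes {..<N}. \<Prod>j<N. z (\<sigma> j) powi l j) = f z * inv_prod N z ^ k"
      using that by (rule sum_permuted_monomials[of N l])
    let ?B = "range (\<lambda>ms z. eprod N ms z * inv_prod N z ^ k)"
    have fB: "(\<lambda>z. f z * inv_prod N z ^ k) \<in> lincomb ?B"
      by (rule lincomb_mult[OF _ f(1) lincomb_gen[OF singletonI]]) (auto intro!: lincomb_gen)
    have bdd: "bdd_torus_fun N (\<lambda>z. eprod N ms z * inv_prod N z ^ k)" for ms
      using sym_deriv_mult[OF sym_deriv_eprod[of N ms] sym_deriv_inv_prod_power[of N k]]
      by (rule bdd_torus_fun_sym_deriv(1))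
    have "integrable M (\<lambda>z. f z * inv_prod N z ^ k) \<and> integrable M' (\<lambda>z. f z * inv_prod N z ^ k) \<and>
      (\<integral>z. f z * inv_prod N z ^ k \<partial>M) = (\<integral>z. f z * inv_prod N z ^ k \<partial>M')"
    proof (rule lincomb_integral_eq[OF fB])
      fix b assume "b \<in> ?B"
      then obtain ms where ms: "b = (\<lambda>z. eprod N ms z * inv_prod N z ^ k)" by blast
      show "integrable M b" "integrable M' b"
        unfolding ms using bdd_torus_fun_integrable[OF bdd] M(1,2) M'(1,2) by (simp_all add: prob_space.finite_measure)
      show "integral\<^sup>L M b = integral\<^sup>L M' b"
        unfolding ms by (rule loop_equations_unique_eprod[OF N M M'])
    qed
    moreover have "(\<integral>z. (\<Sum>\<sigma> | \<sigma> permutes {..<N}. \<Prod>j<N. (z \<circ> \<sigma>) j powi l j) \<partial>X) = (\<integral>z. f z * inv_prod N z ^ k \<partial>X)"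
      if "sets X = sets (torus_measure N)" for X
    proof (rule Bochner_Integration.integral_cong[OF refl])
      fix z assume "z \<in> space X"
      then have "z \<in> unit_tuples N" using sets_eq_imp_space_eq[OF that] space_torus_unit_tuples by blast
      then show "(\<Sum>\<sigma> | \<sigma> permutes {..<N}. \<Prod>j<N. (z \<circ> \<sigma>) j powi l j) = f z * inv_prod N z ^ k" using f(2) by simp
    qed
    ultimately show "(\<integral>z. (\<Prod>j<N. z j powi l j) \<partial>symmetrized N M) = (\<integral>z. (\<Prod>j<N. z j powi l j) \<partial>symmetrized N M')"
      unfolding integral_symmetrized[OF M(1,2) bdd_prod[OF order_refl]] integral_symmetrized[OF M'(1,2) bdd_prod[OF order_refl]]
      using M(2) M'(2) by simp
  qed
  then show ?thesis using emeasure_symmetrized[OF M(1,2) B] emeasure_symmetrized[OF M'(1,2) B] by simp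
qed

text \<open>Any listing of the eigenvalues is a permutation of the selected one, so a
  permutation-closed event is decided by \<open>eigen_sel A\<close>.\<close>

lemma eigenvalue_event:
  fixes A :: "'n::finite cmatrix"
  assumes "A \<in> unitary_group" "B \<in> sets (torus_measure CARD('n))" "permutation_closed CARD('n) B"
  shows "(\<exists>z\<in>B. eigenvalue_tuple A z) \<longleftrightarrow> eigen_sel A \<in> B"
proof
  obtain V where V: "V \<in> unitary_group" "A = conj_diag V (eigen_sel A)" using eigen_sel(2)[OF assms(1)] by blast
  have et: "eigenvalue_tuple A (eigen_sel A)" using eigenvalue_tuple_conj_diag[OF V(1), of "eigen_sel A"] V(2) by simp
  then show "eigen_sel A \<in> B \<Longrightarrow> \<exists>z\<in>B. eigenvalue_tuple A z" by blast
  assume "\<exists>z\<in>B. eigenvalue_tuple A z"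
  then obtain z where z: "z \<in> B" "eigenvalue_tuple A z" by blast
  obtain \<sigma> where \<sigma>: "\<sigma> permutes {..<CARD('n)}" "\<And>j. j < CARD('n) \<Longrightarrow> eigen_sel A j = z (\<sigma> j)"
    using eigenvalue_tuple_unique[OF et z(2)] by blast
  have "z \<in> space (torus_measure CARD('n))" using z(1) sets.sets_into_space[OF assms(2)] by blast
  then have z_ext: "z \<in> extensional {..<CARD('n)}" unfolding space_torus_measure PiE_def by (rule IntD2)
  have sel_ext: "eigen_sel A \<in> extensional {..<CARD('n)}"
    using eigen_sel(1)[OF assms(1)] unfolding space_torus_measure PiE_def by (rule IntD2)
  \<comment> \<open>Equality of functions also concerns indices from \<open>CARD('n)\<close> on:
    there both tuples take the default value of extensional functions, and \<open>\<sigma>\<close>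
    is the identity.\<close>
  have "eigen_sel A j = (z \<circ> \<sigma>) j" for j
  proof (cases "j \<in> {..<CARD('n)}")
    case False
    show ?thesis
      unfolding comp_apply permutes_not_in[OF \<sigma>(1) False] extensional_arb[OF z_ext False] extensional_arb[OF sel_ext False] ..
  qed (simp only: \<sigma>(2) comp_apply lessThan_iff)
  then have "eigen_sel A = z \<circ> \<sigma>" by (rule ext)
  then show "eigen_sel A \<in> B" using z(1) \<sigma>(1) assms(3) by (auto simp: permutation_closed_def)
qed

lemma unitary_law_eigen_sel_measurable:
  fixes M :: "'n::finite cmatrix measure"
  assumes "unitary_law M" shows "eigen_sel \<in> measurable M (torus_measure CARD('n))"
  using eigen_sel_measurable assms by (simp add: unitary_law_def cong: measurable_cong_sets)

lemma eigenvalue_event_set: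
  fixes M :: "'n::finite cmatrix measure"
  assumes "unitary_law M" "B \<in> sets (torus_measure CARD('n))" "permutation_closed CARD('n) B"
  shows "{A \<in> space M. \<exists>z\<in>B. eigenvalue_tuple A z} = eigen_sel -` B \<inter> space M"
  using eigenvalue_event[OF _ assms(2,3)] unitary_law_space[OF assms(1)] by auto

text \<open>The law of the selected eigenvalues satisfies the loop equations by right invariance of
  M, as does \<open>circular_law\<close>; uniqueness identifies the two on permutation-closed
  events.\<close>

lemma haar_eigenvalue_law:
  fixes M :: "'n::finite cmatrix measure"
  assumes M: "haar_unitary M" and B: "B \<in> sets (torus_measure CARD('n))" "permutation_closed CARD('n) B"
  shows "{A \<in> space M. \<exists>z\<in>B. eigenvalue_tuple A z} \<in> sets M"
    and "emeasure M {A \<in> space M. \<exists>z\<in>B. eigenvalue_tuple A z} = emeasure (circular_law CARD('n)) B"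
proof -
  note law = haar_unitary_law[OF M]
  interpret prob_space M using law by (simp add: unitary_law_def)
  note sel = unitary_law_eigen_sel_measurable[OF law]
  note ev = eigenvalue_event_set[OF law B]
  show "{A \<in> space M. \<exists>z\<in>B. eigenvalue_tuple A z} \<in> sets M"
    unfolding ev using sel B(1) by (rule measurable_sets)
  let ?D = "distr M (torus_measure CARD('n)) eigen_sel"
  have loop: "loop_equations CARD('n) ?D"
    unfolding loop_equations_def
  proof (intro allI impI)
    fix a f d assume fd: "sym_deriv CARD('n) f d"
    let ?G = "\<lambda>z. repulsion CARD('n) a z * f z + (\<Sum>i<CARD('n). z i ^ a * d i z)"
    have "bdd_torus_fun CARD('n) ?G"
      by (intro bdd_torus_fun_add bdd_torus_fun_mult bdd_torus_fun_sum bdd_torus_fun_power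
          bdd_torus_fun_repulsion bdd_torus_fun_sym_deriv[OF fd]) simp_all
    then have "?G \<in> borel_measurable (torus_measure CARD('n))" unfolding bdd_torus_fun_def by (rule conjunct1)
    then have "integral\<^sup>L ?D ?G = (\<integral>A. ?G (eigen_sel A) \<partial>M)" by (rule integral_distr[OF sel])
    also have "\<dots> = 0"
    proof (rule loop_equation_unitary[OF law _ _ fd])
      show "distr M M (\<lambda>A. A ** V) = M" if "V \<in> unitary_group" for V :: "'n cmatrix"
        by (rule haar_unitary_right_invariant[OF M that])
      show "eigen_sel A \<in> unit_tuples CARD('n) \<and> (\<exists>V\<in>unitary_group. A = conj_diag V (eigen_sel A))"
        if "A \<in> unitary_group" for A :: "'n cmatrix"
        using eigen_sel(1,2)[OF that] space_torus_unit_tuples by blast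
    qed
    finally show "integral\<^sup>L ?D ?G = 0" .
  qed
  have "emeasure M {A \<in> space M. \<exists>z\<in>B. eigenvalue_tuple A z} = emeasure ?D B"
    unfolding ev by (rule emeasure_distr[OF sel B(1), symmetric])
  also have "\<dots> = emeasure (circular_law CARD('n)) B"
    by (rule loop_equations_unique[OF _ prob_space_distr[OF sel] _ loop prob_space_circular_law sets_circular_law
        loop_equations_circular_law B]) simp_all
  finally show "emeasure M {A \<in> space M. \<exists>z\<in>B. eigenvalue_tuple A z} = emeasure (circular_law CARD('n)) B" .
qed

lemma haar_eigenvalue_density:
  fixes M :: "'n::finite cmatrix measure"
  assumes M: "haar_unitary M"
    and w: "\<And>z. z \<in> unit_circle \<Longrightarrow> w z = (\<Sum>s<CARD('n). u s * z powi (- int s))"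
    and u: "\<And>s. s < CARD('n) \<Longrightarrow> u s \<noteq> 0"
  shows "eigenvalue_density M (polya_density CARD('n) w)"
proof -
  let ?N = "CARD('n)" and ?T = "torus_measure CARD('n)"
  let ?r = "\<lambda>z. (norm (vandermonde CARD('n) z))\<^sup>2 / fact CARD('n)"
  have p: "polya_density ?N w z = of_real (?r z)" if "z \<in> space ?T" for z
  proof -
    have z: "z \<in> unit_tuples ?N" using that space_torus_unit_tuples by blast
    have "polya_density ?N w z = vdm_weight ?N z / fact ?N" by (rule polya_density_eq[OF w u z])
    then show ?thesis using vdm_weight_eq(2)[OF z] by simp
  qed
  have r_measurable: "?r \<in> borel_measurable ?T" by measurable
  have "(\<lambda>z. complex_of_real (?r z)) \<in> borel_measurable ?T" by (rule measurable_compose[OF r_measurable borel_measurable_of_real])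
  moreover have "polya_density ?N w \<in> borel_measurable ?T \<longleftrightarrow> (\<lambda>z. complex_of_real (?r z)) \<in> borel_measurable ?T"
    by (rule measurable_cong) (rule p)
  ultimately have "polya_density ?N w \<in> borel_measurable ?T" by (simp only:)
  moreover have "AE z in ?T. 0 \<le> polya_density ?N w z"
  proof (rule AE_I2)
    fix z assume "z \<in> space ?T"
    then show "0 \<le> polya_density ?N w z"
      by (simp add: p less_eq_complex_def del: of_real_divide of_real_power)
  qed
  moreover have "AE z in ?T. polya_density ?N w (z \<circ> \<sigma>) = polya_density ?N w z" if \<sigma>: "\<sigma> permutes {..<?N}" for \<sigma>
  proof (rule AE_I2)
    fix z assume z: "z \<in> space ?T"
    then have "z \<circ> \<sigma> \<in> space ?T" by (rule measurable_space[OF permute_coords_measurable[OF \<sigma>]])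
    then show "polya_density ?N w (z \<circ> \<sigma>) = polya_density ?N w z"
      by (simp only: p z norm_vandermonde_permute[OF \<sigma>])
  qed
  moreover have "{A \<in> space M. \<exists>z\<in>B. eigenvalue_tuple A z} \<in> sets M \<and>
      emeasure M {A \<in> space M. \<exists>z\<in>B. eigenvalue_tuple A z} = (\<integral>\<^sup>+ z\<in>B. ennreal (Re (polya_density ?N w z)) \<partial>?T)"
    if B: "B \<in> sets ?T" "permutation_closed ?N B" for B
  proof
    show "{A \<in> space M. \<exists>z\<in>B. eigenvalue_tuple A z} \<in> sets M" by (rule haar_eigenvalue_law(1)[OF M B])
    have "emeasure M {A \<in> space M. \<exists>z\<in>B. eigenvalue_tuple A z} = emeasure (circular_law ?N) B"
      by (rule haar_eigenvalue_law(2)[OF M B])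
    also have "\<dots> = (\<integral>\<^sup>+ z\<in>B. ennreal (?r z) \<partial>?T)"
      unfolding circular_law_def using r_measurable B(1) by (intro emeasure_density) measurable
    also have "\<dots> = (\<integral>\<^sup>+ z\<in>B. ennreal (Re (polya_density ?N w z)) \<partial>?T)"
      by (intro nn_integral_cong) (simp only: p Re_complex_of_real)
    finally show "emeasure M {A \<in> space M. \<exists>z\<in>B. eigenvalue_tuple A z} = (\<integral>\<^sup>+ z\<in>B. ennreal (Re (polya_density ?N w z)) \<partial>?T)" .
  qed
  ultimately show ?thesis unfolding eigenvalue_density_def by blast
qed

text \<open>The probability that the conjugate of A by a random V with law H falls into E. For
  Haar-distributed V this is a class function of A.\<close>

definition conj_average :: "'n::finite cmatrix measure \<Rightarrow> 'n cmatrix set \<Rightarrow> 'n cmatrix \<Rightarrow> ennreal" where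
  "conj_average H E A = (\<integral>\<^sup>+V. indicator E (V ** A ** adjoint_matrix V) \<partial>H)"

lemma conj_map_pair_measurable:
  fixes M H :: "'n::finite cmatrix measure"
  assumes "unitary_law M" "unitary_law H"
  shows "(\<lambda>(A, V). V ** A ** adjoint_matrix V) \<in> measurable (M \<Otimes>\<^sub>M H) M"
proof (rule unitary_law_pair_measurable[OF assms assms(1)])
  show "continuous_on UNIV (\<lambda>p :: 'n cmatrix \<times> 'n cmatrix. snd p ** fst p ** adjoint_matrix (snd p))"
    by (intro continuous_on_matrix_mult continuous_on_adjoint continuous_on_fst continuous_on_snd continuous_on_id)
qed (intro unitary_mult unitary_adjoint)

lemma conj_average_measurable:
  fixes M H :: "'n::finite cmatrix measure"
  assumes "unitary_law M" "unitary_law H" "E \<in> sets M"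
  shows "conj_average H E \<in> borel_measurable M"
proof -
  interpret H: prob_space H using assms(2) by (simp add: unitary_law_def)
  have "(\<lambda>p. indicator E ((\<lambda>(A, V). V ** A ** adjoint_matrix V) p) :: ennreal) \<in> borel_measurable (M \<Otimes>\<^sub>M H)"
    by (rule measurable_compose[OF conj_map_pair_measurable[OF assms(1,2)] borel_measurable_indicator[OF assms(3)]])
  then have "(\<lambda>(A, V). indicator E (V ** A ** adjoint_matrix V) :: ennreal) \<in> borel_measurable (M \<Otimes>\<^sub>M H)"
    by (simp add: case_prod_unfold)
  then show ?thesis unfolding conj_average_def [abs_def] by (rule H.borel_measurable_nn_integral)
qed

text \<open>After exchanging the integrals, the inner one for fixed V is the mass of E under the law
  conjugated by V, which is M itself.\<close>

lemma nn_integral_conj_average: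
  fixes M H :: "'n::finite cmatrix measure"
  assumes M: "unitarily_invariant M" and H: "unitary_law H" and E: "E \<in> sets M"
  shows "(\<integral>\<^sup>+A. conj_average H E A \<partial>M) = emeasure M E"
proof -
  have law: "unitary_law M" using M by (simp add: unitarily_invariant_def)
  interpret H: prob_space H using H by (simp add: unitary_law_def)
  interpret M: prob_space M using law by (simp add: unitary_law_def)
  interpret HM: pair_sigma_finite M H ..
  have "(\<lambda>p. indicator E ((\<lambda>(A, V). V ** A ** adjoint_matrix V) p) :: ennreal) \<in> borel_measurable (M \<Otimes>\<^sub>M H)"
    by (rule measurable_compose[OF conj_map_pair_measurable[OF law H] borel_measurable_indicator[OF E]])
  then have m: "(\<lambda>(A, V). indicator E (V ** A ** adjoint_matrix V) :: ennreal) \<in> borel_measurable (M \<Otimes>\<^sub>M H)"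
    by (simp add: case_prod_unfold)
  have "(\<integral>\<^sup>+A. conj_average H E A \<partial>M) = (\<integral>\<^sup>+V. (\<integral>\<^sup>+A. indicator E (V ** A ** adjoint_matrix V) \<partial>M) \<partial>H)"
    unfolding conj_average_def by (rule HM.Fubini'[OF m, symmetric])
  also have "\<dots> = (\<integral>\<^sup>+V. emeasure M E \<partial>H)"
  proof (rule nn_integral_cong)
    fix V assume "V \<in> space H"
    then have V: "V \<in> unitary_group" using unitary_law_space[OF H] by simp
    have "(\<integral>\<^sup>+A. indicator E (V ** A ** adjoint_matrix V) \<partial>M) = emeasure (distr M M (\<lambda>A. V ** A ** adjoint_matrix V)) E"
      by (rule unitary_law_vimage_emeasure[OF law unitary_law_mult_measurable[OF law V unitary_adjoint[OF V]] E, symmetric])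
    also have "\<dots> = emeasure M E" using M V by (simp add: unitarily_invariant_def)
    finally show "(\<integral>\<^sup>+A. indicator E (V ** A ** adjoint_matrix V) \<partial>M) = emeasure M E" .
  qed
  also have "\<dots> = emeasure M E" by (simp add: H.emeasure_space_1)
  finally show ?thesis .
qed

text \<open>Conjugating A by V replaces the integration variable W by \<open>W ** V\<close>, which
  right invariance of H absorbs.\<close>

lemma conj_average_conj:
  fixes H :: "'n::finite cmatrix measure"
  assumes H: "haar_unitary H" and E: "E \<in> sets H" and V: "V \<in> unitary_group" and A: "A \<in> unitary_group"
  shows "conj_average H E (V ** A ** adjoint_matrix V) = conj_average H E A"
proof -
  note law = haar_unitary_law[OF H]
  have m: "(\<lambda>W. W ** V) \<in> measurable H H"
    using unitary_law_mult_measurable[OF law unitary_one V] by simp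
  have "(\<lambda>W. W ** A ** adjoint_matrix W) \<in> measurable H H"
    using V A by (intro unitary_law_measurable_self[OF law] continuous_on_matrix_mult continuous_on_adjoint
        continuous_on_id continuous_on_const unitary_mult unitary_adjoint)
  then have ind: "(\<lambda>W. indicator E (W ** A ** adjoint_matrix W) :: ennreal) \<in> borel_measurable H"
    by (rule measurable_compose[OF _ borel_measurable_indicator[OF E]])
  have "(\<integral>\<^sup>+W. indicator E (W ** A ** adjoint_matrix W) \<partial>distr H H (\<lambda>W. W ** V))
      = (\<integral>\<^sup>+W. indicator E (W ** V ** A ** adjoint_matrix (W ** V)) \<partial>H)"
    by (subst nn_integral_distr[OF m]) (simp_all add: ind)
  then show ?thesis
    unfolding conj_average_def haar_unitary_right_invariant[OF H V] by (simp add: adjoint_mult matrix_mul_assoc)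
qed

lemma diag_mat_of_measurable:
  fixes M :: "'n::finite cmatrix measure"
  assumes "unitary_law M"
  shows "diag_mat_of \<in> measurable (torus_measure CARD('n)) M"
proof (rule unitary_law_measurable_into[OF assms])
  show "(diag_mat_of :: _ \<Rightarrow> 'n cmatrix) \<in> borel_measurable (torus_measure CARD('n))"
  proof (intro borel_measurable_vec)
    fix i j :: 'n
    have "(\<lambda>z. z (enum_index i)) \<in> borel_measurable (torus_measure CARD('n))"
      by (rule torus_coord_measurable[OF enum_index_less])
    then show "(\<lambda>z. (diag_mat_of z :: 'n cmatrix) $ i $ j) \<in> borel_measurable (torus_measure CARD('n))"
      by (cases "i = j") (simp_all add: diag_mat_of_def)
  qed
  fix z assume "z \<in> space (torus_measure CARD('n))"
  then have "z \<in> unit_tuples CARD('n)" using space_torus_unit_tuples by blast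
  from conj_diag_unitary[OF unitary_one this] show "(diag_mat_of z :: 'n cmatrix) \<in> unitary_group"
    by (simp add: conj_diag_def)
qed

text \<open>Averaging writes \<open>emeasure M E\<close> as the integral of the class function
  \<open>conj_average H E\<close>, hence of a symmetric function g of the eigenvalues. Preimages of
  Borel sets under g are permutation-closed events, so g of the eigenvalues has the same
  distribution, and thus the same integral, under M and M'.\<close>

lemma unitarily_invariant_eqI:
  fixes M M' :: "'n::finite cmatrix measure"
  assumes M: "unitarily_invariant M" and M': "unitarily_invariant M'"
    and eq: "\<And>B. B \<in> sets (torus_measure CARD('n)) \<Longrightarrow> permutation_closed CARD('n) B \<Longrightarrow>
      emeasure M {A \<in> space M. \<exists>z\<in>B. eigenvalue_tuple A z} = emeasure M' {A \<in> space M'. \<exists>z\<in>B. eigenvalue_tuple A z}"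
  shows "M = M'"
proof -
  obtain H :: "'n cmatrix measure" where H: "haar_unitary H" using haar_unitary_exists by blast
  note lawH = haar_unitary_law[OF H]
  have law: "unitary_law M" "unitary_law M'" using M M' by (simp_all add: unitarily_invariant_def)
  then have sets_eq: "sets M = sets M'" "sets M = sets H" using lawH by (simp_all add: unitary_law_def)
  let ?T = "torus_measure CARD('n)"
  show ?thesis
  proof (rule measure_eqI[OF sets_eq(1)])
    fix E assume E: "E \<in> sets M"
    then have EH: "E \<in> sets H" using sets_eq by simp
    let ?g = "\<lambda>z. conj_average H E (diag_mat_of z)"
    have g_measurable: "?g \<in> borel_measurable ?T"
      by (rule measurable_compose[OF diag_mat_of_measurable[OF lawH] conj_average_measurable[OF lawH lawH EH]])
    have unitary_diag: "diag_mat_of z \<in> (unitary_group :: 'n cmatrix set)" if "z \<in> space ?T" for z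
      using measurable_space[OF diag_mat_of_measurable[OF lawH] that] unitary_law_space[OF lawH] by simp
    have g_eigen: "conj_average H E A = ?g (eigen_sel A)" if A: "A \<in> unitary_group" for A
    proof -
      obtain V where V: "V \<in> unitary_group" "A = conj_diag V (eigen_sel A)" using eigen_sel(2)[OF A] by blast
      have "conj_average H E (conj_diag V (eigen_sel A)) = ?g (eigen_sel A)"
        unfolding conj_diag_def by (rule conj_average_conj[OF H EH V(1) unitary_diag[OF eigen_sel(1)[OF A]]])
      then show ?thesis using V(2) by simp
    qed
    \<comment> \<open>The diagonal matrices of z and of its permutation are unitarily conjugate, so
      the class function agrees on them.\<close>
    have g_permute: "?g (z \<circ> \<sigma>) = ?g z" if z: "z \<in> space ?T" and \<sigma>: "\<sigma> permutes {..<CARD('n)}" for z \<sigma>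
    proof -
      obtain V :: "'n cmatrix" where V: "V \<in> unitary_group" "conj_diag (mat 1) z = conj_diag V (z \<circ> \<sigma>)"
        using conj_diag_permute[OF unitary_one \<sigma>, of "z \<circ> \<sigma>" z] by auto
      have "z \<circ> \<sigma> \<in> space ?T" using z by (rule measurable_space[OF permute_coords_measurable[OF \<sigma>]])
      then have "conj_average H E (conj_diag V (z \<circ> \<sigma>)) = ?g (z \<circ> \<sigma>)"
        unfolding conj_diag_def by (intro conj_average_conj[OF H EH V(1)] unitary_diag)
      moreover have "conj_diag V (z \<circ> \<sigma>) = diag_mat_of z" unfolding V(2)[symmetric] by (simp add: conj_diag_def)
      ultimately show ?thesis by simp
    qed
    have gs_measurable: "(\<lambda>A. ?g (eigen_sel A)) \<in> borel_measurable X" if "unitary_law X" for X :: "'n cmatrix measure"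
      by (rule measurable_compose[OF unitary_law_eigen_sel_measurable[OF that] g_measurable])
    have "distr M borel (\<lambda>A. ?g (eigen_sel A)) = distr M' borel (\<lambda>A. ?g (eigen_sel A))"
    proof (rule measure_eqI)
      fix S assume "S \<in> sets (distr M borel (\<lambda>A. ?g (eigen_sel A)))"
      then have S: "S \<in> sets borel" by simp
      let ?B = "?g -` S \<inter> space ?T"
      have B: "?B \<in> sets ?T" using g_measurable S by (rule measurable_sets)
      have Bp: "permutation_closed CARD('n) ?B"
        unfolding permutation_closed_def
      proof (intro allI impI ballI)
        fix \<sigma> z assume \<sigma>: "\<sigma> permutes {..<CARD('n)}" and z: "z \<in> ?B"
        have "z \<circ> \<sigma> \<in> space ?T" using z by (intro measurable_space[OF permute_coords_measurable[OF \<sigma>]]) simp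
        then show "z \<circ> \<sigma> \<in> ?B" using z g_permute[OF _ \<sigma>, of z] by simp
      qed
      have ev: "emeasure (distr X borel (\<lambda>A. ?g (eigen_sel A))) S = emeasure X {A \<in> space X. \<exists>z\<in>?B. eigenvalue_tuple A z}"
        if X: "unitary_law X" for X :: "'n cmatrix measure"
      proof -
        have "(\<lambda>A. ?g (eigen_sel A)) -` S \<inter> space X = eigen_sel -` ?B \<inter> space X"
          using measurable_space[OF unitary_law_eigen_sel_measurable[OF X]] by blast
        then show ?thesis
          unfolding eigenvalue_event_set[OF X B Bp] using emeasure_distr[OF gs_measurable[OF X] S] by simp
      qed
      show "emeasure (distr M borel (\<lambda>A. ?g (eigen_sel A))) S = emeasure (distr M' borel (\<lambda>A. ?g (eigen_sel A))) S"
        unfolding ev[OF law(1)] ev[OF law(2)] by (rule eq[OF B Bp])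
    qed simp
    then have d: "(\<integral>\<^sup>+x. x \<partial>distr M borel (\<lambda>A. ?g (eigen_sel A))) = (\<integral>\<^sup>+x. x \<partial>distr M' borel (\<lambda>A. ?g (eigen_sel A)))"
      by simp
    have e: "emeasure X E = (\<integral>\<^sup>+x. x \<partial>distr X borel (\<lambda>A. ?g (eigen_sel A)))"
      if X: "unitarily_invariant X" and EX: "E \<in> sets X" for X :: "'n cmatrix measure"
    proof -
      have lawX: "unitary_law X" using X by (simp add: unitarily_invariant_def)
      have "emeasure X E = (\<integral>\<^sup>+A. conj_average H E A \<partial>X)" by (rule nn_integral_conj_average[OF X lawH EX, symmetric])
      also have "\<dots> = (\<integral>\<^sup>+A. ?g (eigen_sel A) \<partial>X)"
      proof (rule nn_integral_cong)
        fix A assume "A \<in> space X"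
        then show "conj_average H E A = ?g (eigen_sel A)" unfolding unitary_law_space[OF lawX] by (rule g_eigen)
      qed
      also have "\<dots> = (\<integral>\<^sup>+x. x \<partial>distr X borel (\<lambda>A. ?g (eigen_sel A)))"
        by (rule nn_integral_distr[OF gs_measurable[OF lawX], symmetric]) simp
      finally show ?thesis .
    qed
    have E': "E \<in> sets M'" using E sets_eq(1) by simp
    from d show "emeasure M E = emeasure M' E" unfolding e[OF M E] e[OF M' E'] .
  qed
qed

theorem proposition10:
  fixes N :: nat and u :: "nat \<Rightarrow> complex" and \<omega> :: "complex \<Rightarrow> complex"
  assumes N: "N = CARD('n::finite)"
    and u: "\<And>s. s < N \<Longrightarrow> u s = cnj (u (N - 1 - s)) \<and> u s \<noteq> 0"
    and u_mid: "odd N \<Longrightarrow> 0 < u ((N - 1) div 2)"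
    and \<omega>: "\<And>z. z \<in> unit_circle \<Longrightarrow> \<omega> z = (\<Sum>s<N. u s * z powi (- int s))"
  shows "(\<exists>M :: (complex ^ 'n ^ 'n) measure. cyclic_polya_ensemble \<omega> M) \<and>
    (\<forall>M :: (complex ^ 'n ^ 'n) measure. cyclic_polya_ensemble \<omega> M \<longleftrightarrow> haar_unitary M) \<and>
    (\<forall>M :: (complex ^ 'n ^ 'n) measure.
       haar_unitary M \<longrightarrow> eigenvalue_density M (polya_density N \<omega>))"
proof -
  have u_nz: "\<And>s. s < N \<Longrightarrow> u s \<noteq> 0" and u_cnj: "\<And>s. s < N \<Longrightarrow> u s = cnj (u (N - 1 - s))"
    using u by blast+
  have "N > 0" using N by simp
  from trig_L1_sym_diff[OF \<omega> u_cnj this] have L1: "\<omega> \<in> L1_sym_diff N" .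
  have "(\<Prod>j<N. circle_transform \<omega> (int j)) = (\<Prod>j<N. u j)"
    using circle_transform_trig[OF \<omega>] by (intro prod.cong) auto
  then have pos: "0 < (\<Prod>j<N. circle_transform \<omega> (int j))" using prod_transform_pos[OF u u_mid] by simp
  have density: "eigenvalue_density M (polya_density N \<omega>)" if "haar_unitary M" for M :: "'n cmatrix measure"
    unfolding N by (rule haar_eigenvalue_density[OF that \<omega>[unfolded N] u_nz[unfolded N]])
  have haar: "cyclic_polya_ensemble \<omega> M" if "haar_unitary M" for M :: "'n cmatrix measure"
    using L1 pos density[OF that] haar_unitary_invariant[OF that] unfolding cyclic_polya_ensemble_def N by blast
  obtain H :: "'n cmatrix measure" where H: "haar_unitary H" using haar_unitary_exists by blast
  have "haar_unitary M" if M: "cyclic_polya_ensemble \<omega> M" for M :: "'n cmatrix measure"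
  proof -
    \<comment> \<open>The density fixes only the masses of permutation-invariant eigenvalue events,
      but conjugation invariance of both laws extends the agreement to all events.\<close>
    have "M = H"
    proof (rule unitarily_invariant_eqI)
      show "unitarily_invariant M" using M by (simp add: cyclic_polya_ensemble_def)
      show "unitarily_invariant H" by (rule haar_unitary_invariant[OF H])
      have dens: "eigenvalue_density M (polya_density N \<omega>)" using M N by (simp add: cyclic_polya_ensemble_def)
      fix B assume "B \<in> sets (torus_measure CARD('n))" "permutation_closed CARD('n) B"
      then show "emeasure M {A \<in> space M. \<exists>z\<in>B. eigenvalue_tuple A z} = emeasure H {A \<in> space H. \<exists>z\<in>B. eigenvalue_tuple A z}"
        using dens density[OF H] unfolding eigenvalue_density_def by simp
    qed
    then show ?thesis using H by simp
  qed
  then show ?thesis using haar density H by blast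
qed

end
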